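(* Let $(g,J_+,J_-)$ be a generalized Kähler structure on a smooth manifold $M$ with $[J_+,J_-]=0$, let $Q=J_+J_-$, and let $T_\pm M\subset TM$ be the $(\pm1)$-eigenbundles of $Q$. Then $T_+M$ and $T_-M$ are mutually $g$-orthogonal, are integrable (so they are tangent to two transverse foliations of $M$), are holomorphic sub-bundles of $TM$ with respect to both $J_+$ and $J_-$, and $g$ restricts to a Kähler metric on each leaf of either foliation (with respect to the complex structure induced on the leaf by $J_\pm$).
   Context: A generalized Kähler structure on $M$ is a triple $(g,J_+,J_-)$ consisting of a Riemannian metric $g$ and two integrable almost complex structures $J_\pm$ compatible with $g$ (i.e. $g(J_\pm\cdot,J_\pm\cdot)=g$), such that, with $F_\pm=gJ_\pm$ (i.e. $F_\pm(X,Y)=g(J_\pm X,Y)$) and $d^c_\pm=i(\bar\partial-\partial)$ the operators associated to $J_\pm$, one has $d^c_+F_++d^c_-F_-=0$ and $dd^c_\pm F_\pm=0$. When $J_+,J_-$ commute, $Q=J_+J_-$ satisfies $Q^2=\mathrm{id}$, so $TM=T_+M\oplus T_-M$; both sub-bundles are $J_\pm$-invariant, with $J_-=-J_+$ on $T_+M$ and $J_-=J_+$ on $T_-M$. For a complex structure $J$, $TM$ (identified with $T^{1,0}M$) carries its canonical holomorphic structure, with Cauchy–Riemann operator $\bar\partial_XY=\tfrac12([X,Y]+J[JX,Y])$; a $J$-invariant sub-bundle is holomorphic if it is preserved by this operator. *)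

theory Defs
  imports "HOL-Analysis.Analysis" "HOL-Library.Function_Algebras"
begin

fun Ck_on :: "nat \<Rightarrow> 'a::euclidean_space set \<Rightarrow> ('a \<Rightarrow> 'b::euclidean_space) \<Rightarrow> bool" where
  "Ck_on 0 S f \<longleftrightarrow> continuous_on S f"
| "Ck_on (Suc k) S f \<longleftrightarrow> (\<forall>x\<in>S. f differentiable (at x)) \<and>
     (\<forall>v. Ck_on k S (\<lambda>x. frechet_derivative f (at x) v))"

text \<open>\<^const>\<open>Ck_on\<close> is meant for open sets. On an arbitrary set, smoothness means having local smooth
  extensions. It is needed for relatively open subsets of linear subspaces, which
  serve as the model spaces of charts.\<close>

definition smooth_on :: "'a::euclidean_space set \<Rightarrow> ('a \<Rightarrow> 'b::euclidean_space) \<Rightarrow> bool" where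
  "smooth_on S f \<longleftrightarrow> (\<forall>x\<in>S. \<exists>V h. open V \<and> x \<in> V \<and> (\<forall>k. Ck_on k V h) \<and> (\<forall>y\<in>V \<inter> S. h y = f y))"


text \<open>A chart is a homeomorphism from an open set onto an open subset of a linear subspace (its
  model) of an ambient Euclidean space. Letting the model be a subspace rather than a whole type
  allows the leaves of a foliation, whose dimension is not fixed by a type (and may be 0), to be
  treated as manifolds in exactly the same way as the ambient manifold.\<close>

datatype ('m, 'e) chart = Chart (chart_dom: "'m set") (chart_map: "'m \<Rightarrow> 'e") (model: "'e set")

datatype ('m, 'e) charted_space =
  Charted_Space (topo: "'m topology") (atlas: "('m, 'e) chart set")

definition points :: "('m, 'e) charted_space \<Rightarrow> 'm set" where
  "points M = topspace (topo M)"

definition is_chart :: "'m topology \<Rightarrow> ('m, 'e::euclidean_space) chart \<Rightarrow> bool" where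
  "is_chart T c \<longleftrightarrow> openin T (chart_dom c) \<and> subspace (model c) \<and>
     openin (top_of_set (model c)) (chart_map c ` chart_dom c) \<and>
     homeomorphic_map (subtopology T (chart_dom c)) (top_of_set (chart_map c ` chart_dom c))
       (chart_map c)"

definition chart_inv :: "('m, 'e) chart \<Rightarrow> 'e \<Rightarrow> 'm" where
  "chart_inv c = inv_into (chart_dom c) (chart_map c)"

definition compatible :: "('m, 'e::euclidean_space) chart \<Rightarrow> ('m, 'e) chart \<Rightarrow> bool" where
  "compatible c d \<longleftrightarrow>
     smooth_on (chart_map c ` (chart_dom c \<inter> chart_dom d)) (chart_map d \<circ> chart_inv c) \<and>
     smooth_on (chart_map d ` (chart_dom c \<inter> chart_dom d)) (chart_map c \<circ> chart_inv d)"

definition smooth_manifold :: "nat \<Rightarrow> ('m, 'e::euclidean_space) charted_space \<Rightarrow> bool" where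
  "smooth_manifold n M \<longleftrightarrow>
     Hausdorff_space (topo M) \<and> second_countable (topo M) \<and>
     (\<forall>c\<in>atlas M. is_chart (topo M) c \<and> dim (model c) = n) \<and>
     (\<Union>c\<in>atlas M. chart_dom c) = points M \<and>
     (\<forall>c\<in>atlas M. \<forall>d\<in>atlas M. compatible c d)"

definition smooth_fun_on ::
  "('m, 'e::euclidean_space) charted_space \<Rightarrow> 'm set \<Rightarrow> ('m \<Rightarrow> real) \<Rightarrow> bool" where
  "smooth_fun_on M U f \<longleftrightarrow> openin (topo M) U \<and>
     (\<forall>c\<in>atlas M. smooth_on (chart_map c ` (chart_dom c \<inter> U)) (f \<circ> chart_inv c))"

definition smooth_near ::
  "('m, 'e::euclidean_space) charted_space \<Rightarrow> 'm \<Rightarrow> ('m \<Rightarrow> real) \<Rightarrow> bool" where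
  "smooth_near M p f \<longleftrightarrow> (\<exists>U. p \<in> U \<and> smooth_fun_on M U f)"


instantiation "fun" :: (type, real_vector) real_vector
begin

definition scaleR_fun :: "real \<Rightarrow> ('a \<Rightarrow> 'b) \<Rightarrow> 'a \<Rightarrow> 'b" where
  "scaleR_fun a f = (\<lambda>x. a *\<^sub>R f x)"

instance
  by standard (auto simp: scaleR_fun_def plus_fun_def scaleR_add_right scaleR_add_left)

end

text \<open>A tangent vector at \<open>p\<close> is a directional derivative operator on the functions that are
  smooth near \<open>p\<close>; on all other functions it takes the dummy value 0. In this way tangent spaces
  are linear subspaces of the real vector space \<open>('m \<Rightarrow> real) \<Rightarrow> real\<close>.\<close>

type_synonym 'm tvec = "('m \<Rightarrow> real) \<Rightarrow> real"

definition chart_vec ::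
  "('m, 'e::euclidean_space) charted_space \<Rightarrow> ('m, 'e) chart \<Rightarrow> 'm \<Rightarrow> 'e \<Rightarrow> 'm tvec" where
  "chart_vec M c p w = (\<lambda>f. if smooth_near M p f
     then deriv (\<lambda>t. f (chart_inv c (chart_map c p + t *\<^sub>R w))) 0 else 0)"

definition tangent_space :: "('m, 'e::euclidean_space) charted_space \<Rightarrow> 'm \<Rightarrow> 'm tvec set" where
  "tangent_space M p = {chart_vec M c p w | c w. c \<in> atlas M \<and> p \<in> chart_dom c \<and> w \<in> model c}"

text \<open>The differential of the coordinate map of a chart, applied to a tangent vector.\<close>

definition chart_coords :: "('m, 'e::euclidean_space) chart \<Rightarrow> 'm tvec \<Rightarrow> 'e" where
  "chart_coords c v = (\<Sum>b\<in>Basis. v (\<lambda>q. chart_map c q \<bullet> b) *\<^sub>R b)"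

definition vector_field_on ::
  "('m, 'e::euclidean_space) charted_space \<Rightarrow> 'm set \<Rightarrow> ('m \<Rightarrow> 'm tvec) \<Rightarrow> bool" where
  "vector_field_on M U X \<longleftrightarrow> openin (topo M) U \<and> (\<forall>p\<in>U. X p \<in> tangent_space M p) \<and>
     (\<forall>V f. V \<subseteq> U \<and> smooth_fun_on M V f \<longrightarrow> smooth_fun_on M V (\<lambda>p. X p f))"

definition lie_bracket :: "('m, 'e::euclidean_space) charted_space \<Rightarrow>
    ('m \<Rightarrow> 'm tvec) \<Rightarrow> ('m \<Rightarrow> 'm tvec) \<Rightarrow> 'm \<Rightarrow> 'm tvec" where
  "lie_bracket M X Y p = (\<lambda>f. if smooth_near M p f
     then X p (\<lambda>q. Y q f) - Y p (\<lambda>q. X q f) else 0)"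


type_synonym 'm metric = "'m \<Rightarrow> 'm tvec \<Rightarrow> 'm tvec \<Rightarrow> real"

type_synonym 'm endo = "'m \<Rightarrow> 'm tvec \<Rightarrow> 'm tvec"

definition riemannian_metric ::
  "('m, 'e::euclidean_space) charted_space \<Rightarrow> 'm metric \<Rightarrow> bool" where
  "riemannian_metric M g \<longleftrightarrow>
     (\<forall>p\<in>points M.
        (\<forall>u\<in>tangent_space M p. \<forall>v\<in>tangent_space M p. \<forall>w\<in>tangent_space M p. \<forall>a.
           g p (u + v) w = g p u w + g p v w \<and> g p (a *\<^sub>R u) w = a * g p u w) \<and>
        (\<forall>v\<in>tangent_space M p. \<forall>w\<in>tangent_space M p. g p v w = g p w v) \<and>
        (\<forall>v\<in>tangent_space M p. v \<noteq> 0 \<longrightarrow> g p v v > 0)) \<and>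
     (\<forall>U X Y. vector_field_on M U X \<and> vector_field_on M U Y \<longrightarrow>
        smooth_fun_on M U (\<lambda>p. g p (X p) (Y p)))"

definition almost_complex ::
  "('m, 'e::euclidean_space) charted_space \<Rightarrow> 'm endo \<Rightarrow> bool" where
  "almost_complex M J \<longleftrightarrow>
     (\<forall>p\<in>points M.
        (\<forall>v\<in>tangent_space M p. J p v \<in> tangent_space M p \<and> J p (J p v) = - v) \<and>
        (\<forall>v\<in>tangent_space M p. \<forall>w\<in>tangent_space M p. \<forall>a.
           J p (v + w) = J p v + J p w \<and> J p (a *\<^sub>R v) = a *\<^sub>R J p v)) \<and>
     (\<forall>U X. vector_field_on M U X \<longrightarrow> vector_field_on M U (\<lambda>p. J p (X p)))"

definition nijenhuis :: "('m, 'e::euclidean_space) charted_space \<Rightarrow> 'm endo \<Rightarrow>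
    ('m \<Rightarrow> 'm tvec) \<Rightarrow> ('m \<Rightarrow> 'm tvec) \<Rightarrow> 'm \<Rightarrow> 'm tvec" where
  "nijenhuis M J X Y p =
     lie_bracket M (\<lambda>q. J q (X q)) (\<lambda>q. J q (Y q)) p
     - J p (lie_bracket M (\<lambda>q. J q (X q)) Y p)
     - J p (lie_bracket M X (\<lambda>q. J q (Y q)) p)
     - lie_bracket M X Y p"

definition integrable_complex ::
  "('m, 'e::euclidean_space) charted_space \<Rightarrow> 'm endo \<Rightarrow> bool" where
  "integrable_complex M J \<longleftrightarrow> almost_complex M J \<and>
     (\<forall>U X Y. vector_field_on M U X \<and> vector_field_on M U Y \<longrightarrow> (\<forall>p\<in>U. nijenhuis M J X Y p = 0))"

definition compatible_metric ::
  "('m, 'e::euclidean_space) charted_space \<Rightarrow> 'm metric \<Rightarrow> 'm endo \<Rightarrow> bool" where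
  "compatible_metric M g J \<longleftrightarrow> (\<forall>p\<in>points M. \<forall>v\<in>tangent_space M p. \<forall>w\<in>tangent_space M p.
     g p (J p v) (J p w) = g p v w)"


text \<open>A complex-valued \<open>k\<close>-form is evaluated on lists of \<open>k\<close> tangent vectors; values on lists of
  other lengths are irrelevant.\<close>

type_synonym 'm form = "'m \<Rightarrow> 'm tvec list \<Rightarrow> complex"

definition fundamental_form :: "'m metric \<Rightarrow> 'm endo \<Rightarrow> 'm form" where
  "fundamental_form g J p vs = complex_of_real (g p (J p (vs ! 0)) (vs ! 1))"

definition tvec_complex :: "'m tvec \<Rightarrow> ('m \<Rightarrow> complex) \<Rightarrow> complex" where
  "tvec_complex v h = complex_of_real (v (\<lambda>q. Re (h q))) + \<i> * complex_of_real (v (\<lambda>q. Im (h q)))"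

text \<open>The exterior derivative in local coordinates: the vectors \<open>v\<^sub>0, ..., v\<^sub>k\<close> at \<open>p\<close> are extended
  to vector fields with constant coefficients in a chart around \<open>p\<close>. These commute, so that only
  the derivative terms of the invariant formula remain. For (smooth, alternating, multilinear)
  forms the result does not depend on the chart.\<close>

definition ext_deriv :: "('m, 'e::euclidean_space) charted_space \<Rightarrow> 'm form \<Rightarrow> 'm form" where
  "ext_deriv M \<omega> p vs =
     (let c = (SOME c. c \<in> atlas M \<and> p \<in> chart_dom c)
      in \<Sum>i<length vs. (-1) ^ i * tvec_complex (vs ! i)
           (\<lambda>q. \<omega> q (map (\<lambda>v. chart_vec M c q (chart_coords c v)) (take i vs @ drop (Suc i) vs))))"

text \<open>Complex-multilinear extension to complexified tangent vectors; the pair \<open>(a, b)\<close> stands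
  for \<open>a + \<i> b\<close>.\<close>

definition complexify :: "'m form \<Rightarrow> 'm \<Rightarrow> ('m tvec \<times> 'm tvec) list \<Rightarrow> complex" where
  "complexify \<omega> p zs = (\<Sum>S\<in>Pow {..<length zs}. \<i> ^ card S *
     \<omega> p (map (\<lambda>j. if j \<in> S then snd (zs ! j) else fst (zs ! j)) [0..<length zs]))"

definition vec10 :: "'m endo \<Rightarrow> 'm \<Rightarrow> 'm tvec \<Rightarrow> 'm tvec \<times> 'm tvec" where
  "vec10 J p v = ((1/2) *\<^sub>R v, (-1/2) *\<^sub>R J p v)"

definition vec01 :: "'m endo \<Rightarrow> 'm \<Rightarrow> 'm tvec \<Rightarrow> 'm tvec \<times> 'm tvec" where
  "vec01 J p v = ((1/2) *\<^sub>R v, (1/2) *\<^sub>R J p v)"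

text \<open>\<open>vec10\<close> and \<open>vec01\<close> are \<open>(v - \<i> J v) / 2\<close> and \<open>(v + \<i> J v) / 2\<close>. The sum in \<open>type_part\<close> runs over the choices of
  the \<open>r\<close> slots that receive \<open>(1,0)\<close> vectors.\<close>

definition type_part :: "'m endo \<Rightarrow> nat \<Rightarrow> nat \<Rightarrow> 'm form \<Rightarrow> 'm form" where
  "type_part J r s \<omega> p vs =
     (if length vs = r + s
      then \<Sum>S | S \<subseteq> {..<r + s} \<and> card S = r.
        complexify \<omega> p (map (\<lambda>j. if j \<in> S then vec10 J p (vs ! j) else vec01 J p (vs ! j)) [0..<r + s])
      else 0)"

definition del :: "('m, 'e::euclidean_space) charted_space \<Rightarrow> 'm endo \<Rightarrow> 'm form \<Rightarrow> 'm form" where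
  "del M J \<omega> p vs = (\<Sum>r<length vs. let s = length vs - 1 - r in
     type_part J (Suc r) s (ext_deriv M (type_part J r s \<omega>)) p vs)"

definition delbar :: "('m, 'e::euclidean_space) charted_space \<Rightarrow> 'm endo \<Rightarrow> 'm form \<Rightarrow> 'm form" where
  "delbar M J \<omega> p vs = (\<Sum>r<length vs. let s = length vs - 1 - r in
     type_part J r (Suc s) (ext_deriv M (type_part J r s \<omega>)) p vs)"

definition d_c :: "('m, 'e::euclidean_space) charted_space \<Rightarrow> 'm endo \<Rightarrow> 'm form \<Rightarrow> 'm form" where
  "d_c M J \<omega> p vs = \<i> * (delbar M J \<omega> p vs - del M J \<omega> p vs)"

definition form_zero :: "('m, 'e::euclidean_space) charted_space \<Rightarrow> nat \<Rightarrow> 'm form \<Rightarrow> bool" where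
  "form_zero M k \<omega> \<longleftrightarrow>
     (\<forall>p\<in>points M. \<forall>vs. length vs = k \<and> set vs \<subseteq> tangent_space M p \<longrightarrow> \<omega> p vs = 0)"


definition kaehler_structure ::
  "('m, 'e::euclidean_space) charted_space \<Rightarrow> 'm metric \<Rightarrow> 'm endo \<Rightarrow> bool" where
  "kaehler_structure M g J \<longleftrightarrow>
     riemannian_metric M g \<and> integrable_complex M J \<and> compatible_metric M g J \<and>
     form_zero M 3 (ext_deriv M (fundamental_form g J))"

definition generalized_kaehler ::
  "('m, 'e::euclidean_space) charted_space \<Rightarrow> 'm metric \<Rightarrow> 'm endo \<Rightarrow> 'm endo \<Rightarrow> bool" where
  "generalized_kaehler M g Jp Jm \<longleftrightarrow>
     riemannian_metric M g \<and>
     integrable_complex M Jp \<and> integrable_complex M Jm \<and>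
     compatible_metric M g Jp \<and> compatible_metric M g Jm \<and>
     form_zero M 3 (\<lambda>p vs. d_c M Jp (fundamental_form g Jp) p vs
                          + d_c M Jm (fundamental_form g Jm) p vs) \<and>
     form_zero M 4 (ext_deriv M (d_c M Jp (fundamental_form g Jp))) \<and>
     form_zero M 4 (ext_deriv M (d_c M Jm (fundamental_form g Jm)))"


text \<open>Sub-bundles have local smooth frames; the rank is only locally constant, since \<open>M\<close> need not
  be connected.\<close>

definition subbundle ::
  "('m, 'e::euclidean_space) charted_space \<Rightarrow> ('m \<Rightarrow> 'm tvec set) \<Rightarrow> bool" where
  "subbundle M D \<longleftrightarrow> (\<forall>p\<in>points M. \<exists>U k (X :: nat \<Rightarrow> 'm \<Rightarrow> 'm tvec). p \<in> U \<and> openin (topo M) U \<and>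
     (\<forall>i<k. vector_field_on M U (X i)) \<and>
     (\<forall>q\<in>U. inj_on (\<lambda>i. X i q) {..<k} \<and> independent ((\<lambda>i. X i q) ` {..<k}) \<and>
        span ((\<lambda>i. X i q) ` {..<k}) = D q))"

definition section_on :: "('m, 'e::euclidean_space) charted_space \<Rightarrow>
    ('m \<Rightarrow> 'm tvec set) \<Rightarrow> 'm set \<Rightarrow> ('m \<Rightarrow> 'm tvec) \<Rightarrow> bool" where
  "section_on M D U X \<longleftrightarrow> vector_field_on M U X \<and> (\<forall>p\<in>U. X p \<in> D p)"

definition integrable_distribution ::
  "('m, 'e::euclidean_space) charted_space \<Rightarrow> ('m \<Rightarrow> 'm tvec set) \<Rightarrow> bool" where
  "integrable_distribution M D \<longleftrightarrow> subbundle M D \<and>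
     (\<forall>U X Y. section_on M D U X \<and> section_on M D U Y \<longrightarrow> (\<forall>p\<in>U. lie_bracket M X Y p \<in> D p))"

definition orthogonal_distributions :: "('m, 'e::euclidean_space) charted_space \<Rightarrow> 'm metric \<Rightarrow>
    ('m \<Rightarrow> 'm tvec set) \<Rightarrow> ('m \<Rightarrow> 'm tvec set) \<Rightarrow> bool" where
  "orthogonal_distributions M g D E \<longleftrightarrow> (\<forall>p\<in>points M. \<forall>v\<in>D p. \<forall>w\<in>E p. g p v w = 0)"

text \<open>The Cauchy--Riemann operator of \<open>(TM, J)\<close>, with \<open>TM\<close> identified with its \<open>(1,0)\<close> part.\<close>

definition cauchy_riemann :: "('m, 'e::euclidean_space) charted_space \<Rightarrow> 'm endo \<Rightarrow>
    ('m \<Rightarrow> 'm tvec) \<Rightarrow> ('m \<Rightarrow> 'm tvec) \<Rightarrow> 'm \<Rightarrow> 'm tvec" where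
  "cauchy_riemann M J X Y p =
     (1/2) *\<^sub>R (lie_bracket M X Y p + J p (lie_bracket M (\<lambda>q. J q (X q)) Y p))"

definition holomorphic_subbundle ::
  "('m, 'e::euclidean_space) charted_space \<Rightarrow> 'm endo \<Rightarrow> ('m \<Rightarrow> 'm tvec set) \<Rightarrow> bool" where
  "holomorphic_subbundle M J D \<longleftrightarrow> subbundle M D \<and>
     (\<forall>p\<in>points M. \<forall>v\<in>D p. J p v \<in> D p) \<and>
     (\<forall>U X Y. vector_field_on M U X \<and> section_on M D U Y \<longrightarrow>
        (\<forall>p\<in>U. cauchy_riemann M J X Y p \<in> D p))"

text \<open>A foliation is given by a foliation atlas. A pair \<open>(c, W)\<close> is a foliated chart whose plaques
  are the (components of the) level sets of the coordinates transverse to the subspace \<open>W\<close>.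
  The last condition says that the transverse coordinates of \<open>d\<close> are locally functions of the
  transverse coordinates of \<open>c\<close> alone.\<close>

type_synonym ('m, 'e) foliation_atlas = "(('m, 'e) chart \<times> 'e set) set"

definition foliation ::
  "('m, 'e::euclidean_space) charted_space \<Rightarrow> ('m, 'e) foliation_atlas \<Rightarrow> bool" where
  "foliation M F \<longleftrightarrow>
     (\<forall>(c, W)\<in>F. is_chart (topo M) c \<and> (\<forall>d\<in>atlas M. compatible c d) \<and>
        subspace W \<and> W \<subseteq> model c) \<and>
     (\<Union>(c, W)\<in>F. chart_dom c) = points M \<and>
     (\<forall>(c, W)\<in>F. \<forall>(d, W')\<in>F. \<forall>p\<in>chart_dom c \<inter> chart_dom d.
        \<exists>U. openin (topo M) U \<and> p \<in> U \<and> U \<subseteq> chart_dom c \<inter> chart_dom d \<and>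
          (\<forall>q\<in>U. \<forall>q'\<in>U. chart_map c q - chart_map c q' \<in> W \<longrightarrow>
             chart_map d q - chart_map d q' \<in> W'))"

definition foliation_tangent :: "('m, 'e::euclidean_space) charted_space \<Rightarrow>
    ('m, 'e) foliation_atlas \<Rightarrow> 'm \<Rightarrow> 'm tvec set" where
  "foliation_tangent M F p =
     {v \<in> tangent_space M p. \<exists>(c, W)\<in>F. p \<in> chart_dom c \<and> chart_coords c v \<in> W}"

definition tangent_to_foliation :: "('m, 'e::euclidean_space) charted_space \<Rightarrow>
    ('m \<Rightarrow> 'm tvec set) \<Rightarrow> ('m, 'e) foliation_atlas \<Rightarrow> bool" where
  "tangent_to_foliation M D F \<longleftrightarrow> foliation M F \<and> (\<forall>p\<in>points M. foliation_tangent M F p = D p)"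

definition transverse_foliations :: "('m, 'e::euclidean_space) charted_space \<Rightarrow>
    ('m, 'e) foliation_atlas \<Rightarrow> ('m, 'e) foliation_atlas \<Rightarrow> bool" where
  "transverse_foliations M F G \<longleftrightarrow> (\<forall>p\<in>points M.
     {v + w | v w. v \<in> foliation_tangent M F p \<and> w \<in> foliation_tangent M G p} = tangent_space M p)"

text \<open>The leaf topology is generated by the relatively open pieces of plaques; the leaves are its
  connected components. Each leaf carries the smooth structure whose charts are the restrictions
  of the foliated charts to plaques.\<close>

definition leaf_topology :: "('m, 'e::euclidean_space) charted_space \<Rightarrow>
    ('m, 'e) foliation_atlas \<Rightarrow> 'm topology" where
  "leaf_topology M F = topology_generated_by
     {{q \<in> U. chart_map c q - chart_map c p \<in> W} | c W U p.
        (c, W) \<in> F \<and> openin (topo M) U \<and> U \<subseteq> chart_dom c \<and> p \<in> U}"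

definition leaves :: "('m, 'e::euclidean_space) charted_space \<Rightarrow>
    ('m, 'e) foliation_atlas \<Rightarrow> 'm set set" where
  "leaves M F = connected_components_of (leaf_topology M F)"

definition leaf_space :: "('m, 'e::euclidean_space) charted_space \<Rightarrow>
    ('m, 'e) foliation_atlas \<Rightarrow> 'm set \<Rightarrow> ('m, 'e) charted_space" where
  "leaf_space M F L = Charted_Space (subtopology (leaf_topology M F) L)
     {Chart {q \<in> chart_dom c \<inter> L. chart_map c q - chart_map c p \<in> W}
        (\<lambda>q. chart_map c q - chart_map c p) W | c W p. (c, W) \<in> F \<and> p \<in> chart_dom c \<inter> L}"

text \<open>The differential of the inclusion of a leaf, and the tensors induced on the leaf. The
  endomorphism \<open>leaf_endo\<close> is the intended one if the leaf is tangent to a \<open>J\<close>-invariant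
  distribution.\<close>

definition leaf_incl :: "('m, 'e::euclidean_space) charted_space \<Rightarrow> 'm \<Rightarrow> 'm tvec \<Rightarrow> 'm tvec" where
  "leaf_incl M p v = (\<lambda>f. if smooth_near M p f then v f else 0)"

definition leaf_metric ::
  "('m, 'e::euclidean_space) charted_space \<Rightarrow> 'm metric \<Rightarrow> 'm metric" where
  "leaf_metric M g p v w = g p (leaf_incl M p v) (leaf_incl M p w)"

definition leaf_endo :: "('m, 'e::euclidean_space) charted_space \<Rightarrow>
    ('m, 'e) foliation_atlas \<Rightarrow> 'm set \<Rightarrow> 'm endo \<Rightarrow> 'm endo" where
  "leaf_endo M F L J p v = (THE u. u \<in> tangent_space (leaf_space M F L) p \<and>
     leaf_incl M p u = J p (leaf_incl M p v))"

definition kaehler_leaves :: "('m, 'e::euclidean_space) charted_space \<Rightarrow> 'm metric \<Rightarrow> 'm endo \<Rightarrow>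
    ('m, 'e) foliation_atlas \<Rightarrow> bool" where
  "kaehler_leaves M g J F \<longleftrightarrow> (\<forall>L\<in>leaves M F.
     kaehler_structure (leaf_space M F L) (leaf_metric M g) (leaf_endo M F L J))"


definition commuting ::
  "('m, 'e::euclidean_space) charted_space \<Rightarrow> 'm endo \<Rightarrow> 'm endo \<Rightarrow> bool" where
  "commuting M J K \<longleftrightarrow> (\<forall>p\<in>points M. \<forall>v\<in>tangent_space M p. J p (K p v) = K p (J p v))"

definition eigenbundle :: "('m, 'e::euclidean_space) charted_space \<Rightarrow> 'm endo \<Rightarrow> real \<Rightarrow>
    'm \<Rightarrow> 'm tvec set" where
  "eigenbundle M Q a p = {v \<in> tangent_space M p. Q p v = a *\<^sub>R v}"

end

theory Submission
  imports Defs
begin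

text \<open>
  Fix \<open>\<sigma> = \<plusminus>1\<close> and let \<open>T\<close> be the \<open>\<sigma>\<close>-eigenbundle of \<open>Q = J\<^sub>+ J\<^sub>-\<close>. It consists of the vectors with
  \<open>J\<^sub>- v = -\<sigma> J\<^sub>+ v\<close>, and \<open>Q\<close> is a \<open>g\<close>-isometry, so the two eigenbundles are orthogonal and
  \<open>F\<^sub>- = -\<sigma> F\<^sub>+\<close> as soon as one argument lies in \<open>T\<close>. Everything else comes from three identities.

  \<^item> A fundamental form has type (1,1), and for such forms \<open>d\<^sup>c F\<close> is \<open>-dF(J, J, J)\<close>
    (\<open>d_c_fundamental_form\<close>). The condition \<open>d\<^sup>c\<^sub>+ F\<^sub>+ + d\<^sup>c\<^sub>- F\<^sub>- = 0\<close> therefore says that \<open>dF\<^sub>+\<close> and \<open>dF\<^sub>-\<close> agree, up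
    to the product of the three eigenvalues, on eigenvectors of \<open>Q\<close> (\<open>torsion_mixed\<close>). For \<open>X, Y\<close> in \<open>T\<close> and
    \<open>Z\<close> in the other eigenbundle, Cartan's formula reduces this to \<open>F\<^sub>+([X, Y], Z) = 0\<close>, so that \<open>T\<close> is
    involutive (\<open>TT_involutive\<close>).
  \<^item> On three vectors of \<open>T\<close> the same relation reads \<open>dF\<^sub>+ = \<sigma> dF\<^sub>-\<close>, whereas \<open>F\<^sub>- = -\<sigma> F\<^sub>+\<close> on \<open>T\<close> together
    with involutivity gives \<open>dF\<^sub>- = -\<sigma> dF\<^sub>+\<close>. Hence both forms are closed along \<open>T\<close> (\<open>F_closed_on_TT\<close>).
  \<^item> For \<open>B\<close> in the other eigenbundle and \<open>Y\<close> in \<open>T\<close>, adding the vanishing Nijenhuis tensors of \<open>J\<^sub>+\<close> and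
    \<open>J\<^sub>-\<close> cancels the terms in \<open>J Y\<close>; what remains says that the Cauchy--Riemann operator of \<open>B\<close> preserves
    \<open>T\<close> (\<open>cauchy_riemann_TT\<close>).

  The foliations come from the Frobenius theorem, in the form needed here: the distribution is the
  range of a smooth field of projections. Near a point it is the graph over its value there, which
  yields a frame whose brackets vanish; moving along the frame for time one defines coordinates that
  make the distribution constant (\<open>straightening\<close>, \<open>foliated_chart\<close>). This rests on the smooth dependence
  of solutions of differential equations on parameters (\<open>parameter_dependence\<close>).

  For the leaves, let a foliation atlas tangent to \<open>T\<close> be given. Plaques in its charts make every leaf
  a manifold, whose vector fields extend locally to sections of \<open>T\<close> on \<open>M\<close> (\<open>leaf_extension\<close>). Lie
  brackets and the Cartan formula agree for a field and its extension, so that integrability of the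
  induced complex structure and closedness of its fundamental form are inherited from \<open>M\<close>
  (\<open>leaf_kaehler\<close>).
\<close>

section \<open>Differentiability with a parameter\<close>

text \<open>Parametrised differentiability of class \<open>C\<^sup>k\<close>: \<open>k\<close> directional derivatives in \<open>x\<close>, all jointly continuous in
  \<open>(t, x)\<close>. In \<open>t\<close> only continuity is asked for, because this is the regularity that the Picard operator
  preserves. Directional rather than total derivatives keep all derivatives in the same function type.\<close>
fun PC :: "nat \<Rightarrow> real set \<Rightarrow> 'a::euclidean_space set \<Rightarrow> (real \<Rightarrow> 'a \<Rightarrow> 'b::real_normed_vector) \<Rightarrow> bool"
 where
 "PC 0 I T g \<longleftrightarrow> continuous_on (I \<times> T) (\<lambda>(t, x). g t x)"
| "PC (Suc k) I T g \<longleftrightarrow> continuous_on (I \<times> T) (\<lambda>(t, x). g t x) \<and>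
   (\<forall>v. \<exists>g'. PC k I T g' \<and>
    (\<forall>t\<in>I. \<forall>x\<in>T. ((\<lambda>s. g t (x + s *\<^sub>R v)) has_vector_derivative g' t x) (at 0)))"

lemma PC_cont: "PC k I T g ==> continuous_on (I \<times> T) (\<lambda>(t, x). g t x)"
 by (cases k) auto

lemma PC_Suc_D: "PC (Suc k) I T g ==> PC k I T g"
proof (induction k arbitrary: g)
 case (Suc k)
 then show ?case by (meson PC.simps(2))
qed auto

text \<open>Names the family of directional derivatives whose existence \<open>PC (Suc k)\<close> asserts.\<close>
definition partials :: "nat \<Rightarrow> real set \<Rightarrow> 'a::euclidean_space set \<Rightarrow> (real \<Rightarrow> 'a \<Rightarrow> 'b::real_normed_vector) \<Rightarrow>
  ('a \<Rightarrow> real \<Rightarrow> 'a \<Rightarrow> 'b) \<Rightarrow> bool" where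
 "partials k I T g g' \<longleftrightarrow> (\<forall>v. PC k I T (g' v)) \<and>
   (\<forall>v. \<forall>t\<in>I. \<forall>x\<in>T. ((\<lambda>s. g t (x + s *\<^sub>R v)) has_vector_derivative g' v t x) (at 0))"

lemma partialsD:
 assumes "partials k I T g g'"
 shows "PC k I T (g' v)"
  and "t \<in> I ==> x \<in> T ==> ((\<lambda>s. g t (x + s *\<^sub>R v)) has_vector_derivative g' v t x) (at 0)"
 using assms unfolding partials_def by auto

lemma PC_SucE:
 assumes "PC (Suc k) I T g"
 obtains g' where "partials k I T g g'"
proof -
 from assms have "\<forall>v. \<exists>g'. PC k I T g' \<and>
    (\<forall>t\<in>I. \<forall>x\<in>T. ((\<lambda>s. g t (x + s *\<^sub>R v)) has_vector_derivative g' t x) (at 0))"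
  unfolding PC.simps by blast
 from choice[OF this] show ?thesis using that unfolding partials_def by blast
qed

lemma PC_SucI:
 assumes "continuous_on (I \<times> T) (\<lambda>(t, x). g t x)"
  and "\<And>v. PC k I T (g' v)"
  and "\<And>v t x. t \<in> I ==> x \<in> T ==> ((\<lambda>s. g t (x + s *\<^sub>R v)) has_vector_derivative g' v t x) (at 0)"
 shows "PC (Suc k) I T g"
 unfolding PC.simps using assms by blast

lemma has_vd_line_cong:
 fixes x v :: "'a::real_normed_vector"
 assumes "open T" "x \<in> T" "\<And>y. y \<in> T ==> f y = g y"
  and "((\<lambda>s. f (x + s *\<^sub>R v)) has_vector_derivative d) (at (0::real))"
 shows "((\<lambda>s. g (x + s *\<^sub>R v)) has_vector_derivative d) (at 0)"
proof -
 have "open ((\<lambda>s. x + s *\<^sub>R v) -` T)"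
  by (rule open_vimage[OF assms(1)]) (intro continuous_intros)
 then show ?thesis
  by (rule has_vector_derivative_transform_within_open[OF assms(4)]) (use assms in auto)
qed

lemma PC_cong:
 assumes "open T" "\<And>t x. t \<in> I ==> x \<in> T ==> f t x = g t x" "PC k I T f"
 shows "PC k I T g"
proof -
 have c: "continuous_on (I \<times> T) (\<lambda>(t, x). g t x)"
  using PC_cont[OF assms(3)] by (rule continuous_on_eq) (use assms(2) in auto)
 show ?thesis
 proof (cases k)
  case 0
  then show ?thesis using c by simp
 next
  case (Suc j)
  obtain f' where pf: "partials j I T f f'"
   using PC_SucE[OF assms(3)[unfolded Suc]] by blast
  note f' = partialsD[OF pf]
  show ?thesis unfolding Suc
   by (rule PC_SucI[OF c f'(1)])
    (rule has_vd_line_cong[OF assms(1) _ _ f'(2)], use assms(2) in auto)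
 qed
qed

lemma PC_const: "PC k I T (\<lambda>t x. c)"
 by (induction k arbitrary: c) (auto simp: case_prod_beta intro!: exI[of _ "\<lambda>t x. 0"])

lemma PC_id: "PC k I T (\<lambda>t x. x)"
proof (cases k)
 case (Suc j)
 have "((\<lambda>s. x + s *\<^sub>R v) has_vector_derivative v) (at 0)" for x v :: 'a
  by (auto intro!: derivative_eq_intros)
 then show ?thesis unfolding Suc
  by (intro PC_SucI[OF _ PC_const]) (auto simp: case_prod_beta intro!: continuous_intros)
qed (auto simp: case_prod_beta intro!: continuous_intros)

lemma PC_add: "PC k I T f ==> PC k I T g ==> PC k I T (\<lambda>t x. f t x + g t x)"
proof (induction k arbitrary: f g)
 case 0
 then show ?case by (auto simp: case_prod_beta intro: continuous_intros)
next
 case (Suc k)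
 obtain f' where pf: "partials k I T f f'"
  using PC_SucE[OF Suc.prems(1)] by blast
 note f' = partialsD[OF pf]
 obtain g' where pg: "partials k I T g g'"
  using PC_SucE[OF Suc.prems(2)] by blast
 note g' = partialsD[OF pg]
 show ?case
  by (rule PC_SucI[OF _ Suc.IH[OF f'(1) g'(1)] has_vector_derivative_add[OF f'(2) g'(2)]])
   (use PC_cont[OF Suc.prems(1)] PC_cont[OF Suc.prems(2)] in
    \<open>auto simp: case_prod_beta intro: continuous_intros\<close>)
qed

lemma PC_linear:
 assumes "bounded_linear L"
 shows "PC k I T f ==> PC k I T (\<lambda>t x. L (f t x))"
proof (induction k arbitrary: f)
 case 0
 then show ?case using assms
  by (auto simp: case_prod_beta intro: bounded_linear.continuous_on)
next
 case (Suc k)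
 obtain f' where pf: "partials k I T f f'"
  using PC_SucE[OF Suc.prems(1)] by blast
 note f' = partialsD[OF pf]
 show ?case
  by (rule PC_SucI[OF _ Suc.IH[OF f'(1)] bounded_linear.has_vector_derivative[OF assms f'(2)]])
   (use PC_cont[OF Suc.prems(1)] assms in
    \<open>auto simp: case_prod_beta intro: bounded_linear.continuous_on\<close>)
qed

lemma PC_bilinear:
 assumes "bounded_bilinear B"
 shows "PC k I T f ==> PC k I T g ==> PC k I T (\<lambda>t x. B (f t x) (g t x))"
proof (induction k arbitrary: f g)
 case 0
 then show ?case using assms
  by (auto simp: case_prod_beta intro: bounded_bilinear.continuous_on)
next
 case (Suc k)
 obtain f' where pf: "partials k I T f f'"
  using PC_SucE[OF Suc.prems(1)] by blast
 note f' = partialsD[OF pf]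
 obtain g' where pg: "partials k I T g g'"
  using PC_SucE[OF Suc.prems(2)] by blast
 note g' = partialsD[OF pg]
 have d: "((\<lambda>s. B (f t (x + s *\<^sub>R v)) (g t (x + s *\<^sub>R v))) has_vector_derivative
   B (f t x) (g' v t x) + B (f' v t x) (g t x)) (at 0)" if "t \<in> I" "x \<in> T" for t x v
  using bounded_bilinear.has_vector_derivative[OF assms f'(2)[OF that] g'(2)[OF that]] by simp
 have c: "PC k I T (\<lambda>t x. B (f t x) (g' v t x) + B (f' v t x) (g t x))" for v
  by (intro PC_add Suc.IH f' g' PC_Suc_D[OF Suc.prems(1)] PC_Suc_D[OF Suc.prems(2)])
 show ?case
  by (rule PC_SucI[OF _ c d])
   (use PC_cont[OF Suc.prems(1)] PC_cont[OF Suc.prems(2)] assms in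
    \<open>auto simp: case_prod_beta intro: bounded_bilinear.continuous_on\<close>)
qed

lemma PC_sum: "finite A ==> (\<And>i. i \<in> A ==> PC k I T (f i)) ==> PC k I T (\<lambda>t x. \<Sum>i\<in>A. f i t x)"
 by (induction A rule: finite_induct) (auto intro: PC_add PC_const simp del: PC.simps)

lemmas PC_scaleR = PC_bilinear[OF bounded_bilinear_scaleR]
lemmas PC_inner = PC_bilinear[OF bounded_bilinear_inner]

text \<open>The mean value inequality for \<open>\<phi> s - s c\<close>. It measures the failure of \<open>\<phi>\<close> to be affine, which is how it
  enters both the passage from partial to total derivatives and the symmetry of second derivatives.\<close>
lemma mean_value_increment:
 fixes \<phi> :: "real \<Rightarrow> 'b::real_normed_vector"
 assumes "\<And>s. s \<in> closed_segment 0 r ==> (\<phi> has_vector_derivative \<phi>' s) (at s)"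
  and "\<And>s. s \<in> closed_segment 0 r ==> norm (\<phi>' s - c) \<le> \<epsilon>"
 shows "norm (\<phi> r - \<phi> 0 - r *\<^sub>R c) \<le> \<bar>r\<bar> * \<epsilon>"
proof -
 have "norm ((\<phi> r - r *\<^sub>R c) - (\<phi> 0 - 0 *\<^sub>R c)) \<le> \<epsilon> * norm (r - 0)"
 proof (rule differentiable_bound[where S = "closed_segment 0 r" and f' = "\<lambda>s h. h *\<^sub>R (\<phi>' s - c)"])
  fix s assume s: "s \<in> closed_segment 0 r"
  have "((\<lambda>s. \<phi> s - s *\<^sub>R c) has_vector_derivative \<phi>' s - c) (at s within closed_segment 0 r)"
   by (rule has_vector_derivative_at_within) (auto intro!: derivative_eq_intros assms(1)[OF s])
  then show "((\<lambda>s. \<phi> s - s *\<^sub>R c) has_derivative (\<lambda>h. h *\<^sub>R (\<phi>' s - c))) (at s within closed_segment 0 r)"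
   by (simp add: has_vector_derivative_def)
  show "onorm (\<lambda>h. h *\<^sub>R (\<phi>' s - c)) \<le> \<epsilon>"
  proof (rule onorm_le)
   fix h :: real
   show "norm (h *\<^sub>R (\<phi>' s - c)) \<le> \<epsilon> * norm h"
    using mult_left_mono[OF assms(2)[OF s], of "\<bar>h\<bar>"] by (simp add: mult.commute)
  qed
 qed auto
 then show ?thesis by (simp add: mult.commute algebra_simps)
qed

lemma has_vd_line_shift:
 fixes x v :: "'a::real_normed_vector"
 assumes "((\<lambda>s. f ((x + s0 *\<^sub>R v) + s *\<^sub>R v)) has_vector_derivative d) (at (0::real))"
 shows "((\<lambda>s. f (x + s *\<^sub>R v)) has_vector_derivative d) (at s0)"
proof -
 have "((\<lambda>s::real. s - s0) has_vector_derivative 1) (at s0)"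
  by (auto intro!: derivative_eq_intros)
 from vector_diff_chain_at[OF this, of "\<lambda>s. f ((x + s0 *\<^sub>R v) + s *\<^sub>R v)" d] assms
 show ?thesis by (simp add: o_def algebra_simps)
qed

lemma dir_mean_value:
 fixes f :: "'a::real_normed_vector \<Rightarrow> 'b::real_normed_vector"
 assumes "\<And>s. s \<in> closed_segment 0 r ==> x + s *\<^sub>R v \<in> T"
  and "\<And>y. y \<in> T ==> ((\<lambda>s. f (y + s *\<^sub>R v)) has_vector_derivative f' y) (at (0::real))"
  and "\<And>s. s \<in> closed_segment 0 r ==> norm (f' (x + s *\<^sub>R v) - c) \<le> \<epsilon>"
 shows "norm (f (x + r *\<^sub>R v) - f x - r *\<^sub>R c) \<le> \<bar>r\<bar> * \<epsilon>"
proof -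
 have "norm ((\<lambda>s. f (x + s *\<^sub>R v)) r - (\<lambda>s. f (x + s *\<^sub>R v)) 0 - r *\<^sub>R c) \<le> \<bar>r\<bar> * \<epsilon>"
  by (rule mean_value_increment[where \<phi>' = "\<lambda>s. f' (x + s *\<^sub>R v)"])
   (auto intro!: has_vd_line_shift assms)
 then show ?thesis by simp
qed

text \<open>The increment of \<open>f\<close> is taken along the edges of a path that changes one coordinate at a time. Each
  edge contributes its partial derivative at \<open>x\<close> up to a small multiple of its length, by continuity at
  \<open>x\<close> and the mean value inequality.\<close>
lemma has_derivative_from_partials:
 fixes f :: "'a::euclidean_space \<Rightarrow> 'b::real_normed_vector"
 assumes T: "open T" "x \<in> T"
  and d: "\<And>b y. b \<in> Basis ==> y \<in> T ==> ((\<lambda>s. f (y + s *\<^sub>R b)) has_vector_derivative f' b y) (at (0::real))"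
  and c: "\<And>b. b \<in> Basis ==> isCont (f' b) x"
 shows "(f has_derivative (\<lambda>v. \<Sum>b\<in>Basis. (v \<bullet> b) *\<^sub>R f' b x)) (at x)"
 unfolding has_derivative_iff_norm
proof
 show "bounded_linear (\<lambda>v. \<Sum>b\<in>Basis. (v \<bullet> b) *\<^sub>R f' b x)"
  by (intro bounded_linear_intros bounded_linear_sum)
next
 let ?L = "\<lambda>B h. \<Sum>b\<in>B. (h \<bullet> b) *\<^sub>R f' b x"
 define n where "n = real DIM('a)"
 have n: "n \<ge> 1" unfolding n_def using DIM_positive[where 'a='a] by linarith
 have key: "\<exists>\<delta>>0. \<forall>h. norm h < \<delta> \<longrightarrow> norm (f (x + h) - f x - ?L Basis h) \<le> e * norm h" if e: "e > 0" for e
 proof -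
  have "\<exists>\<delta>>0. \<forall>y\<in>ball x \<delta>. y \<in> T \<and> (\<forall>b\<in>Basis. norm (f' b y - f' b x) \<le> e / n)"
  proof -
   have "\<forall>\<^sub>F y in nhds x. y \<in> T" using T by (metis eventually_nhds_in_open)
   moreover have "\<forall>\<^sub>F y in nhds x. norm (f' b y - f' b x) < e / n" if "b \<in> Basis" for b
   proof -
    have "((f' b) \<longlongrightarrow> f' b x) (nhds x)" using c[OF that] by (simp add: isCont_def tendsto_at_iff_tendsto_nhds)
    from tendstoD[OF this, of "e / n"] show ?thesis using e n by (simp add: dist_norm)
   qed
   then have "\<forall>\<^sub>F y in nhds x. \<forall>b\<in>Basis. norm (f' b y - f' b x) < e / n"
    by (simp add: eventually_ball_finite_distrib)
   ultimately have "\<forall>\<^sub>F y in nhds x. y \<in> T \<and> (\<forall>b\<in>Basis. norm (f' b y - f' b x) < e / n)"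
    by (rule eventually_conj)
   then show ?thesis unfolding eventually_nhds_metric by (metis dist_commute mem_ball less_imp_le)
  qed
  then obtain \<delta> where \<delta>: "\<delta> > 0" "\<And>y. y \<in> ball x \<delta> ==> y \<in> T"
   "\<And>y b. y \<in> ball x \<delta> ==> b \<in> Basis ==> norm (f' b y - f' b x) \<le> e / n" by blast
  have main: "norm (f (x + (\<Sum>b\<in>B. (h \<bullet> b) *\<^sub>R b)) - f x - ?L B h) \<le> real (card B) * (e / n * norm h)"
   if h: "norm h < \<delta> / n" and "finite B" "B \<subseteq> Basis" for h B
   using that(2,3)
  proof (induction B rule: finite_induct)
   case (insert b B)
   define y where "y = x + (\<Sum>b\<in>B. (h \<bullet> b) *\<^sub>R b)"
   have in_ball: "y + s *\<^sub>R b \<in> ball x \<delta>" if s: "s \<in> closed_segment 0 (h \<bullet> b)" for s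
   proof -
    have s': "\<bar>s\<bar> \<le> \<bar>h \<bullet> b\<bar>" using s by (auto simp: closed_segment_eq_real_ivl split: if_splits)
    have "dist x (y + s *\<^sub>R b) = norm ((\<Sum>b\<in>B. (h \<bullet> b) *\<^sub>R b) + s *\<^sub>R b)"
     unfolding y_def dist_norm by (metis add.assoc add_diff_cancel_left' norm_minus_commute)
    also have "\<dots> \<le> (\<Sum>b\<in>B. \<bar>h \<bullet> b\<bar>) + \<bar>s\<bar>"
    proof (rule norm_triangle_le, rule add_mono)
     have "norm (\<Sum>b\<in>B. (h \<bullet> b) *\<^sub>R b) \<le> (\<Sum>b\<in>B. norm ((h \<bullet> b) *\<^sub>R b))" by (rule norm_sum)
     also have "\<dots> = (\<Sum>b\<in>B. \<bar>h \<bullet> b\<bar>)" using insert.prems by (intro sum.cong) auto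
     finally show "norm (\<Sum>b\<in>B. (h \<bullet> b) *\<^sub>R b) \<le> (\<Sum>b\<in>B. \<bar>h \<bullet> b\<bar>)" .
     show "norm (s *\<^sub>R b) \<le> \<bar>s\<bar>" using insert.prems by auto
    qed
    also have "\<dots> \<le> (\<Sum>b\<in>insert b B. \<bar>h \<bullet> b\<bar>)" using insert s' by simp
    also have "\<dots> \<le> (\<Sum>b\<in>Basis. \<bar>h \<bullet> b\<bar>)" using insert.prems by (intro sum_mono2) auto
    also have "\<dots> \<le> (\<Sum>b\<in>(Basis::'a set). norm h)" by (intro sum_mono Basis_le_norm)
    also have "\<dots> = n * norm h" by (simp add: n_def)
    also have "\<dots> < \<delta>" using h n by (simp add: field_simps)
    finally show ?thesis by simp
   qed
   have "norm (f (y + (h \<bullet> b) *\<^sub>R b) - f y - (h \<bullet> b) *\<^sub>R f' b x) \<le> \<bar>h \<bullet> b\<bar> * (e / n)"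
    by (rule dir_mean_value[where T = "ball x \<delta>" and f' = "f' b"])
     (use in_ball insert.prems \<delta> d in auto)
   also have "\<dots> \<le> e / n * norm h"
    using insert.prems e n by (subst mult.commute) (intro mult_left_mono Basis_le_norm, auto)
   finally have 1: "norm (f (y + (h \<bullet> b) *\<^sub>R b) - f y - (h \<bullet> b) *\<^sub>R f' b x) \<le> e / n * norm h" .
   have 2: "norm (f y - f x - ?L B h) \<le> real (card B) * (e / n * norm h)"
    using insert unfolding y_def by auto
   have "f (x + (\<Sum>b\<in>insert b B. (h \<bullet> b) *\<^sub>R b)) - f x - ?L (insert b B) h
    = (f (y + (h \<bullet> b) *\<^sub>R b) - f y - (h \<bullet> b) *\<^sub>R f' b x) + (f y - f x - ?L B h)"
    using insert(1,2) unfolding y_def by (simp add: add.commute add.left_commute)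
   then have "norm (f (x + (\<Sum>b\<in>insert b B. (h \<bullet> b) *\<^sub>R b)) - f x - ?L (insert b B) h)
    \<le> e / n * norm h + real (card B) * (e / n * norm h)"
    using norm_triangle_mono[OF 1 2] by (simp only:)
   also have "\<dots> = real (card (insert b B)) * (e / n * norm h)"
    using insert(1,2) by (simp add: algebra_simps add_divide_distrib)
   finally show ?case .
  qed auto
  have "norm (f (x + h) - f x - ?L Basis h) \<le> e * norm h" if "norm h < \<delta> / n" for h
   using main[OF that finite_Basis subset_refl] n by (simp add: euclidean_representation n_def)
  then show ?thesis using \<delta>(1) n by (intro exI[of _ "\<delta> / n"]) auto
 qed
 show "(\<lambda>y. norm (f y - f x - ?L Basis (y - x)) / norm (y - x)) \<midarrow>x\<rightarrow> 0"
 proof (rule LIM_I)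
  fix r :: real assume r: "r > 0"
  obtain \<delta> where \<delta>: "\<delta> > 0" "\<And>h. norm h < \<delta> ==> norm (f (x + h) - f x - ?L Basis h) \<le> r / 2 * norm h"
   using key[of "r / 2"] r by auto
  show "\<exists>s>0. \<forall>y. y \<noteq> x \<and> norm (y - x) < s \<longrightarrow> norm (norm (f y - f x - ?L Basis (y - x)) / norm (y - x) - 0) < r"
  proof (intro exI[of _ \<delta>] conjI allI impI \<delta>(1))
   fix y assume y: "y \<noteq> x \<and> norm (y - x) < \<delta>"
   have "norm (f y - f x - ?L Basis (y - x)) \<le> r / 2 * norm (y - x)" using \<delta>(2)[of "y - x"] y by simp
   also have "\<dots> < r * norm (y - x)" using y r by simp
   finally show "norm (norm (f y - f x - ?L Basis (y - x)) / norm (y - x) - 0) < r"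
    using y by (simp add: divide_less_eq)
  qed
 qed
qed

lemma has_derivative_imp_line:
 assumes "(f has_derivative f') (at x)"
 shows "((\<lambda>s. f (x + s *\<^sub>R v)) has_vector_derivative f' v) (at (0::real))"
proof -
 have "((\<lambda>s. x + s *\<^sub>R v) has_derivative (\<lambda>s. s *\<^sub>R v)) (at 0)"
  by (auto intro!: derivative_eq_intros)
 from diff_chain_at[OF this, of f f'] assms
 have "((\<lambda>s. f (x + s *\<^sub>R v)) has_derivative (\<lambda>s. f' (s *\<^sub>R v))) (at 0)" by (simp add: o_def)
 then show ?thesis unfolding has_vector_derivative_def
  using linear_scale[OF has_derivative_linear[OF assms]] by simp
qed

lemma PC_continuous_slice:
 assumes "PC k I T g" "t \<in> I" shows "continuous_on T (g t)"
proof -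
 have "continuous_on T ((\<lambda>(t, x). g t x) \<circ> (\<lambda>x. (t, x)))"
  by (rule continuous_on_compose) (auto intro!: continuous_intros continuous_on_subset[OF PC_cont[OF assms(1)]] assms)
 then show ?thesis by (simp add: o_def)
qed

lemma partials_has_derivative:
 fixes g :: "real \<Rightarrow> 'a::euclidean_space \<Rightarrow> 'b::real_normed_vector"
 assumes T: "open T" and I: "t \<in> I" "x \<in> T" and p: "partials k I T g g'"
 shows "(g t has_derivative (\<lambda>v. g' v t x)) (at x)"
proof -
 note g' = partialsD[OF p]
 have 1: "(g t has_derivative (\<lambda>v. \<Sum>b\<in>Basis. (v \<bullet> b) *\<^sub>R g' b t x)) (at x)"
 proof (rule has_derivative_from_partials[OF T I(2), where f' = "\<lambda>b y. g' b t y"])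
  show "isCont (g' b t) x" for b
   using PC_continuous_slice[OF g'(1) I(1)] T I(2) continuous_on_eq_continuous_at by blast
 qed (use g'(2) I in auto)
 have "(\<Sum>b\<in>Basis. (v \<bullet> b) *\<^sub>R g' b t x) = g' v t x" for v
  by (rule vector_derivative_unique_at[OF has_derivative_imp_line[OF 1] g'(2)[OF I]])
 with 1 show ?thesis by simp
qed

text \<open>By induction on \<open>k\<close>: the directional derivative of the composition is a sum over the standard basis of
  products of functions that are one degree less regular, and those are covered by the hypothesis.\<close>
lemma PC_compose:
 fixes g :: "real \<Rightarrow> 'a::euclidean_space \<Rightarrow> 'b::real_normed_vector"
  and u :: "real \<Rightarrow> 'c::euclidean_space \<Rightarrow> 'a"
 assumes T: "open T"
 shows "PC k I T g ==> PC k I V u ==> (\<And>t x. t \<in> I ==> x \<in> V ==> u t x \<in> T) ==>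
  PC k I V (\<lambda>t x. g t (u t x))"
proof (induction k arbitrary: g)
 case 0
 have "continuous_on (I \<times> V) ((\<lambda>(t, x). g t x) \<circ> (\<lambda>z. (fst z, u (fst z) (snd z))))"
  by (rule continuous_on_compose)
   (use 0 in \<open>auto simp: case_prod_beta intro!: continuous_intros elim!: continuous_on_subset\<close>)
 then show ?case by (simp add: o_def case_prod_beta)
next
 case (Suc k)
 have c: "continuous_on (I \<times> V) ((\<lambda>(t, x). g t x) \<circ> (\<lambda>z. (fst z, u (fst z) (snd z))))"
  by (rule continuous_on_compose)
   (use Suc.prems(3) PC_cont[OF Suc.prems(1)] PC_cont[OF Suc.prems(2)] in
    \<open>auto simp: case_prod_beta intro!: continuous_intros elim!: continuous_on_subset\<close>)
 obtain g' where pg: "partials k I T g g'"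
  using PC_SucE[OF Suc.prems(1)] by blast
 note g' = partialsD[OF pg]
 obtain u' where pu: "partials k I V u u'"
  using PC_SucE[OF Suc.prems(2)] by blast
 note u' = partialsD[OF pu]
 have d: "((\<lambda>s. g t (u t (x + s *\<^sub>R v))) has_vector_derivative
   (\<Sum>b\<in>Basis. (u' v t x \<bullet> b) *\<^sub>R g' b t (u t x))) (at 0)" if tx: "t \<in> I" "x \<in> V" for t x v
 proof -
  have gd: "(g t has_derivative (\<lambda>v. g' v t (u t x))) (at (u t x))"
   by (rule partials_has_derivative[OF T]) (use tx Suc.prems(3) pg in auto)
  have "(\<Sum>b\<in>Basis. (w \<bullet> b) *\<^sub>R g' b t (u t x)) = g' w t (u t x)" for w
   by (subst euclidean_representation[of w, symmetric], subst linear_sum[OF has_derivative_linear[OF gd]])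
    (simp add: linear_scale[OF has_derivative_linear[OF gd]])
  moreover have "((\<lambda>s. g t (u t (x + s *\<^sub>R v))) has_vector_derivative g' (u' v t x) t (u t x)) (at 0)"
   using diff_chain_at[of "\<lambda>s. u t (x + s *\<^sub>R v)" "\<lambda>h. h *\<^sub>R u' v t x" 0 "g t" "\<lambda>v. g' v t (u t x)"]
    u'(2)[OF tx] gd linear_scale[OF has_derivative_linear[OF gd]]
   by (simp add: has_vector_derivative_def o_def)
  ultimately show ?thesis by simp
 qed
 have k: "PC k I V (\<lambda>t x. \<Sum>b\<in>Basis. (u' v t x \<bullet> b) *\<^sub>R g' b t (u t x))" for v
  by (intro PC_sum finite_Basis PC_scaleR PC_inner u'(1) PC_const Suc.IH g'(1) PC_Suc_D[OF Suc.prems(2)])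
   (use Suc.prems(3) in auto)
 show ?case
  by (rule PC_SucI[OF _ k d]) (use c in \<open>simp_all add: o_def case_prod_beta\<close>)
qed

text \<open>Links the class \<open>Ck_on\<close> with the parametrised one, so that closure properties need to be shown only once.\<close>
lemma Ck_on_iff_PC:
 fixes f :: "'a::euclidean_space \<Rightarrow> 'b::euclidean_space"
 assumes S: "open S"
 shows "Ck_on k S f \<longleftrightarrow> PC k {0} S (\<lambda>_. f)"
proof (induction k arbitrary: f)
 have cont: "continuous_on ({0::real} \<times> S) (\<lambda>(t, x). f x) \<longleftrightarrow> continuous_on S f" for f :: "'a \<Rightarrow> 'b"
 proof
  assume "continuous_on ({0::real} \<times> S) (\<lambda>(t, x). f x)"
  then have "continuous_on S ((\<lambda>(t, x). f x) \<circ> (\<lambda>x. (0::real, x)))"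
   by (intro continuous_on_compose) (auto intro!: continuous_intros elim!: continuous_on_subset)
  then show "continuous_on S f" by (simp add: o_def)
 next
  assume "continuous_on S f"
  then have "continuous_on ({0::real} \<times> S) (f \<circ> snd)"
   by (intro continuous_on_compose) (auto intro!: continuous_intros elim!: continuous_on_subset)
  then show "continuous_on ({0::real} \<times> S) (\<lambda>(t, x). f x)" by (simp add: o_def case_prod_beta)
 qed
 {
  case 0
  show ?case using cont by simp
 next
  case (Suc k)
  show ?case
  proof
   assume L: "Ck_on (Suc k) S f"
   then have "continuous_on S f"
    by (auto intro!: continuous_at_imp_continuous_on differentiable_imp_continuous_within)
   moreover have "((\<lambda>s. f (x + s *\<^sub>R v)) has_vector_derivative frechet_derivative f (at x) v) (at 0)"
    if "x \<in> S" for x v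
    using L that by (intro has_derivative_imp_line) (auto simp: frechet_derivative_works)
   ultimately show "PC (Suc k) {0} S (\<lambda>_. f)"
    using L Suc.IH by (intro PC_SucI[where g' = "\<lambda>v _ x. frechet_derivative f (at x) v"]) (auto simp: cont)
  next
   assume "PC (Suc k) {0} S (\<lambda>_. f)"
   then obtain g' where pg: "partials k {0} S (\<lambda>_. f) g'"
    using PC_SucE[of k "{0}" S "\<lambda>_. f"] by blast
   note g' = partialsD[OF pg]
   have d: "(f has_derivative (\<lambda>v. g' v 0 x)) (at x)" if "x \<in> S" for x
    by (rule partials_has_derivative[OF S _ that pg]) auto
   have e: "frechet_derivative f (at x) v = g' v 0 x" if "x \<in> S" for x v
    using frechet_derivative_at[OF d[OF that]] by metis
   have "Ck_on k S (\<lambda>x. frechet_derivative f (at x) v)" for v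
    unfolding Suc.IH by (rule PC_cong[OF S _ g'(1)[of v]]) (auto simp: e)
   then show "Ck_on (Suc k) S f" using d by (auto simp: differentiable_def)
  qed
 }
qed

section \<open>Smooth maps on open sets\<close>

definition Cinf :: "'a::euclidean_space set \<Rightarrow> ('a \<Rightarrow> 'b::euclidean_space) \<Rightarrow> bool" where
 "Cinf S f \<longleftrightarrow> open S \<and> (\<forall>k. Ck_on k S f)"

abbreviation Dd :: "('a::real_normed_vector \<Rightarrow> 'b::real_normed_vector) \<Rightarrow> 'a \<Rightarrow> 'a \<Rightarrow> 'b" where
 "Dd f x v \<equiv> frechet_derivative f (at x) v"

lemma Cinf_open: "Cinf S f ==> open S"
 by (simp add: Cinf_def)

lemma Cinf_iff_PC: "Cinf S f \<longleftrightarrow> open S \<and> (\<forall>k. PC k {0} S (\<lambda>_. f))"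
 unfolding Cinf_def using Ck_on_iff_PC by blast

lemma PC_time_independent:
 assumes S: "open S"
 shows "PC k {0} S (\<lambda>_. f) ==> PC k I S (\<lambda>_. f)"
proof (induction k arbitrary: f)
 have c: "continuous_on (I \<times> S) (\<lambda>(t, x). f x)" if "PC k {0} S (\<lambda>_. f)" for k and f :: "'a \<Rightarrow> 'b"
 proof -
  have "continuous_on S f" using PC_continuous_slice[OF that, of 0] by simp
  then have "continuous_on (I \<times> S) (f \<circ> snd)"
   by (intro continuous_on_compose) (auto intro!: continuous_intros elim!: continuous_on_subset)
  then show ?thesis by (simp add: o_def case_prod_beta)
 qed
 {
  case 0
  show ?case using c[OF 0] by simp
 next
  case (Suc k)
  obtain f' where pf: "partials k {0} S (\<lambda>_. f) f'" using PC_SucE[OF Suc.prems] by blast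
  have "PC k {0} S (\<lambda>_. f' v 0)" for v
   by (rule PC_cong[OF S _ partialsD(1)[OF pf, of v]]) simp
  then have "PC k I S (\<lambda>_. f' v 0)" for v by (rule Suc.IH)
  then show ?case
   by (intro PC_SucI[where g' = "\<lambda>v _. f' v 0"]) (use c[OF Suc.prems] partialsD(2)[OF pf] in auto)
 }
qed

lemma PC_subset: "PC k I T g ==> T' \<subseteq> T ==> PC k I T' g"
proof (induction k arbitrary: g)
 have c: "continuous_on (I \<times> T') (\<lambda>(t, x). g t x)" if "PC k I T g" "T' \<subseteq> T" for k and g :: "real \<Rightarrow> 'a \<Rightarrow> 'b"
  using PC_cont[OF that(1)] by (rule continuous_on_subset) (use that in auto)
 {
  case 0
  then show ?case using c[OF 0] by simp
 next
  case (Suc k)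
  obtain g' where pg: "partials k I T g g'" using PC_SucE[OF Suc.prems(1)] by blast
  show ?case
   by (rule PC_SucI[OF c[OF Suc.prems] Suc.IH[OF partialsD(1)[OF pg] Suc.prems(2)] partialsD(2)[OF pg]])
    (use Suc.prems(2) in auto)
 }
qed

lemma Cinf_subset: "Cinf S f ==> open S' ==> S' \<subseteq> S ==> Cinf S' f"
 unfolding Cinf_iff_PC by (auto intro: PC_subset simp del: PC.simps)

lemma Cinf_cong: "Cinf S f ==> (\<And>x. x \<in> S ==> f x = g x) ==> Cinf S g"
 unfolding Cinf_iff_PC by (auto intro: PC_cong[where f = "\<lambda>_. f"] simp del: PC.simps)

lemma Cinf_const: "open S ==> Cinf S (\<lambda>x. c)"
 unfolding Cinf_iff_PC by (auto intro: PC_const simp del: PC.simps)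

lemma Cinf_id: "open S ==> Cinf S (\<lambda>x. x)"
 unfolding Cinf_iff_PC by (auto intro: PC_id simp del: PC.simps)

lemma Cinf_add: "Cinf S f ==> Cinf S g ==> Cinf S (\<lambda>x. f x + g x)"
 unfolding Cinf_iff_PC by (auto intro: PC_add simp del: PC.simps)

lemma Cinf_sum:
 "open S ==> finite A ==> (\<And>i. i \<in> A ==> Cinf S (f i)) ==> Cinf S (\<lambda>x. \<Sum>i\<in>A. f i x)"
 unfolding Cinf_iff_PC by (auto intro!: PC_sum simp del: PC.simps)

lemma Cinf_bilinear:
 "bounded_bilinear B ==> Cinf S f ==> Cinf S g ==> Cinf S (\<lambda>x. B (f x) (g x))"
 unfolding Cinf_iff_PC by (auto intro: PC_bilinear simp del: PC.simps)

lemmas Cinf_scaleR = Cinf_bilinear[OF bounded_bilinear_scaleR]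
lemmas Cinf_inner = Cinf_bilinear[OF bounded_bilinear_inner]

lemma Cinf_linear: "linear L ==> Cinf S f ==> Cinf S (\<lambda>x. L (f x))"
 unfolding Cinf_iff_PC by (auto intro: PC_linear simp del: PC.simps simp: linear_conv_bounded_linear)

lemma Cinf_uminus: "Cinf S f ==> Cinf S (\<lambda>x. - f x)"
 by (rule Cinf_linear[of uminus]) (auto intro!: linearI)

lemma Cinf_diff: "Cinf S f ==> Cinf S g ==> Cinf S (\<lambda>x. f x - g x)"
 using Cinf_add[OF _ Cinf_uminus] by auto

lemma Cinf_mult: "Cinf S f ==> Cinf S g ==> Cinf S (\<lambda>x. f x * g x :: real)"
 using Cinf_scaleR[of S f g] by simp

lemma linear_Pairs: "linear (\<lambda>a. (a, 0))" "linear (\<lambda>b. (0, b))"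
 by (auto intro!: linearI)

lemma Cinf_Pair: "Cinf S f ==> Cinf S g ==> Cinf S (\<lambda>x. (f x, g x))"
 using Cinf_add[OF Cinf_linear[OF linear_Pairs(1)] Cinf_linear[OF linear_Pairs(2)], of S f g]
 by simp

lemma Cinf_compose:
 "Cinf T g ==> Cinf S f ==> (\<And>x. x \<in> S ==> f x \<in> T) ==> Cinf S (\<lambda>x. g (f x))"
 unfolding Cinf_iff_PC by (auto intro!: PC_compose[where g = "\<lambda>_. g" and u = "\<lambda>_. f"] simp del: PC.simps)

lemma Cinf_continuous_on: "Cinf S f ==> continuous_on S f"
 unfolding Cinf_def by (metis Ck_on.simps(1))

lemma Cinf_differentiable: "Cinf S f ==> x \<in> S ==> f differentiable (at x)"
 unfolding Cinf_def by (metis Ck_on.simps(2))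

lemma Cinf_has_derivative: "Cinf S f ==> x \<in> S ==> (f has_derivative Dd f x) (at x)"
 using Cinf_differentiable frechet_derivative_works by blast

lemma Cinf_linear_Dd: "Cinf S f ==> x \<in> S ==> linear (Dd f x)"
 by (rule has_derivative_linear[OF Cinf_has_derivative])

lemma Cinf_line: "Cinf S f ==> x \<in> S ==>
  ((\<lambda>s. f (x + s *\<^sub>R v)) has_vector_derivative Dd f x v) (at 0)"
 by (rule has_derivative_imp_line[OF Cinf_has_derivative])

lemma Cinf_line_unique: "Cinf S f ==> x \<in> S ==>
  ((\<lambda>s. f (x + s *\<^sub>R v)) has_vector_derivative d) (at 0) ==> Dd f x v = d"
 using vector_derivative_unique_at[OF Cinf_line] .

lemma Dd_eqI: "(f has_derivative f') (at x) ==> Dd f x v = f' v"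
 by (metis frechet_derivative_at)

lemma Cinf_Dd: "Cinf S f ==> Cinf S (\<lambda>x. Dd f x v)"
 unfolding Cinf_def by (metis Ck_on.simps(2))

lemma linear_Basis_expand:
 fixes L :: "'a::euclidean_space \<Rightarrow> 'b::real_vector"
 assumes "linear L" shows "L v = (\<Sum>b\<in>Basis. (v \<bullet> b) *\<^sub>R L b)"
 by (subst euclidean_representation[of v, symmetric], subst linear_sum[OF assms])
  (simp add: linear_scale[OF assms])

lemma linear_projection_exists:
 fixes E :: "'e::euclidean_space set"
 assumes E: "subspace E"
 shows "\<exists>p. linear p \<and> range p = E \<and> (\<forall>x\<in>E. p x = x)"
proof -
 have "linear (\<lambda>x::'e. x)" by (rule linearI) auto
 from linear_exists_left_inverse_on[OF this E] obtain g where g: "range g \<subseteq> E" "linear g" "\<forall>v\<in>E. g v = v"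
  by (auto simp: inj_on_def)
 then show ?thesis by (intro exI[of _ g]) (auto simp: image_iff, metis)
qed

text \<open>Families of linear maps are handled as functions that are smooth in the point for each fixed vector;
  expanding in the standard basis makes them smooth on smoothly varying vectors.\<close>
lemma Cinf_linear_family:
 assumes "\<And>v. Cinf S (\<lambda>x. L x v)" "\<And>x. x \<in> S ==> linear (L x)" "Cinf S f"
 shows "Cinf S (\<lambda>x. L x (f x))"
proof (rule Cinf_cong)
 show "Cinf S (\<lambda>x. \<Sum>b\<in>Basis. (f x \<bullet> b) *\<^sub>R L x b)"
  by (intro Cinf_sum Cinf_scaleR Cinf_inner assms Cinf_const Cinf_open[OF assms(3)]) auto
qed (use linear_Basis_expand[OF assms(2)] in simp)

lemma Cinf_Dd_family: "Cinf S f ==> Cinf S w ==> Cinf S (\<lambda>x. Dd f x (w x))"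
 by (rule Cinf_linear_family) (auto intro: Cinf_Dd Cinf_linear_Dd)

lemma Cinf_local:
 assumes "\<And>x. x \<in> S ==> \<exists>V. x \<in> V \<and> V \<subseteq> S \<and> Cinf V f"
 shows "Cinf S f"
proof -
 have o: "open S" using assms Cinf_open by (subst open_subopen) blast
 have main: "Ck_on k S f" if "\<And>x. x \<in> S ==> \<exists>V. open V \<and> x \<in> V \<and> Ck_on k V f" for k and f :: "'a \<Rightarrow> 'b"
  using that
 proof (induction k arbitrary: f)
  case 0
  have "isCont f x" if x: "x \<in> S" for x
  proof -
   obtain V where "open V" "x \<in> V" "Ck_on 0 V f" using 0[OF x] by blast
   then show ?thesis using continuous_on_eq_continuous_at by auto
  qed
  then show ?case by (simp add: continuous_at_imp_continuous_on)
 next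
  case (Suc k)
  show ?case unfolding Ck_on.simps
  proof (intro conjI ballI allI Suc.IH)
   fix x assume "x \<in> S" then show "f differentiable at x" using Suc.prems by (metis Ck_on.simps(2))
  next
   fix v x assume "x \<in> S"
   then show "\<exists>V. open V \<and> x \<in> V \<and> Ck_on k V (\<lambda>x. Dd f x v)" using Suc.prems by (metis Ck_on.simps(2))
  qed
 qed
 show ?thesis unfolding Cinf_def
 proof (intro conjI o allI, rule main)
  fix x k assume "x \<in> S"
  then obtain V where "x \<in> V" "Cinf V f" using assms by metis
  then show "\<exists>V. open V \<and> x \<in> V \<and> Ck_on k V f" by (auto simp: Cinf_def)
 qed
qed

lemma Dd_cong:
 assumes "open S" "x \<in> S" "\<And>y. y \<in> S ==> f y = g y" "f differentiable (at x)"
 shows "Dd g x v = Dd f x v"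
proof (rule Dd_eqI)
 show "(g has_derivative Dd f x) (at x)"
  by (rule has_derivative_transform_within_open[OF _ assms(1,2,3)])
   (use assms(4) frechet_derivative_works in blast)
qed

lemma Cinf_Dd_compose:
 assumes "Cinf T g" "Cinf S f" "x \<in> S" "f x \<in> T"
 shows "Dd (\<lambda>x. g (f x)) x v = Dd g (f x) (Dd f x v)"
proof (rule Dd_eqI)
 show "((\<lambda>x. g (f x)) has_derivative (\<lambda>v. Dd g (f x) (Dd f x v))) (at x)"
  using diff_chain_at[OF Cinf_has_derivative[OF assms(2,3)] Cinf_has_derivative[OF assms(1,4)]]
  by (simp add: o_def)
qed

lemma Cinf_Dd_linear: "Cinf S f ==> x \<in> S ==> linear L ==> Dd (\<lambda>x. L (f x)) x v = L (Dd f x v)"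
 by (rule Dd_eqI) (auto intro: bounded_linear.has_derivative Cinf_has_derivative
  simp: linear_conv_bounded_linear)

lemma Cinf_Dd_add: "Cinf S f ==> Cinf S g ==> x \<in> S ==>
  Dd (\<lambda>x. f x + g x) x v = Dd f x v + Dd g x v"
 by (rule Dd_eqI) (auto intro!: has_derivative_add Cinf_has_derivative)

lemma Cinf_Dd_bilinear: "bounded_bilinear B ==> Cinf S f ==> Cinf S g ==> x \<in> S ==>
  Dd (\<lambda>x. B (f x) (g x)) x v = B (f x) (Dd g x v) + B (Dd f x v) (g x)"
 by (rule Dd_eqI) (auto intro!: bounded_bilinear.FDERIV Cinf_has_derivative)

lemma Cinf_Dd_sum: "finite A ==> (\<And>i. i \<in> A ==> Cinf S (f i)) ==> x \<in> S ==>
  Dd (\<lambda>x. \<Sum>i\<in>A. f i x) x v = (\<Sum>i\<in>A. Dd (f i) x v)"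
 by (rule Dd_eqI) (auto intro!: has_derivative_sum Cinf_has_derivative)

lemma Dd_const: "Dd (\<lambda>x. c) x v = 0"
 by (rule Dd_eqI) auto

lemma Dd_family_expand:
 assumes L: "\<And>v. Cinf S (\<lambda>x. L x v)" "\<And>x. x \<in> S ==> linear (L x)" and x: "x \<in> S"
 shows "Dd (\<lambda>y. L y a) x v = (\<Sum>b\<in>Basis. (a \<bullet> b) *\<^sub>R Dd (\<lambda>y. L y b) x v)"
proof -
 note o = Cinf_open[OF L(1)]
 have c: "Cinf S (\<lambda>y. \<Sum>b\<in>Basis. (a \<bullet> b) *\<^sub>R L y b)"
  by (intro Cinf_sum[OF o finite_Basis] Cinf_scaleR Cinf_const[OF o] L(1))
 have "Dd (\<lambda>y. L y a) x v = Dd (\<lambda>y. \<Sum>b\<in>Basis. (a \<bullet> b) *\<^sub>R L y b) x v"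
  by (rule Dd_cong[OF o x linear_Basis_expand[OF L(2), symmetric] Cinf_differentiable[OF c x]])
 also have "\<dots> = (\<Sum>b\<in>Basis. (a \<bullet> b) *\<^sub>R Dd (\<lambda>y. L y b) x v)"
  by (subst Cinf_Dd_sum[OF finite_Basis Cinf_scaleR[OF Cinf_const[OF o] L(1)] x])
   (simp add: Cinf_Dd_bilinear[OF bounded_bilinear_scaleR Cinf_const[OF o] L(1) x] Dd_const)
 finally show ?thesis .
qed

lemma Cinf_Dd_linear_family:
 assumes L: "\<And>v. Cinf S (\<lambda>x. L x v)" "\<And>x. x \<in> S ==> linear (L x)" and f: "Cinf S f" and x: "x \<in> S"
 shows "Dd (\<lambda>x. L x (f x)) x v = Dd (\<lambda>y. L y (f x)) x v + L x (Dd f x v)"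
proof -
 note o = Cinf_open[OF f]
 note cs = Cinf_inner[OF f Cinf_const[OF o]]
 have b: "Dd (\<lambda>x. f x \<bullet> b) x v = Dd f x v \<bullet> b" for b
  using Cinf_Dd_bilinear[OF bounded_bilinear_inner f Cinf_const[OF o] x] by (simp add: Dd_const)
 have c: "Cinf S (\<lambda>y. \<Sum>b\<in>Basis. (f y \<bullet> b) *\<^sub>R L y b)"
  by (intro Cinf_sum[OF o finite_Basis] Cinf_scaleR cs L(1))
 have "Dd (\<lambda>x. L x (f x)) x v = Dd (\<lambda>y. \<Sum>b\<in>Basis. (f y \<bullet> b) *\<^sub>R L y b) x v"
  by (rule Dd_cong[OF o x linear_Basis_expand[OF L(2), symmetric] Cinf_differentiable[OF c x]])
 also have "\<dots> = (\<Sum>b\<in>Basis. (f x \<bullet> b) *\<^sub>R Dd (\<lambda>y. L y b) x v + (Dd f x v \<bullet> b) *\<^sub>R L x b)"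
  by (subst Cinf_Dd_sum[OF finite_Basis Cinf_scaleR[OF cs L(1)] x])
   (simp add: Cinf_Dd_bilinear[OF bounded_bilinear_scaleR cs L(1) x] b)
 also have "\<dots> = Dd (\<lambda>y. L y (f x)) x v + L x (Dd f x v)"
  by (simp add: sum.distrib Dd_family_expand[OF L x, of "f x"] linear_Basis_expand[OF L(2)[OF x], of "Dd f x v", symmetric])
 finally show ?thesis .
qed

text \<open>Both second derivatives are limits of the same second difference quotient of \<open>f\<close>, taken along the
  parallelogram spanned by \<open>r u\<close> and \<open>r v\<close>.\<close>
lemma Dd_symmetric:
 assumes f: "Cinf S f" and x: "x \<in> S"
 shows "Dd (\<lambda>y. Dd f y u) x v = Dd (\<lambda>y. Dd f y v) x u"
proof -
 have half: "\<exists>\<delta>>0. \<forall>r. \<bar>r\<bar> < \<delta> \<longrightarrow>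
   norm (f (x + r *\<^sub>R u + r *\<^sub>R v) - f (x + r *\<^sub>R u) - f (x + r *\<^sub>R v) + f x
    - (r * r) *\<^sub>R Dd (\<lambda>y. Dd f y u) x v) \<le> r * r * e" if e: "e > 0" for e u v
 proof -
  let ?A = "\<lambda>x. Dd (\<lambda>y. Dd f y u) x v"
  have "continuous_on S ?A" by (intro Cinf_continuous_on Cinf_Dd f)
  then have "isCont ?A x" using Cinf_open[OF f] x continuous_on_eq_continuous_at by blast
  then have "\<forall>\<^sub>F y in nhds x. norm (?A y - ?A x) < e"
   using tendstoD[of ?A "?A x" "nhds x" e] e tendsto_at_iff_tendsto_nhds[of ?A x]
   by (simp add: isCont_def dist_norm)
  moreover have "\<forall>\<^sub>F y in nhds x. y \<in> S" using Cinf_open[OF f] x by (rule eventually_nhds_in_open)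
  ultimately have "\<forall>\<^sub>F y in nhds x. y \<in> S \<and> norm (?A y - ?A x) < e" by eventually_elim simp
  then obtain d where d: "d > 0" "\<And>y. dist y x < d ==> y \<in> S \<and> norm (?A y - ?A x) < e"
   unfolding eventually_nhds_metric by blast
  define \<delta> where "\<delta> = d / (norm u + norm v + 1)"
  have \<delta>: "\<delta> > 0" unfolding \<delta>_def using d(1) by (simp add: add_nonneg_pos)
  have near: "dist (x + a *\<^sub>R u + b *\<^sub>R v) x < d" if "\<bar>r\<bar> < \<delta>" "\<bar>a\<bar> \<le> \<bar>r\<bar>" "\<bar>b\<bar> \<le> \<bar>r\<bar>" for a b r
  proof -
   have "dist (x + a *\<^sub>R u + b *\<^sub>R v) x = norm (a *\<^sub>R u + b *\<^sub>R v)" by (simp add: dist_norm)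
   also have "\<dots> \<le> \<bar>a\<bar> * norm u + \<bar>b\<bar> * norm v" by (rule norm_triangle_le) simp
   also have "\<dots> \<le> \<bar>r\<bar> * norm u + \<bar>r\<bar> * norm v"
    by (intro add_mono mult_right_mono) (use that in auto)
   also have "\<dots> \<le> \<bar>r\<bar> * (norm u + norm v + 1)" by (simp add: algebra_simps)
   also have "\<dots> < \<delta> * (norm u + norm v + 1)"
    by (rule mult_strict_right_mono[OF that(1)]) (simp add: add_nonneg_pos)
   also have "\<dots> = d" unfolding \<delta>_def using add_nonneg_pos[of "norm u + norm v" 1] by simp
   finally show ?thesis .
  qed
  have seg: "\<bar>s\<bar> \<le> \<bar>r\<bar>" if "s \<in> closed_segment 0 r" for s r :: real
   using that by (auto simp: closed_segment_eq_real_ivl split: if_splits)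
  show ?thesis
  proof (intro exI[of _ \<delta>] conjI \<delta> allI impI)
   fix r :: real assume r: "\<bar>r\<bar> < \<delta>"
   let ?\<phi> = "\<lambda>s. f (x + s *\<^sub>R u + r *\<^sub>R v) - f (x + s *\<^sub>R u)"
   have "norm (?\<phi> r - ?\<phi> 0 - r *\<^sub>R (r *\<^sub>R ?A x)) \<le> \<bar>r\<bar> * (\<bar>r\<bar> * e)"
   proof (rule mean_value_increment)
    fix s assume s: "s \<in> closed_segment 0 r"
    have in1: "x + s *\<^sub>R u + r *\<^sub>R v \<in> S" and in2: "x + s *\<^sub>R u \<in> S"
     using d(2)[OF near[OF r seg[OF s], of r]] d(2)[OF near[OF r seg[OF s], of 0]] by auto
    have "((\<lambda>s. f ((x + r *\<^sub>R v) + s *\<^sub>R u)) has_vector_derivative Dd f (x + s *\<^sub>R u + r *\<^sub>R v) u) (at s)"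
     by (rule has_vd_line_shift) (use Cinf_line[OF f in1, of u] in \<open>simp add: algebra_simps\<close>)
    moreover have "((\<lambda>s. f (x + s *\<^sub>R u)) has_vector_derivative Dd f (x + s *\<^sub>R u) u) (at s)"
     by (rule has_vd_line_shift) (use Cinf_line[OF f in2, of u] in simp)
    ultimately show "(?\<phi> has_vector_derivative Dd f (x + s *\<^sub>R u + r *\<^sub>R v) u - Dd f (x + s *\<^sub>R u) u) (at s)"
     by (auto intro!: has_vector_derivative_diff simp: algebra_simps)
    show "norm (Dd f (x + s *\<^sub>R u + r *\<^sub>R v) u - Dd f (x + s *\<^sub>R u) u - r *\<^sub>R ?A x) \<le> \<bar>r\<bar> * e"
    proof (rule dir_mean_value[where T = S and f' = ?A])
     fix s' assume s': "s' \<in> closed_segment 0 r"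
     note nn = d(2)[OF near[OF r seg[OF s] seg[OF s']]]
     show "x + s *\<^sub>R u + s' *\<^sub>R v \<in> S" "norm (?A (x + s *\<^sub>R u + s' *\<^sub>R v) - ?A x) \<le> e"
      using nn by auto
    qed (rule Cinf_line[OF Cinf_Dd[OF f]])
   qed
   then show "norm (f (x + r *\<^sub>R u + r *\<^sub>R v) - f (x + r *\<^sub>R u) - f (x + r *\<^sub>R v) + f x
    - (r * r) *\<^sub>R ?A x) \<le> r * r * e" by (simp add: algebra_simps flip: abs_mult)
  qed
 qed
 let ?A = "Dd (\<lambda>y. Dd f y u) x v" and ?B = "Dd (\<lambda>y. Dd f y v) x u"
 have "norm (?A - ?B) \<le> 0 + 2 * e" if e: "e > 0" for e
 proof -
  obtain \<delta>1 where 1: "\<delta>1 > 0" "\<And>r. \<bar>r\<bar> < \<delta>1 ==> norm (f (x + r *\<^sub>R u + r *\<^sub>R v) - f (x + r *\<^sub>R u) - f (x + r *\<^sub>R v) + f x - (r * r) *\<^sub>R ?A) \<le> r * r * e"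
   using half[OF e] by blast
  obtain \<delta>2 where 2: "\<delta>2 > 0" "\<And>r. \<bar>r\<bar> < \<delta>2 ==> norm (f (x + r *\<^sub>R v + r *\<^sub>R u) - f (x + r *\<^sub>R v) - f (x + r *\<^sub>R u) + f x - (r * r) *\<^sub>R ?B) \<le> r * r * e"
   using half[OF e] by blast
  define r where "r = min \<delta>1 \<delta>2 / 2"
  have r: "r > 0" "\<bar>r\<bar> < \<delta>1" "\<bar>r\<bar> < \<delta>2" using 1(1) 2(1) by (auto simp: r_def min_def)
  define Q where "Q = f (x + r *\<^sub>R u + r *\<^sub>R v) - f (x + r *\<^sub>R u) - f (x + r *\<^sub>R v) + f x"
  have a: "norm (Q - (r * r) *\<^sub>R ?A) \<le> r * r * e" unfolding Q_def by (rule 1(2)[OF r(2)])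
  have b: "norm (Q - (r * r) *\<^sub>R ?B) \<le> r * r * e" unfolding Q_def
   using 2(2)[OF r(3)] by (simp add: algebra_simps)
  have "(r * r) *\<^sub>R (?A - ?B) = (Q - (r * r) *\<^sub>R ?B) - (Q - (r * r) *\<^sub>R ?A)" by (simp add: algebra_simps)
  then have "norm ((r * r) *\<^sub>R (?A - ?B)) \<le> norm (Q - (r * r) *\<^sub>R ?B) + norm (Q - (r * r) *\<^sub>R ?A)"
   using norm_triangle_ineq4 by metis
  also have "\<dots> \<le> (r * r) * (2 * e)" using a b by simp
  finally have "(r * r) * norm (?A - ?B) \<le> (r * r) * (2 * e)" by simp
  then show ?thesis using r(1) by (simp add: mult_le_cancel_left)
 qed
 note est = this
 have "norm (?A - ?B) \<le> 0"
 proof (rule field_le_epsilon)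
  fix e :: real assume "e > 0"
  then show "norm (?A - ?B) \<le> 0 + e" using est[of "e / 2"] by simp
 qed
 then show ?thesis by simp
qed

lemma has_vector_derivative_iff_quotient:
 "(f has_vector_derivative d) (at 0) \<longleftrightarrow> ((\<lambda>s::real. (1 / s) *\<^sub>R (f s - f 0)) \<longlongrightarrow> d) (at 0)"
proof -
 have "(f has_vector_derivative d) (at 0) \<longleftrightarrow> ((\<lambda>s. norm (f s - f 0 - s *\<^sub>R d) / norm s) \<longlongrightarrow> 0) (at 0)"
  by (simp add: has_vector_derivative_def has_derivative_iff_norm bounded_linear_scaleR_left)
 also have "\<dots> \<longleftrightarrow> ((\<lambda>s. norm ((1 / s) *\<^sub>R (f s - f 0) - d)) \<longlongrightarrow> 0) (at 0)"
 proof (rule filterlim_cong[OF refl refl])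
  have "norm (f s - f 0 - s *\<^sub>R d) / norm s = norm ((1 / s) *\<^sub>R (f s - f 0) - d)" if "s \<noteq> 0" for s
  proof -
   have "(1 / s) *\<^sub>R (f s - f 0) - d = (1 / s) *\<^sub>R (f s - f 0 - s *\<^sub>R d)"
    using that by (simp add: algebra_simps)
   then show ?thesis by (simp add: divide_inverse mult.commute)
  qed
  then show "\<forall>\<^sub>F s in at 0. norm (f s - f 0 - s *\<^sub>R d) / norm s = norm ((1 / s) *\<^sub>R (f s - f 0) - d)"
   by (auto simp: eventually_at_filter)
 qed
 also have "\<dots> \<longleftrightarrow> ((\<lambda>s::real. (1 / s) *\<^sub>R (f s - f 0)) \<longlongrightarrow> d) (at 0)"
  by (simp add: tendsto_norm_zero_iff LIM_zero_iff)
 finally show ?thesis .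
qed

text \<open>The inverse of a smooth family of invertible maps is smooth. The uniform bound on the inverses makes
  them continuous; then \<open>dC = -C (dB) C\<close> expresses their derivative through themselves, and regularity
  follows by induction.\<close>
lemma Cinf_inverse_family:
 fixes B C :: "'a::euclidean_space \<Rightarrow> 'b::euclidean_space \<Rightarrow> 'b"
 assumes S: "open S"
  and B: "\<And>v. Cinf S (\<lambda>x. B x v)" "\<And>x. x \<in> S ==> linear (B x)"
  and C: "\<And>x. x \<in> S ==> linear (C x)" "\<And>x v. x \<in> S ==> norm (C x v) \<le> 2 * norm v"
  and inv: "\<And>x v. x \<in> S ==> C x (B x v) = v" "\<And>x v. x \<in> S ==> B x (C x v) = v"
 shows "Cinf S (\<lambda>x. C x v)"
proof -
 have diff: "C y v - C x v = C y (B x (C x v) - B y (C x v))" if "x \<in> S" "y \<in> S" for x y v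
  using inv[OF that(1)] inv[OF that(2)] by (simp add: linear_diff[OF C(1)[OF that(2)]])
 have cont: "continuous_on S (\<lambda>x. C x v)" for v
 proof (rule continuous_at_imp_continuous_on, rule ballI)
  fix x assume x: "x \<in> S"
  have "isCont (\<lambda>y. B y (C x v)) x"
   using Cinf_continuous_on[OF B(1)] continuous_on_eq_continuous_at[OF S] x by blast
  then have l: "((\<lambda>y. 2 * norm (B x (C x v) - B y (C x v))) \<longlongrightarrow> 2 * norm (B x (C x v) - B x (C x v))) (at x)"
   unfolding isCont_def by (intro tendsto_intros)
  have "((\<lambda>y. C y v - C x v) \<longlongrightarrow> 0) (at x)"
  proof (rule Lim_null_comparison)
   show "((\<lambda>y. 2 * norm (B x (C x v) - B y (C x v))) \<longlongrightarrow> 0) (at x)" using l by simp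
   show "\<forall>\<^sub>F y in at x. norm (C y v - C x v) \<le> 2 * norm (B x (C x v) - B y (C x v))"
    using eventually_at_in_open'[OF S x] by eventually_elim (use C(2) diff[OF x] in metis)
  qed
  then show "isCont (\<lambda>x. C x v) x" unfolding isCont_def by (simp add: LIM_zero_iff)
 qed
 define D where "D w v x = (\<Sum>b\<in>Basis. (C x v \<bullet> b) *\<^sub>R Dd (\<lambda>y. B y b) x w)" for w v x
 have D: "D w v x = Dd (\<lambda>y. B y (C x v)) x w" if x: "x \<in> S" for w v x
  unfolding D_def by (rule Dd_family_expand[OF B x, symmetric])
 have d: "((\<lambda>s. C (x + s *\<^sub>R w) v) has_vector_derivative - (\<Sum>b\<in>Basis. (D w v x \<bullet> b) *\<^sub>R C x b)) (at 0)"
  if x: "x \<in> S" for x v w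
  unfolding has_vector_derivative_iff_quotient
 proof (rule Lim_transform_eventually)
  let ?q = "\<lambda>s. (1 / s) *\<^sub>R (B (x + s *\<^sub>R w) (C x v) - B (x + 0 *\<^sub>R w) (C x v))"
  have "(?q \<longlongrightarrow> D w v x) (at 0)"
   using Cinf_line[OF B(1)[of "C x v"] x, where v = w] unfolding has_vector_derivative_iff_quotient D[OF x] .
  moreover have "((\<lambda>s. C (x + s *\<^sub>R w) b) \<longlongrightarrow> C x b) (at 0)" for b
  proof -
   have "isCont (\<lambda>y. C y b) (x + 0 *\<^sub>R w)"
    using cont continuous_on_eq_continuous_at[OF S] x by auto
   moreover have "isCont (\<lambda>s. x + s *\<^sub>R w) 0" by (intro continuous_intros)
   ultimately have "isCont (\<lambda>s. C (x + s *\<^sub>R w) b) 0"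
    using isCont_o2[of 0 "\<lambda>s. x + s *\<^sub>R w" "\<lambda>y. C y b"] by blast
   then show ?thesis by (simp add: isCont_def)
  qed
  ultimately show "((\<lambda>s. - (\<Sum>b\<in>Basis. (?q s \<bullet> b) *\<^sub>R C (x + s *\<^sub>R w) b)) \<longlongrightarrow>
   - (\<Sum>b\<in>Basis. (D w v x \<bullet> b) *\<^sub>R C x b)) (at 0)"
   by (intro tendsto_intros)
  have "open ((\<lambda>s. x + s *\<^sub>R w) -` S)"
   by (rule open_vimage[OF S]) (intro continuous_intros)
  then have "\<forall>\<^sub>F s in at 0. s \<in> (\<lambda>s. x + s *\<^sub>R w) -` S"
   by (rule eventually_at_in_open') (simp add: x)
  then show "\<forall>\<^sub>F s in at 0. - (\<Sum>b\<in>Basis. (?q s \<bullet> b) *\<^sub>R C (x + s *\<^sub>R w) b)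
   = (1 / s) *\<^sub>R (C (x + s *\<^sub>R w) v - C (x + 0 *\<^sub>R w) v)"
  proof eventually_elim
   case (elim s)
   then have y: "x + s *\<^sub>R w \<in> S" by simp
   have "(\<Sum>b\<in>Basis. (?q s \<bullet> b) *\<^sub>R C (x + s *\<^sub>R w) b) = C (x + s *\<^sub>R w) (?q s)"
    by (rule linear_Basis_expand[OF C(1)[OF y], symmetric])
   also have "\<dots> = (1 / s) *\<^sub>R (C (x + s *\<^sub>R w) (B (x + s *\<^sub>R w) (C x v) - B x (C x v)))"
    by (simp add: linear_scale[OF C(1)[OF y]])
   also have "\<dots> = (1 / s) *\<^sub>R (C x v - C (x + s *\<^sub>R w) v)"
   proof -
    have "C (x + s *\<^sub>R w) (B (x + s *\<^sub>R w) (C x v) - B x (C x v))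
     = - C (x + s *\<^sub>R w) (B x (C x v) - B (x + s *\<^sub>R w) (C x v))"
     by (simp add: linear_diff[OF C(1)[OF y]])
    then show ?thesis by (simp flip: diff[OF x y])
   qed
   finally show ?case by (simp add: algebra_simps)
  qed
 qed
 have "PC k {0} S (\<lambda>_ x. C x v)" for k v
 proof (induction k arbitrary: v)
  have c: "continuous_on ({0::real} \<times> S) (\<lambda>(t, x). C x v)" for v
  proof -
   have "continuous_on ({0::real} \<times> S) ((\<lambda>x. C x v) \<circ> snd)"
    by (intro continuous_on_compose) (auto intro!: continuous_intros cont)
   then show ?thesis by (simp add: o_def case_prod_beta)
  qed
  {
   case 0
   show ?case using c by simp
  next
   case (Suc k)
   have Dk: "PC k {0} S (\<lambda>_. D w v)" for w
    unfolding D_def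
   proof (rule PC_sum[OF finite_Basis PC_scaleR[OF PC_inner[OF Suc.IH PC_const]]])
    show "PC k {0} S (\<lambda>_ x. Dd (\<lambda>y. B y b) x w)" for b
     using Cinf_Dd[OF B(1), of b w] unfolding Cinf_iff_PC by blast
   qed
   have "PC k {0} S (\<lambda>_ x. - (\<Sum>b\<in>Basis. (D w v x \<bullet> b) *\<^sub>R C x b))" for w
    by (rule PC_linear[OF bounded_linear_minus[OF bounded_linear_ident]
       PC_sum[OF finite_Basis PC_scaleR[OF PC_inner[OF Dk PC_const] Suc.IH]]])
   then show ?case by (rule PC_SucI[OF c]) (use d in auto)
  }
 qed
 then show ?thesis unfolding Cinf_iff_PC using S by blast
qed

section \<open>Ordinary differential equations with parameters\<close>

lemma integral_bound_unit:
 fixes z :: "real \<Rightarrow> 'e::euclidean_space"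
 assumes "t \<in> {0..1}" "continuous_on {0..1} z" "\<And>s. s \<in> {0..1} ==> norm (z s) \<le> C"
 shows "norm (integral {0..t} z) \<le> C"
proof -
 have C: "C \<ge> 0" using assms(3)[of 0] norm_ge_zero[of "z 0"] by (simp del: norm_ge_zero)
 have "norm (integral {0..t} z) \<le> C * (t - 0)"
  by (rule integral_bound) (use assms in \<open>auto elim: continuous_on_subset\<close>)
 also have "\<dots> \<le> C" using assms(1) C by (simp add: mult_left_le)
 finally show ?thesis .
qed

lemma integrable_sub_unit:
 fixes z :: "real \<Rightarrow> 'e::euclidean_space"
 assumes "continuous_on {0..1} z" "t \<in> {0..1}"
 shows "z integrable_on {0..t}"
 by (rule integrable_continuous_real, rule continuous_on_subset[OF assms(1)]) (use assms(2) in auto)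

text \<open>The estimate behind the uniqueness and stability of solutions: a bound of \<open>z\<close> in terms of a fraction of its
  own supremum can be absorbed.\<close>
lemma sup_norm_estimate:
 fixes z :: "real \<Rightarrow> 'e::real_normed_vector"
 assumes z: "continuous_on {0..1} z"
  and est: "\<And>t M. t \<in> {0..1} ==> (\<And>s. s \<in> {0..1} ==> norm (z s) \<le> M) ==> norm (z t) \<le> a + q * M"
  and q: "q < 1" and t: "t \<in> {0..1}"
 shows "(1 - q) * norm (z t) \<le> a"
proof -
 have "continuous_on {0..1} (\<lambda>t. norm (z t))" using z by (intro continuous_intros)
 then obtain m where m: "m \<in> {0..1}" "\<And>s. s \<in> {0..1} ==> norm (z s) \<le> norm (z m)"
  using continuous_attains_sup[of "{0..1::real}" "\<lambda>t. norm (z t)"] by auto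
 have "norm (z m) \<le> a + q * norm (z m)" using est[OF m(1)] m(2) by blast
 then have "(1 - q) * norm (z m) \<le> a" by (simp add: algebra_simps)
 moreover have "(1 - q) * norm (z t) \<le> (1 - q) * norm (z m)"
  using m(2)[OF t] q by (intro mult_left_mono) auto
 ultimately show ?thesis by linarith
qed

text \<open>Uniformity in \<open>t\<close> comes from compactness of the graph of the curve.\<close>
lemma continuous_near_curve:
 fixes g :: "real \<Rightarrow> 'a::euclidean_space \<Rightarrow> 'b::real_normed_vector"
 assumes T: "open T" and g: "continuous_on ({0..1} \<times> T) (\<lambda>(t, x). g t x)"
  and c: "continuous_on {0..1} c" "\<And>t. t \<in> {0..1} ==> c t \<in> T" and e: "e > 0"
 shows "\<exists>\<delta>>0. \<forall>t\<in>{0..1}. \<forall>x. norm (x - c t) < \<delta> \<longrightarrow> x \<in> T \<and> norm (g t x - g t (c t)) \<le> e"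
proof -
 define K where "K = (\<lambda>t. (t, c t)) ` {0..1}"
 have "compact K" unfolding K_def using c(1) by (intro compact_continuous_image continuous_intros) auto
 have "\<exists>d>0. \<forall>s x. s \<in> {0..1} \<and> dist (s, x) (t, c t) < d \<longrightarrow> x \<in> T \<and> norm (g s x - g t (c t)) < e / 2"
  if t: "t \<in> {0..1}" for t
 proof -
  obtain d1 where d1: "d1 > 0" "\<And>z. z \<in> {0..1} \<times> T ==> dist z (t, c t) < d1 ==>
    dist (case z of (s, x) \<Rightarrow> g s x) (g t (c t)) < e / 2"
   using g[unfolded continuous_on_iff, rule_format, of "(t, c t)" "e / 2"] t c(2) e by auto
  obtain d2 where d2: "d2 > 0" "\<And>x. dist x (c t) < d2 ==> x \<in> T"
   using T c(2)[OF t] unfolding open_dist by blast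
  show ?thesis
  proof (intro exI[of _ "min d1 d2"] conjI allI impI)
   show "min d1 d2 > 0" using d1 d2 by auto
   fix s x assume a: "s \<in> {0..1} \<and> dist (s, x) (t, c t) < min d1 d2"
   have "dist x (c t) \<le> dist (s, x) (t, c t)" by (metis dist_snd_le snd_conv)
   then show xT: "x \<in> T" using a d2(2) by simp
   show "norm (g s x - g t (c t)) < e / 2" using d1(2)[of "(s, x)"] a xT by (simp add: dist_norm)
  qed
 qed
 then have "\<forall>t\<in>{0..1}. \<exists>d>0. \<forall>s x. s \<in> {0..1} \<and> dist (s, x) (t, c t) < d \<longrightarrow>
   x \<in> T \<and> norm (g s x - g t (c t)) < e / 2" by blast
 from bchoice[OF this] obtain d where d': "\<forall>t\<in>{0..1}. d t > 0 \<and> (\<forall>s x. s \<in> {0..1} \<and>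
   dist (s, x) (t, c t) < d t \<longrightarrow> x \<in> T \<and> norm (g s x - g t (c t)) < e / 2)" by blast
 have d: "d t > 0" if "t \<in> {0..1}" for t using d' that by blast
 have d2: "x \<in> T \<and> norm (g s x - g t (c t)) < e / 2"
  if "t \<in> {0..1}" "s \<in> {0..1}" "dist (s, x) (t, c t) < d t" for t s x using d' that by blast
 have cover: "K \<subseteq> \<Union> ((\<lambda>t. ball (t, c t) (d t)) ` {0..1})"
 proof
  fix k assume "k \<in> K"
  then obtain t where "t \<in> {0..1}" "k = (t, c t)" by (auto simp: K_def)
  then show "k \<in> \<Union> ((\<lambda>t. ball (t, c t) (d t)) ` {0..1})" using d[of t] by (auto intro!: bexI[of _ t])
 qed
 obtain \<delta> where \<delta>: "\<delta> > 0" "\<forall>k\<in>K. \<exists>G\<in>(\<lambda>t. ball (t, c t) (d t)) ` {0..1}. ball k \<delta> \<subseteq> G"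
  by (rule Heine_Borel_lemma[OF \<open>compact K\<close> cover]) (auto intro: that)
 show ?thesis
 proof (intro exI[of _ \<delta>] conjI \<delta>(1) ballI allI impI)
  fix t x assume t: "t \<in> {0..1}" and x: "norm (x - c t) < \<delta>"
  have "(t, c t) \<in> K" using t by (auto simp: K_def)
  from bspec[OF \<delta>(2) this] obtain t0 where t0: "t0 \<in> {0..1}" "ball (t, c t) \<delta> \<subseteq> ball (t0, c t0) (d t0)"
   by blast
  have "(t, c t) \<in> ball (t, c t) \<delta>" using \<delta>(1) by simp
  moreover have "(t, x) \<in> ball (t, c t) \<delta>" using x by (simp add: dist_Pair_Pair dist_norm norm_minus_commute)
  ultimately have in_ball: "dist (t, c t) (t0, c t0) < d t0" "dist (t, x) (t0, c t0) < d t0"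
   using t0(2) by (metis dist_commute in_mono mem_ball)+
  show "x \<in> T" using d2[OF t0(1) t in_ball(2)] by blast
  have "norm (g t x - g t0 (c t0)) < e / 2" "norm (g t (c t) - g t0 (c t0)) < e / 2"
   using d2[OF t0(1) t in_ball(2)] d2[OF t0(1) t in_ball(1)] by auto
  then have "norm (g t x - g t0 (c t0) - (g t (c t) - g t0 (c t0))) \<le> e / 2 + e / 2"
   by (intro norm_triangle_le_diff) simp
  then show "norm (g t x - g t (c t)) \<le> e" by simp
 qed
qed

text \<open>The error of linearisation at \<open>c t\<close> is controlled, by the mean value inequality, by the oscillation of the
  derivatives near the curve, which is uniformly small.\<close>
lemma uniform_linearization_near_curve:
 fixes f :: "real \<Rightarrow> 'a::euclidean_space \<Rightarrow> 'b::real_normed_vector"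
 assumes T: "open T" and p: "partials k {0..1} T f f'"
  and c: "continuous_on {0..1} c" "\<And>t. t \<in> {0..1} ==> c t \<in> T" and e: "e > 0"
 shows "\<exists>\<delta>>0. \<forall>t\<in>{0..1}. \<forall>h. norm h < \<delta> \<longrightarrow> c t + h \<in> T \<and>
   norm (f t (c t + h) - f t (c t) - f' h t (c t)) \<le> e * norm h"
proof -
 define n where "n = real DIM('a)"
 have n: "n \<ge> 1" unfolding n_def using DIM_positive[where 'a='a] by linarith
 have "\<forall>b\<in>(Basis::'a set). \<exists>\<delta>>0. \<forall>t\<in>{0..1}. \<forall>x. norm (x - c t) < \<delta> \<longrightarrow>
   x \<in> T \<and> norm (f' b t x - f' b t (c t)) \<le> e / n"
  using continuous_near_curve[OF T PC_cont[OF partialsD(1)[OF p]] c, of "e / n"] e n by auto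
 then obtain d where d: "\<And>b. b \<in> (Basis::'a set) ==> d b > 0"
  "\<And>b t x. b \<in> (Basis::'a set) ==> t \<in> {0..1} ==> norm (x - c t) < d b ==>
   x \<in> T \<and> norm (f' b t x - f' b t (c t)) \<le> e / n" by metis
 define \<delta> where "\<delta> = Min (d ` Basis)"
 have \<delta>: "\<delta> > 0" "\<And>b. b \<in> Basis ==> \<delta> \<le> d b" unfolding \<delta>_def using d(1) by auto
 have inT: "x \<in> T" if "t \<in> {0..1}" "norm (x - c t) < \<delta>" for t x
  using d(2)[OF SOME_Basis that(1)] \<delta>(2)[OF SOME_Basis] that(2) by fastforce
 show ?thesis
 proof (intro exI[of _ \<delta>] conjI \<delta>(1) ballI allI impI)
  fix t :: real and h :: 'a assume t: "t \<in> {0..1}" and h: "norm h < \<delta>"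
  show "c t + h \<in> T" using inT[OF t, of "c t + h"] h by simp
  have lin: "linear (\<lambda>v. f' v t x)" if "x \<in> T" for x
   using has_derivative_linear[OF partials_has_derivative[OF T t that p]] .
  have seg: "norm (c t + s *\<^sub>R h - c t) < \<delta>" if "s \<in> closed_segment 0 1" for s
  proof -
   have s: "\<bar>s\<bar> \<le> 1" using that by (auto simp: closed_segment_eq_real_ivl)
   have "norm (c t + s *\<^sub>R h - c t) = \<bar>s\<bar> * norm h" by simp
   also have "\<dots> \<le> 1 * norm h" using s by (intro mult_right_mono) auto
   finally show ?thesis using h by simp
  qed
  have "norm (f t (c t + 1 *\<^sub>R h) - f t (c t) - 1 *\<^sub>R f' h t (c t)) \<le> \<bar>1\<bar> * (e * norm h)"
  proof (rule dir_mean_value[where T = T and f' = "\<lambda>x. f' h t x"])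
   show "c t + s *\<^sub>R h \<in> T" if "s \<in> closed_segment 0 1" for s
    using inT[OF t seg[OF that]] .
   show "((\<lambda>s. f t (y + s *\<^sub>R h)) has_vector_derivative f' h t y) (at 0)" if "y \<in> T" for y
    by (rule partialsD(2)[OF p t that])
   fix s :: real assume s: "s \<in> closed_segment 0 1"
   let ?x = "c t + s *\<^sub>R h"
   have "f' h t ?x - f' h t (c t) = (\<Sum>b\<in>Basis. (h \<bullet> b) *\<^sub>R (f' b t ?x - f' b t (c t)))"
    using linear_Basis_expand[OF lin[OF inT[OF t seg[OF s]]], of h]
     linear_Basis_expand[OF lin[OF c(2)[OF t]], of h]
    by (simp add: scaleR_diff_right sum_subtractf)
   also have "norm \<dots> \<le> (\<Sum>b\<in>(Basis::'a set). norm h * (e / n))"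
   proof (rule sum_norm_le)
    fix b :: 'a assume b: "b \<in> Basis"
    have "norm (f' b t ?x - f' b t (c t)) \<le> e / n"
     using d(2)[OF b t] seg[OF s] \<delta>(2)[OF b] by (meson less_le_trans)
    then show "norm ((h \<bullet> b) *\<^sub>R (f' b t ?x - f' b t (c t))) \<le> norm h * (e / n)"
     unfolding norm_scaleR by (intro mult_mono) (use Basis_le_norm[OF b, of h] in auto)
   qed
   also have "\<dots> = e * norm h" using n by (simp add: n_def)
   finally show "norm (f' h t ?x - f' h t (c t)) \<le> e * norm h" .
  qed
  then show "norm (f t (c t + h) - f t (c t) - f' h t (c t)) \<le> e * norm h" by simp
 qed
qed

text \<open>Picard iteration. With Lipschitz constant 1/2 on the unit time interval consecutive iterates differ by a
  geometric sequence in the supremum norm, so they converge uniformly.\<close>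
lemma integral_equation_solution:
 fixes F :: "real \<Rightarrow> 'e::euclidean_space \<Rightarrow> 'e"
 assumes C: "closed C" and F: "continuous_on ({0..1} \<times> C) (\<lambda>(t, y). F t y)"
  and lip: "\<And>t y z. t \<in> {0..1} ==> y \<in> C ==> z \<in> C ==> norm (F t y - F t z) \<le> norm (y - z) / 2"
  and h: "continuous_on {0..1} h" "\<And>t. t \<in> {0..1} ==> h t \<in> C"
  and inv: "\<And>z t. continuous_on {0..1} z ==> (\<And>s. s \<in> {0..1} ==> z s \<in> C) ==> t \<in> {0..1} ==>
   h t + integral {0..t} (\<lambda>s. F s (z s)) \<in> C"
 shows "\<exists>y. continuous_on {0..1} y \<and>
  (\<forall>t\<in>{0..1}. y t \<in> C \<and> y t = h t + integral {0..t} (\<lambda>s. F s (y s)))"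
proof -
 define \<Phi> where "\<Phi> z t = h t + integral {0..t} (\<lambda>s. F s (z s))" for z t
 define adm where "adm z \<longleftrightarrow> continuous_on {0..1} z \<and> (\<forall>s\<in>{0..1}. z s \<in> C)" for z :: "real \<Rightarrow> 'e"
 have Fz: "continuous_on {0..1} (\<lambda>s. F s (z s))" if "adm z" for z
 proof -
  have "continuous_on {0..1} ((\<lambda>(t, y). F t y) \<circ> (\<lambda>s. (s, z s)))"
   by (rule continuous_on_compose)
    (use that F in \<open>auto simp: adm_def intro!: continuous_intros elim!: continuous_on_subset\<close>)
  then show ?thesis by (simp add: o_def)
 qed
 have adm\<Phi>: "adm (\<Phi> z)" if "adm z" for z
 proof -
  have "continuous_on {0..1} (\<lambda>t. integral {0..t} (\<lambda>s. F s (z s)))"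
   by (rule indefinite_integral_continuous_1[OF integrable_continuous_real[OF Fz[OF that]]])
  then show ?thesis using that h(1) inv[of z] unfolding adm_def \<Phi>_def by (auto intro!: continuous_intros)
 qed
 have contr: "norm (\<Phi> z t - \<Phi> w t) \<le> M / 2"
  if "adm z" "adm w" "\<And>s. s \<in> {0..1} ==> norm (z s - w s) \<le> M" "t \<in> {0..1}" for z w t M
 proof -
  have "\<Phi> z t - \<Phi> w t = integral {0..t} (\<lambda>s. F s (z s) - F s (w s))"
   unfolding \<Phi>_def using Fz[OF that(1)] Fz[OF that(2)]
   by (subst integral_diff) (auto intro!: integrable_sub_unit that)
  also have "norm \<dots> \<le> M / 2"
  proof (rule integral_bound_unit[OF that(4)])
   show "continuous_on {0..1} (\<lambda>s. F s (z s) - F s (w s))"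
    using Fz[OF that(1)] Fz[OF that(2)] by (intro continuous_intros)
   fix s :: real assume s: "s \<in> {0..1}"
   show "norm (F s (z s) - F s (w s)) \<le> M / 2"
    using lip[OF s, of "z s" "w s"] that(1,2) that(3)[OF s] s by (auto simp: adm_def)
  qed
  finally show ?thesis .
 qed
 define Z where "Z n = (\<Phi> ^^ n) h" for n
 have Z0: "Z 0 = h" and ZS: "Z (Suc n) = \<Phi> (Z n)" for n by (auto simp: Z_def)
 have admZ: "adm (Z n)" for n
  by (induction n) (use h adm\<Phi> in \<open>auto simp: Z0 ZS adm_def\<close>)
 obtain K where K: "\<And>s. s \<in> {0..1} ==> norm (Z 1 s - Z 0 s) \<le> K"
 proof -
  have "continuous_on {0..1} (\<lambda>s. norm (Z 1 s - Z 0 s))"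
   using admZ[of 0] admZ[of 1] by (auto simp: adm_def intro!: continuous_intros)
  then have "bdd_above ((\<lambda>s. norm (Z 1 s - Z 0 s)) ` {0..1})"
   by (intro bounded_imp_bdd_above compact_imp_bounded compact_continuous_image) auto
  then obtain M where "\<forall>s\<in>{0..1}. norm (Z 1 s - Z 0 s) \<le> M" unfolding bdd_above_def by auto
  then show thesis using that[of M] by blast
 qed
 have step: "norm (Z (Suc n) s - Z n s) \<le> K * (1 / 2) ^ n" if "s \<in> {0..1}" for n s
  using that
 proof (induction n arbitrary: s)
  case (Suc n)
  have "norm (\<Phi> (Z (Suc n)) s - \<Phi> (Z n) s) \<le> (K * (1 / 2) ^ n) / 2"
   by (rule contr[OF admZ admZ Suc.IH Suc.prems])
  then show ?case by (simp add: ZS)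
 qed (use K in simp)
 define y where "y s = Z 0 s + suminf (\<lambda>i. Z (Suc i) s - Z i s)" for s
 have "uniform_limit {0..1} (\<lambda>n s. \<Sum>i<n. Z (Suc i) s - Z i s) (\<lambda>s. suminf (\<lambda>i. Z (Suc i) s - Z i s)) sequentially"
  by (rule Weierstrass_m_test[where M = "\<lambda>n. K * (1 / 2) ^ n"]) (use step in \<open>auto intro!: summable_mult summable_geometric\<close>)
 then have "uniform_limit {0..1} (\<lambda>n s. Z 0 s + (\<Sum>i<n. Z (Suc i) s - Z i s)) y sequentially"
  unfolding y_def by (intro uniform_limit_add uniform_limit_const)
 moreover have "(\<lambda>n s. Z 0 s + (\<Sum>i<n. Z (Suc i) s - Z i s)) = Z"
  using sum_lessThan_telescope[of "\<lambda>i. Z i s" for s] by (auto simp: fun_eq_iff)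
 ultimately have lim: "uniform_limit {0..1} Z y sequentially" by simp
 have y1: "continuous_on {0..1} y"
  by (rule uniform_limit_theorem[OF _ lim]) (use admZ in \<open>auto simp: adm_def\<close>)
 have ptw: "(\<lambda>n. Z n s) \<longlonglongrightarrow> y s" if "s \<in> {0..1}" for s
  by (rule tendsto_uniform_limitI[OF lim that])
 have y2: "y s \<in> C" if "s \<in> {0..1}" for s
  by (rule closed_sequentially[OF C _ ptw[OF that]]) (use admZ that in \<open>auto simp: adm_def\<close>)
 have admy: "adm y" using y1 y2 by (simp add: adm_def)
 have y3: "y t = \<Phi> y t" if t: "t \<in> {0..1}" for t
 proof -
  have "(\<lambda>n. \<Phi> (Z n) t) \<longlonglongrightarrow> \<Phi> y t"
  proof (rule metric_LIMSEQ_I)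
   fix r :: real assume r: "r > 0"
   then have "\<forall>\<^sub>F n in sequentially. \<forall>s\<in>{0..1}. dist (Z n s) (y s) < r"
    using lim unfolding uniform_limit_iff by blast
   then obtain N where N: "\<And>n s. n \<ge> N ==> s \<in> {0..1} ==> dist (Z n s) (y s) < r"
    unfolding eventually_sequentially by blast
   show "\<exists>N. \<forall>n\<ge>N. dist (\<Phi> (Z n) t) (\<Phi> y t) < r"
   proof (intro exI[of _ N] allI impI)
    fix n assume n: "n \<ge> N"
    have "norm (\<Phi> (Z n) t - \<Phi> y t) \<le> r / 2"
     by (rule contr[OF admZ admy _ t]) (use N[OF n] in \<open>auto simp: dist_norm intro: less_imp_le\<close>)
    then show "dist (\<Phi> (Z n) t) (\<Phi> y t) < r" using r by (simp add: dist_norm)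
   qed
  qed
  then have "(\<lambda>n. Z (Suc n) t) \<longlonglongrightarrow> \<Phi> y t" by (simp add: ZS)
  moreover have "(\<lambda>n. Z (Suc n) t) \<longlonglongrightarrow> y t" using ptw[OF t] by (rule LIMSEQ_Suc)
  ultimately show ?thesis by (rule LIMSEQ_unique[rotated])
 qed
 show ?thesis using y1 y2 y3 unfolding \<Phi>_def by (intro exI[of _ y]) blast
qed

lemma PC_compose_curve:
 fixes g :: "real \<Rightarrow> 'a::euclidean_space \<Rightarrow> 'b::real_normed_vector"
 assumes "open T" "continuous_on ({0..1} \<times> T) (\<lambda>(t, x). g t x)" "continuous_on {0..1} c"
  "\<And>t. t \<in> {0..1} ==> c t \<in> T"
 shows "continuous_on {0..1} (\<lambda>t. g t (c t))"
proof -
 have "continuous_on {0..1} ((\<lambda>(t, x). g t x) \<circ> (\<lambda>t. (t, c t)))"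
  by (rule continuous_on_compose)
   (use assms in \<open>auto intro!: continuous_intros elim!: continuous_on_subset\<close>)
 then show ?thesis by (simp add: o_def)
qed

text \<open>Solutions of integral equations are as regular in the parameter as their data. Continuity is the
  estimate for the difference of two solutions. For the inductive step, the expected derivative solves the
  linearised equation, which is of the same kind with data of class \<open>C\<^sup>k\<close>; it is the derivative because the
  difference quotient satisfies the linearised equation up to a small error.\<close>
theorem parameter_dependence:
 fixes f :: "real \<Rightarrow> 'p::euclidean_space \<times> 'e::euclidean_space \<Rightarrow> 'e"
 assumes V: "open V"
 shows "open B ==> PC k {0..1} (V \<times> B) f ==> PC k {0..1} V h ==>
  (\<And>t p x z. t \<in> {0..1} ==> p \<in> V ==> x \<in> B ==> z \<in> B ==> norm (f t (p, x) - f t (p, z)) \<le> norm (x - z) / 2) ==>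
  (\<And>p. p \<in> V ==> continuous_on {0..1} (\<lambda>t. y t p)) ==>
  (\<And>t p. t \<in> {0..1} ==> p \<in> V ==> y t p \<in> B) ==>
  (\<And>t p. t \<in> {0..1} ==> p \<in> V ==> y t p = h t p + integral {0..t} (\<lambda>s. f s (p, y s p))) ==>
  PC k {0..1} V y"
proof (induction k arbitrary: B f h y)
 case 0
 have VB: "open (V \<times> B)" using V 0(1) by (rule open_Times)
 have fc: "continuous_on ({0..1} \<times> (V \<times> B)) (\<lambda>(t, x). f t x)" using PC_cont[OF 0(2)] .
 have hc: "continuous_on ({0..1} \<times> V) (\<lambda>(t, x). h t x)" using PC_cont[OF 0(3)] .
 have fy: "continuous_on {0..1} (\<lambda>s. f s (p, y s q))" if "p \<in> V" "q \<in> V" for p q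
  by (rule PC_compose_curve[OF VB fc]) (use that 0(5,6) in \<open>auto intro!: continuous_intros\<close>)
 have unif: "\<exists>\<delta>>0. \<forall>p. norm (p - q) < \<delta> \<longrightarrow> p \<in> V \<and> (\<forall>t\<in>{0..1}. norm (y t p - y t q) \<le> e)"
  if q: "q \<in> V" and e: "e > 0" for q e
 proof -
  obtain d1 where d1: "d1 > 0" "\<And>t p. t \<in> {0..1} ==> norm (p - q) < d1 ==> p \<in> V \<and> norm (h t p - h t q) \<le> e / 4"
   using continuous_near_curve[OF V hc continuous_on_const, of q "e / 4"] q e by auto
  obtain d2 where d2: "d2 > 0" "\<And>t x. t \<in> {0..1} ==> norm (x - (q, y t q)) < d2 ==>
    x \<in> V \<times> B \<and> norm (f t x - f t (q, y t q)) \<le> e / 4"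
  proof -
   have "continuous_on {0..1} (\<lambda>t. (q, y t q))" using 0(5)[OF q] by (intro continuous_intros)
   from continuous_near_curve[OF VB fc this, of "e / 4"] q e 0(6) show ?thesis using that by auto
  qed
  show ?thesis
  proof (intro exI[of _ "min d1 d2"] conjI allI impI ballI)
   show "min d1 d2 > 0" using d1(1) d2(1) by simp
   fix p assume p: "norm (p - q) < min d1 d2"
   show pV: "p \<in> V" using d1(2)[of 0 p] p by simp
   fix t :: real assume t: "t \<in> {0..1}"
   have "(1 - 1 / 2) * norm (y t p - y t q) \<le> e / 2"
   proof (rule sup_norm_estimate[OF _ _ _ t])
    show "continuous_on {0..1} (\<lambda>t. y t p - y t q)" using 0(5) pV q by (intro continuous_intros)
    fix t M assume t: "t \<in> {0..1::real}" and M: "\<And>s. s \<in> {0..1} ==> norm (y s p - y s q) \<le> M"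
    have "norm (integral {0..t} (\<lambda>s. f s (p, y s p) - f s (q, y s q))) \<le> M / 2 + e / 4"
    proof (rule integral_bound_unit[OF t])
     show "continuous_on {0..1} (\<lambda>s. f s (p, y s p) - f s (q, y s q))"
      using fy pV q by (intro continuous_intros)
     fix s :: real assume s: "s \<in> {0..1}"
     have "norm (f s (p, y s p) - f s (p, y s q)) \<le> M / 2"
      using 0(4)[OF s pV 0(6)[OF s pV] 0(6)[OF s q]] M[OF s] by simp
     moreover have "norm (f s (p, y s q) - f s (q, y s q)) \<le> e / 4"
      using d2(2)[OF s, of "(p, y s q)"] p by (simp add: norm_Pair)
     ultimately show "norm (f s (p, y s p) - f s (q, y s q)) \<le> M / 2 + e / 4"
      by (metis norm_diff_triangle_le)
    qed
    moreover have "norm (h t p - h t q) \<le> e / 4" using d1(2)[OF t] p by simp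
    moreover have "y t p - y t q = (h t p - h t q) + integral {0..t} (\<lambda>s. f s (p, y s p) - f s (q, y s q))"
    proof -
     have "integral {0..t} (\<lambda>s. f s (p, y s p) - f s (q, y s q))
      = integral {0..t} (\<lambda>s. f s (p, y s p)) - integral {0..t} (\<lambda>s. f s (q, y s q))"
      by (rule integral_diff) (intro integrable_sub_unit fy pV q t)+
     then show ?thesis unfolding 0(7)[OF t pV] 0(7)[OF t q] by simp
    qed
    ultimately have "norm (y t p - y t q) \<le> e / 4 + (M / 2 + e / 4)"
     by (simp only: norm_triangle_mono[of "h t p - h t q" "e / 4" _ "M / 2 + e / 4"])
    then show "norm (y t p - y t q) \<le> e / 2 + 1 / 2 * M" by linarith
   qed simp
   then show "norm (y t p - y t q) \<le> e" by simp
  qed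
 qed
 have "\<exists>d>0. \<forall>z\<in>{0..1} \<times> V. dist z (t, q) < d \<longrightarrow> dist (case z of (s, p) \<Rightarrow> y s p) (y t q) < e"
  if t: "t \<in> {0..1}" and q: "q \<in> V" and e: "e > 0" for t q e
 proof -
  obtain d1 where d1: "d1 > 0" "\<And>p t. norm (p - q) < d1 ==> t \<in> {0..1} ==> norm (y t p - y t q) \<le> e / 3"
   using unif[OF q, of "e / 3"] e by auto
  obtain d2 where d2: "d2 > 0" "\<And>s. s \<in> {0..1} ==> dist s t < d2 ==> dist (y s q) (y t q) < e / 3"
   using 0(5)[OF q, unfolded continuous_on_iff, rule_format, OF t, of "e / 3"] e by auto
  show ?thesis
  proof (intro exI[of _ "min d1 d2"] conjI ballI impI)
   show "min d1 d2 > 0" using d1(1) d2(1) by simp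
   fix z assume z: "z \<in> {0..1} \<times> V" and dz: "dist z (t, q) < min d1 d2"
   obtain s p where sp: "z = (s, p)" "s \<in> {0..1}" using z by auto
   have a: "dist s t < d2" "dist p q < d1"
    using dist_fst_le[of z "(t, q)"] dist_snd_le[of z "(t, q)"] dz by (auto simp: sp(1))
   then have "dist (y s p) (y s q) \<le> e / 3" using d1(2)[OF _ sp(2)] by (simp add: dist_norm)
   moreover have "dist (y s q) (y t q) < e / 3" using d2(2)[OF sp(2) a(1)] .
   ultimately have "dist (y s p) (y t q) < e" using dist_triangle[of "y s p" "y t q" "y s q"] e by linarith
   then show "dist (case z of (s, p) \<Rightarrow> y s p) (y t q) < e" by (simp add: sp(1))
  qed
 qed
 then have "continuous_on ({0..1} \<times> V) (\<lambda>(t, x). y t x)"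
  unfolding continuous_on_iff by (force simp del: dist_Pair_Pair)
 then show ?case by simp
next
 case (Suc k)
 note B = Suc.prems(1) and lip = Suc.prems(4) and yc = Suc.prems(5) and yB = Suc.prems(6) and yeq = Suc.prems(7)
 have VB: "open (V \<times> B)" using V B by (rule open_Times)
 have yk: "PC k {0..1} V y"
  by (rule Suc.IH[OF B PC_Suc_D[OF Suc.prems(2)] PC_Suc_D[OF Suc.prems(3)] lip yc yB yeq])
 obtain f' where f': "partials k {0..1} (V \<times> B) f f'" using PC_SucE[OF Suc.prems(2)] by blast
 obtain h' where h': "partials k {0..1} V h h'" using PC_SucE[OF Suc.prems(3)] by blast
 have fder: "(f t has_derivative (\<lambda>u. f' u t x)) (at x)" if "t \<in> {0..1}" "x \<in> V \<times> B" for t x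
  by (rule partials_has_derivative[OF VB that f'])
 note flin = has_derivative_linear[OF fder]
 have yVB: "(p, y t p) \<in> V \<times> B" if "t \<in> {0..1}" "p \<in> V" for t p using yB that by simp
 \<comment> \<open>The linearised equation inherits the Lipschitz constant 1/2.\<close>
 have f'bound: "norm (f' (0, c) t (p, y t p)) \<le> norm c / 2" if t: "t \<in> {0..1}" and p: "p \<in> V" for c t p
 proof -
  let ?q = "\<lambda>s. (1 / s) *\<^sub>R (f t ((p, y t p) + s *\<^sub>R (0, c)) - f t ((p, y t p) + 0 *\<^sub>R (0, c)))"
  have "(?q \<longlongrightarrow> f' (0, c) t (p, y t p)) (at 0)"
   using partialsD(2)[OF f' t yVB[OF t p], of "(0, c)"] unfolding has_vector_derivative_iff_quotient .
  then have "((\<lambda>s. norm (?q s)) \<longlongrightarrow> norm (f' (0, c) t (p, y t p))) (at 0)" by (rule tendsto_norm)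
  moreover have "\<forall>\<^sub>F s in at 0. norm (?q s) \<le> norm c / 2"
  proof -
   have "open ((\<lambda>s. y t p + s *\<^sub>R c) -` B)"
    by (rule open_vimage[OF B]) (intro continuous_intros)
   then have "\<forall>\<^sub>F s in at 0. s \<in> (\<lambda>s. y t p + s *\<^sub>R c) -` B"
    by (rule eventually_at_in_open') (simp add: yB[OF t p])
   moreover have "\<forall>\<^sub>F s in at (0::real). s \<noteq> 0" by (simp add: eventually_at_filter)
   ultimately show ?thesis
   proof eventually_elim
    case (elim s)
    have L: "norm (f t (p, y t p + s *\<^sub>R c) - f t (p, y t p)) \<le> norm (s *\<^sub>R c) / 2"
     using lip[OF t p _ yB[OF t p], of "y t p + s *\<^sub>R c"] elim by simp
    have "norm (?q s) = (1 / \<bar>s\<bar>) * norm (f t (p, y t p + s *\<^sub>R c) - f t (p, y t p))" by simp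
    also have "\<dots> \<le> (1 / \<bar>s\<bar>) * (norm (s *\<^sub>R c) / 2)" using L by (intro mult_left_mono) auto
    also have "\<dots> = norm c / 2" using elim by simp
    finally show ?case .
   qed
  qed
  ultimately show ?thesis by (rule tendsto_upperbound) simp
 qed
 have yk2: "PC k {0..1} (V \<times> UNIV) (\<lambda>t (x :: 'p \<times> 'e). y t (fst x))"
  by (rule PC_compose[OF V yk]) (auto intro!: PC_linear[OF bounded_linear_fst] PC_id)
 have pair: "PC k {0..1} (V \<times> UNIV) (\<lambda>t (x :: 'p \<times> 'e). (fst x, y t (fst x)))"
 proof -
  have "PC k {0..1} (V \<times> UNIV) (\<lambda>t (x :: 'p \<times> 'e). (fst x, 0) + (0, y t (fst x)))"
   by (rule PC_add[OF PC_linear[OF bounded_linear_Pair[OF bounded_linear_fst bounded_linear_zero] PC_id]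
     PC_linear[OF bounded_linear_Pair[OF bounded_linear_zero bounded_linear_ident] yk2]])
  then show ?thesis by simp
 qed
 have f'y: "PC k {0..1} (V \<times> UNIV) (\<lambda>t (x :: 'p \<times> 'e). f' u t (fst x, y t (fst x)))" for u
  by (rule PC_compose[OF VB partialsD(1)[OF f'] pair]) (use yB in auto)
 \<comment> \<open>The right hand side of the linearised equation. Its linear dependence on the unknown is spelled out in the basis, which
  exhibits its regularity.\<close>
 define F where "F v t x = f' (v, 0) t (fst x, y t (fst x)) +
   (\<Sum>e\<in>Basis. (snd x \<bullet> e) *\<^sub>R f' (0, e) t (fst x, y t (fst x)))" for v t and x :: "'p \<times> 'e"
 have Fk: "PC k {0..1} (V \<times> UNIV) (F v)" for v
  unfolding F_def
  by (rule PC_add[OF f'y PC_sum[OF finite_Basis PC_scaleR[OF PC_inner[OF PC_linear[OF bounded_linear_snd PC_id] PC_const] f'y]]])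
 have Feq: "F v t (p, c) = f' (v, c) t (p, y t p)" if t: "t \<in> {0..1}" and p: "p \<in> V" for v t p c
 proof -
  note lin = flin[OF t yVB[OF t p]]
  have lin2: "linear (\<lambda>c. f' (0, c) t (p, y t p))"
   using linear_compose[OF linear_Pairs(2) lin] by (simp add: o_def)
  have "f' (v, c) t (p, y t p) = f' (v, 0) t (p, y t p) + f' (0, c) t (p, y t p)"
   using linear_add[OF lin, of "(v, 0)" "(0, c)"] by simp
  then show ?thesis unfolding F_def using linear_Basis_expand[OF lin2, of c] by simp
 qed
 have Flip: "norm (F v t (p, x) - F v t (p, z)) \<le> norm (x - z) / 2" if t: "t \<in> {0..1}" and p: "p \<in> V" for v t p x z
 proof -
  have "F v t (p, x) - F v t (p, z) = f' (0, x - z) t (p, y t p)"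
   unfolding Feq[OF t p] using linear_diff[OF flin[OF t yVB[OF t p]], of "(v, x)" "(v, z)"] by simp
  then show ?thesis using f'bound[OF t p] by simp
 qed
 have Fcont: "continuous_on ({0..1} \<times> UNIV) (\<lambda>(t, x). F v t (p, x))" if p: "p \<in> V" for v p
 proof -
  have "continuous_on ({0..1} \<times> UNIV) ((\<lambda>(t, x). F v t x) \<circ> (\<lambda>(t, x). (t, (p, x))))"
   by (rule continuous_on_compose)
    (use PC_cont[OF Fk[of v]] p in \<open>auto simp: case_prod_beta intro!: continuous_intros elim!: continuous_on_subset\<close>)
  then show ?thesis by (simp add: o_def case_prod_beta)
 qed
 have h'c: "continuous_on {0..1} (\<lambda>t. h' v t p)" if "p \<in> V" for v p
  by (rule PC_compose_curve[OF V PC_cont[OF partialsD(1)[OF h']] continuous_on_const]) (use that in auto)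
 have ex: "\<exists>c. continuous_on {0..1} c \<and> (\<forall>t\<in>{0..1}. c t = h' v t p + integral {0..t} (\<lambda>s. F v s (p, c s)))"
  if p: "p \<in> V" for v p
 proof -
  have "\<exists>c. continuous_on {0..1} c \<and> (\<forall>t\<in>{0..1}. c t \<in> (UNIV :: 'e set) \<and>
   c t = h' v t p + integral {0..t} (\<lambda>s. F v s (p, c s)))"
   by (rule integral_equation_solution[OF closed_UNIV Fcont[OF p, of v] Flip[OF _ p] h'c[OF p, of v]]) simp_all
  then show ?thesis by blast
 qed
 define c where "c v p = (SOME c. continuous_on {0..1} c \<and>
  (\<forall>t\<in>{0..1}. c t = h' v t p + integral {0..t} (\<lambda>s. F v s (p, c s))))" for v p
 have c1: "continuous_on {0..1} (c v p)" if "p \<in> V" for v p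
  using someI_ex[OF ex[OF that, of v]] unfolding c_def by (rule conjunct1)
 have c2: "c v p t = h' v t p + integral {0..t} (\<lambda>s. F v s (p, c v p s))" if "p \<in> V" "t \<in> {0..1}" for v p t
  using conjunct2[OF someI_ex[OF ex[OF that(1), of v]], rule_format, OF that(2)] unfolding c_def .
 have ck: "PC k {0..1} V (\<lambda>t p. c v p t)" for v
  by (rule Suc.IH[OF open_UNIV Fk partialsD(1)[OF h'] Flip c1 UNIV_I c2])
 have der: "((\<lambda>s. y t (p + s *\<^sub>R v)) has_vector_derivative c v p t) (at 0)" if t: "t \<in> {0..1}" and p: "p \<in> V" for t p v
 proof -
  have cb: "\<exists>K. \<forall>s\<in>{0..1}. norm (c v p s) \<le> K"
  proof -
   have "bounded (c v p ` {0..1})"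
    using c1[OF p] by (intro compact_imp_bounded compact_continuous_image) auto
   then show ?thesis unfolding bounded_iff by blast
  qed
  then obtain K where K: "\<And>s. s \<in> {0..1} ==> norm (c v p s) \<le> K" by blast
  have K0: "K \<ge> 0" using K[of 0] norm_ge_zero[of "c v p 0"] by (simp del: norm_ge_zero)
  define L where "L = norm v + K"
  have L0: "L \<ge> 0" using K0 by (simp add: L_def)
  have key: "\<exists>\<delta>>0. \<forall>s. \<bar>s\<bar> < \<delta> \<longrightarrow> norm (y t (p + s *\<^sub>R v) - y t p - s *\<^sub>R c v p t) \<le> 4 * (1 + norm v + L) * e * \<bar>s\<bar>"
   if e: "e > 0" "e \<le> 1 / 4" for e
  proof -
   obtain d1 where d1: "d1 > 0" "\<And>t w. t \<in> {0..1} ==> norm w < d1 ==> p + w \<in> V \<and> norm (h t (p + w) - h t p - h' w t p) \<le> e * norm w"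
    using uniform_linearization_near_curve[OF V h' continuous_on_const, of p e] p e by auto
   obtain d2 where d2: "d2 > 0" "\<And>t w. t \<in> {0..1} ==> norm w < d2 ==> (p, y t p) + w \<in> V \<times> B \<and>
     norm (f t ((p, y t p) + w) - f t (p, y t p) - f' w t (p, y t p)) \<le> e * norm w"
   proof -
    have "continuous_on {0..1} (\<lambda>t. (p, y t p))" using yc[OF p] by (intro continuous_intros)
    from uniform_linearization_near_curve[OF VB f' this, of e] yVB p e show ?thesis using that by auto
   qed
   obtain d3 where d3: "d3 > 0" "\<And>t x. t \<in> {0..1} ==> norm (x - p) < d3 ==> norm (y t x - y t p) \<le> d2 / 2"
    using continuous_near_curve[OF V PC_cont[OF yk] continuous_on_const, of p "d2 / 2"] p d2(1) by auto
   define d where "d = min d1 (min (d2 / 2) d3) / (norm v + 1)"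
   have nv: "norm v + 1 > 0" by (simp add: add_nonneg_pos)
   have d: "d > 0" unfolding d_def using d1(1) d2(1) d3(1) nv by simp
   show ?thesis
   proof (intro exI[of _ d] conjI d allI impI)
    fix s :: real assume s: "\<bar>s\<bar> < d"
    have sv: "norm (s *\<^sub>R v) < min d1 (min (d2 / 2) d3)"
    proof -
     have "norm (s *\<^sub>R v) \<le> \<bar>s\<bar> * (norm v + 1)" by (simp add: algebra_simps)
     also have "\<dots> < d * (norm v + 1)" using s nv by (rule mult_strict_right_mono)
     finally show ?thesis using nv by (simp add: d_def)
    qed
    let ?p = "p + s *\<^sub>R v"
    have pV: "?p \<in> V" using d1(2)[of 0 "s *\<^sub>R v"] sv by simp
    define z where "z r = y r ?p - y r p - s *\<^sub>R c v p r" for r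
    have fyc: "continuous_on {0..1} (\<lambda>r. f r (q, y r q))" if "q \<in> V" for q
     by (rule PC_compose_curve[OF VB PC_cont[OF Suc.prems(2)]]) (use that yB yc in \<open>auto intro!: continuous_intros\<close>)
    have Fcc: "continuous_on {0..1} (\<lambda>r. F v r (p, c v p r))"
     by (rule PC_compose_curve[OF _ Fcont[OF p] c1[OF p]]) auto
    have "(1 - 3 / 4) * norm (z t) \<le> (1 + norm v + L) * e * \<bar>s\<bar>"
    proof (rule sup_norm_estimate[OF _ _ _ t])
     show "continuous_on {0..1} z" unfolding z_def using yc[OF pV] yc[OF p] c1[OF p] by (intro continuous_intros)
     fix t M assume t: "t \<in> {0..1::real}" and M: "\<And>r. r \<in> {0..1} ==> norm (z r) \<le> M"
     have M0: "M \<ge> 0" using M[OF t] norm_ge_zero[of "z t"] by linarith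
     have zt: "z t = (h t ?p - h t p - h' (s *\<^sub>R v) t p) +
       integral {0..t} (\<lambda>r. f r (?p, y r ?p) - f r (p, y r p) - s *\<^sub>R F v r (p, c v p r))"
     proof -
      have hl: "h' (s *\<^sub>R v) t p = s *\<^sub>R h' v t p"
       using linear_scale[OF has_derivative_linear[OF partials_has_derivative[OF V t p h']]] .
      have i: "(\<lambda>r. f r (?p, y r ?p)) integrable_on {0..t}" "(\<lambda>r. f r (p, y r p)) integrable_on {0..t}"
       "(\<lambda>r. F v r (p, c v p r)) integrable_on {0..t}"
       using fyc[OF pV] fyc[OF p] Fcc t by (auto intro!: integrable_sub_unit)
      have "integral {0..t} (\<lambda>r. f r (?p, y r ?p) - f r (p, y r p) - s *\<^sub>R F v r (p, c v p r))
       = integral {0..t} (\<lambda>r. f r (?p, y r ?p)) - integral {0..t} (\<lambda>r. f r (p, y r p))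
        - s *\<^sub>R integral {0..t} (\<lambda>r. F v r (p, c v p r))"
       using i by (simp add: integral_diff integrable_diff integral_cmul integrable_cmul)
      then show ?thesis unfolding z_def yeq[OF t pV] yeq[OF t p] c2[OF p t] hl
       by (simp add: algebra_simps)
     qed
     have "norm (integral {0..t} (\<lambda>r. f r (?p, y r ?p) - f r (p, y r p) - s *\<^sub>R F v r (p, c v p r)))
      \<le> M / 2 + e * (\<bar>s\<bar> * L + M)"
     proof (rule integral_bound_unit[OF t])
      show "continuous_on {0..1} (\<lambda>r. f r (?p, y r ?p) - f r (p, y r p) - s *\<^sub>R F v r (p, c v p r))"
       using fyc[OF pV] fyc[OF p] Fcc by (intro continuous_intros)
      fix r :: real assume r: "r \<in> {0..1}"
      define H where "H = (s *\<^sub>R v, y r ?p - y r p)"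
      have Hn: "norm H \<le> norm (s *\<^sub>R v) + norm (y r ?p - y r p)"
       unfolding H_def norm_Pair by (rule sqrt_sum_squares_le_sum) auto
      have "norm (y r ?p - y r p) \<le> d2 / 2" using d3(2)[OF r, of ?p] sv by simp
      then have H: "norm H < d2" using Hn sv by simp
      have y_eq: "y r ?p - y r p = z r + s *\<^sub>R c v p r" by (simp add: z_def)
      have "norm (y r ?p - y r p) \<le> M + \<bar>s\<bar> * K"
       unfolding y_eq using M[OF r] K[OF r] by (intro norm_triangle_mono) (auto intro: mult_left_mono)
      then have HL: "norm H \<le> \<bar>s\<bar> * L + M" using Hn by (simp add: L_def algebra_simps)
      note lin = flin[OF r yVB[OF r p]]
      have "f' H r (p, y r p) = f' (0, z r) r (p, y r p) + s *\<^sub>R F v r (p, c v p r)"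
      proof -
       have "H = (0, z r) + s *\<^sub>R (v, c v p r)" by (simp add: H_def y_eq)
       then show ?thesis unfolding Feq[OF r p] by (simp only: linear_add[OF lin] linear_scale[OF lin])
      qed
      then have "f r (?p, y r ?p) - f r (p, y r p) - s *\<^sub>R F v r (p, c v p r)
       = f' (0, z r) r (p, y r p) + (f r ((p, y r p) + H) - f r (p, y r p) - f' H r (p, y r p))"
       by (simp add: H_def)
      moreover have "norm (f' (0, z r) r (p, y r p)) \<le> M / 2"
       using f'bound[OF r p, of "z r"] M[OF r] by simp
      moreover have "norm (f r ((p, y r p) + H) - f r (p, y r p) - f' H r (p, y r p)) \<le> e * (\<bar>s\<bar> * L + M)"
       using d2(2)[OF r H] mult_left_mono[OF HL, of e] e by linarith
      ultimately show "norm (f r (?p, y r ?p) - f r (p, y r p) - s *\<^sub>R F v r (p, c v p r)) \<le> M / 2 + e * (\<bar>s\<bar> * L + M)"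
       using norm_triangle_mono by metis
     qed
     moreover have "norm (h t ?p - h t p - h' (s *\<^sub>R v) t p) \<le> e * (\<bar>s\<bar> * norm v)"
      using d1(2)[OF t, of "s *\<^sub>R v"] sv by simp
     ultimately have "norm (z t) \<le> e * (\<bar>s\<bar> * norm v) + (M / 2 + e * (\<bar>s\<bar> * L + M))"
      unfolding zt by (rule norm_triangle_mono[rotated])
     also have "\<dots> \<le> (1 + norm v + L) * e * \<bar>s\<bar> + 3 / 4 * M"
     proof -
      have "e * M \<le> 1 / 4 * M" using e M0 by (intro mult_right_mono) auto
      moreover have "0 \<le> e * \<bar>s\<bar>" using e by simp
      ultimately show ?thesis by (simp add: algebra_simps)
     qed
     finally show "norm (z t) \<le> (1 + norm v + L) * e * \<bar>s\<bar> + 3 / 4 * M" .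
    qed simp
    then show "norm (y t (p + s *\<^sub>R v) - y t p - s *\<^sub>R c v p t) \<le> 4 * (1 + norm v + L) * e * \<bar>s\<bar>"
     by (simp add: z_def algebra_simps)
   qed
  qed
  show ?thesis
   unfolding has_vector_derivative_iff_quotient
  proof (rule LIM_I)
   fix r :: real assume r: "r > 0"
   define A where "A = 4 * (1 + norm v + L)"
   have A: "A > 0" using L0 by (simp add: A_def add_pos_nonneg)
   define e where "e = min (1 / 4) (r / (2 * A))"
   have e: "e > 0" "e \<le> 1 / 4" "A * e < r"
   proof -
    show "e > 0" "e \<le> 1 / 4" using r A by (auto simp: e_def)
    have "A * e \<le> A * (r / (2 * A))" using A by (intro mult_left_mono) (auto simp: e_def)
    then show "A * e < r" using A r by simp
   qed
   obtain \<delta> where \<delta>: "\<delta> > 0" "\<And>s. \<bar>s\<bar> < \<delta> ==> norm (y t (p + s *\<^sub>R v) - y t p - s *\<^sub>R c v p t) \<le> A * e * \<bar>s\<bar>"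
    using key[OF e(1,2)] unfolding A_def by blast
   show "\<exists>\<delta>>0. \<forall>s. s \<noteq> 0 \<and> norm (s - 0) < \<delta> \<longrightarrow>
    norm ((1 / s) *\<^sub>R (y t (p + s *\<^sub>R v) - y t (p + 0 *\<^sub>R v)) - c v p t) < r"
   proof (intro exI[of _ \<delta>] conjI \<delta>(1) allI impI)
    fix s :: real assume s: "s \<noteq> 0 \<and> norm (s - 0) < \<delta>"
    have "(1 / s) *\<^sub>R (y t (p + s *\<^sub>R v) - y t (p + 0 *\<^sub>R v)) - c v p t
     = (1 / s) *\<^sub>R (y t (p + s *\<^sub>R v) - y t p - s *\<^sub>R c v p t)"
     using s by (simp add: scaleR_diff_right)
    then have "norm ((1 / s) *\<^sub>R (y t (p + s *\<^sub>R v) - y t (p + 0 *\<^sub>R v)) - c v p t)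
     = norm (y t (p + s *\<^sub>R v) - y t p - s *\<^sub>R c v p t) / \<bar>s\<bar>" by (simp add: divide_inverse mult.commute)
    also have "\<dots> \<le> A * e" using \<delta>(2)[of s] s by (simp add: divide_le_eq)
    finally show "norm ((1 / s) *\<^sub>R (y t (p + s *\<^sub>R v) - y t (p + 0 *\<^sub>R v)) - c v p t) < r" using e(3) by simp
   qed
  qed
 qed
 show ?case by (rule PC_SucI[OF PC_cont[OF yk] ck der])
qed

section \<open>Straightening a commuting frame\<close>

lemma PC_slice: "PC k I T g ==> t \<in> I ==> PC k {0} T (\<lambda>_. g t)"
proof (induction k arbitrary: g)
 have c: "continuous_on ({0::real} \<times> T) (\<lambda>(_, x). g t x)" if "PC k I T g" "t \<in> I" for k and g :: "real \<Rightarrow> 'a \<Rightarrow> 'b"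
 proof -
  have "continuous_on ({0::real} \<times> T) (g t \<circ> snd)"
   by (rule continuous_on_compose) (use PC_continuous_slice[OF that] in \<open>auto intro!: continuous_intros\<close>)
  then show ?thesis by (simp add: o_def case_prod_beta)
 qed
 {
  case 0
  then show ?case using c[OF 0] by simp
 next
  case (Suc k)
  obtain g' where pg: "partials k I T g g'" using PC_SucE[OF Suc.prems(1)] by blast
  show ?case
   by (rule PC_SucI[OF c[OF Suc.prems] Suc.IH[OF partialsD(1)[OF pg] Suc.prems(2)]])
    (use partialsD(2)[OF pg Suc.prems(2)] in auto)
 }
qed

lemma Cinf_PC_slice: "open T ==> (\<And>k. PC k I T g) ==> t \<in> I ==> Cinf T (g t)"
 unfolding Cinf_iff_PC using PC_slice by blast

lemma Cinf_imp_PC: "Cinf S f ==> PC k I S (\<lambda>_. f)"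
 unfolding Cinf_iff_PC by (auto intro: PC_time_independent simp del: PC.simps)

lemma Cinf_curve:
 assumes f: "Cinf S f" and \<gamma>: "(\<gamma> has_vector_derivative d) (at s within I)" "\<gamma> s \<in> S"
 shows "((\<lambda>s. f (\<gamma> s)) has_vector_derivative Dd f (\<gamma> s) d) (at s within I)"
proof -
 note fd = Cinf_has_derivative[OF f \<gamma>(2)]
 have "((f \<circ> \<gamma>) has_derivative (Dd f (\<gamma> s) \<circ> (\<lambda>h. h *\<^sub>R d))) (at s within I)"
  by (rule diff_chain_within[OF \<gamma>(1)[unfolded has_vector_derivative_def]])
   (rule has_derivative_at_withinI[OF fd])
 then show ?thesis
  using linear_scale[OF has_derivative_linear[OF fd]] by (simp add: has_vector_derivative_def o_def)
qed

lemma Cinf_bound_on_compact: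
 assumes f: "Cinf S f" and K: "compact K" "K \<subseteq> S"
 shows "\<exists>C\<ge>0. \<forall>x\<in>K. norm (f x) \<le> C"
proof -
 have "bounded (f ` K)"
  using Cinf_continuous_on[OF f] K by (meson compact_continuous_image compact_imp_bounded continuous_on_subset)
 then obtain C where C: "\<And>x. x \<in> K ==> norm (f x) \<le> C" unfolding bounded_iff by auto
 show ?thesis by (rule exI[of _ "max C 0"]) (use C in \<open>auto simp: le_max_iff_disj\<close>)
qed

lemma Cinf_lipschitz_on_compact_convex:
 fixes f :: "'a::euclidean_space \<Rightarrow> 'b::euclidean_space"
 assumes f: "Cinf S f" and K: "compact K" "convex K" "K \<subseteq> S"
 shows "\<exists>C\<ge>0. \<forall>x\<in>K. \<forall>y\<in>K. norm (f x - f y) \<le> C * norm (x - y)"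
proof -
 have "\<forall>b\<in>(Basis::'a set). \<exists>C\<ge>0. \<forall>x\<in>K. norm (Dd f x b) \<le> C"
  by (intro ballI Cinf_bound_on_compact[OF Cinf_Dd[OF f] K(1,3)])
 from bchoice[OF this] obtain c where cc: "\<forall>b\<in>(Basis::'a set). c b \<ge> 0 \<and> (\<forall>x\<in>K. norm (Dd f x b) \<le> c b)" ..
 have c: "c b \<ge> 0" "x \<in> K ==> norm (Dd f x b) \<le> c b" if "b \<in> (Basis::'a set)" for b x
  using bspec[OF cc that] by blast+
 show ?thesis
 proof (intro exI[of _ "\<Sum>b\<in>Basis. c b"] conjI ballI)
  show "(\<Sum>b\<in>Basis. c b) \<ge> 0" by (intro sum_nonneg c(1))
  fix x y assume xy: "x \<in> K" "y \<in> K"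
  show "norm (f x - f y) \<le> (\<Sum>b\<in>Basis. c b) * norm (x - y)"
  proof (rule differentiable_bound[OF K(2) _ _ xy])
   fix z assume z: "z \<in> K"
   show "(f has_derivative Dd f z) (at z within K)"
    by (rule has_derivative_at_withinI[OF Cinf_has_derivative[OF f subsetD[OF K(3) z]]])
   have zS: "z \<in> S" by (rule subsetD[OF K(3) z])
   show "onorm (Dd f z) \<le> (\<Sum>b\<in>Basis. c b)"
   proof (rule onorm_le)
    fix v
    have "norm (Dd f z v) = norm (\<Sum>b\<in>Basis. (v \<bullet> b) *\<^sub>R Dd f z b)"
     by (rule arg_cong[OF linear_Basis_expand[OF Cinf_linear_Dd[OF f zS]]])
    also have "\<dots> \<le> (\<Sum>b\<in>Basis. norm v * c b)"
    proof (rule sum_norm_le)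
     fix b :: 'a assume b: "b \<in> Basis"
     show "norm ((v \<bullet> b) *\<^sub>R Dd f z b) \<le> norm v * c b"
      unfolding norm_scaleR
      by (intro mult_mono) (use Basis_le_norm[OF b, of v] c(2)[OF b z] in auto)
    qed
    finally show "norm (Dd f z v) \<le> (\<Sum>b\<in>Basis. c b) * norm v"
     by (simp add: sum_distrib_left mult.commute)
   qed
  qed
 qed
qed

lemma Dd_norm_le_lipschitz:
 assumes f: "Cinf S f" and x: "x \<in> S"
  and lip: "\<And>y z. y \<in> S ==> z \<in> S ==> norm (f y - f z) \<le> L * norm (y - z)"
 shows "norm (Dd f x v) \<le> L * norm v"
proof -
 let ?q = "\<lambda>s. (1 / s) *\<^sub>R (f (x + s *\<^sub>R v) - f (x + 0 *\<^sub>R v))"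
 have "(?q \<longlongrightarrow> Dd f x v) (at 0)"
  using Cinf_line[OF f x, of v] unfolding has_vector_derivative_iff_quotient .
 then have "((\<lambda>s. norm (?q s)) \<longlongrightarrow> norm (Dd f x v)) (at 0)" by (rule tendsto_norm)
 moreover have "\<forall>\<^sub>F s in at 0. norm (?q s) \<le> L * norm v"
 proof -
  have "open ((\<lambda>s. x + s *\<^sub>R v) -` S)"
   by (rule open_vimage[OF Cinf_open[OF f]]) (intro continuous_intros)
  then have "\<forall>\<^sub>F s in at 0. s \<in> (\<lambda>s. x + s *\<^sub>R v) -` S"
   by (rule eventually_at_in_open') (simp add: x)
  moreover have "\<forall>\<^sub>F s in at (0::real). s \<noteq> 0" by (simp add: eventually_at_filter)
  ultimately show ?thesis
  proof eventually_elim
   case (elim s)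
   have L: "norm (f (x + s *\<^sub>R v) - f x) \<le> L * norm (s *\<^sub>R v)"
    using lip[of "x + s *\<^sub>R v" x] elim x by simp
   have "norm (?q s) = (1 / \<bar>s\<bar>) * norm (f (x + s *\<^sub>R v) - f x)" by simp
   also have "\<dots> \<le> (1 / \<bar>s\<bar>) * (L * norm (s *\<^sub>R v))" using L by (intro mult_left_mono) auto
   also have "\<dots> = L * norm v" using elim by simp
   finally show ?case .
  qed
 qed
 ultimately show ?thesis by (rule tendsto_upperbound) simp
qed

text \<open>Differentiation under the integral sign.\<close>
lemma deriv_parameter_integral:
 fixes q :: "real \<Rightarrow> 'a::euclidean_space \<Rightarrow> 'b::euclidean_space"
 assumes V: "open V" "p \<in> V" and q: "partials k {0..1} V q q'" "continuous_on ({0..1} \<times> V) (\<lambda>(t, x). q t x)"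
  and t: "t \<in> {0..1}"
 shows "((\<lambda>s. integral {0..t} (\<lambda>r. q r (p + s *\<^sub>R v))) has_vector_derivative
  integral {0..t} (\<lambda>r. q' v r p)) (at 0)"
 unfolding has_vector_derivative_iff_quotient
proof (rule LIM_I)
 fix e :: real assume e: "e > 0"
 define n where "n = norm v + 1"
 have n: "n > 0" "norm v \<le> n" by (auto simp: n_def add_nonneg_pos)
 obtain d where d: "d > 0" "\<And>r w. r \<in> {0..1} ==> norm w < d ==> p + w \<in> V \<and>
   norm (q r (p + w) - q r p - q' w r p) \<le> e / (2 * n) * norm w"
  using uniform_linearization_near_curve[OF V(1) q(1) continuous_on_const, of p "e / (2 * n)"] V(2) e n by auto
 have qc: "continuous_on {0..1} (\<lambda>r. q r x)" if "x \<in> V" for x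
  by (rule PC_compose_curve[OF V(1) q(2) continuous_on_const that])
 have q'c: "continuous_on {0..1} (\<lambda>r. q' v r p)"
  by (rule PC_compose_curve[OF V(1) PC_cont[OF partialsD(1)[OF q(1)]] continuous_on_const V(2)])
 show "\<exists>\<delta>>0. \<forall>s. s \<noteq> 0 \<and> norm (s - 0) < \<delta> \<longrightarrow>
   norm ((1 / s) *\<^sub>R (integral {0..t} (\<lambda>r. q r (p + s *\<^sub>R v)) - integral {0..t} (\<lambda>r. q r (p + 0 *\<^sub>R v))) -
    integral {0..t} (\<lambda>r. q' v r p)) < e"
 proof (intro exI[of _ "d / n"] conjI allI impI)
  show "d / n > 0" using d(1) n by simp
  fix s :: real assume s: "s \<noteq> 0 \<and> norm (s - 0) < d / n"
  have "norm (s *\<^sub>R v) \<le> \<bar>s\<bar> * n" using n(2) by (simp add: mult_left_mono)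
  also have "\<dots> < d" using s n by (simp add: field_simps)
  finally have sv: "norm (s *\<^sub>R v) < d" .
  have pV: "p + s *\<^sub>R v \<in> V" using d(2)[OF t sv] by simp
  let ?z = "\<lambda>r. q r (p + s *\<^sub>R v) - q r p - s *\<^sub>R q' v r p"
  have i: "(\<lambda>r. q r (p + s *\<^sub>R v)) integrable_on {0..t}" "(\<lambda>r. q r p) integrable_on {0..t}"
   "(\<lambda>r. q' v r p) integrable_on {0..t}"
   by (intro integrable_sub_unit qc q'c pV V t)+
  have "norm (integral {0..t} ?z) \<le> e / 2 * \<bar>s\<bar>"
  proof (rule integral_bound_unit[OF t])
   show "continuous_on {0..1} ?z" by (intro continuous_intros qc q'c pV V)
   fix r :: real assume r: "r \<in> {0..1}"
   have "q' (s *\<^sub>R v) r p = s *\<^sub>R q' v r p"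
    using linear_scale[OF has_derivative_linear[OF partials_has_derivative[OF V(1) r V(2) q(1)]]] .
   then have "norm (?z r) \<le> e / (2 * n) * norm (s *\<^sub>R v)" using d(2)[OF r sv] by simp
   also have "\<dots> \<le> e / (2 * n) * (\<bar>s\<bar> * n)"
    using e n by (intro mult_left_mono) (auto intro: mult_left_mono)
   also have "\<dots> = e / 2 * \<bar>s\<bar>" using n by simp
   finally show "norm (?z r) \<le> e / 2 * \<bar>s\<bar>" .
  qed
  moreover have "integral {0..t} ?z = integral {0..t} (\<lambda>r. q r (p + s *\<^sub>R v)) - integral {0..t} (\<lambda>r. q r p)
    - s *\<^sub>R integral {0..t} (\<lambda>r. q' v r p)"
   using i by (simp add: integral_diff integrable_diff integral_cmul integrable_cmul)
  ultimately have b: "norm (integral {0..t} (\<lambda>r. q r (p + s *\<^sub>R v)) - integral {0..t} (\<lambda>r. q r p)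
    - s *\<^sub>R integral {0..t} (\<lambda>r. q' v r p)) \<le> e / 2 * \<bar>s\<bar>" by simp
  have "(1 / s) *\<^sub>R (integral {0..t} (\<lambda>r. q r (p + s *\<^sub>R v)) - integral {0..t} (\<lambda>r. q r (p + 0 *\<^sub>R v))) -
    integral {0..t} (\<lambda>r. q' v r p) = (1 / s) *\<^sub>R (integral {0..t} (\<lambda>r. q r (p + s *\<^sub>R v)) - integral {0..t} (\<lambda>r. q r p)
    - s *\<^sub>R integral {0..t} (\<lambda>r. q' v r p))" (is "?l = ?r")
   using s by (simp add: scaleR_diff_right)
  then have "norm ?l = \<bar>1 / s\<bar> * norm (integral {0..t} (\<lambda>r. q r (p + s *\<^sub>R v)) - integral {0..t} (\<lambda>r. q r p)
    - s *\<^sub>R integral {0..t} (\<lambda>r. q' v r p))" by (simp only: norm_scaleR)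
  also have "\<dots> \<le> \<bar>1 / s\<bar> * (e / 2 * \<bar>s\<bar>)" using b by (rule mult_left_mono) simp
  also have "\<dots> = e / 2" using s by simp
  finally show "norm ?l < e" using e by simp
 qed
qed

lemma integral_equation_derivative:
 fixes \<phi> :: "real \<Rightarrow> 'e::euclidean_space"
 assumes "continuous_on {0..1} \<phi>" "\<And>t. t \<in> {0..1} ==> y t = x + integral {0..t} \<phi>" "t \<in> {0..1}"
 shows "(y has_vector_derivative \<phi> t) (at t within {0..1})"
proof (rule has_vector_derivative_transform[OF assms(3)])
 show "y s = x + integral {0..s} \<phi>" if "s \<in> {0..1}" for s using assms(2)[OF that] .
 show "((\<lambda>s. x + integral {0..s} \<phi>) has_vector_derivative \<phi> t) (at t within {0..1})"
  using has_vector_derivative_add[OF has_vector_derivative_const integral_has_vector_derivative[OF assms(1,3)], of x]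
  by simp
qed

lemma derivative_integral_equation:
 fixes \<phi> :: "real \<Rightarrow> 'e::euclidean_space"
 assumes "\<And>t. t \<in> {0..1} ==> (y has_vector_derivative \<phi> t) (at t within {0..1})" "t \<in> {0..1}"
 shows "integral {0..t} \<phi> = y t - y 0"
proof (rule integral_unique, rule fundamental_theorem_of_calculus)
 show "(y has_vector_derivative \<phi> s) (at s within {0..t})" if "s \<in> {0..t}" for s
  by (rule has_vector_derivative_within_subset[OF assms(1)]) (use that assms(2) in auto)
qed (use assms(2) in auto)

text \<open>\<open>Y t (w, x)\<close> is the flow for time \<open>t\<close> of the field \<open>y \<mapsto> G y w\<close> with constant frame coefficients \<open>w\<close>, started at \<open>x\<close>.
  For small \<open>w\<close> the field is small and has Lipschitz constant 1/2, so that time one is reached inside the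
  ball.\<close>
lemma flow_along_frame:
 fixes G :: "'e::euclidean_space \<Rightarrow> 'e \<Rightarrow> 'e"
 assumes x0: "x0 \<in> \<Omega>" and G: "\<And>v. Cinf \<Omega> (\<lambda>x. G x v)" "\<And>x. x \<in> \<Omega> ==> linear (G x)"
 obtains \<rho> r Y where "\<rho> > 0" "ball x0 r \<subseteq> \<Omega>" "ball x0 \<rho> \<subseteq> ball x0 r"
  "\<And>k. PC k {0..1} (ball 0 \<rho> \<times> ball x0 \<rho>) Y"
  "\<And>p t. p \<in> ball 0 \<rho> \<times> ball x0 \<rho> ==> t \<in> {0..1} ==> Y t p \<in> ball x0 r"
  "\<And>p t. p \<in> ball 0 \<rho> \<times> ball x0 \<rho> ==> t \<in> {0..1} ==>
   Y t p = snd p + integral {0..t} (\<lambda>s. G (Y s p) (fst p))"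
  "\<And>w y z. w \<in> ball 0 \<rho> ==> y \<in> ball x0 r ==> z \<in> ball x0 r ==> norm (G y w - G z w) \<le> norm (y - z) / 2"
proof -
 have \<Omega>: "open \<Omega>" using Cinf_open[OF G(1)] .
 obtain r where r: "r > 0" "cball x0 r \<subseteq> \<Omega>" using \<Omega> x0 open_contains_cball by blast
 have "\<forall>b\<in>(Basis::'e set). \<exists>C\<ge>0. \<forall>x\<in>cball x0 r. \<forall>y\<in>cball x0 r. norm (G x b - G y b) \<le> C * norm (x - y)"
  by (intro ballI[of Basis] Cinf_lipschitz_on_compact_convex[OF G(1) compact_cball convex_cball r(2)])
 from bchoice[OF this] obtain c where cc: "\<forall>b\<in>(Basis::'e set). c b \<ge> 0 \<and>
  (\<forall>x\<in>cball x0 r. \<forall>y\<in>cball x0 r. norm (G x b - G y b) \<le> c b * norm (x - y))" ..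
 have c: "c b \<ge> 0" "x \<in> cball x0 r ==> y \<in> cball x0 r ==> norm (G x b - G y b) \<le> c b * norm (x - y)"
  if "b \<in> (Basis::'e set)" for b x y
  using bspec[OF cc that] by blast+
 have "\<forall>b\<in>(Basis::'e set). \<exists>C\<ge>0. \<forall>x\<in>cball x0 r. norm (G x b) \<le> C"
  by (intro ballI[of Basis] Cinf_bound_on_compact[OF G(1) compact_cball r(2)])
 from bchoice[OF this] obtain c' where cc': "\<forall>b\<in>(Basis::'e set). c' b \<ge> 0 \<and> (\<forall>x\<in>cball x0 r. norm (G x b) \<le> c' b)" ..
 have c': "c' b \<ge> 0" "x \<in> cball x0 r ==> norm (G x b) \<le> c' b" if "b \<in> (Basis::'e set)" for b x
  using bspec[OF cc' that] by blast+
 define A where "A = (\<Sum>b\<in>Basis. c b) + (\<Sum>b\<in>Basis. c' b) + 1"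
 have A0: "(\<Sum>b\<in>Basis. c b) \<ge> 0" "(\<Sum>b\<in>Basis. c' b) \<ge> 0" by (intro sum_nonneg c c'; assumption)+
 then have A: "A > 0" "(\<Sum>b\<in>Basis. c b) \<le> A" "(\<Sum>b\<in>Basis. c' b) \<le> A" by (auto simp: A_def)
 have lip: "norm (G x w - G y w) \<le> A * norm w * norm (x - y)" if "x \<in> cball x0 r" "y \<in> cball x0 r" for x y w
 proof -
  have "G x w - G y w = (\<Sum>b\<in>Basis. (w \<bullet> b) *\<^sub>R (G x b - G y b))"
   using linear_Basis_expand[OF G(2)[OF subsetD[OF r(2) that(1)]], of w]
    linear_Basis_expand[OF G(2)[OF subsetD[OF r(2) that(2)]], of w]
   by (simp only: scaleR_diff_right sum_subtractf)
  also have "norm \<dots> \<le> (\<Sum>b\<in>Basis. norm w * (c b * norm (x - y)))"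
  proof (rule sum_norm_le)
   fix b :: 'e assume b: "b \<in> Basis"
   show "norm ((w \<bullet> b) *\<^sub>R (G x b - G y b)) \<le> norm w * (c b * norm (x - y))"
    unfolding norm_scaleR
    by (intro mult_mono) (use Basis_le_norm[OF b, of w] c(2)[OF b that] in auto)
  qed
  also have "\<dots> = (\<Sum>b\<in>Basis. c b) * (norm w * norm (x - y))"
   by (subst sum_distrib_right) (rule sum.cong, auto)
  also have "\<dots> \<le> A * (norm w * norm (x - y))" using A(2) by (intro mult_right_mono) auto
  finally show ?thesis by (simp add: mult.assoc)
 qed
 have bd: "norm (G x w) \<le> A * norm w" if "x \<in> cball x0 r" for x w
 proof -
  have "G x w = (\<Sum>b\<in>Basis. (w \<bullet> b) *\<^sub>R G x b)"
   by (rule linear_Basis_expand[OF G(2)[OF subsetD[OF r(2) that]]])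
  also have "norm \<dots> \<le> (\<Sum>b\<in>Basis. norm w * c' b)"
  proof (rule sum_norm_le)
   fix b :: 'e assume b: "b \<in> Basis"
   show "norm ((w \<bullet> b) *\<^sub>R G x b) \<le> norm w * c' b"
    unfolding norm_scaleR
    by (intro mult_mono) (use Basis_le_norm[OF b, of w] c'(2)[OF b that] in auto)
  qed
  also have "\<dots> = (\<Sum>b\<in>Basis. c' b) * norm w"
   by (subst sum_distrib_right) (rule sum.cong, auto)
  also have "\<dots> \<le> A * norm w" using A(3) by (intro mult_right_mono) auto
  finally show ?thesis .
 qed
 \<comment> \<open>The three bounds: initial points stay well inside the ball, the Lipschitz constant \<open>A |w|\<close> is at most 1/2,
  and the distance travelled in time one is at most \<open>r / 4\<close>.\<close>
 define \<rho> where "\<rho> = min (r / 4) (min (1 / (2 * A)) (r / (4 * A)))"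
 have \<rho>: "\<rho> > 0" "\<rho> \<le> r / 4" "A * \<rho> \<le> 1 / 2" "A * \<rho> \<le> r / 4"
 proof -
  show "\<rho> > 0" "\<rho> \<le> r / 4" using r A by (auto simp: \<rho>_def)
  have "A * \<rho> \<le> A * (1 / (2 * A))" "A * \<rho> \<le> A * (r / (4 * A))"
   using A by (intro mult_left_mono; simp add: \<rho>_def)+
  then show "A * \<rho> \<le> 1 / 2" "A * \<rho> \<le> r / 4" using A by auto
 qed
 have Aw: "A * norm w \<le> A * \<rho>" if "w \<in> ball 0 \<rho>" for w :: 'e
  using that A(1) by (intro mult_left_mono) auto
 have half: "norm (G x w - G y w) \<le> norm (x - y) / 2"
  if "w \<in> ball 0 \<rho>" "x \<in> cball x0 r" "y \<in> cball x0 r" for w x y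
 proof -
  have "norm (G x w - G y w) \<le> (A * norm w) * norm (x - y)" by (rule lip[OF that(2,3)])
  also have "\<dots> \<le> 1 / 2 * norm (x - y)" using Aw[OF that(1)] \<rho>(3) by (intro mult_right_mono) auto
  finally show ?thesis by simp
 qed
 let ?V = "ball (0::'e) \<rho> \<times> ball x0 \<rho>"
 let ?C = "cball x0 (r / 2)"
 have CK: "?C \<subseteq> cball x0 r" using r(1) by auto
 have ex: "\<exists>y :: real \<Rightarrow> 'e. continuous_on {0..1} y \<and> (\<forall>t\<in>{0..1}. y t \<in> ?C \<and> y t = snd p + integral {0..t} (\<lambda>s. G (y s) (fst p)))"
  if p: "p \<in> ?V" for p
 proof -
  have Gc: "continuous_on ?C (\<lambda>y. G y (fst p))"
   using Cinf_continuous_on[OF G(1)] by (rule continuous_on_subset) (use CK r(2) in auto)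
  show ?thesis
  proof (rule integral_equation_solution[of ?C "\<lambda>_ y. G y (fst p)" "\<lambda>_. snd p"])
   have "continuous_on ({0..1::real} \<times> ?C) ((\<lambda>y. G y (fst p)) \<circ> snd)"
    by (rule continuous_on_compose) (use Gc in \<open>auto intro!: continuous_intros\<close>)
   then show "continuous_on ({0..1::real} \<times> ?C) (\<lambda>(t, y). G y (fst p))" by (simp add: o_def case_prod_beta)
   show "norm (G y (fst p) - G z (fst p)) \<le> norm (y - z) / 2" if "y \<in> ?C" "z \<in> ?C" for y z
   proof (rule half)
    show "fst p \<in> ball 0 \<rho>" using p by auto
   qed (use that CK in blast)+
   have "dist x0 (snd p) < \<rho>" using p by auto
   then have sp: "dist x0 (snd p) \<le> r / 4" using \<rho>(2) by simp
   then show "snd p \<in> ?C" using r(1) by simp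
   fix z :: "real \<Rightarrow> 'e" and t :: real
   assume z: "continuous_on {0..1} z" "\<And>s. s \<in> {0..1} ==> z s \<in> ?C" and t: "t \<in> {0..1}"
   have "norm (integral {0..t} (\<lambda>s. G (z s) (fst p))) \<le> r / 4"
   proof (rule integral_bound_unit[OF t])
    show "continuous_on {0..1} (\<lambda>s. G (z s) (fst p))"
     using continuous_on_compose2[OF Gc z(1)] z(2) by blast
    fix s :: real assume s: "s \<in> {0..1}"
    have "norm (G (z s) (fst p)) \<le> A * norm (fst p)" using bd z(2)[OF s] CK by blast
    also have "\<dots> \<le> r / 4" using Aw[of "fst p"] p \<rho>(4) by auto
    finally show "norm (G (z s) (fst p)) \<le> r / 4" .
   qed
   moreover have "dist x0 (snd p + integral {0..t} (\<lambda>s. G (z s) (fst p)))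
     \<le> dist x0 (snd p) + norm (integral {0..t} (\<lambda>s. G (z s) (fst p)))"
    using norm_triangle_ineq4[of "x0 - snd p" "integral {0..t} (\<lambda>s. G (z s) (fst p))"]
    by (simp add: dist_norm diff_diff_eq)
   ultimately show "snd p + integral {0..t} (\<lambda>s. G (z s) (fst p)) \<in> ?C" using sp by simp
  qed (rule closed_cball, rule continuous_on_const)
 qed
 define Y where "Y t p = (SOME y :: real \<Rightarrow> 'e. continuous_on {0..1} y \<and>
   (\<forall>t\<in>{0..1}. y t \<in> ?C \<and> y t = snd p + integral {0..t} (\<lambda>s. G (y s) (fst p)))) t" for t p
 have Y1: "continuous_on {0..1} (\<lambda>t. Y t p)" if "p \<in> ?V" for p
  using someI_ex[OF ex[OF that]] unfolding Y_def by (rule conjunct1)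
 have Y2: "Y t p \<in> ?C \<and> Y t p = snd p + integral {0..t} (\<lambda>s. G (Y s p) (fst p))"
  if "p \<in> ?V" "t \<in> {0..1}" for p t
  using conjunct2[OF someI_ex[OF ex[OF that(1)]], rule_format, OF that(2)] unfolding Y_def .
 have Y3: "Y t p \<in> ball x0 r" if "p \<in> ?V" "t \<in> {0..1}" for p t
  using Y2[OF that] r(1) by auto
 have pc: "PC k {0..1} ?V Y" for k
 proof (rule parameter_dependence[where B = "ball x0 r" and f = "\<lambda>_ z. G (snd z) (fst (fst z))" and h = "\<lambda>_ p. snd p"])
  have b\<Omega>: "ball x0 r \<subseteq> \<Omega>" using r(2) ball_subset_cball by blast
  have o: "open (?V \<times> ball x0 r)" by (intro open_Times open_ball)
  have "Cinf (?V \<times> ball x0 r) (\<lambda>z. G (snd z) (fst (fst z)))"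
  proof (rule Cinf_linear_family[where L = "\<lambda>z. G (snd z)" and f = "\<lambda>z. fst (fst z)"])
   show "Cinf (?V \<times> ball x0 r) (\<lambda>z. G (snd z) v)" for v
    by (rule Cinf_compose[where f = snd, OF G(1) Cinf_linear[OF linear_snd Cinf_id[OF o]]])
     (use b\<Omega> in auto)
   show "linear (G (snd z))" if "z \<in> ?V \<times> ball x0 r" for z using G(2) that b\<Omega> by auto
   show "Cinf (?V \<times> ball x0 r) (\<lambda>z. fst (fst z))"
    by (intro Cinf_linear[OF linear_fst] Cinf_id[OF o])
  qed
  then show "PC k {0..1} (?V \<times> ball x0 r) (\<lambda>_ z. G (snd z) (fst (fst z)))" by (rule Cinf_imp_PC)
  show "PC k {0..1} ?V (\<lambda>_ p. snd p)"
   by (rule PC_linear[OF bounded_linear_snd PC_id])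
  show "norm (G (snd (p, x)) (fst (fst (p, x))) - G (snd (p, z)) (fst (fst (p, z)))) \<le> norm (x - z) / 2"
   if "p \<in> ?V" "x \<in> ball x0 r" "z \<in> ball x0 r" for p x z
   using half[of "fst p" x z] that by auto
  show "Y t p = snd p + integral {0..t} (\<lambda>s. G (snd (p, Y s p)) (fst (fst (p, Y s p))))"
   if "t \<in> {0..1}" "p \<in> ?V" for t p using Y2[OF that(2,1)] by simp
 qed (use Y1 Y3 in \<open>auto intro: open_Times\<close>)
 show thesis
 proof (rule that[OF \<rho>(1) _ _ pc Y3])
  show "ball x0 r \<subseteq> \<Omega>" using r(2) by auto
  show "ball x0 \<rho> \<subseteq> ball x0 r" using \<rho>(2) r(1) by (intro subset_ball) auto
 qed (use Y2 half in auto)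
qed

lemma integral_equation_unique:
 fixes H :: "'e::euclidean_space \<Rightarrow> 'e" and y z :: "real \<Rightarrow> 'e"
 assumes y: "continuous_on {0..1} y" "\<And>t. t \<in> {0..1} ==> y t \<in> B"
   "\<And>t. t \<in> {0..1} ==> y t = x + integral {0..t} (\<lambda>s. H (y s))"
  and z: "continuous_on {0..1} z" "\<And>t. t \<in> {0..1} ==> z t \<in> B"
   "\<And>t. t \<in> {0..1} ==> z t = x + integral {0..t} (\<lambda>s. H (z s))"
  and lip: "\<And>y z. y \<in> B ==> z \<in> B ==> norm (H y - H z) \<le> norm (y - z) / 2"
  and H: "continuous_on B H" and t: "t \<in> {0..1}"
 shows "y t = z t"
proof -
 have Hy: "continuous_on {0..1} (\<lambda>s. H (y s))" "continuous_on {0..1} (\<lambda>s. H (z s))"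
  by (rule continuous_on_compose2[OF H]; use y z in auto)+
 have "(1 - 1 / 2) * norm (y t - z t) \<le> 0"
 proof (rule sup_norm_estimate[OF _ _ _ t])
  show "continuous_on {0..1} (\<lambda>t. y t - z t)" using y(1) z(1) by (intro continuous_intros)
  fix t M assume t: "t \<in> {0..1::real}" and M: "\<And>s. s \<in> {0..1} ==> norm (y s - z s) \<le> M"
  have "norm (integral {0..t} (\<lambda>s. H (y s) - H (z s))) \<le> M / 2"
  proof (rule integral_bound_unit[OF t])
   show "continuous_on {0..1} (\<lambda>s. H (y s) - H (z s))" using Hy by (intro continuous_intros)
   fix s :: real assume s: "s \<in> {0..1}"
   show "norm (H (y s) - H (z s)) \<le> M / 2"
    using lip[OF y(2)[OF s] z(2)[OF s]] M[OF s] by simp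
  qed
  moreover have "y t - z t = integral {0..t} (\<lambda>s. H (y s) - H (z s))"
  proof -
   have "integral {0..t} (\<lambda>s. H (y s) - H (z s)) = integral {0..t} (\<lambda>s. H (y s)) - integral {0..t} (\<lambda>s. H (z s))"
    by (rule integral_diff) (intro integrable_sub_unit Hy t)+
   then show ?thesis unfolding y(3)[OF t] z(3)[OF t] by simp
  qed
  ultimately show "norm (y t - z t) \<le> 0 + 1 / 2 * M" by simp
 qed simp
 then show ?thesis by simp
qed

text \<open>The frame as a function of base point and coefficients together.\<close>
lemma Dd_frame:
 fixes G :: "'e::euclidean_space \<Rightarrow> 'e \<Rightarrow> 'e"
 assumes G: "\<And>v. Cinf \<Omega> (\<lambda>x. G x v)" "\<And>x. x \<in> \<Omega> ==> linear (G x)" and y: "y \<in> \<Omega>"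
 shows "Cinf (\<Omega> \<times> UNIV) (\<lambda>z. G (fst z) (snd z))"
  and "Dd (\<lambda>z. G (fst z) (snd z)) (y, w) (c, v) = Dd (\<lambda>y. G y w) y c + G y v"
proof -
 have o: "open (\<Omega> \<times> (UNIV :: 'e set))" using Cinf_open[OF G(1)] by (intro open_Times) auto
 have fstC: "Cinf (\<Omega> \<times> (UNIV :: 'e set)) fst" and sndC: "Cinf (\<Omega> \<times> (UNIV :: 'e set)) snd"
  using Cinf_linear[OF linear_fst Cinf_id[OF o]] Cinf_linear[OF linear_snd Cinf_id[OF o]] by auto
 have L: "Cinf (\<Omega> \<times> (UNIV :: 'e set)) (\<lambda>z. G (fst z) v)" for v
  by (rule Cinf_compose[OF G(1) fstC]) auto
 have lin: "linear (G (fst z))" if "z \<in> \<Omega> \<times> (UNIV :: 'e set)" for z using that G(2) by auto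
 show "Cinf (\<Omega> \<times> UNIV) (\<lambda>z. G (fst z) (snd z))"
  by (rule Cinf_linear_family[where L = "\<lambda>z. G (fst z)", OF L lin sndC])
 have yw: "(y, w) \<in> \<Omega> \<times> UNIV" using y by simp
 have d1: "Dd fst (y, w) (c, v) = c" by (subst Dd_eqI[OF bounded_linear_imp_has_derivative[OF bounded_linear_fst]]) simp
 have d2: "Dd snd (y, w) (c, v) = v" by (subst Dd_eqI[OF bounded_linear_imp_has_derivative[OF bounded_linear_snd]]) simp
 have "Dd (\<lambda>z. G (fst z) (snd z)) (y, w) (c, v)
  = Dd (\<lambda>z. G (fst z) w) (y, w) (c, v) + G y v"
  using Cinf_Dd_linear_family[where L = "\<lambda>z. G (fst z)", OF L lin sndC yw, of "(c, v)"] d2 by simp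
 also have "Dd (\<lambda>z. G (fst z) w) (y, w) (c, v) = Dd (\<lambda>y. G y w) y c"
  using Cinf_Dd_compose[OF G(1) fstC yw, of w "(c, v)"] y d1 by simp
 finally show "Dd (\<lambda>z. G (fst z) (snd z)) (y, w) (c, v) = Dd (\<lambda>y. G y w) y c + G y v" .
qed

text \<open>A frame \<open>G\<close> that commutes, \<open>[G v, G w] = 0\<close>, consists of coordinate fields. The map \<open>\<Psi>\<close> starts at the point of the
  transversal \<open>ker P\<close> (translated to \<open>x0\<close>) below \<open>z\<close> and flows for time one in the direction \<open>P (z - x0)\<close>. Since
  \<open>P (G x v) = P v\<close>, the flow moves the \<open>P\<close>-component at constant speed, so that \<open>\<Psi>\<close> is inverted by flowing
  back. The last conclusion says that the coordinate change stays within any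
  subspace that contains the frame, such as the model of a chart.\<close>
theorem straightening:
 fixes G :: "'e::euclidean_space \<Rightarrow> 'e \<Rightarrow> 'e" and P :: "'e \<Rightarrow> 'e"
 assumes x0: "x0 \<in> \<Omega>" and G: "\<And>v. Cinf \<Omega> (\<lambda>x. G x v)" "\<And>x. x \<in> \<Omega> ==> linear (G x)"
  and P: "linear P" "\<And>v. P (P v) = P v" "\<And>x v. x \<in> \<Omega> ==> P (G x v) = P v"
  and comm: "\<And>x v w. x \<in> \<Omega> ==> P v = v ==> P w = w ==>
   Dd (\<lambda>y. G y w) x (G x v) = Dd (\<lambda>y. G y v) x (G x w)"
 obtains N N' \<Phi> \<Psi> where "x0 \<in> N" "N \<subseteq> \<Omega>" "Cinf N \<Phi>" "Cinf N' \<Psi>"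
  "\<And>x. x \<in> N ==> \<Phi> x \<in> N'" "\<And>z. z \<in> N' ==> \<Psi> z \<in> N"
  "\<And>x. x \<in> N ==> \<Psi> (\<Phi> x) = x" "\<And>z. z \<in> N' ==> \<Phi> (\<Psi> z) = z"
  "\<And>x v. x \<in> N ==> P v = v ==> Dd \<Phi> x (G x v) = v"
  "\<And>E x. subspace E ==> (\<And>x v. x \<in> \<Omega> ==> G x v \<in> E) ==> (\<And>v. P v \<in> E) ==> x \<in> N ==> \<Phi> x - x \<in> E"
proof -
 obtain \<rho> r Y where \<rho>: "\<rho> > 0" and r\<Omega>: "ball x0 r \<subseteq> \<Omega>" and \<rho>r: "ball x0 \<rho> \<subseteq> ball x0 r"
  and pc: "\<And>k. PC k {0..1} (ball 0 \<rho> \<times> ball x0 \<rho>) Y"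
  and Yb: "\<And>p t. p \<in> ball 0 \<rho> \<times> ball x0 \<rho> ==> t \<in> {0..1} ==> Y t p \<in> ball x0 r"
  and Yeq: "\<And>p t. p \<in> ball 0 \<rho> \<times> ball x0 \<rho> ==> t \<in> {0..1} ==>
   Y t p = snd p + integral {0..t} (\<lambda>s. G (Y s p) (fst p))"
  and lip: "\<And>w y z. w \<in> ball 0 \<rho> ==> y \<in> ball x0 r ==> z \<in> ball x0 r ==> norm (G y w - G z w) \<le> norm (y - z) / 2"
  using flow_along_frame[OF x0 G] by (smt (verit))
 let ?V = "ball (0::'e) \<rho> \<times> ball x0 \<rho>"
 have V: "open ?V" by (intro open_Times open_ball)
 have Gc: "continuous_on (ball x0 r) (\<lambda>y. G y w)" for w
  using Cinf_continuous_on[OF G(1)] r\<Omega> by (rule continuous_on_subset)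
 have Yc: "continuous_on {0..1} (\<lambda>t. Y t p)" if "p \<in> ?V" for p
  by (rule PC_compose_curve[OF V PC_cont[OF pc] continuous_on_const that])
 have GYc: "continuous_on {0..1} (\<lambda>t. G (Y t p) w)" if "p \<in> ?V" for p w
  by (rule continuous_on_compose2[OF Gc Yc[OF that]]) (use Yb[OF that] in auto)
 have Y0: "Y 0 p = snd p" if "p \<in> ?V" for p using Yeq[OF that, of 0] by simp
 have Y1C: "Cinf ?V (Y 1)" by (rule Cinf_PC_slice[OF V pc]) simp
 have Yder: "((\<lambda>t. Y t p) has_vector_derivative G (Y t p) (fst p)) (at t within {0..1})"
  if "p \<in> ?V" "t \<in> {0..1}" for p t
  by (rule integral_equation_derivative[OF GYc[OF that(1)] Yeq[OF that(1)] that(2)])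
 have PY: "P (Y t p) = P (snd p) + t *\<^sub>R P (fst p)" if p: "p \<in> ?V" and t: "t \<in> {0..1}" for p t
 proof -
  have bl: "bounded_linear P" using P(1) by (simp add: linear_conv_bounded_linear)
  have "P (integral {0..t} (\<lambda>s. G (Y s p) (fst p))) = integral {0..t} (P \<circ> (\<lambda>s. G (Y s p) (fst p)))"
   by (rule integral_linear[OF integrable_sub_unit[OF GYc[OF p] t] bl, symmetric])
  also have "\<dots> = integral {0..t} (\<lambda>s. P (fst p))"
  proof (rule integral_cong)
   fix s assume "s \<in> {0..t}"
   then have "s \<in> {0..1}" using t by auto
   then have "Y s p \<in> \<Omega>" using Yb[OF p] r\<Omega> by blast
   then show "(P \<circ> (\<lambda>s. G (Y s p) (fst p))) s = P (fst p)" using P(3) by simp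
  qed
  also have "\<dots> = t *\<^sub>R P (fst p)" using t by simp
  finally show ?thesis using Yeq[OF p t] by (simp add: linear_add[OF P(1)])
 qed
 \<comment> \<open>Flowing back along \<open>-w\<close> retraces the path, by uniqueness.\<close>
 have reverse: "Y 1 (- w, Y 1 (w, x)) = x" if p: "(w, x) \<in> ?V" and q: "(- w, Y 1 (w, x)) \<in> ?V" for w x
 proof -
  have zc: "continuous_on {0..1} (\<lambda>t. Y (1 - t) (w, x))"
   by (rule continuous_on_compose2[OF Yc[OF p]]) (auto intro!: continuous_intros)
  have Glin: "linear (G (Y t (w, x)))" if "t \<in> {0..1}" for t
   using G(2) Yb[OF p that] r\<Omega> by blast
  have "Y 1 (- w, Y 1 (w, x)) = Y (1 - 1) (w, x)"
  proof (rule integral_equation_unique[where y = "\<lambda>t. Y t (- w, Y 1 (w, x))" and z = "\<lambda>t. Y (1 - t) (w, x)"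
     and t = 1 and B = "ball x0 r" and H = "\<lambda>y. G y (- w)" and x = "Y 1 (w, x)"])
   show "Y t (- w, Y 1 (w, x)) = Y 1 (w, x) + integral {0..t} (\<lambda>s. G (Y s (- w, Y 1 (w, x))) (- w))"
    if "t \<in> {0..1}" for t using Yeq[OF q that] by simp
   show "Y (1 - t) (w, x) = Y 1 (w, x) + integral {0..t} (\<lambda>s. G (Y (1 - s) (w, x)) (- w))" if t: "t \<in> {0..1}" for t
   proof -
    have "((\<lambda>t. Y (1 - t) (w, x)) has_vector_derivative G (Y (1 - s) (w, x)) (- w)) (at s within {0..1})"
     if s: "s \<in> {0..1}" for s
    proof -
     have s1: "1 - s \<in> {0..1}" using s by auto
     have "((\<lambda>t. Y t (w, x)) \<circ> (\<lambda>t. 1 - t) has_vector_derivative (- 1) *\<^sub>R G (Y (1 - s) (w, x)) w) (at s within {0..1})"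
     proof (rule vector_diff_chain_within)
      show "((\<lambda>t. 1 - t) has_vector_derivative - 1) (at s within {0..1})"
       by (auto intro!: derivative_eq_intros)
      have "(\<lambda>t. 1 - t) ` {0..1::real} = {0..1}" by (auto simp: image_iff intro: bexI[of _ "1 - _"])
      then show "((\<lambda>t. Y t (w, x)) has_vector_derivative G (Y (1 - s) (w, x)) w) (at (1 - s) within (\<lambda>t. 1 - t) ` {0..1})"
       using Yder[OF p s1] by simp
     qed
     then show ?thesis using linear_neg[OF Glin[OF s1], of w] by (simp add: o_def)
    qed
    from derivative_integral_equation[OF this t] show ?thesis by simp
   qed
   show "continuous_on (ball x0 r) (\<lambda>y. G y (- w))" by (rule Gc)
   show "norm (G y (- w) - G z (- w)) \<le> norm (y - z) / 2" if "y \<in> ball x0 r" "z \<in> ball x0 r" for y z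
    using lip[of "- w" y z] that q by simp
  qed (use Yc[OF q] zc Yb[OF q] Yb[OF p] in auto)
  then show ?thesis using Y0[OF p] by simp
 qed
 define \<alpha> where "\<alpha> z = (P (z - x0), z - P (z - x0))" for z
 define \<beta> where "\<beta> x = (- P (x - x0), x)" for x
 define \<Psi> where "\<Psi> z = Y 1 (\<alpha> z)" for z
 define \<Phi> where "\<Phi> x = Y 1 (\<beta> x) + P (x - x0)" for x
 have Pz: "Cinf UNIV (\<lambda>z. P (z - x0))"
  by (intro Cinf_linear[OF P(1)] Cinf_diff Cinf_id Cinf_const open_UNIV)
 have \<alpha>C: "Cinf UNIV \<alpha>" and \<beta>C: "Cinf UNIV \<beta>" unfolding \<alpha>_def[abs_def] \<beta>_def[abs_def]
  by (intro Cinf_Pair Pz Cinf_diff Cinf_uminus Cinf_id open_UNIV)+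
 have o\<alpha>: "open (\<alpha> -` ?V)" and o\<beta>: "open (\<beta> -` ?V)"
  using Cinf_continuous_on[OF \<alpha>C] Cinf_continuous_on[OF \<beta>C] V open_vimage by blast+
 have \<Psi>C: "Cinf (\<alpha> -` ?V) \<Psi>" unfolding \<Psi>_def[abs_def]
  by (rule Cinf_compose[OF Y1C Cinf_subset[OF \<alpha>C o\<alpha>]]) auto
 have \<Phi>C: "Cinf (\<beta> -` ?V) \<Phi>" unfolding \<Phi>_def[abs_def]
  by (intro Cinf_add Cinf_compose[OF Y1C Cinf_subset[OF \<beta>C o\<beta>]] Cinf_subset[OF Pz o\<beta>]) auto
 \<comment> \<open>Domains are cut down twice, so that both compositions are defined and inverse to each other.\<close>
 define A where "A = \<alpha> -` ?V \<inter> \<Psi> -` (\<beta> -` ?V)"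
 define A' where "A' = \<beta> -` ?V \<inter> \<Phi> -` (\<alpha> -` ?V)"
 have oA: "open A" unfolding A_def
  by (rule continuous_open_preimage[OF Cinf_continuous_on[OF \<Psi>C] o\<alpha> o\<beta>])
 have oA': "open A'" unfolding A'_def
  by (rule continuous_open_preimage[OF Cinf_continuous_on[OF \<Phi>C] o\<beta> o\<alpha>])
 have P\<Psi>: "P (\<Psi> z - x0) = P (z - x0)" if "\<alpha> z \<in> ?V" for z
  using PY[OF that, of 1] by (simp add: \<Psi>_def \<alpha>_def linear_diff[OF P(1)] linear_add[OF P(1)] P(2))
 have P\<Phi>: "P (\<Phi> x - x0) = P (x - x0)" if "\<beta> x \<in> ?V" for x
  using PY[OF that, of 1] by (simp add: \<Phi>_def \<beta>_def linear_diff[OF P(1)] linear_add[OF P(1)] linear_neg[OF P(1)] P(2))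
 have \<Phi>\<Psi>: "\<Phi> (\<Psi> z) = z" if z: "z \<in> A" for z
 proof -
  have a: "\<alpha> z \<in> ?V" and b: "\<beta> (\<Psi> z) \<in> ?V" using z by (auto simp: A_def)
  have b': "\<beta> (\<Psi> z) = (- P (z - x0), Y 1 (P (z - x0), z - P (z - x0)))"
   using P\<Psi>[OF a] by (simp add: \<beta>_def) (simp add: \<Psi>_def \<alpha>_def)
  have "Y 1 (\<beta> (\<Psi> z)) = z - P (z - x0)"
   using reverse[of "P (z - x0)" "z - P (z - x0)"] a b unfolding b' by (simp add: \<alpha>_def)
  then show ?thesis using P\<Psi>[OF a] by (simp add: \<Phi>_def)
 qed
 have \<Psi>\<Phi>: "\<Psi> (\<Phi> x) = x" if x: "x \<in> A'" for x
 proof -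
  have b: "\<beta> x \<in> ?V" and a: "\<alpha> (\<Phi> x) \<in> ?V" using x by (auto simp: A'_def)
  have a': "\<alpha> (\<Phi> x) = (- (- P (x - x0)), Y 1 (- P (x - x0), x))"
   using P\<Phi>[OF b] by (simp add: \<alpha>_def) (simp add: \<Phi>_def \<beta>_def)
  show ?thesis
   using reverse[of "- P (x - x0)" x] a b unfolding \<Psi>_def a' by (simp add: \<beta>_def)
 qed
 define N where "N = A' \<inter> \<Phi> -` A"
 define N' where "N' = A \<inter> \<Psi> -` A'"
 have oN: "open N" unfolding N_def
  by (rule continuous_open_preimage[OF Cinf_continuous_on[OF Cinf_subset[OF \<Phi>C oA']] oA' oA]) (auto simp: A'_def)
 have oN': "open N'" unfolding N'_def
  by (rule continuous_open_preimage[OF Cinf_continuous_on[OF Cinf_subset[OF \<Psi>C oA]] oA oA']) (auto simp: A_def)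
 have c0: "(0, x0) \<in> ?V" using \<rho> by simp
 have Y10: "Y 1 (0, x0) = x0"
 proof -
  have "integral {0..1} (\<lambda>s. G (Y s (0, x0)) 0) = integral {0..1::real} (\<lambda>s. 0)"
  proof (rule integral_cong)
   fix s :: real assume "s \<in> {0..1}"
   then have "Y s (0, x0) \<in> \<Omega>" using Yb[OF c0] r\<Omega> by blast
   then show "G (Y s (0, x0)) 0 = 0" using linear_0[OF G(2)] by blast
  qed
  then show ?thesis using Yeq[OF c0, of 1] by simp
 qed
 have ab0: "\<alpha> x0 = (0, x0)" "\<beta> x0 = (0, x0)" by (simp_all add: \<alpha>_def \<beta>_def linear_0[OF P(1)])
 have f0: "\<Phi> x0 = x0" "\<Psi> x0 = x0" using Y10 by (simp_all add: \<Phi>_def \<Psi>_def ab0 linear_0[OF P(1)])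
 have A0: "x0 \<in> A" "x0 \<in> A'" using f0 ab0 c0 by (auto simp: A_def A'_def)
 \<comment> \<open>The derivative \<open>c\<close> of the flow in its coefficients \<open>w\<close> and the curve \<open>t G (y t) v\<close> solve the same linear equation,
  the second one because the frame commutes; so they agree.\<close>
 have D\<Psi>: "Dd \<Psi> z v = G (\<Psi> z) v" if z: "z \<in> A" and v: "P v = v" for z v
 proof -
  define w where "w = P (z - x0)"
  define x where "x = z - w"
  have p: "(w, x) \<in> ?V" using z by (auto simp: A_def \<alpha>_def w_def x_def)
  have w: "P w = w" by (simp add: w_def P(2))
  define y where "y t = Y t (w, x)" for t
  have y\<Omega>: "y t \<in> \<Omega>" and yb: "y t \<in> ball x0 r" if "t \<in> {0..1}" for t
   using Yb[OF p that] r\<Omega> by (auto simp: y_def)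
  obtain Y' where Y': "partials 0 {0..1} ?V Y Y'" using PC_SucE[OF pc[of "Suc 0"]] by blast
  define c where "c t = Y' (v, 0) t (w, x)" for t
  have cc: "continuous_on {0..1} c" unfolding c_def
   by (rule PC_compose_curve[OF V PC_cont[OF partialsD(1)[OF Y']] continuous_on_const p])
  have cder: "((\<lambda>s. Y t ((w, x) + s *\<^sub>R (v, 0))) has_vector_derivative c t) (at 0)" if "t \<in> {0..1}" for t
   unfolding c_def by (rule partialsD(2)[OF Y' that p])
  define q where "q t p = G (Y t p) (fst p)" for t p
  have qPC: "PC k {0..1} ?V q" for k
  proof -
   have "PC k {0..1} (ball x0 r \<times> UNIV) (\<lambda>_ z. G (fst z) (snd z))"
    by (rule Cinf_imp_PC, rule Cinf_subset[OF Dd_frame(1)[OF G x0]]) (use r\<Omega> in \<open>auto intro: open_Times\<close>)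
   moreover have "PC k {0..1} ?V (\<lambda>t p. (Y t p, 0) + (0, fst p))"
    by (rule PC_add[OF PC_linear[OF bounded_linear_Pair[OF bounded_linear_ident bounded_linear_zero] pc]
      PC_linear[OF bounded_linear_Pair[OF bounded_linear_zero bounded_linear_fst] PC_id]])
   ultimately have "PC k {0..1} ?V (\<lambda>t p. G (fst ((Y t p, 0) + (0, fst p))) (snd ((Y t p, 0) + (0, fst p))))"
    by (rule PC_compose[rotated]) (use Yb in \<open>auto intro: open_Times\<close>)
   then show ?thesis by (simp add: q_def[abs_def])
  qed
  obtain q' where q': "partials 0 {0..1} ?V q q'" using PC_SucE[OF qPC[of "Suc 0"]] by blast
  have q'eq: "q' (v, 0) t (w, x) = Dd (\<lambda>y. G y w) (y t) (c t) + G (y t) v" if t: "t \<in> {0..1}" for t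
  proof -
   let ?\<gamma> = "\<lambda>s. (Y t ((w, x) + s *\<^sub>R (v, 0)), w + s *\<^sub>R v)"
   have "(?\<gamma> has_vector_derivative (c t, v)) (at 0)"
    by (rule has_vector_derivative_Pair[OF cder[OF t]]) (auto intro!: derivative_eq_intros)
   from Cinf_curve[OF Dd_frame(1)[OF G x0] this] y\<Omega>[OF t]
   have "((\<lambda>s. G (fst (?\<gamma> s)) (snd (?\<gamma> s))) has_vector_derivative Dd (\<lambda>z. G (fst z) (snd z)) (y t, w) (c t, v)) (at 0)"
    by (simp add: y_def)
   then have "((\<lambda>s. q t ((w, x) + s *\<^sub>R (v, 0))) has_vector_derivative Dd (\<lambda>z. G (fst z) (snd z)) (y t, w) (c t, v)) (at 0)"
    by (simp add: q_def)
   from vector_derivative_unique_at[OF partialsD(2)[OF q' t p] this] show ?thesis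
    using Dd_frame(2)[OF G y\<Omega>[OF t], of w "c t" v] by simp
  qed
  have ceq: "c t = integral {0..t} (\<lambda>s. Dd (\<lambda>y. G y w) (y s) (c s) + G (y s) v)" if t: "t \<in> {0..1}" for t
  proof -
   have "((\<lambda>s. integral {0..t} (\<lambda>r. q r ((w, x) + s *\<^sub>R (v, 0)))) has_vector_derivative
     integral {0..t} (\<lambda>r. q' (v, 0) r (w, x))) (at 0)"
    by (rule deriv_parameter_integral[OF V p q' PC_cont[OF qPC] t])
   then have "((\<lambda>s. x + integral {0..t} (\<lambda>r. q r ((w, x) + s *\<^sub>R (v, 0)))) has_vector_derivative
     integral {0..t} (\<lambda>r. q' (v, 0) r (w, x))) (at 0)"
    using has_vector_derivative_add[OF has_vector_derivative_const] by fastforce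
   then have d: "((\<lambda>s. (\<lambda>p. snd p + integral {0..t} (\<lambda>r. q r p)) ((w, x) + s *\<^sub>R (v, 0))) has_vector_derivative
     integral {0..t} (\<lambda>r. q' (v, 0) r (w, x))) (at 0)" by simp
   have "((\<lambda>s. Y t ((w, x) + s *\<^sub>R (v, 0))) has_vector_derivative integral {0..t} (\<lambda>r. q' (v, 0) r (w, x))) (at 0)"
    by (rule has_vd_line_cong[OF V p _ d]) (use Yeq[OF _ t] in \<open>simp add: q_def\<close>)
   from vector_derivative_unique_at[OF cder[OF t] this]
   have "c t = integral {0..t} (\<lambda>r. q' (v, 0) r (w, x))" .
   also have "\<dots> = integral {0..t} (\<lambda>s. Dd (\<lambda>y. G y w) (y s) (c s) + G (y s) v)"
   proof (rule integral_cong)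
    fix s assume "s \<in> {0..t}"
    then have "s \<in> {0..1}" using t by auto
    then show "q' (v, 0) s (w, x) = Dd (\<lambda>y. G y w) (y s) (c s) + G (y s) v" by (rule q'eq)
   qed
   finally show ?thesis .
  qed
  have yder: "(y has_vector_derivative G (y t) w) (at t within {0..1})" if "t \<in> {0..1}" for t
   using Yder[OF p that] by (simp add: y_def[abs_def])
  have geq: "t *\<^sub>R G (y t) v = integral {0..t} (\<lambda>s. s *\<^sub>R Dd (\<lambda>y. G y v) (y s) (G (y s) w) + G (y s) v)"
   if t: "t \<in> {0..1}" for t
  proof -
   have "((\<lambda>s. s *\<^sub>R G (y s) v) has_vector_derivative s *\<^sub>R Dd (\<lambda>y. G y v) (y s) (G (y s) w) + 1 *\<^sub>R G (y s) v) (at s within {0..1})"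
    if s: "s \<in> {0..1}" for s
    by (rule has_vector_derivative_scaleR[OF _ Cinf_curve[OF G(1) yder[OF s] y\<Omega>[OF s]]])
     (auto intro!: derivative_eq_intros)
   from derivative_integral_equation[OF this t] show ?thesis by simp
  qed
  define e where "e t = c t - t *\<^sub>R G (y t) v" for t
  have yc: "continuous_on {0..1} y" using Yc[OF p] by (simp add: y_def[abs_def])
  have Gyc: "continuous_on {0..1} (\<lambda>s. G (y s) u)" for u
   using GYc[OF p] by (simp add: y_def)
  have DGc: "continuous_on {0..1} (\<lambda>s. Dd (\<lambda>y. G y u) (y s) (k s))" if "continuous_on {0..1} k" for u k
  proof -
   have ys: "continuous_on {0..1} (\<lambda>s. Dd (\<lambda>y. G y u) (y s) b)" for b
    by (rule continuous_on_compose2[OF Cinf_continuous_on[OF Cinf_Dd[OF G(1)]] yc]) (use y\<Omega> in auto)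
   have "continuous_on {0..1} (\<lambda>s. \<Sum>b\<in>Basis. (k s \<bullet> b) *\<^sub>R Dd (\<lambda>y. G y u) (y s) b)"
    by (intro continuous_on_sum continuous_on_scaleR continuous_on_inner that continuous_on_const ys)
   moreover have "(\<Sum>b\<in>Basis. (k s \<bullet> b) *\<^sub>R Dd (\<lambda>y. G y u) (y s) b) = Dd (\<lambda>y. G y u) (y s) (k s)" if "s \<in> {0..1}" for s
    by (rule linear_Basis_expand[OF Cinf_linear_Dd[OF G(1) y\<Omega>[OF that]], symmetric])
   ultimately show ?thesis by (rule continuous_on_eq)
  qed
  have ec: "continuous_on {0..1} e" unfolding e_def using cc Gyc by (intro continuous_intros)
  have eeq: "e t = integral {0..t} (\<lambda>s. Dd (\<lambda>y. G y w) (y s) (e s))" if t: "t \<in> {0..1}" for t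
  proof -
   have "e t = integral {0..t} (\<lambda>s. (Dd (\<lambda>y. G y w) (y s) (c s) + G (y s) v) -
     (s *\<^sub>R Dd (\<lambda>y. G y v) (y s) (G (y s) w) + G (y s) v))"
    unfolding e_def ceq[OF t] geq[OF t]
    by (rule integral_diff[symmetric]) (intro integrable_sub_unit continuous_intros DGc Gyc cc t)+
   also have "\<dots> = integral {0..t} (\<lambda>s. Dd (\<lambda>y. G y w) (y s) (e s))"
   proof (rule integral_cong)
    fix s assume "s \<in> {0..t}"
    then have s: "s \<in> {0..1}" using t by auto
    note lin = Cinf_linear_Dd[OF G(1) y\<Omega>[OF s], of w]
    show "Dd (\<lambda>y. G y w) (y s) (c s) + G (y s) v - (s *\<^sub>R Dd (\<lambda>y. G y v) (y s) (G (y s) w) + G (y s) v)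
     = Dd (\<lambda>y. G y w) (y s) (e s)"
     using comm[OF y\<Omega>[OF s] v w] by (simp add: e_def linear_diff[OF lin] linear_scale[OF lin])
   qed
   finally show ?thesis .
  qed
  have "(1 - 1 / 2) * norm (e 1) \<le> 0"
  proof (rule sup_norm_estimate[OF ec])
   fix t M assume t: "t \<in> {0..1::real}" and M: "\<And>s. s \<in> {0..1} ==> norm (e s) \<le> M"
   have "norm (integral {0..t} (\<lambda>s. Dd (\<lambda>y. G y w) (y s) (e s))) \<le> 1 / 2 * M"
   proof (rule integral_bound_unit[OF t DGc[OF ec]])
    fix s :: real assume s: "s \<in> {0..1}"
    have wb: "w \<in> ball 0 \<rho>" using p by auto
    have "norm (Dd (\<lambda>y. G y w) (y s) (e s)) \<le> 1 / 2 * norm (e s)"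
     by (rule Dd_norm_le_lipschitz[OF Cinf_subset[OF G(1) open_ball r\<Omega>] yb[OF s]])
      (use lip[OF wb] in auto)
    then show "norm (Dd (\<lambda>y. G y w) (y s) (e s)) \<le> 1 / 2 * M" using M[OF s] by simp
   qed
   then show "norm (e t) \<le> 0 + 1 / 2 * M" using eeq[OF t] by simp
  qed auto
  then have c1: "c 1 = G (y 1) v" by (simp add: e_def)
  have "\<alpha> (z + s *\<^sub>R v) = (w, x) + s *\<^sub>R (v, 0)" for s
  proof -
   have "P (z + s *\<^sub>R v - x0) = P (z - x0) + s *\<^sub>R v"
    using v by (simp add: linear_diff[OF P(1)] linear_add[OF P(1)] linear_scale[OF P(1)])
   then show ?thesis by (simp add: \<alpha>_def w_def x_def)
  qed
  then have "((\<lambda>s. \<Psi> (z + s *\<^sub>R v)) has_vector_derivative c 1) (at 0)"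
   using cder[of 1] by (simp add: \<Psi>_def)
  then have "Dd \<Psi> z v = c 1"
   by (rule Cinf_line_unique[OF \<Psi>C, rotated]) (use z in \<open>auto simp: A_def\<close>)
  moreover have "\<Psi> z = y 1" by (simp add: \<Psi>_def \<alpha>_def y_def w_def x_def)
  ultimately show ?thesis using c1 by simp
 qed
 have \<Phi>N: "Cinf N \<Phi>" by (rule Cinf_subset[OF \<Phi>C oN]) (auto simp: N_def A'_def)
 have \<Psi>N': "Cinf N' \<Psi>" by (rule Cinf_subset[OF \<Psi>C oN']) (auto simp: N'_def A_def)
 have NN': "\<Phi> x \<in> N'" if "x \<in> N" for x using that \<Psi>\<Phi> by (auto simp: N_def N'_def)
 have N'N: "\<Psi> z \<in> N" if "z \<in> N'" for z using that \<Phi>\<Psi> by (auto simp: N_def N'_def)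
 show thesis
 proof (rule that[OF _ _ \<Phi>N \<Psi>N' NN' N'N])
  show "x0 \<in> N" using A0 f0 by (simp add: N_def)
  show "N \<subseteq> \<Omega>" using \<rho>r r\<Omega> by (auto simp: N_def A'_def \<beta>_def)
  show "\<Psi> (\<Phi> x) = x" if "x \<in> N" for x using that \<Psi>\<Phi> by (simp add: N_def)
  show "\<Phi> (\<Psi> z) = z" if "z \<in> N'" for z using that \<Phi>\<Psi> by (simp add: N'_def)
  show "Dd \<Phi> x (G x v) = v" if x: "x \<in> N" and v: "P v = v" for x v
  proof -
   define z where "z = \<Phi> x"
   have z: "z \<in> N'" "\<Psi> z = x" using NN'[OF x] x \<Psi>\<Phi> by (auto simp: z_def N_def)
   have "Dd (\<lambda>z. \<Phi> (\<Psi> z)) z v = Dd (\<lambda>z. z) z v"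
    by (rule Dd_cong[OF oN' z(1)]) (use \<Phi>\<Psi> in \<open>auto simp: N'_def\<close>)
   moreover have "Dd (\<lambda>z. \<Phi> (\<Psi> z)) z v = Dd \<Phi> (\<Psi> z) (Dd \<Psi> z v)"
    by (rule Cinf_Dd_compose[OF \<Phi>N \<Psi>N' z(1)]) (use z x in simp)
   moreover have "Dd (\<lambda>z. z) z v = v" by (rule Dd_eqI[OF has_derivative_ident])
   ultimately show ?thesis using D\<Psi>[of z v] v z by (simp add: N'_def)
  qed
  show "\<Phi> x - x \<in> E" if E: "subspace E" and GE: "\<And>x v. x \<in> \<Omega> ==> G x v \<in> E" and PE: "\<And>v. P v \<in> E"
   and x: "x \<in> N" for E x
  proof -
   have b: "\<beta> x \<in> ?V" using x by (auto simp: N_def A'_def)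
   have eq: "Y 1 (\<beta> x) = x + integral {0..1} (\<lambda>s. G (Y s (\<beta> x)) (fst (\<beta> x)))"
    using Yeq[OF b, of 1] by (simp add: \<beta>_def)
   have "integral {0..1} (\<lambda>s. G (Y s (\<beta> x)) (fst (\<beta> x))) \<in> E"
   proof -
    obtain p where p: "linear p" "range p = E" "\<forall>x\<in>E. p x = x"
     using linear_projection_exists[OF E] by blast
    define L where "L u = u - p u" for u
    have L: "bounded_linear L" unfolding L_def using p(1)
     by (intro bounded_linear_sub bounded_linear_ident) (simp add: linear_conv_bounded_linear)
    have L0: "L u = 0 \<longleftrightarrow> u \<in> E" for u
    proof
     assume "L u = 0" then have "u = p u" by (simp add: L_def)
     then show "u \<in> E" using p(2) by (metis rangeI)
    qed (use p(3) in \<open>simp add: L_def\<close>)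
    have "integral {0..1} (L \<circ> (\<lambda>s. G (Y s (\<beta> x)) (fst (\<beta> x)))) = L (integral {0..1} (\<lambda>s. G (Y s (\<beta> x)) (fst (\<beta> x))))"
     by (rule integral_linear[OF integrable_sub_unit[OF GYc[OF b]] L]) simp
    moreover have "integral {0..1} (L \<circ> (\<lambda>s. G (Y s (\<beta> x)) (fst (\<beta> x)))) = integral {0..1::real} (\<lambda>s. 0)"
    proof (rule integral_cong)
     fix s :: real assume "s \<in> {0..1}"
     then have "Y s (\<beta> x) \<in> \<Omega>" using Yb[OF b] r\<Omega> by blast
     then show "(L \<circ> (\<lambda>s. G (Y s (\<beta> x)) (fst (\<beta> x)))) s = 0" using GE L0 by simp
    qed
    ultimately show ?thesis using L0 by simp
   qed
   then show ?thesis using PE subspace_add[OF E] unfolding \<Phi>_def eq by (simp add: algebra_simps)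
  qed
 qed
qed

section \<open>Projections and smooth maps on subspaces\<close>

text \<open>Some linear projection onto \<open>E\<close>. Composing with it turns functions on subsets of the subspace \<open>E\<close> into functions on
  open sets of the whole space, where derivatives are available.\<close>
definition proj :: "'e::euclidean_space set \<Rightarrow> 'e \<Rightarrow> 'e" where
 "proj E = (SOME p. linear p \<and> range p = E \<and> (\<forall>x\<in>E. p x = x))"

lemma
 assumes "subspace E"
 shows linear_proj: "linear (proj E)" and range_proj: "range (proj E) = E"
  and proj_id: "x \<in> E ==> proj E x = x"
 using someI_ex[OF linear_projection_exists[OF assms]] unfolding proj_def[symmetric] by auto

lemma proj_in: "subspace E ==> proj E x \<in> E"
 using range_proj by blast

lemma proj_proj: "subspace E ==> proj E (proj E x) = proj E x"
 by (simp add: proj_id proj_in)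

lemma Cinf_proj: "subspace E ==> open S ==> Cinf S (proj E)"
 using Cinf_linear[OF linear_proj Cinf_id] by auto

lemma open_proj_vimage:
 assumes E: "subspace E" and S: "openin (top_of_set E) S"
 shows "open (proj E -` S)"
proof -
 obtain T where T: "open T" "S = E \<inter> T" using S openin_open by metis
 have "proj E -` S = proj E -` T" using T(2) proj_in[OF E] by auto
 then show ?thesis
  using open_vimage[OF T(1)] Cinf_continuous_on[OF Cinf_proj[OF E open_UNIV]] by simp
qed

lemma smooth_onI:
 assumes "\<And>x. x \<in> S ==> \<exists>V h. x \<in> V \<and> Cinf V h \<and> (\<forall>y\<in>V \<inter> S. h y = f y)"
 shows "smooth_on S f"
 unfolding smooth_on_def
proof
 fix x assume "x \<in> S"
 then obtain V h where "x \<in> V" "Cinf V h" "\<forall>y\<in>V \<inter> S. h y = f y" using assms by meson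
 then show "\<exists>V h. open V \<and> x \<in> V \<and> (\<forall>k. Ck_on k V h) \<and> (\<forall>y\<in>V \<inter> S. h y = f y)"
  unfolding Cinf_def by meson
qed

text \<open>Smoothness by local extensions becomes smoothness of a single function: local extensions composed with
  the projection agree with it.\<close>
lemma smooth_on_iff_Cinf:
 assumes E: "subspace E" and S: "openin (top_of_set E) S"
 shows "smooth_on S f \<longleftrightarrow> Cinf (proj E -` S) (\<lambda>x. f (proj E x))"
proof
 assume f: "smooth_on S f"
 show "Cinf (proj E -` S) (\<lambda>x. f (proj E x))"
 proof (rule Cinf_local)
  fix x assume x: "x \<in> proj E -` S"
  then obtain V h where V: "open V" "proj E x \<in> V" "\<forall>k. Ck_on k V h" "\<forall>y\<in>V \<inter> S. h y = f y"
   using f unfolding smooth_on_def by blast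
  have h: "Cinf V h" using V by (simp add: Cinf_def)
  define U where "U = proj E -` (V \<inter> S)"
  have U: "open U"
   unfolding U_def by (rule open_proj_vimage[OF E]) (metis S V(1) openin_Int_open inf_commute)
  have "Cinf U (\<lambda>x. h (proj E x))"
   by (rule Cinf_compose[OF h Cinf_proj[OF E U]]) (auto simp: U_def)
  then have "Cinf U (\<lambda>x. f (proj E x))"
   by (rule Cinf_cong) (use V(4) in \<open>auto simp: U_def\<close>)
  then show "\<exists>V. x \<in> V \<and> V \<subseteq> proj E -` S \<and> Cinf V (\<lambda>x. f (proj E x))"
   using x V(2) by (intro exI[of _ U]) (auto simp: U_def)
 qed
next
 assume f: "Cinf (proj E -` S) (\<lambda>x. f (proj E x))"
 have "S \<subseteq> E" using S openin_subset by fastforce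
 then show "smooth_on S f"
  by (intro smooth_onI exI[of _ "proj E -` S"] exI[of _ "\<lambda>x. f (proj E x)"])
   (use f proj_id[OF E] in \<open>auto simp: subset_iff\<close>)
qed

section \<open>Charts\<close>

text \<open>The part of the manifold axioms on which the local theory depends. Leaves satisfy it by construction, which
  makes the results about \<open>M\<close> available on leaves as well.\<close>
definition smooth_atlas :: "('m, 'e::euclidean_space) charted_space \<Rightarrow> bool" where
 "smooth_atlas M \<longleftrightarrow> (\<forall>c\<in>atlas M. is_chart (topo M) c) \<and> (\<Union>c\<in>atlas M. chart_dom c) = points M \<and>
   (\<forall>c\<in>atlas M. \<forall>d\<in>atlas M. compatible c d)"

definition smooth_chart :: "('m, 'e::euclidean_space) charted_space \<Rightarrow> ('m, 'e) chart \<Rightarrow> bool" where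
 "smooth_chart M c \<longleftrightarrow> is_chart (topo M) c \<and> (\<forall>d\<in>atlas M. compatible c d)"

definition cinv :: "('m, 'e::euclidean_space) chart \<Rightarrow> 'e \<Rightarrow> 'm" where
 "cinv c x = chart_inv c (proj (model c) x)"

text \<open>The coordinate region of \<open>U\<close>, thickened along the kernel of the projection onto the model so that it becomes
  open in the ambient space; \<open>cinv\<close> is the inverse chart extended to it.\<close>
definition creg :: "('m, 'e::euclidean_space) chart \<Rightarrow> 'm set \<Rightarrow> 'e set" where
 "creg c U = proj (model c) -` (chart_map c ` (chart_dom c \<inter> U))"

lemma smooth_atlas_chart: "smooth_atlas M ==> c \<in> atlas M ==> smooth_chart M c"
 by (auto simp: smooth_atlas_def smooth_chart_def)

lemma smooth_chartD: "smooth_chart M c ==> is_chart (topo M) c"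
 by (simp add: smooth_chart_def)

lemma smooth_atlas_cover: "smooth_atlas M ==> p \<in> points M ==> \<exists>c\<in>atlas M. p \<in> chart_dom c"
 unfolding smooth_atlas_def by blast

context
 fixes T :: "'m topology" and c :: "('m, 'e::euclidean_space) chart"
 assumes c: "is_chart T c"
begin

lemma chart_open: "openin T (chart_dom c)"
 and chart_subspace: "subspace (model c)"
 using c by (auto simp: is_chart_def)

lemma chart_dom_topspace: "chart_dom c \<subseteq> topspace T"
 using openin_subset[OF chart_open] .

lemma chart_inj: "inj_on (chart_map c) (chart_dom c)"
proof -
 have "homeomorphic_map (subtopology T (chart_dom c)) (top_of_set (chart_map c ` chart_dom c)) (chart_map c)"
  using c by (simp add: is_chart_def)
 from homeomorphic_imp_injective_map[OF this] show ?thesis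
  using chart_dom_topspace by (simp add: Int_absorb1)
qed

lemma chart_inv_map: "q \<in> chart_dom c ==> chart_inv c (chart_map c q) = q"
 by (simp add: chart_inv_def chart_inj)

lemma chart_image_open:
 assumes "openin T U"
 shows "openin (top_of_set (model c)) (chart_map c ` (chart_dom c \<inter> U))"
proof -
 have h: "homeomorphic_map (subtopology T (chart_dom c)) (top_of_set (chart_map c ` chart_dom c)) (chart_map c)"
  and o: "openin (top_of_set (model c)) (chart_map c ` chart_dom c)"
  using c by (auto simp: is_chart_def)
 have "openin (subtopology T (chart_dom c)) (chart_dom c \<inter> U)"
  using assms by (simp add: openin_subtopology_Int2)
 then have "openin (top_of_set (chart_map c ` chart_dom c)) (chart_map c ` (chart_dom c \<inter> U))"
  using homeomorphic_imp_open_map[OF h] unfolding open_map_def by blast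
 then show ?thesis using o openin_trans by blast
qed

lemma chart_map_model: "q \<in> chart_dom c ==> chart_map c q \<in> model c"
 using chart_image_open[OF openin_topspace] chart_dom_topspace openin_subset[of "top_of_set (model c)"]
 by fastforce

lemma chart_preimage_open:
 assumes V: "open V"
 shows "openin T {q \<in> chart_dom c. chart_map c q \<in> V}"
proof -
 have h: "homeomorphic_map (subtopology T (chart_dom c)) (top_of_set (chart_map c ` chart_dom c)) (chart_map c)"
  using c by (simp add: is_chart_def)
 have "openin (top_of_set (chart_map c ` chart_dom c)) (chart_map c ` chart_dom c \<inter> V)"
  using V by (rule openin_open_Int)
 from openin_continuous_map_preimage[OF homeomorphic_imp_continuous_map[OF h] this]
 have "openin (subtopology T (chart_dom c)) {q \<in> chart_dom c. chart_map c q \<in> V}"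
  using chart_dom_topspace by (simp add: Int_absorb1 conj_commute cong: conj_cong)
 then show ?thesis using chart_open openin_trans_full by blast
qed

lemma open_creg: "openin T U ==> open (creg c U)"
 unfolding creg_def by (rule open_proj_vimage[OF chart_subspace chart_image_open])

lemma cinv_map: "q \<in> chart_dom c ==> cinv c (chart_map c q) = q"
 by (simp add: cinv_def proj_id[OF chart_subspace] chart_map_model chart_inv_map)

lemma cinv_creg:
 assumes "x \<in> creg c U"
 shows "cinv c x \<in> U" "cinv c x \<in> chart_dom c" "chart_map c (cinv c x) = proj (model c) x"
proof -
 obtain q where q: "q \<in> chart_dom c" "q \<in> U" "proj (model c) x = chart_map c q"
  using assms by (auto simp: creg_def)
 have e: "cinv c x = q" unfolding cinv_def q(3) by (rule chart_inv_map[OF q(1)])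
 show "cinv c x \<in> U" "cinv c x \<in> chart_dom c" "chart_map c (cinv c x) = proj (model c) x"
  unfolding e q(3) by (rule q(2), rule q(1), rule refl)
qed

lemma creg_sub: "x \<in> creg c U ==> cinv c x \<in> V ==> x \<in> creg c V"
 using cinv_creg(2,3)[of x U] unfolding creg_def by (metis IntI imageI vimageI)

lemma map_creg: "q \<in> chart_dom c ==> q \<in> U ==> chart_map c q \<in> creg c U"
 by (auto simp: creg_def proj_id[OF chart_subspace] chart_map_model)

lemma proj_creg: "x \<in> creg c U ==> proj (model c) x \<in> creg c U"
 by (simp add: creg_def proj_proj[OF chart_subspace])

lemma cinv_proj: "cinv c (proj (model c) x) = cinv c x"
 by (simp add: cinv_def proj_proj[OF chart_subspace])

lemma creg_mono: "U \<subseteq> V ==> creg c U \<subseteq> creg c V"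
 by (auto simp: creg_def)

lemma creg_Int_dom: "creg c (U \<inter> chart_dom c) = creg c U"
 by (auto simp: creg_def)

lemma smooth_on_chart_iff:
 assumes "openin T U"
 shows "smooth_on (chart_map c ` (chart_dom c \<inter> U)) (f \<circ> chart_inv c) \<longleftrightarrow> Cinf (creg c U) (\<lambda>x. f (cinv c x))"
 using smooth_on_iff_Cinf[OF chart_subspace chart_image_open[OF assms], of "f \<circ> chart_inv c"]
 by (simp add: creg_def cinv_def)

end

lemma is_chartI:
 fixes \<phi> :: "'m \<Rightarrow> 'e::euclidean_space"
 assumes D: "openin T D" and E: "subspace E" and inj: "inj_on \<phi> D"
  and cont: "\<And>V. open V ==> openin T {q \<in> D. \<phi> q \<in> V}"
  and op: "\<And>U. openin T U ==> U \<subseteq> D ==> openin (top_of_set E) (\<phi> ` U)"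
 shows "is_chart T (Chart D \<phi> E)"
proof -
 have DT: "D \<subseteq> topspace T" using openin_subset[OF D] .
 have im: "openin (top_of_set E) (\<phi> ` D)" by (rule op[OF D subset_refl])
 have "homeomorphic_map (subtopology T D) (top_of_set (\<phi> ` D)) \<phi>"
 proof (rule bijective_open_imp_homeomorphic_map)
  show "continuous_map (subtopology T D) (top_of_set (\<phi> ` D)) \<phi>"
   unfolding continuous_map_def
  proof (intro conjI allI impI)
   show "\<phi> \<in> topspace (subtopology T D) \<rightarrow> topspace (top_of_set (\<phi> ` D))" by auto
   fix V assume "openin (top_of_set (\<phi> ` D)) V"
   then obtain V' where V': "open V'" "V = \<phi> ` D \<inter> V'" using openin_open by metis
   have "{q \<in> topspace (subtopology T D). \<phi> q \<in> V} = D \<inter> {q \<in> D. \<phi> q \<in> V'}" using DT V'(2) by auto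
   then show "openin (subtopology T D) {q \<in> topspace (subtopology T D). \<phi> q \<in> V}"
    using openin_subtopology_Int2[OF cont[OF V'(1)]] by simp
  qed
  show "open_map (subtopology T D) (top_of_set (\<phi> ` D)) \<phi>"
   unfolding open_map_def
  proof (intro allI impI)
   fix U assume "openin (subtopology T D) U"
   then have U: "openin T U" "U \<subseteq> D" using openin_open_subtopology[OF D] by auto
   show "openin (top_of_set (\<phi> ` D)) (\<phi> ` U)"
    by (rule openin_subset_trans[OF op[OF U]]) (use U(2) openin_subset[OF im] in auto)
  qed
 qed (use DT inj in \<open>auto simp: Int_absorb1\<close>)
 then show ?thesis unfolding is_chart_def using D E im by simp
qed

section \<open>Smooth functions\<close>

lemma smooth_fun_on_iff:
 assumes M: "smooth_atlas M"
 shows "smooth_fun_on M U f \<longleftrightarrow> openin (topo M) U \<and> (\<forall>c\<in>atlas M. Cinf (creg c U) (\<lambda>x. f (cinv c x)))"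
 unfolding smooth_fun_on_def
 using smooth_on_chart_iff smooth_chartD[OF smooth_atlas_chart[OF M]] by blast

lemma smooth_fun_open: "smooth_fun_on M U f ==> openin (topo M) U"
 by (simp add: smooth_fun_on_def)

context
 fixes M :: "('m, 'e::euclidean_space) charted_space"
 assumes M: "smooth_atlas M"
begin

lemma atlas_transition:
 assumes c: "smooth_chart M c" and d: "d \<in> atlas M"
 shows "Cinf (creg c (chart_dom d)) (\<lambda>x. chart_map d (cinv c x))"
  and "Cinf (creg d (chart_dom c)) (\<lambda>x. chart_map c (cinv d x))"
proof -
 note c' = smooth_chartD[OF c] and d' = smooth_chartD[OF smooth_atlas_chart[OF M d]]
 have "compatible c d" using c d by (simp add: smooth_chart_def)
 then show "Cinf (creg c (chart_dom d)) (\<lambda>x. chart_map d (cinv c x))"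
  and "Cinf (creg d (chart_dom c)) (\<lambda>x. chart_map c (cinv d x))"
  using smooth_on_chart_iff[OF c' chart_open[OF d']] smooth_on_chart_iff[OF d' chart_open[OF c']]
  by (auto simp: compatible_def Int_commute)
qed

lemma smooth_fun_rep:
 assumes c: "smooth_chart M c" and f: "smooth_fun_on M U f"
 shows "Cinf (creg c U) (\<lambda>x. f (cinv c x))"
proof (rule Cinf_local)
 note c' = smooth_chartD[OF c]
 have U: "openin (topo M) U" using f by (rule smooth_fun_open)
 fix x assume x: "x \<in> creg c U"
 have "cinv c x \<in> points M"
  using subsetD[OF openin_subset[OF U] cinv_creg(1)[OF c' x]] by (simp add: points_def)
 then obtain d where d: "d \<in> atlas M" "cinv c x \<in> chart_dom d" using smooth_atlas_cover[OF M] by blast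
 note d' = smooth_chartD[OF smooth_atlas_chart[OF M d(1)]]
 let ?V = "creg c (U \<inter> chart_dom d)"
 have oV: "open ?V" by (rule open_creg[OF c']) (use U chart_open[OF d'] in blast)
 have xV: "x \<in> ?V" by (rule creg_sub[OF c' x]) (use d(2) cinv_creg(1)[OF c' x] in blast)
 have "Cinf ?V (\<lambda>x. (\<lambda>y. f (cinv d y)) (chart_map d (cinv c x)))"
 proof (rule Cinf_compose[where g = "\<lambda>y. f (cinv d y)" and f = "\<lambda>x. chart_map d (cinv c x)"])
  show "Cinf (creg d U) (\<lambda>y. f (cinv d y))"
   using f d(1) unfolding smooth_fun_on_iff[OF M] by (rule bspec[OF conjunct2])
  show "Cinf ?V (\<lambda>x. chart_map d (cinv c x))"
   by (rule Cinf_subset[OF atlas_transition(1)[OF c d(1)] oV creg_mono[OF c']]) auto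
  show "chart_map d (cinv c x) \<in> creg d U" if "x \<in> ?V" for x
   by (rule map_creg[OF d']) (use cinv_creg(1)[OF c' that] in blast)+
 qed
 then have "Cinf ?V (\<lambda>x. f (cinv c x))"
 proof (rule Cinf_cong)
  fix x assume "x \<in> ?V"
  then have "cinv c x \<in> chart_dom d" using cinv_creg(1)[OF c'] by blast
  then show "f (cinv d (chart_map d (cinv c x))) = f (cinv c x)" by (simp add: cinv_map[OF d'])
 qed
 then show "\<exists>V. x \<in> V \<and> V \<subseteq> creg c U \<and> Cinf V (\<lambda>x. f (cinv c x))"
  by (intro exI[of _ ?V] conjI xV creg_mono[OF c' Int_lower1])
qed

lemma smooth_fun_onI:
 assumes c: "smooth_chart M c" and U: "openin (topo M) U" "U \<subseteq> chart_dom c"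
  and f: "Cinf (creg c U) (\<lambda>x. f (cinv c x))"
 shows "smooth_fun_on M U f"
 unfolding smooth_fun_on_iff[OF M]
proof (intro conjI U(1) ballI)
 fix d assume d: "d \<in> atlas M"
 note c' = smooth_chartD[OF c] and d' = smooth_chartD[OF smooth_atlas_chart[OF M d]]
 have "Cinf (creg d U) (\<lambda>x. (\<lambda>y. f (cinv c y)) (chart_map c (cinv d x)))"
 proof (rule Cinf_compose[OF f])
  show "Cinf (creg d U) (\<lambda>x. chart_map c (cinv d x))"
   by (rule Cinf_subset[OF atlas_transition(2)[OF c d] open_creg[OF d' U(1)] creg_mono[OF d' U(2)]])
  show "chart_map c (cinv d x) \<in> creg c U" if "x \<in> creg d U" for x
   by (rule map_creg[OF c']) (use cinv_creg(1)[OF d' that] U(2) in blast)+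
 qed
 then show "Cinf (creg d U) (\<lambda>x. f (cinv d x))"
 proof (rule Cinf_cong)
  fix x assume "x \<in> creg d U"
  then have "cinv d x \<in> chart_dom c" using cinv_creg(1)[OF d'] U(2) by blast
  then show "f (cinv c (chart_map c (cinv d x))) = f (cinv d x)" by (simp add: cinv_map[OF c'])
 qed
qed

lemma atlas_is_chart: "c \<in> atlas M ==> is_chart (topo M) c"
 by (rule smooth_chartD[OF smooth_atlas_chart[OF M]])

lemma smooth_fun_onD: "smooth_fun_on M U f ==> c \<in> atlas M ==> Cinf (creg c U) (\<lambda>x. f (cinv c x))"
 unfolding smooth_fun_on_iff[OF M] by (rule bspec[OF conjunct2])

lemma smooth_fun_on_atlasI:
 "openin (topo M) U ==> (\<And>c. c \<in> atlas M ==> Cinf (creg c U) (\<lambda>x. f (cinv c x))) ==> smooth_fun_on M U f"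
 unfolding smooth_fun_on_iff[OF M] by (intro conjI ballI)

lemma smooth_fun_subset:
 assumes f: "smooth_fun_on M U f" and V: "openin (topo M) V" "V \<subseteq> U"
 shows "smooth_fun_on M V f"
proof (rule smooth_fun_on_atlasI[OF V(1)])
 fix c assume c: "c \<in> atlas M"
 note c' = atlas_is_chart[OF c]
 show "Cinf (creg c V) (\<lambda>x. f (cinv c x))"
  by (rule Cinf_subset[OF smooth_fun_onD[OF f c] open_creg[OF c' V(1)] creg_mono[OF c' V(2)]])
qed

lemma smooth_fun_cong:
 assumes f: "smooth_fun_on M U f" and fg: "\<And>q. q \<in> U ==> f q = g q"
 shows "smooth_fun_on M U g"
proof (rule smooth_fun_on_atlasI[OF smooth_fun_open[OF f]])
 fix c assume c: "c \<in> atlas M"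
 show "Cinf (creg c U) (\<lambda>x. g (cinv c x))"
  by (rule Cinf_cong[OF smooth_fun_onD[OF f c] fg[OF cinv_creg(1)[OF atlas_is_chart[OF c]]]])
qed

lemma smooth_fun_local:
 assumes U: "openin (topo M) U" and f: "\<And>p. p \<in> U ==> \<exists>V. p \<in> V \<and> V \<subseteq> U \<and> smooth_fun_on M V f"
 shows "smooth_fun_on M U f"
 unfolding smooth_fun_on_iff[OF M]
proof (intro conjI U ballI Cinf_local)
 fix c x assume c: "c \<in> atlas M" and x: "x \<in> creg c U"
 note c' = smooth_chartD[OF smooth_atlas_chart[OF M c]]
 obtain V where V: "cinv c x \<in> V" "V \<subseteq> U" "smooth_fun_on M V f" using f[OF cinv_creg(1)[OF c' x]] by blast
 have "x \<in> creg c V" by (rule creg_sub[OF c' x V(1)])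
 then show "\<exists>V. x \<in> V \<and> V \<subseteq> creg c U \<and> Cinf V (\<lambda>x. f (cinv c x))"
  by (intro exI[of _ "creg c V"] conjI creg_mono[OF c' V(2)] bspec[OF conjunct2[OF V(3)[unfolded smooth_fun_on_iff[OF M]]] c])
qed

lemma smooth_nearE:
 assumes "smooth_near M p f" "openin (topo M) W" "p \<in> W"
 obtains U where "p \<in> U" "U \<subseteq> W" "smooth_fun_on M U f"
proof -
 obtain U where U: "p \<in> U" "smooth_fun_on M U f" using assms(1) unfolding smooth_near_def by blast
 have "smooth_fun_on M (U \<inter> W) f"
  by (rule smooth_fun_subset[OF U(2) openin_Int[OF smooth_fun_open[OF U(2)] assms(2)] Int_lower1])
 then show thesis by (rule that[OF IntI[OF U(1) assms(3)] Int_lower2])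
qed

lemma smooth_nearI: "p \<in> U ==> smooth_fun_on M U f ==> smooth_near M p f"
 unfolding smooth_near_def by (intro exI conjI)

lemma smooth_near_cong:
 assumes "smooth_near M p f" "openin (topo M) W" "p \<in> W" "\<And>q. q \<in> W ==> f q = g q"
 shows "smooth_near M p g"
proof -
 obtain U where U: "p \<in> U" "U \<subseteq> W" "smooth_fun_on M U f" using smooth_nearE[OF assms(1-3)] .
 show ?thesis by (rule smooth_nearI[OF U(1) smooth_fun_cong[OF U(3) assms(4)[OF subsetD[OF U(2)]]]])
qed

lemma smooth_fun_coord:
 assumes c: "smooth_chart M c" and \<phi>: "Cinf S \<phi>"
  and U: "openin (topo M) U" "U \<subseteq> chart_dom c" "chart_map c ` U \<subseteq> S"
 shows "smooth_fun_on M U (\<lambda>q. \<phi> (chart_map c q))"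
proof (rule smooth_fun_onI[OF c U(1,2)])
 note c' = smooth_chartD[OF c]
 have "Cinf (creg c U) (\<lambda>x. \<phi> (proj (model c) x))"
 proof (rule Cinf_compose[OF \<phi> Cinf_proj[OF chart_subspace[OF c'] open_creg[OF c' U(1)]]])
  show "proj (model c) x \<in> S" if "x \<in> creg c U" for x
   using that U(3) by (auto simp: creg_def)
 qed
 then show "Cinf (creg c U) (\<lambda>x. \<phi> (chart_map c (cinv c x)))"
  by (rule Cinf_cong) (simp add: cinv_creg(3)[OF c'])
qed

lemma smooth_fun_coordinate:
 assumes c: "smooth_chart M c"
 shows "smooth_fun_on M (chart_dom c) (\<lambda>q. chart_map c q \<bullet> b)"
 by (rule smooth_fun_coord[OF c Cinf_inner[OF Cinf_id[OF open_UNIV] Cinf_const[OF open_UNIV]] chart_open[OF smooth_chartD[OF c]]]) auto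

lemma transition:
 assumes c: "smooth_chart M c" and d: "smooth_chart M d"
 shows "Cinf (creg c (chart_dom d)) (\<lambda>x. chart_map d (cinv c x))"
proof -
 note d' = smooth_chartD[OF d] and c' = smooth_chartD[OF c]
 have o: "open (creg c (chart_dom d))" by (rule open_creg[OF c' chart_open[OF d']])
 have "Cinf (creg c (chart_dom d)) (\<lambda>x. \<Sum>b\<in>Basis. (chart_map d (cinv c x) \<bullet> b) *\<^sub>R b)"
  by (intro Cinf_sum o finite_Basis Cinf_scaleR Cinf_const smooth_fun_rep[OF c smooth_fun_coordinate[OF d]])
 then show ?thesis by (simp add: euclidean_representation)
qed

lemma smooth_fun_const:
 assumes "openin (topo M) U" shows "smooth_fun_on M U (\<lambda>q. k)"
 by (rule smooth_fun_on_atlasI[OF assms Cinf_const[OF open_creg[OF atlas_is_chart assms]]])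

lemma smooth_fun_add:
 assumes f: "smooth_fun_on M U f" and g: "smooth_fun_on M U g"
 shows "smooth_fun_on M U (\<lambda>q. f q + g q)"
 by (rule smooth_fun_on_atlasI[OF smooth_fun_open[OF f] Cinf_add[OF smooth_fun_onD[OF f] smooth_fun_onD[OF g]]])

lemma smooth_fun_mult:
 assumes f: "smooth_fun_on M U f" and g: "smooth_fun_on M U g"
 shows "smooth_fun_on M U (\<lambda>q. f q * g q)"
 by (rule smooth_fun_on_atlasI[OF smooth_fun_open[OF f] Cinf_mult[OF smooth_fun_onD[OF f] smooth_fun_onD[OF g]]])

lemma smooth_fun_cmult: "smooth_fun_on M U f ==> smooth_fun_on M U (\<lambda>q. k * f q)"
 by (rule smooth_fun_mult[OF smooth_fun_const[OF smooth_fun_open]])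

section \<open>Tangent vectors\<close>

lemma chart_vec_apply:
 assumes c: "smooth_chart M c" and p: "p \<in> chart_dom c" and w: "w \<in> model c" and f: "smooth_near M p f"
 shows "chart_vec M c p w f = Dd (\<lambda>x. f (cinv c x)) (chart_map c p) w"
proof -
 note c' = smooth_chartD[OF c]
 obtain U where U: "p \<in> U" "smooth_fun_on M U f" using f unfolding smooth_near_def by blast
 have "chart_inv c (chart_map c p + t *\<^sub>R w) = cinv c (chart_map c p + t *\<^sub>R w)" for t
  unfolding cinv_def using proj_id[OF chart_subspace[OF c']] chart_map_model[OF c' p] w
   chart_subspace[OF c'] by (simp add: subspace_add subspace_scale)
 moreover have "((\<lambda>t. f (cinv c (chart_map c p + t *\<^sub>R w))) has_vector_derivative
   Dd (\<lambda>x. f (cinv c x)) (chart_map c p) w) (at 0)"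
  by (rule Cinf_line[OF smooth_fun_rep[OF c U(2)] map_creg[OF c' p U(1)]])
 ultimately show ?thesis
  using f by (simp add: chart_vec_def DERIV_imp_deriv has_real_derivative_iff_has_vector_derivative)
qed

lemma chart_vec_nonsmooth: "\<not> smooth_near M p f ==> chart_vec M c p w f = 0"
 by (simp add: chart_vec_def)

lemma Dd_in_subspace:
 assumes E: "subspace E" and f: "Cinf S f" and x: "x \<in> S" and fE: "\<And>y. y \<in> S ==> f y \<in> E"
 shows "Dd f x v \<in> E"
proof -
 have "Dd (\<lambda>y. proj E (f y)) x v = Dd f x v"
  by (rule Dd_cong[OF Cinf_open[OF f] x _ Cinf_differentiable[OF f x]]) (simp add: proj_id[OF E] fE)
 then have "Dd f x v = proj E (Dd f x v)" using Cinf_Dd_linear[OF f x linear_proj[OF E]] by simp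
 then show ?thesis using proj_in[OF E] by metis
qed

lemma Dd_proj_rep:
 assumes c: "smooth_chart M c" and f: "smooth_fun_on M U f" and x: "x \<in> creg c U"
 shows "Dd (\<lambda>x. f (cinv c x)) (proj (model c) x) (proj (model c) v) = Dd (\<lambda>x. f (cinv c x)) x v"
proof -
 note c' = smooth_chartD[OF c]
 note E = chart_subspace[OF c'] and o = open_creg[OF c' smooth_fun_open[OF f]]
 note fC = smooth_fun_rep[OF c f]
 have "Dd (\<lambda>x. (\<lambda>y. f (cinv c y)) (proj (model c) x)) x v
   = Dd (\<lambda>x. f (cinv c x)) (proj (model c) x) (Dd (proj (model c)) x v)"
  by (rule Cinf_Dd_compose[OF fC Cinf_proj[OF E o] x proj_creg[OF c' x]])
 moreover have "Dd (proj (model c)) x v = proj (model c) v"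
  by (rule Dd_eqI) (use linear_proj[OF E] in \<open>simp add: linear_conv_bounded_linear bounded_linear_imp_has_derivative\<close>)
 ultimately show ?thesis by (simp add: cinv_proj[OF c'])
qed

lemma chart_coords_vec:
 assumes c: "smooth_chart M c" and p: "p \<in> chart_dom c" and w: "w \<in> model c"
 shows "chart_coords c (chart_vec M c p w) = w"
proof -
 note c' = smooth_chartD[OF c]
 note E = chart_subspace[OF c'] and o = open_creg[OF c' chart_open[OF c']]
 have "chart_vec M c p w (\<lambda>q. chart_map c q \<bullet> b) = w \<bullet> b" for b
 proof -
  have sn: "smooth_near M p (\<lambda>q. chart_map c q \<bullet> b)"
   by (rule smooth_nearI[OF p smooth_fun_coordinate[OF c]])
  have x: "chart_map c p \<in> creg c (chart_dom c)" by (rule map_creg[OF c' p p])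
  have lin: "linear (\<lambda>x. proj (model c) x \<bullet> b)"
   using linear_proj[OF E] by (auto intro!: linearI simp: linear_add linear_scale inner_add_left)
  have "Dd (\<lambda>x. chart_map c (cinv c x) \<bullet> b) (chart_map c p) w = Dd (\<lambda>x. proj (model c) x \<bullet> b) (chart_map c p) w"
  proof (rule Dd_cong[OF o x])
   show "(\<lambda>x. proj (model c) x \<bullet> b) differentiable at (chart_map c p)"
    using lin by (simp add: linear_conv_bounded_linear bounded_linear_imp_differentiable)
  qed (simp add: cinv_creg(3)[OF c'])
  also have "\<dots> = proj (model c) w \<bullet> b"
   by (rule Dd_eqI) (use lin in \<open>simp add: linear_conv_bounded_linear bounded_linear_imp_has_derivative\<close>)
  finally show ?thesis using chart_vec_apply[OF c p w sn] proj_id[OF E w] by simp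
 qed
 then show ?thesis by (simp add: chart_coords_def euclidean_representation)
qed

text \<open>The transformation rule of tangent vectors, by the chain rule for the transition map.\<close>
lemma chart_vec_change:
 assumes c: "smooth_chart M c" and d: "smooth_chart M d" and p: "p \<in> chart_dom c" "p \<in> chart_dom d"
  and w: "w \<in> model c"
 shows "Dd (\<lambda>x. chart_map d (cinv c x)) (chart_map c p) w \<in> model d"
  and "chart_vec M c p w = chart_vec M d p (Dd (\<lambda>x. chart_map d (cinv c x)) (chart_map c p) w)"
proof -
 note c' = smooth_chartD[OF c] and d' = smooth_chartD[OF d]
 have x: "chart_map c p \<in> creg c (chart_dom d)" by (rule map_creg[OF c' p])
 show m: "Dd (\<lambda>x. chart_map d (cinv c x)) (chart_map c p) w \<in> model d"
  by (rule Dd_in_subspace[OF chart_subspace[OF d'] transition[OF c d] x])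
   (rule chart_map_model[OF d' cinv_creg(1)[OF c']])
 show "chart_vec M c p w = chart_vec M d p (Dd (\<lambda>x. chart_map d (cinv c x)) (chart_map c p) w)"
 proof
  fix f
  show "chart_vec M c p w f = chart_vec M d p (Dd (\<lambda>x. chart_map d (cinv c x)) (chart_map c p) w) f"
  proof (cases "smooth_near M p f")
   case True
   obtain U where U: "p \<in> U" "U \<subseteq> chart_dom c \<inter> chart_dom d" "smooth_fun_on M U f"
    using smooth_nearE[OF True openin_Int[OF chart_open[OF c'] chart_open[OF d']] IntI[OF p]] .
   note oU = smooth_fun_open[OF U(3)]
   have xU: "chart_map c p \<in> creg c U" by (rule map_creg[OF c' p(1) U(1)])
   have \<tau>: "Cinf (creg c U) (\<lambda>x. chart_map d (cinv c x))"
    by (rule Cinf_subset[OF transition[OF c d] open_creg[OF c' oU] creg_mono[OF c']]) (use U(2) in auto)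
   have cp: "cinv c (chart_map c p) = p" by (rule cinv_map[OF c' p(1)])
   have "Dd (\<lambda>x. f (cinv c x)) (chart_map c p) w = Dd (\<lambda>x. (\<lambda>y. f (cinv d y)) (chart_map d (cinv c x))) (chart_map c p) w"
   proof (rule Dd_cong[OF open_creg[OF c' oU] xU, symmetric])
    fix y assume y: "y \<in> creg c U"
    then have "cinv c y \<in> chart_dom d" using cinv_creg(1)[OF c' y] U(2) by blast
    then show "f (cinv c y) = f (cinv d (chart_map d (cinv c y)))" by (simp add: cinv_map[OF d'])
   qed (rule Cinf_differentiable[OF smooth_fun_rep[OF c U(3)] xU])
   also have "\<dots> = Dd (\<lambda>y. f (cinv d y)) (chart_map d p) (Dd (\<lambda>x. chart_map d (cinv c x)) (chart_map c p) w)"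
    using Cinf_Dd_compose[OF smooth_fun_rep[OF d U(3)] \<tau> xU] map_creg[OF d' p(2) U(1)] cp by simp
   finally show ?thesis by (simp add: chart_vec_apply[OF c p(1) w True] chart_vec_apply[OF d p(2) m True])
  qed (simp add: chart_vec_nonsmooth)
 qed
qed

lemma tangent_space_chart:
 assumes c: "smooth_chart M c" and p: "p \<in> chart_dom c"
 shows "tangent_space M p = {chart_vec M c p w | w. w \<in> model c}"
proof
 show "tangent_space M p \<subseteq> {chart_vec M c p w | w. w \<in> model c}"
 proof
  fix v assume "v \<in> tangent_space M p"
  then obtain d w where d: "d \<in> atlas M" "p \<in> chart_dom d" "w \<in> model d" and v: "v = chart_vec M d p w"
   unfolding tangent_space_def by blast
  from chart_vec_change[OF smooth_atlas_chart[OF M d(1)] c d(2) p d(3)]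
  show "v \<in> {chart_vec M c p w | w. w \<in> model c}" unfolding v by blast
 qed
 have "p \<in> points M" using chart_dom_topspace[OF smooth_chartD[OF c]] p by (auto simp: points_def)
 then obtain d where d: "d \<in> atlas M" "p \<in> chart_dom d" using smooth_atlas_cover[OF M] by blast
 show "{chart_vec M c p w | w. w \<in> model c} \<subseteq> tangent_space M p"
 proof
  fix v assume "v \<in> {chart_vec M c p w | w. w \<in> model c}"
  then obtain w where w: "w \<in> model c" and v: "v = chart_vec M c p w" by blast
  from chart_vec_change[OF c smooth_atlas_chart[OF M d(1)] p d(2) w]
  show "v \<in> tangent_space M p" unfolding v tangent_space_def using d by blast
 qed
qed

lemma chart_vec_tangent:
 "smooth_chart M c ==> p \<in> chart_dom c ==> w \<in> model c ==> chart_vec M c p w \<in> tangent_space M p"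
 by (auto simp: tangent_space_chart)

lemma chart_coords_tangent:
 assumes c: "smooth_chart M c" and p: "p \<in> chart_dom c" and v: "v \<in> tangent_space M p"
 shows "chart_coords c v \<in> model c" "chart_vec M c p (chart_coords c v) = v"
proof -
 obtain w where "w \<in> model c" "v = chart_vec M c p w" using v tangent_space_chart[OF c p] by blast
 then show "chart_coords c v \<in> model c" "chart_vec M c p (chart_coords c v) = v"
  using chart_coords_vec[OF c p] by auto
qed

lemma chart_vec_add:
 assumes c: "smooth_chart M c" and p: "p \<in> chart_dom c" and w: "w \<in> model c" "w' \<in> model c"
 shows "chart_vec M c p (w + w') = chart_vec M c p w + chart_vec M c p w'"
  and "chart_vec M c p (a *\<^sub>R w) = a *\<^sub>R chart_vec M c p w"
proof -
 note c' = smooth_chartD[OF c]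
 note E = chart_subspace[OF c']
 have lin: "linear (Dd (\<lambda>x. f (cinv c x)) (chart_map c p))" if f: "smooth_near M p f" for f
 proof -
  obtain U where U: "p \<in> U" "smooth_fun_on M U f" using f unfolding smooth_near_def by blast
  show ?thesis by (rule Cinf_linear_Dd[OF smooth_fun_rep[OF c U(2)] map_creg[OF c' p U(1)]])
 qed
 show "chart_vec M c p (w + w') = chart_vec M c p w + chart_vec M c p w'"
 proof
  fix f show "chart_vec M c p (w + w') f = (chart_vec M c p w + chart_vec M c p w') f"
   by (cases "smooth_near M p f")
    (simp_all add: chart_vec_apply[OF c p] chart_vec_nonsmooth w subspace_add[OF E] linear_add[OF lin])
 qed
 show "chart_vec M c p (a *\<^sub>R w) = a *\<^sub>R chart_vec M c p w"
 proof
  fix f show "chart_vec M c p (a *\<^sub>R w) f = (a *\<^sub>R chart_vec M c p w) f"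
   by (cases "smooth_near M p f")
    (simp_all add: scaleR_fun_def chart_vec_apply[OF c p] chart_vec_nonsmooth w subspace_scale[OF E] linear_scale[OF lin])
 qed
qed

lemma chart_coords_add: "chart_coords c (u + v) = chart_coords c u + chart_coords c v"
 and chart_coords_scale: "chart_coords c (a *\<^sub>R v) = a *\<^sub>R chart_coords c v"
 by (simp_all add: chart_coords_def scaleR_fun_def sum.distrib scaleR_add_left scaleR_sum_right)

lemma subspace_tangent:
 assumes p: "p \<in> points M"
 shows "subspace (tangent_space M p)"
proof -
 obtain c where c: "c \<in> atlas M" "p \<in> chart_dom c" using smooth_atlas_cover[OF M p] by blast
 note sc = smooth_atlas_chart[OF M c(1)]
 note E = chart_subspace[OF smooth_chartD[OF sc]]
 show ?thesis
 proof (rule subspaceI)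
  show "0 \<in> tangent_space M p"
   using chart_vec_add(2)[OF sc c(2) subspace_0[OF E] subspace_0[OF E], of 0]
    chart_vec_tangent[OF sc c(2) subspace_0[OF E]] by simp
  fix u v a assume u: "u \<in> tangent_space M p" and v: "v \<in> tangent_space M p"
  obtain w w' where w: "w \<in> model c" "w' \<in> model c" and uv: "u = chart_vec M c p w" "v = chart_vec M c p w'"
   using u v unfolding tangent_space_chart[OF sc c(2)] by blast
  show "u + v \<in> tangent_space M p" "a *\<^sub>R u \<in> tangent_space M p"
   using chart_vec_tangent[OF sc c(2) subspace_add[OF E w]] chart_vec_tangent[OF sc c(2) subspace_scale[OF E w(1)]]
   by (simp_all add: chart_vec_add[OF sc c(2) w] uv)
 qed
qed

lemma tangent_nonsmooth: "v \<in> tangent_space M p ==> \<not> smooth_near M p f ==> v f = 0"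
 unfolding tangent_space_def by (auto simp: chart_vec_nonsmooth)

lemma tangent_local:
 assumes v: "v \<in> tangent_space M p" and W: "openin (topo M) W" "p \<in> W" and fg: "\<And>q. q \<in> W ==> f q = g q"
 shows "v f = v g"
proof (cases "smooth_near M p f")
 case True
 have g: "smooth_near M p g" by (rule smooth_near_cong[OF True W fg])
 obtain c w where c: "c \<in> atlas M" "p \<in> chart_dom c" "w \<in> model c" "v = chart_vec M c p w"
  using v unfolding tangent_space_def by blast
 note sc = smooth_atlas_chart[OF M c(1)]
 note c' = smooth_chartD[OF sc]
 obtain U where U: "p \<in> U" "U \<subseteq> W" "smooth_fun_on M U f" using smooth_nearE[OF True W] .
 have x: "chart_map c p \<in> creg c U" by (rule map_creg[OF c' c(2) U(1)])
 have "Dd (\<lambda>x. g (cinv c x)) (chart_map c p) w = Dd (\<lambda>x. f (cinv c x)) (chart_map c p) w"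
  by (rule Dd_cong[OF open_creg[OF c' smooth_fun_open[OF U(3)]] x _ Cinf_differentiable[OF smooth_fun_rep[OF sc U(3)] x]])
   (rule fg[OF subsetD[OF U(2) cinv_creg(1)[OF c']]])
 then show ?thesis using chart_vec_apply[OF sc c(2,3)] True g c(4) by simp
next
 case False
 have "smooth_near M p f" if "smooth_near M p g"
  by (rule smooth_near_cong[OF that W]) (simp add: fg)
 with False have "\<not> smooth_near M p g" by blast
 then show ?thesis using tangent_nonsmooth[OF v] False by simp
qed

lemma tangent_derivation:
 assumes v: "v \<in> tangent_space M p" and f: "smooth_near M p f" and g: "smooth_near M p g"
 shows "v (\<lambda>q. f q + g q) = v f + v g" "v (\<lambda>q. k * f q) = k * v f" "v (\<lambda>q. k) = 0"
proof -
 obtain c w where c: "c \<in> atlas M" "p \<in> chart_dom c" "w \<in> model c" "v = chart_vec M c p w"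
  using v unfolding tangent_space_def by blast
 note sc = smooth_atlas_chart[OF M c(1)]
 note c' = smooth_chartD[OF sc]
 obtain U where U: "p \<in> U" "U \<subseteq> chart_dom c" "smooth_fun_on M U f"
  using smooth_nearE[OF f chart_open[OF c'] c(2)] .
 obtain V where V: "p \<in> V" "V \<subseteq> U" "smooth_fun_on M V g"
  using smooth_nearE[OF g smooth_fun_open[OF U(3)] U(1)] .
 have fV: "smooth_fun_on M V f" by (rule smooth_fun_subset[OF U(3) smooth_fun_open[OF V(3)] V(2)])
 have x: "chart_map c p \<in> creg c V" by (rule map_creg[OF c' c(2) V(1)])
 have n: "smooth_near M p (\<lambda>q. f q + g q)" "smooth_near M p (\<lambda>q. k * f q)" "smooth_near M p (\<lambda>q. k)"
  by (rule smooth_nearI[OF V(1)], rule smooth_fun_add[OF fV V(3)] smooth_fun_cmult[OF fV] smooth_fun_const[OF smooth_fun_open[OF V(3)]])+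
 note fC = smooth_fun_rep[OF sc fV] and gC = smooth_fun_rep[OF sc V(3)]
 have lk: "linear (\<lambda>y::real. k * y)" by (rule linearI) (auto simp: algebra_simps)
 show "v (\<lambda>q. f q + g q) = v f + v g" "v (\<lambda>q. k * f q) = k * v f" "v (\<lambda>q. k) = 0"
  using Cinf_Dd_add[OF fC gC x, of w] Cinf_Dd_linear[OF fC x lk, of w]
  by (simp_all add: c(4) chart_vec_apply[OF sc c(2,3)] n f g Dd_const)
qed

end

section \<open>Vector fields and brackets\<close>

context
 fixes M :: "('m, 'e::euclidean_space) charted_space"
 assumes M: "smooth_atlas M"
begin

lemma vf_open: "vector_field_on M U X ==> openin (topo M) U"
 by (simp add: vector_field_on_def)

lemma vf_tangent: "vector_field_on M U X ==> p \<in> U ==> X p \<in> tangent_space M p"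
 by (simp add: vector_field_on_def)

lemma vf_smooth: "vector_field_on M U X ==> V \<subseteq> U ==> smooth_fun_on M V f ==> smooth_fun_on M V (\<lambda>p. X p f)"
 by (simp add: vector_field_on_def)

lemma vfI:
 assumes "openin (topo M) U" "\<And>p. p \<in> U ==> X p \<in> tangent_space M p"
  "\<And>V f. V \<subseteq> U ==> smooth_fun_on M V f ==> smooth_fun_on M V (\<lambda>p. X p f)"
 shows "vector_field_on M U X"
 unfolding vector_field_on_def using assms by blast

lemma vf_subset:
 assumes X: "vector_field_on M U X" and V: "openin (topo M) V" "V \<subseteq> U"
 shows "vector_field_on M V X"
 by (rule vfI[OF V(1) vf_tangent[OF X subsetD[OF V(2)]] vf_smooth[OF X order_trans[OF _ V(2)]]])

lemma vf_cong:
 assumes X: "vector_field_on M U X" and XY: "\<And>p. p \<in> U ==> X p = Y p"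
 shows "vector_field_on M U Y"
proof (rule vfI[OF vf_open[OF X]])
 show "Y p \<in> tangent_space M p" if "p \<in> U" for p using vf_tangent[OF X that] XY[OF that] by simp
 fix V f assume V: "V \<subseteq> U" and f: "smooth_fun_on M V f"
 show "smooth_fun_on M V (\<lambda>p. Y p f)"
  by (rule smooth_fun_cong[OF M vf_smooth[OF X V f]]) (use XY V in auto)
qed

lemma vf_local:
 assumes U: "openin (topo M) U" and X: "\<And>p. p \<in> U ==> \<exists>V. p \<in> V \<and> V \<subseteq> U \<and> vector_field_on M V X"
 shows "vector_field_on M U X"
proof (rule vfI[OF U])
 show "X p \<in> tangent_space M p" if "p \<in> U" for p using X[OF that] vf_tangent by blast
 fix W f assume W: "W \<subseteq> U" and f: "smooth_fun_on M W f"
 note oW = smooth_fun_open[OF f]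
 show "smooth_fun_on M W (\<lambda>p. X p f)"
 proof (rule smooth_fun_local[OF M oW])
  fix p assume p: "p \<in> W"
  obtain V where V: "p \<in> V" "V \<subseteq> U" "vector_field_on M V X" using X W p by blast
  have o: "openin (topo M) (V \<inter> W)" by (rule openin_Int[OF vf_open[OF V(3)] oW])
  have "smooth_fun_on M (V \<inter> W) (\<lambda>p. X p f)"
   by (rule vf_smooth[OF V(3) Int_lower1 smooth_fun_subset[OF M f o Int_lower2]])
  then show "\<exists>V. p \<in> V \<and> V \<subseteq> W \<and> smooth_fun_on M V (\<lambda>p. X p f)"
   using V(1) p by (intro exI[of _ "V \<inter> W"]) simp
 qed
qed

lemma points_open: "openin (topo M) U ==> p \<in> U ==> p \<in> points M"
 using openin_subset points_def by fastforce

lemma vf_add: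
 assumes X: "vector_field_on M U X" and Y: "vector_field_on M U Y"
 shows "vector_field_on M U (\<lambda>p. X p + Y p)"
proof (rule vfI[OF vf_open[OF X]])
 show "X p + Y p \<in> tangent_space M p" if "p \<in> U" for p
  by (rule subspace_add[OF subspace_tangent[OF M points_open[OF vf_open[OF X] that]] vf_tangent[OF X that] vf_tangent[OF Y that]])
 show "smooth_fun_on M V (\<lambda>p. (X p + Y p) f)" if "V \<subseteq> U" "smooth_fun_on M V f" for V f
  using smooth_fun_add[OF M vf_smooth[OF X that] vf_smooth[OF Y that]] by simp
qed

lemma vf_scale:
 assumes X: "vector_field_on M U X"
 shows "vector_field_on M U (\<lambda>p. a *\<^sub>R X p)"
proof (rule vfI[OF vf_open[OF X]])
 show "a *\<^sub>R X p \<in> tangent_space M p" if "p \<in> U" for p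
  by (rule subspace_scale[OF subspace_tangent[OF M points_open[OF vf_open[OF X] that]] vf_tangent[OF X that]])
 show "smooth_fun_on M V (\<lambda>p. (a *\<^sub>R X p) f)" if "V \<subseteq> U" "smooth_fun_on M V f" for V f
  using smooth_fun_cmult[OF M vf_smooth[OF X that], of a] by (simp add: scaleR_fun_def)
qed

definition vcoord :: "('m, 'e) chart \<Rightarrow> ('m \<Rightarrow> 'm tvec) \<Rightarrow> 'e \<Rightarrow> 'e" where
 "vcoord c X x = chart_coords c (X (cinv c x))"

lemma vf_coords:
 assumes X: "vector_field_on M U X" and c: "smooth_chart M c"
 shows "Cinf (creg c U) (vcoord c X)"
proof -
 note c' = smooth_chartD[OF c]
 let ?V = "U \<inter> chart_dom c"
 have oV: "openin (topo M) ?V" by (rule openin_Int[OF vf_open[OF X] chart_open[OF c']])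
 have "smooth_fun_on M ?V (\<lambda>p. X p (\<lambda>q. chart_map c q \<bullet> b))" for b
  by (rule vf_smooth[OF X Int_lower1 smooth_fun_subset[OF M smooth_fun_coordinate[OF M c] oV Int_lower2]])
 from smooth_fun_rep[OF M c this]
 have "Cinf (creg c U) (\<lambda>x. X (cinv c x) (\<lambda>q. chart_map c q \<bullet> b))" for b
  unfolding creg_Int_dom[OF c'] .
 then show ?thesis unfolding vcoord_def[abs_def] chart_coords_def
  by (intro Cinf_sum Cinf_scaleR Cinf_const finite_Basis open_creg[OF c' vf_open[OF X]])
qed

lemma vcoord_model:
 assumes X: "vector_field_on M U X" and c: "smooth_chart M c" and x: "x \<in> creg c U"
 shows "vcoord c X x \<in> model c" "X (cinv c x) = chart_vec M c (cinv c x) (vcoord c X x)"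
 using chart_coords_tangent[OF M c cinv_creg(2)[OF smooth_chartD[OF c] x]
   vf_tangent[OF X cinv_creg(1)[OF smooth_chartD[OF c] x]]]
 by (simp_all add: vcoord_def)

lemma vcoord_map:
 assumes c: "smooth_chart M c" and p: "p \<in> chart_dom c"
 shows "vcoord c X (chart_map c p) = chart_coords c (X p)"
 by (simp add: vcoord_def cinv_map[OF smooth_chartD[OF c] p])

text \<open>In a chart, vector fields are the same as smooth coefficient functions; this is how all vector fields below
  are built.\<close>
lemma vf_chart_vec:
 assumes c: "smooth_chart M c" and U: "openin (topo M) U" "U \<subseteq> chart_dom c"
  and w: "\<And>q. q \<in> U ==> w q \<in> model c" "Cinf (creg c U) (\<lambda>x. w (cinv c x))"
 shows "vector_field_on M U (\<lambda>q. chart_vec M c q (w q))"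
proof (rule vfI[OF U(1)])
 note c' = smooth_chartD[OF c]
 show "chart_vec M c q (w q) \<in> tangent_space M q" if "q \<in> U" for q
  by (rule chart_vec_tangent[OF M c subsetD[OF U(2) that] w(1)[OF that]])
 fix V f assume V: "V \<subseteq> U" and f: "smooth_fun_on M V f"
 note oV = smooth_fun_open[OF f]
 have o: "open (creg c V)" by (rule open_creg[OF c' oV])
 note fC = smooth_fun_rep[OF M c f]
 have "Cinf (creg c V) (\<lambda>x. Dd (\<lambda>x. f (cinv c x)) x (w (cinv c x)))"
  by (rule Cinf_Dd_family[OF fC Cinf_subset[OF w(2) o creg_mono[OF c' V]]])
 then have "Cinf (creg c V) (\<lambda>x. chart_vec M c (cinv c x) (w (cinv c x)) f)"
 proof (rule Cinf_cong)
  fix x assume x: "x \<in> creg c V"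
  note q = cinv_creg[OF c' x]
  have wm: "w (cinv c x) \<in> model c" by (rule w(1)[OF subsetD[OF V q(1)]])
  have "chart_vec M c (cinv c x) (w (cinv c x)) f = Dd (\<lambda>x. f (cinv c x)) (proj (model c) x) (w (cinv c x))"
   using chart_vec_apply[OF M c q(2) wm smooth_nearI[OF M q(1) f]] q(3) by simp
  also have "\<dots> = Dd (\<lambda>x. f (cinv c x)) x (w (cinv c x))"
   using Dd_proj_rep[OF M c f x, of "w (cinv c x)"] proj_id[OF chart_subspace[OF c'] wm] by simp
  finally show "Dd (\<lambda>x. f (cinv c x)) x (w (cinv c x)) = chart_vec M c (cinv c x) (w (cinv c x)) f" ..
 qed
 then show "smooth_fun_on M V (\<lambda>q. chart_vec M c q (w q) f)"
  by (rule smooth_fun_onI[OF M c oV order_trans[OF V U(2)]])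
qed

lemma vf_from_coords:
 assumes c: "smooth_chart M c" and U: "openin (topo M) U" "U \<subseteq> chart_dom c"
  and X: "\<And>q. q \<in> U ==> X q \<in> tangent_space M q" "Cinf (creg c U) (vcoord c X)"
 shows "vector_field_on M U X"
proof (rule vf_cong[OF vf_chart_vec[OF c U, of "\<lambda>q. chart_coords c (X q)"]])
 fix q assume q: "q \<in> U"
 note t = chart_coords_tangent[OF M c subsetD[OF U(2) q] X(1)[OF q]]
 show "chart_coords c (X q) \<in> model c" "chart_vec M c q (chart_coords c (X q)) = X q" using t by auto
qed (use X(2) in \<open>simp add: vcoord_def[abs_def]\<close>)

lemma vf_const:
 assumes c: "smooth_chart M c" and w: "w \<in> model c"
 shows "vector_field_on M (chart_dom c) (\<lambda>q. chart_vec M c q w)"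
 by (rule vf_chart_vec[OF c chart_open[OF smooth_chartD[OF c]] subset_refl w
    Cinf_const[OF open_creg[OF smooth_chartD[OF c] chart_open[OF smooth_chartD[OF c]]]]])

lemma vf_extension:
 assumes v: "v \<in> tangent_space M p" and p: "p \<in> points M"
 obtains U X where "p \<in> U" "vector_field_on M U X" "X p = v"
proof -
 obtain c where c: "c \<in> atlas M" "p \<in> chart_dom c" using smooth_atlas_cover[OF M p] by blast
 note sc = smooth_atlas_chart[OF M c(1)]
 note t = chart_coords_tangent[OF M sc c(2) v]
 show thesis by (rule that[OF c(2) vf_const[OF sc t(1)] t(2)])
qed

lemma vf_apply:
 assumes X: "vector_field_on M U X" and c: "smooth_chart M c" and f: "smooth_fun_on M V f"
  and V: "V \<subseteq> U" and x: "x \<in> creg c V"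
 shows "X (cinv c x) f = Dd (\<lambda>x. f (cinv c x)) x (vcoord c X x)"
proof -
 note c' = smooth_chartD[OF c]
 note q = cinv_creg[OF c' x]
 note m = vcoord_model[OF X c subsetD[OF creg_mono[OF c' V] x]]
 have "X (cinv c x) f = chart_vec M c (cinv c x) (vcoord c X x) f" using m(2) by simp
 also have "\<dots> = Dd (\<lambda>x. f (cinv c x)) (proj (model c) x) (vcoord c X x)"
  using chart_vec_apply[OF M c q(2) m(1) smooth_nearI[OF M q(1) f]] q(3) by simp
 also have "\<dots> = Dd (\<lambda>x. f (cinv c x)) x (vcoord c X x)"
  using Dd_proj_rep[OF M c f x, of "vcoord c X x"] proj_id[OF chart_subspace[OF c'] m(1)] by simp
 finally show ?thesis .
qed

lemma vf_apply_point:
 assumes X: "vector_field_on M U X" and c: "smooth_chart M c" and f: "smooth_fun_on M V f"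
  and V: "V \<subseteq> U" and p: "p \<in> V" "p \<in> chart_dom c"
 shows "X p f = Dd (\<lambda>x. f (cinv c x)) (chart_map c p) (vcoord c X (chart_map c p))"
 using vf_apply[OF X c f V map_creg[OF smooth_chartD[OF c] p(2,1)]]
 by (simp add: cinv_map[OF smooth_chartD[OF c] p(2)])

text \<open>Second derivatives of the test function cancel by symmetry, which leaves the classical coordinate
  expression of the bracket.\<close>
lemma bracket_chart:
 assumes X: "vector_field_on M U X" and Y: "vector_field_on M U Y" and c: "smooth_chart M c"
  and p: "p \<in> U" "p \<in> chart_dom c"
 defines "x0 \<equiv> chart_map c p"
 defines "z \<equiv> Dd (vcoord c Y) x0 (vcoord c X x0) - Dd (vcoord c X) x0 (vcoord c Y x0)"
 shows "z \<in> model c" "lie_bracket M X Y p = chart_vec M c p z"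
proof -
 note c' = smooth_chartD[OF c]
 note E = chart_subspace[OF c']
 have xU: "x0 \<in> creg c U" unfolding x0_def by (rule map_creg[OF c' p(2,1)])
 note XC = vf_coords[OF X c] and YC = vf_coords[OF Y c]
 show zm: "z \<in> model c" unfolding z_def
  by (intro subspace_diff[OF E] Dd_in_subspace[OF M E YC xU] Dd_in_subspace[OF M E XC xU] vcoord_model[OF X c] vcoord_model[OF Y c])
 show "lie_bracket M X Y p = chart_vec M c p z"
 proof
  fix f
  show "lie_bracket M X Y p f = chart_vec M c p z f"
  proof (cases "smooth_near M p f")
   case True
   obtain V where V: "p \<in> V" "V \<subseteq> U" "smooth_fun_on M V f"
    using smooth_nearE[OF M True vf_open[OF X] p(1)] .
   note oV = open_creg[OF c' smooth_fun_open[OF V(3)]]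
   have xV: "x0 \<in> creg c V" unfolding x0_def by (rule map_creg[OF c' p(2) V(1)])
   let ?F = "\<lambda>x. f (cinv c x)"
   note FC = smooth_fun_rep[OF M c V(3)]
   have half: "X p (\<lambda>q. Y q f) = Dd (\<lambda>y. Dd ?F y (vcoord c Y x0)) x0 (vcoord c X x0) + Dd ?F x0 (Dd (vcoord c Y) x0 (vcoord c X x0))"
    if X: "vector_field_on M U X" and Y: "vector_field_on M U Y" for X Y
   proof -
    note YV = Cinf_subset[OF vf_coords[OF Y c] oV creg_mono[OF c' V(2)]]
    have "X p (\<lambda>q. Y q f) = Dd (\<lambda>x. Y (cinv c x) f) x0 (vcoord c X x0)"
     unfolding x0_def by (rule vf_apply_point[OF X c vf_smooth[OF Y V(2,3)] V(2,1) p(2)])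
    also have "\<dots> = Dd (\<lambda>x. Dd ?F x (vcoord c Y x)) x0 (vcoord c X x0)"
     by (rule Dd_cong[OF oV xV vf_apply[OF Y c V(3,2), symmetric] Cinf_differentiable[OF Cinf_Dd_family[OF FC YV] xV]])
    also have "\<dots> = Dd (\<lambda>y. Dd ?F y (vcoord c Y x0)) x0 (vcoord c X x0) + Dd ?F x0 (Dd (vcoord c Y) x0 (vcoord c X x0))"
     by (rule Cinf_Dd_linear_family[where L = "\<lambda>x. Dd ?F x", OF Cinf_Dd[OF FC] Cinf_linear_Dd[OF FC] YV xV])
    finally show ?thesis .
   qed
   have "lie_bracket M X Y p f = X p (\<lambda>q. Y q f) - Y p (\<lambda>q. X q f)"
    using True by (simp add: lie_bracket_def)
   also have "\<dots> = Dd ?F x0 z"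
    unfolding half[OF X Y] half[OF Y X] z_def linear_diff[OF Cinf_linear_Dd[OF FC xV]]
    using Dd_symmetric[OF FC xV, of "vcoord c X x0" "vcoord c Y x0"] by simp
   also have "\<dots> = chart_vec M c p z f"
    using chart_vec_apply[OF M c p(2) zm True] by (simp add: x0_def)
   finally show ?thesis .
  qed (simp add: lie_bracket_def chart_vec_nonsmooth[OF M])
 qed
qed

lemma bracket_tangent:
 assumes "vector_field_on M U X" "vector_field_on M U Y" "p \<in> U"
 shows "lie_bracket M X Y p \<in> tangent_space M p"
proof -
 obtain c where c: "c \<in> atlas M" "p \<in> chart_dom c"
  using smooth_atlas_cover[OF M points_open[OF vf_open[OF assms(1)] assms(3)]] by blast
 note sc = smooth_atlas_chart[OF M c(1)]
 show ?thesis unfolding bracket_chart(2)[OF assms(1,2) sc assms(3) c(2)]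
  by (rule chart_vec_tangent[OF M sc c(2) bracket_chart(1)[OF assms(1,2) sc assms(3) c(2)]])
qed

lemma bracket_local:
 assumes X: "vector_field_on M U X" "vector_field_on M U Y" and W: "openin (topo M) W" "p \<in> W" "W \<subseteq> U"
  and eq: "\<And>q. q \<in> W ==> X q = X' q" "\<And>q. q \<in> W ==> Y q = Y' q"
 shows "lie_bracket M X Y p = lie_bracket M X' Y' p"
proof
 fix f
 have t: "X p \<in> tangent_space M p" "Y p \<in> tangent_space M p"
  using vf_tangent[OF X(1)] vf_tangent[OF X(2)] W by auto
 have "X p (\<lambda>q. Y q f) = X p (\<lambda>q. Y' q f)" "Y p (\<lambda>q. X q f) = Y p (\<lambda>q. X' q f)"
  by (rule tangent_local[OF M t(1) W(1,2)], simp add: eq) (rule tangent_local[OF M t(2) W(1,2)], simp add: eq)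
 then show "lie_bracket M X Y p f = lie_bracket M X' Y' p f"
  using eq W(2) by (simp add: lie_bracket_def)
qed

lemma bracket_antisym: "lie_bracket M X Y p = - lie_bracket M Y X p"
 by (auto simp: lie_bracket_def)

lemma bracket_add_left:
 assumes X: "vector_field_on M U X" "vector_field_on M U X'" "vector_field_on M U Y" and p: "p \<in> U"
 shows "lie_bracket M (\<lambda>q. X q + X' q) Y p = lie_bracket M X Y p + lie_bracket M X' Y p"
proof
 fix f
 show "lie_bracket M (\<lambda>q. X q + X' q) Y p f = (lie_bracket M X Y p + lie_bracket M X' Y p) f"
 proof (cases "smooth_near M p f")
  case True
  obtain V where V: "p \<in> V" "V \<subseteq> U" "smooth_fun_on M V f" using smooth_nearE[OF M True vf_open[OF X(1)] p] .
  have "Y p (\<lambda>q. X q f + X' q f) = Y p (\<lambda>q. X q f) + Y p (\<lambda>q. X' q f)"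
   by (rule tangent_derivation(1)[OF M vf_tangent[OF X(3) p]])
    (rule smooth_nearI[OF M V(1) vf_smooth[OF X(1) V(2,3)]], rule smooth_nearI[OF M V(1) vf_smooth[OF X(2) V(2,3)]])
  then show ?thesis using True by (simp add: lie_bracket_def)
 qed (simp add: lie_bracket_def)
qed

lemma bracket_scale_left:
 assumes X: "vector_field_on M U X" "vector_field_on M U Y" and p: "p \<in> U"
 shows "lie_bracket M (\<lambda>q. a *\<^sub>R X q) Y p = a *\<^sub>R lie_bracket M X Y p"
proof
 fix f
 show "lie_bracket M (\<lambda>q. a *\<^sub>R X q) Y p f = (a *\<^sub>R lie_bracket M X Y p) f"
 proof (cases "smooth_near M p f")
  case True
  obtain V where V: "p \<in> V" "V \<subseteq> U" "smooth_fun_on M V f" using smooth_nearE[OF M True vf_open[OF X(1)] p] .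
  have s: "smooth_near M p (\<lambda>q. X q f)" by (rule smooth_nearI[OF M V(1) vf_smooth[OF X(1) V(2,3)]])
  have "Y p (\<lambda>q. a * X q f) = a * Y p (\<lambda>q. X q f)"
   by (rule tangent_derivation(2)[OF M vf_tangent[OF X(2) p] s s])
  then show ?thesis using True by (simp add: lie_bracket_def scaleR_fun_def right_diff_distrib)
 qed (simp add: lie_bracket_def scaleR_fun_def)
qed

section \<open>Two-forms and the Cartan formula\<close>

definition two_form :: "('m \<Rightarrow> 'm tvec \<Rightarrow> 'm tvec \<Rightarrow> real) \<Rightarrow> bool" where
 "two_form \<omega> \<longleftrightarrow>
   (\<forall>p\<in>points M. \<forall>u\<in>tangent_space M p. \<forall>v\<in>tangent_space M p.
    \<omega> p u v = - \<omega> p v u \<and>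
    (\<forall>w\<in>tangent_space M p. \<forall>a. \<omega> p (u + w) v = \<omega> p u v + \<omega> p w v \<and> \<omega> p (a *\<^sub>R u) v = a * \<omega> p u v)) \<and>
   (\<forall>U X Y. vector_field_on M U X \<and> vector_field_on M U Y \<longrightarrow> smooth_fun_on M U (\<lambda>p. \<omega> p (X p) (Y p)))"

definition cartan :: "('m \<Rightarrow> 'm tvec \<Rightarrow> 'm tvec \<Rightarrow> real) \<Rightarrow>
  ('m \<Rightarrow> 'm tvec) \<Rightarrow> ('m \<Rightarrow> 'm tvec) \<Rightarrow> ('m \<Rightarrow> 'm tvec) \<Rightarrow> 'm \<Rightarrow> real" where
 "cartan \<omega> X Y Z p = X p (\<lambda>q. \<omega> q (Y q) (Z q)) - Y p (\<lambda>q. \<omega> q (X q) (Z q)) + Z p (\<lambda>q. \<omega> q (X q) (Y q))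
   - \<omega> p (lie_bracket M X Y p) (Z p) + \<omega> p (lie_bracket M X Z p) (Y p) - \<omega> p (lie_bracket M Y Z p) (X p)"

text \<open>The real form of the exterior derivative \<open>ext_deriv\<close> on 2-forms: same chart, same extension of the
  arguments by constant coefficients.\<close>
definition d2 :: "('m \<Rightarrow> 'm tvec \<Rightarrow> 'm tvec \<Rightarrow> real) \<Rightarrow> 'm \<Rightarrow> 'm tvec \<Rightarrow> 'm tvec \<Rightarrow> 'm tvec \<Rightarrow> real" where
 "d2 \<omega> p u v w = (let c = (SOME c. c \<in> atlas M \<and> p \<in> chart_dom c);
    E = (\<lambda>v q. chart_vec M c q (chart_coords c v))
   in u (\<lambda>q. \<omega> q (E v q) (E w q)) - v (\<lambda>q. \<omega> q (E u q) (E w q)) + w (\<lambda>q. \<omega> q (E u q) (E v q)))"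

text \<open>The invariant formula for \<open>d\<omega>\<close> depends only on the values of the fields at \<open>p\<close> and agrees with the
  coordinate definition. In the chart \<open>\<omega>\<close> is a family of bilinear maps; the product rule produces, besides
  the three terms of the definition, derivatives of the coefficients of the fields, and these cancel against
  the brackets.\<close>
lemma cartan_eq_d2:
 assumes \<omega>: "two_form \<omega>" and X: "vector_field_on M U X" and Y: "vector_field_on M U Y" and Z: "vector_field_on M U Z"
  and p: "p \<in> U"
 shows "cartan \<omega> X Y Z p = d2 \<omega> p (X p) (Y p) (Z p)"
proof -
 define c where "c = (SOME c. c \<in> atlas M \<and> p \<in> chart_dom c)"
 have "\<exists>c. c \<in> atlas M \<and> p \<in> chart_dom c"
  using smooth_atlas_cover[OF M points_open[OF vf_open[OF X] p]] by blast
 from someI_ex[OF this] have c: "c \<in> atlas M" "p \<in> chart_dom c" by (auto simp: c_def)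
 note sc = smooth_atlas_chart[OF M c(1)]
 note c' = smooth_chartD[OF sc]
 note E = chart_subspace[OF c']
 define x0 where "x0 = chart_map c p"
 let ?D = "chart_dom c"
 let ?S = "creg c (U \<inter> ?D)"
 have oU: "openin (topo M) (U \<inter> ?D)" by (rule openin_Int[OF vf_open[OF X] chart_open[OF c']])
 have x0S: "x0 \<in> ?S" unfolding x0_def by (rule map_creg[OF c' c(2)]) (use p c(2) in simp)
 define e where "e w q = chart_vec M c q (proj (model c) w)" for w q
 have ev: "vector_field_on M ?D (e w)" for w
  unfolding e_def by (rule vf_const[OF sc proj_in[OF E]])
 have et: "e w q \<in> tangent_space M q" if "q \<in> ?D" for w q by (rule vf_tangent[OF ev that])
 define B where "B x a b = \<omega> (cinv c x) (e a (cinv c x)) (e b (cinv c x))" for x a b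
 have BC: "Cinf ?S (\<lambda>x. B x a b)" for a b
 proof -
  have "smooth_fun_on M ?D (\<lambda>q. \<omega> q (e a q) (e b q))" using \<omega> ev unfolding two_form_def by blast
  from smooth_fun_rep[OF M sc smooth_fun_subset[OF M this oU Int_lower2]] show ?thesis by (simp add: B_def)
 qed
 have elin: "e (a + b) q = e a q + e b q" "e (k *\<^sub>R a) q = k *\<^sub>R e a q" if "q \<in> ?D" for a b k q
  unfolding e_def linear_add[OF linear_proj[OF E]] linear_scale[OF linear_proj[OF E]]
  by (rule chart_vec_add[OF M sc that proj_in[OF E] proj_in[OF E]])+
 have qS: "cinv c x \<in> U" "cinv c x \<in> ?D" "cinv c x \<in> points M" if "x \<in> ?S" for x
  using cinv_creg(1)[OF c' that] points_open[OF oU] by auto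
 have anti: "\<omega> q u v = - \<omega> q v u" if "q \<in> points M" "u \<in> tangent_space M q" "v \<in> tangent_space M q" for q u v
  using \<omega> that unfolding two_form_def by blast
 have addl: "\<omega> q (u + w) v = \<omega> q u v + \<omega> q w v" and scl: "\<omega> q (k *\<^sub>R u) v = k * \<omega> q u v"
  if "q \<in> points M" "u \<in> tangent_space M q" "w \<in> tangent_space M q" "v \<in> tangent_space M q" for q u v w k
  using \<omega> that unfolding two_form_def by blast+
 have Banti: "B x a b = - B x b a" if "x \<in> ?S" for x a b
  unfolding B_def by (rule anti) (use qS[OF that] et in auto)
 have Blin1: "linear (\<lambda>a. B x a b)" if x: "x \<in> ?S" for x b
 proof (rule linearI)
  note q = qS[OF x]
  show "B x (a + a') b = B x a b + B x a' b" for a a'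
   unfolding B_def elin(1)[OF q(2)] by (rule addl[OF q(3) et et et]) (rule q(2))+
  show "B x (k *\<^sub>R a) b = k *\<^sub>R B x a b" for k a
   unfolding B_def elin(2)[OF q(2)] real_scaleR_def by (rule scl[OF q(3) et et et]) (rule q(2))+
 qed
 have Blin2: "linear (B x a)" if x: "x \<in> ?S" for x a
 proof -
  have "linear (\<lambda>b. - B x b a)" using Blin1[OF x, of a] by (rule linear_compose_neg)
  moreover have "(\<lambda>b. - B x b a) = B x a" by (rule ext) (rule Banti[OF x, symmetric])
  ultimately show ?thesis by simp
 qed
 have fld: "Cinf ?S (vcoord c V)" "\<And>x. x \<in> ?S ==> V (cinv c x) = e (vcoord c V x) (cinv c x)"
  if V: "vector_field_on M U V" for V
 proof -
  show "Cinf ?S (vcoord c V)" unfolding creg_Int_dom[OF c'] by (rule vf_coords[OF V sc])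
  fix x assume "x \<in> ?S"
  then have x: "x \<in> creg c U" unfolding creg_Int_dom[OF c'] .
  show "V (cinv c x) = e (vcoord c V x) (cinv c x)"
   using vcoord_model[OF V sc x] proj_id[OF E] by (simp add: e_def)
 qed
 have deriv: "X p (\<lambda>q. \<omega> q (Y q) (Z q)) = Dd (\<lambda>x. B x (vcoord c Y x0) (vcoord c Z x0)) x0 (vcoord c X x0)
   + B x0 (Dd (vcoord c Y) x0 (vcoord c X x0)) (vcoord c Z x0)
   + B x0 (vcoord c Y x0) (Dd (vcoord c Z) x0 (vcoord c X x0))"
  if X: "vector_field_on M U X" and Y: "vector_field_on M U Y" and Z: "vector_field_on M U Z" for X Y Z
 proof -
  let ?y = "vcoord c Y" and ?z = "vcoord c Z" and ?u = "vcoord c X x0"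
  have "smooth_fun_on M U (\<lambda>q. \<omega> q (Y q) (Z q))" using \<omega> Y Z unfolding two_form_def by blast
  then have s: "smooth_fun_on M (U \<inter> ?D) (\<lambda>q. \<omega> q (Y q) (Z q))"
   by (rule smooth_fun_subset[OF M _ oU Int_lower1])
  note L1 = Cinf_linear_family[where L = "\<lambda>x b. B x a b" for a, OF BC Blin2 fld(1)[OF Z]]
  have L2: "Cinf ?S (\<lambda>x. B x (?y x) (?z x))"
   by (rule Cinf_linear_family[where L = "\<lambda>x a. B x a (?z x)", OF L1 Blin1 fld(1)[OF Y]])
  have "X p (\<lambda>q. \<omega> q (Y q) (Z q)) = Dd (\<lambda>x. \<omega> (cinv c x) (Y (cinv c x)) (Z (cinv c x))) x0 ?u"
   unfolding x0_def by (rule vf_apply_point[OF X sc s Int_lower1]) (use p c(2) in auto)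
  also have "\<dots> = Dd (\<lambda>x. B x (?y x) (?z x)) x0 ?u"
   by (rule Dd_cong[OF open_creg[OF c' oU] x0S _ Cinf_differentiable[OF L2 x0S]])
    (simp add: B_def fld(2)[OF Y] fld(2)[OF Z])
  also have "\<dots> = Dd (\<lambda>x. B x (?y x0) (?z x)) x0 ?u + B x0 (Dd ?y x0 ?u) (?z x0)"
   by (rule Cinf_Dd_linear_family[where L = "\<lambda>x a. B x a (?z x)", OF L1 Blin1 fld(1)[OF Y] x0S])
  also have "Dd (\<lambda>x. B x (?y x0) (?z x)) x0 ?u = Dd (\<lambda>x. B x (?y x0) (?z x0)) x0 ?u + B x0 (?y x0) (Dd ?z x0 ?u)"
   by (rule Cinf_Dd_linear_family[where L = "\<lambda>x. B x (?y x0)", OF BC Blin2 fld(1)[OF Z] x0S])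
  finally show ?thesis by simp
 qed
 have pt: "cinv c x0 = p" unfolding x0_def by (rule cinv_map[OF c' c(2)])
 have fp: "V p = e (vcoord c V x0) p" if "vector_field_on M U V" for V
  using fld(2)[OF that x0S] pt by simp
 have br: "\<omega> p (lie_bracket M V W p) (Z p) = B x0 (Dd (vcoord c W) x0 (vcoord c V x0)) (vcoord c Z x0)
   - B x0 (Dd (vcoord c V) x0 (vcoord c W x0)) (vcoord c Z x0)"
  if V: "vector_field_on M U V" and W: "vector_field_on M U W" and Z: "vector_field_on M U Z" for V W Z
 proof -
  note b = bracket_chart[OF V W sc p c(2), folded x0_def]
  have "lie_bracket M V W p = e (Dd (vcoord c W) x0 (vcoord c V x0) - Dd (vcoord c V) x0 (vcoord c W x0)) p"
   using b proj_id[OF E] by (simp add: e_def)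
  then show ?thesis using linear_diff[OF Blin1[OF x0S], of "Dd (vcoord c W) x0 (vcoord c V x0)" "Dd (vcoord c V) x0 (vcoord c W x0)"]
   fp[OF Z] by (simp add: B_def pt)
 qed
 define T where "T u v w = Dd (\<lambda>x. B x v w) x0 u" for u v w
 have "cartan \<omega> X Y Z p = T (vcoord c X x0) (vcoord c Y x0) (vcoord c Z x0)
   - T (vcoord c Y x0) (vcoord c X x0) (vcoord c Z x0) + T (vcoord c Z x0) (vcoord c X x0) (vcoord c Y x0)"
  unfolding cartan_def deriv[OF X Y Z] deriv[OF Y X Z] deriv[OF Z X Y] br[OF X Y Z] br[OF X Z Y] br[OF Y Z X] T_def
  using Banti[OF x0S, of "vcoord c X x0" "Dd (vcoord c Z) x0 (vcoord c Y x0)"]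
   Banti[OF x0S, of "vcoord c Y x0" "Dd (vcoord c Z) x0 (vcoord c X x0)"]
   Banti[OF x0S, of "vcoord c X x0" "Dd (vcoord c Y) x0 (vcoord c Z x0)"] by simp
 moreover have "V p (\<lambda>q. \<omega> q (chart_vec M c q (chart_coords c (W p))) (chart_vec M c q (chart_coords c (Z p))))
   = T (vcoord c V x0) (vcoord c W x0) (vcoord c Z x0)"
  if V: "vector_field_on M U V" and W: "vector_field_on M U W" and Z: "vector_field_on M U Z" for V W Z
 proof -
  have m: "chart_coords c (W p) = vcoord c W x0" if "vector_field_on M U W" for W
   using vcoord_map[OF sc c(2)] by (simp add: x0_def)
  have e: "chart_vec M c q (chart_coords c (W p)) = e (vcoord c W x0) q" if W: "vector_field_on M U W" for W q
   using vcoord_model(1)[OF W sc map_creg[OF c' c(2) p]] proj_id[OF E] m[OF W] by (simp add: e_def x0_def)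
  have "smooth_fun_on M ?D (\<lambda>q. \<omega> q (e a q) (e b q))" for a b using \<omega> ev unfolding two_form_def by blast
  then have s: "smooth_fun_on M (U \<inter> ?D) (\<lambda>q. \<omega> q (e a q) (e b q))" for a b
   by (rule smooth_fun_subset[OF M _ oU Int_lower2])
  have "V p (\<lambda>q. \<omega> q (e (vcoord c W x0) q) (e (vcoord c Z x0) q)) = T (vcoord c V x0) (vcoord c W x0) (vcoord c Z x0)"
   unfolding T_def B_def unfolding x0_def
   by (rule vf_apply_point[OF V sc s Int_lower1]) (use p c(2) in auto)
  then show ?thesis unfolding e[OF W] e[OF Z] .
 qed
 ultimately show ?thesis using X Y Z by (simp add: d2_def Let_def c_def[symmetric])
qed

end

section \<open>Exterior derivative and twisted exterior derivative of the fundamental form\<close>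

definition fund :: "'m metric \<Rightarrow> 'm endo \<Rightarrow> 'm \<Rightarrow> 'm tvec \<Rightarrow> 'm tvec \<Rightarrow> real" where
 "fund g J p u v = g p (J p u) v"

lemma sum_Pow_insert:
 assumes "finite A" "a \<notin> A"
 shows "sum f (Pow (insert a A)) = sum f (Pow A) + (\<Sum>S\<in>Pow A. f (insert a S))"
proof -
 have i: "inj_on (insert a) (Pow A)" using assms(2) by (auto simp: inj_on_def)
 have "sum f (Pow (insert a A)) = sum f (Pow A) + sum f (insert a ` Pow A)"
  unfolding Pow_insert by (rule sum.union_disjoint) (use assms in auto)
 then show ?thesis by (simp add: sum.reindex[OF i])
qed

lemma sum_Pow2: "(\<Sum>S\<in>Pow {..<2::nat}. f S) = f {} + f {0} + f {1} + f {0, 1}"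
proof -
 have "{..<2::nat} = insert 1 (insert 0 {})" by auto
 then show ?thesis by (simp add: sum_Pow_insert insert_commute add_ac del: Pow_insert)
qed

lemma sum_Pow3: "(\<Sum>S\<in>Pow {..<3::nat}. f S) =
  f {} + f {0} + f {1} + f {2} + f {0, 1} + f {0, 2} + f {1, 2} + f {0, 1, 2}"
proof -
 have "{..<3::nat} = insert 2 (insert 1 (insert 0 {}))" by auto
 then show ?thesis by (simp add: sum_Pow_insert insert_commute add_ac del: Pow_insert)
qed

text \<open>The cases of the sums in \<open>complexify\<close> and \<open>type_part\<close> that occur for a 2-form and its exterior derivative are
  written out, after which types are a matter of multilinear algebra.\<close>
lemma complexify2:
 "complexify \<omega> p [z0, z1] = \<omega> p [fst z0, fst z1] + \<i> * \<omega> p [snd z0, fst z1] + \<i> * \<omega> p [fst z0, snd z1]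
   - \<omega> p [snd z0, snd z1]"
proof -
 have l: "length [z0, z1] = 2" by simp
 have u: "[0..<2] = [0, 1::nat]" by (simp add: upt_rec)
 show ?thesis unfolding complexify_def l sum_Pow2 u by (simp add: power2_eq_square algebra_simps)
qed

lemma complexify3:
 "complexify \<omega> p [z0, z1, z2] = \<omega> p [fst z0, fst z1, fst z2]
   + \<i> * (\<omega> p [snd z0, fst z1, fst z2] + \<omega> p [fst z0, snd z1, fst z2] + \<omega> p [fst z0, fst z1, snd z2])
   - (\<omega> p [snd z0, snd z1, fst z2] + \<omega> p [snd z0, fst z1, snd z2] + \<omega> p [fst z0, snd z1, snd z2])
   - \<i> * \<omega> p [snd z0, snd z1, snd z2]"
proof -
 have l: "length [z0, z1, z2] = 3" by simp
 have u: "[0..<3] = [0, 1, 2::nat]" by (simp add: upt_rec)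
 show ?thesis unfolding complexify_def l sum_Pow3 u
  by (simp add: power2_eq_square power3_eq_cube algebra_simps)
qed

lemma sum_card_subsets:
 "(\<Sum>S | S \<subseteq> {..<n::nat} \<and> card S = r. f S) = (\<Sum>S\<in>Pow {..<n}. if card S = r then f S else 0)"
proof -
 have "{S. S \<subseteq> {..<n} \<and> card S = r} = {S \<in> Pow {..<n}. card S = r}" by auto
 then show ?thesis by (simp only: sum.inter_filter[OF finite_Pow_iff[THEN iffD2, OF finite_lessThan]])
qed

lemma type_part2:
 "type_part J 2 0 \<omega> p [u, v] = complexify \<omega> p [vec10 J p u, vec10 J p v]"
 "type_part J 1 1 \<omega> p [u, v] = complexify \<omega> p [vec10 J p u, vec01 J p v] + complexify \<omega> p [vec01 J p u, vec10 J p v]"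
 "type_part J 0 2 \<omega> p [u, v] = complexify \<omega> p [vec01 J p u, vec01 J p v]"
proof -
 have u: "[0..<2] = [0, 1::nat]" by (simp add: upt_rec)
 have a: "(2::nat) + 0 = 2" "(1::nat) + 1 = 2" "(0::nat) + 2 = 2" by simp_all
 show "type_part J 2 0 \<omega> p [u, v] = complexify \<omega> p [vec10 J p u, vec10 J p v]"
  "type_part J 1 1 \<omega> p [u, v] = complexify \<omega> p [vec10 J p u, vec01 J p v] + complexify \<omega> p [vec01 J p u, vec10 J p v]"
  "type_part J 0 2 \<omega> p [u, v] = complexify \<omega> p [vec01 J p u, vec01 J p v]"
  unfolding type_part_def a sum_card_subsets sum_Pow2 u by simp_all
qed

lemma type_part3:
 "type_part J 2 1 \<omega> p [u, v, w] = complexify \<omega> p [vec10 J p u, vec10 J p v, vec01 J p w]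
   + complexify \<omega> p [vec10 J p u, vec01 J p v, vec10 J p w] + complexify \<omega> p [vec01 J p u, vec10 J p v, vec10 J p w]"
 "type_part J 1 2 \<omega> p [u, v, w] = complexify \<omega> p [vec10 J p u, vec01 J p v, vec01 J p w]
   + complexify \<omega> p [vec01 J p u, vec10 J p v, vec01 J p w] + complexify \<omega> p [vec01 J p u, vec01 J p v, vec10 J p w]"
proof -
 have u: "[0..<3] = [0, 1, 2::nat]" by (simp add: upt_rec)
 have a: "(2::nat) + 1 = 3" "(1::nat) + 2 = 3" by simp_all
 show "type_part J 2 1 \<omega> p [u, v, w] = complexify \<omega> p [vec10 J p u, vec10 J p v, vec01 J p w]
   + complexify \<omega> p [vec10 J p u, vec01 J p v, vec10 J p w] + complexify \<omega> p [vec01 J p u, vec10 J p v, vec10 J p w]"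
  "type_part J 1 2 \<omega> p [u, v, w] = complexify \<omega> p [vec10 J p u, vec01 J p v, vec01 J p w]
   + complexify \<omega> p [vec01 J p u, vec10 J p v, vec01 J p w] + complexify \<omega> p [vec01 J p u, vec01 J p v, vec10 J p w]"
  unfolding type_part_def a sum_card_subsets sum_Pow3 u by simp_all
qed

context
 fixes M :: "('m, 'e::euclidean_space) charted_space"
 assumes M: "smooth_atlas M"
begin

lemma tangent_const: "v \<in> tangent_space M p ==> p \<in> points M ==> v (\<lambda>q. k) = 0"
proof -
 assume v: "v \<in> tangent_space M p" and p: "p \<in> points M"
 have "smooth_near M p (\<lambda>q. k)"
  by (rule smooth_nearI[OF M _ smooth_fun_const[OF M openin_topspace]]) (use p in \<open>simp add: points_def\<close>)
 from tangent_derivation(3)[OF M v this this] show ?thesis .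
qed

lemma tvec_complex_real:
 assumes v: "v \<in> tangent_space M p" and W: "openin (topo M) W" "p \<in> W"
  and h: "\<And>q. q \<in> W ==> h q = complex_of_real (f q)"
 shows "tvec_complex v h = complex_of_real (v f)"
proof -
 have "v (\<lambda>q. Re (h q)) = v f" "v (\<lambda>q. Im (h q)) = v (\<lambda>q. 0)"
  by (rule tangent_local[OF M v W], simp add: h)+
 then show ?thesis using tangent_const[OF v points_open[OF M W]] by (simp add: tvec_complex_def)
qed

lemma ext_deriv_real:
 assumes \<omega>: "\<And>q a b. q \<in> points M ==> a \<in> tangent_space M q ==> b \<in> tangent_space M q ==>
   \<omega> q [a, b] = complex_of_real (\<beta> q a b)"
  and p: "p \<in> points M" and uvw: "u \<in> tangent_space M p" "v \<in> tangent_space M p" "w \<in> tangent_space M p"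
 shows "ext_deriv M \<omega> p [u, v, w] = complex_of_real (d2 M \<beta> p u v w)"
proof -
 define c where "c = (SOME c. c \<in> atlas M \<and> p \<in> chart_dom c)"
 have "\<exists>c. c \<in> atlas M \<and> p \<in> chart_dom c" using smooth_atlas_cover[OF M p] by blast
 from someI_ex[OF this] have c: "c \<in> atlas M" "p \<in> chart_dom c" by (auto simp: c_def)
 note sc = smooth_atlas_chart[OF M c(1)]
 note o = chart_open[OF smooth_chartD[OF sc]]
 let ?E = "\<lambda>v q. chart_vec M c q (chart_coords c v)"
 have t: "?E x q \<in> tangent_space M q" if "x \<in> tangent_space M p" "q \<in> chart_dom c" for x q
  by (rule chart_vec_tangent[OF M sc that(2) chart_coords_tangent(1)[OF M sc c(2) that(1)]])
 have main: "tvec_complex x (\<lambda>q. \<omega> q [?E y q, ?E z q]) = complex_of_real (x (\<lambda>q. \<beta> q (?E y q) (?E z q)))"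
  if "x \<in> tangent_space M p" "y \<in> tangent_space M p" "z \<in> tangent_space M p" for x y z
  by (rule tvec_complex_real[OF that(1) o c(2)]) (rule \<omega>[OF points_open[OF M o] t[OF that(2)] t[OF that(3)]])
 have s: "{..<length [u, v, w]} = {0, 1, 2}" by auto
 have n: "Suc 2 = 3" "drop 3 [u, v, w] = []" "drop 2 [u, v, w] = [w]" "take 2 [u, v, w] = [u, v]"
  by (simp_all add: numeral_2_eq_2 numeral_3_eq_3)
 show ?thesis
  unfolding ext_deriv_def d2_def[OF M] Let_def c_def[symmetric] s
  using main[OF uvw] main[OF uvw(2,1,3)] main[OF uvw(3,1,2)] by (simp add: n)
qed

text \<open>Applied to multiples of eigenvectors, and to the factors 1/2 in the projections to type.\<close>
lemma d2_scale:
 assumes \<omega>: "two_form M \<omega>" and p: "p \<in> points M"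
  and uvw: "u \<in> tangent_space M p" "v \<in> tangent_space M p" "w \<in> tangent_space M p"
 shows "d2 M \<omega> p (k *\<^sub>R u) (l *\<^sub>R v) (m *\<^sub>R w) = k * l * m * d2 M \<omega> p u v w"
proof -
 define c where "c = (SOME c. c \<in> atlas M \<and> p \<in> chart_dom c)"
 have "\<exists>c. c \<in> atlas M \<and> p \<in> chart_dom c" using smooth_atlas_cover[OF M p] by blast
 from someI_ex[OF this] have c: "c \<in> atlas M" "p \<in> chart_dom c" by (auto simp: c_def)
 note sc = smooth_atlas_chart[OF M c(1)]
 note o = chart_open[OF smooth_chartD[OF sc]]
 let ?E = "\<lambda>v q. chart_vec M c q (chart_coords c v)"
 have cm: "chart_coords c x \<in> model c" if "x \<in> tangent_space M p" for x
  by (rule chart_coords_tangent(1)[OF M sc c(2) that])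
 have t: "?E x q \<in> tangent_space M q" if "x \<in> tangent_space M p" "q \<in> chart_dom c" for x q
  by (rule chart_vec_tangent[OF M sc that(2) cm[OF that(1)]])
 have E: "?E (k *\<^sub>R x) q = k *\<^sub>R ?E x q" if "x \<in> tangent_space M p" "q \<in> chart_dom c" for x q k
  unfolding chart_coords_scale[OF M] by (rule chart_vec_add(2)[OF M sc that(2) cm[OF that(1)] cm[OF that(1)]])
 have sc1: "\<omega> q (k *\<^sub>R a) b = k * \<omega> q a b" and sc2: "\<omega> q a (k *\<^sub>R b) = k * \<omega> q a b"
  if q: "q \<in> points M" and ab: "a \<in> tangent_space M q" "b \<in> tangent_space M q" for q a b k
 proof -
  have *: "\<omega> q (k *\<^sub>R a) b = k * \<omega> q a b" if "a \<in> tangent_space M q" "b \<in> tangent_space M q" for a b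
   using \<omega> q that unfolding two_form_def[OF M] by blast
  show "\<omega> q (k *\<^sub>R a) b = k * \<omega> q a b" by (rule *[OF ab])
  have anti: "\<omega> q a b = - \<omega> q b a" if "a \<in> tangent_space M q" "b \<in> tangent_space M q" for a b
   using \<omega> q that unfolding two_form_def[OF M] by blast
  have kb: "k *\<^sub>R b \<in> tangent_space M q" by (rule subspace_scale[OF subspace_tangent[OF M q] ab(2)])
  show "\<omega> q a (k *\<^sub>R b) = k * \<omega> q a b"
   unfolding anti[OF ab(1) kb] anti[OF ab] *[OF ab(2,1)] by simp
 qed
 have main: "(k *\<^sub>R x) (\<lambda>q. \<omega> q (?E (l *\<^sub>R y) q) (?E (m *\<^sub>R z) q)) = k * l * m * x (\<lambda>q. \<omega> q (?E y q) (?E z q))"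
  if xyz: "x \<in> tangent_space M p" "y \<in> tangent_space M p" "z \<in> tangent_space M p" for x y z k l m
 proof -
  have "x (\<lambda>q. \<omega> q (?E (l *\<^sub>R y) q) (?E (m *\<^sub>R z) q)) = x (\<lambda>q. (l * m) * \<omega> q (?E y q) (?E z q))"
  proof (rule tangent_local[OF M xyz(1) o c(2)])
   fix q assume q: "q \<in> chart_dom c"
   note qp = points_open[OF M o q]
   have "m *\<^sub>R ?E z q \<in> tangent_space M q" by (rule subspace_scale[OF subspace_tangent[OF M qp] t[OF xyz(3) q]])
   then show "\<omega> q (?E (l *\<^sub>R y) q) (?E (m *\<^sub>R z) q) = (l * m) * \<omega> q (?E y q) (?E z q)"
    unfolding E[OF xyz(2) q] E[OF xyz(3) q]
    using sc1[OF qp t[OF xyz(2) q]] sc2[OF qp t[OF xyz(2) q] t[OF xyz(3) q]] by simp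
  qed
  moreover have "smooth_fun_on M (chart_dom c) (\<lambda>q. \<omega> q (?E y q) (?E z q))"
   using \<omega> vf_const[OF M sc cm[OF xyz(2)]] vf_const[OF M sc cm[OF xyz(3)]] unfolding two_form_def[OF M] by blast
  then have sn: "smooth_near M p (\<lambda>q. \<omega> q (?E y q) (?E z q))" by (rule smooth_nearI[OF M c(2)])
  have "x (\<lambda>q. (l * m) * \<omega> q (?E y q) (?E z q)) = (l * m) * x (\<lambda>q. \<omega> q (?E y q) (?E z q))"
   by (rule tangent_derivation(2)[OF M xyz(1) sn sn])
  ultimately show ?thesis by (simp add: scaleR_fun_def)
 qed
 show ?thesis
  unfolding d2_def[OF M] Let_def c_def[symmetric]
  using main[OF uvw] main[OF uvw(2,1,3)] main[OF uvw(3,1,2)] by (simp add: algebra_simps)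
qed

context
 fixes g :: "'m metric" and J :: "'m endo"
 assumes g: "riemannian_metric M g" and J: "integrable_complex M J" and gJ: "compatible_metric M g J"
begin

private lemma ac: "almost_complex M J"
 using J by (simp add: integrable_complex_def)

lemma
 assumes p: "p \<in> points M" and v: "v \<in> tangent_space M p"
 shows J_tangent: "J p v \<in> tangent_space M p"
  and J_sq: "J p (J p v) = - v"
  and J_add: "w \<in> tangent_space M p ==> J p (v + w) = J p v + J p w"
  and J_scale: "J p (a *\<^sub>R v) = a *\<^sub>R J p v"
proof -
 note * = bspec[OF conjunct1[OF ac[unfolded almost_complex_def]] p]
 show "J p v \<in> tangent_space M p" "J p (J p v) = - v" using bspec[OF conjunct1[OF *] v] by simp_all
 show add: "J p (v + w) = J p v + J p w" if "w \<in> tangent_space M p" for w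
  using bspec[OF bspec[OF conjunct2[OF *] v] that] by simp
 show "J p (a *\<^sub>R v) = a *\<^sub>R J p v" using bspec[OF bspec[OF conjunct2[OF *] v] v] by simp
qed

lemma J_vf: "vector_field_on M U X ==> vector_field_on M U (\<lambda>p. J p (X p))"
 using conjunct2[OF ac[unfolded almost_complex_def]] by simp

lemma J_neg: "p \<in> points M ==> v \<in> tangent_space M p ==> J p (- v) = - J p v"
 using J_scale[of p v "-1"] by simp

lemma J_diff: "p \<in> points M ==> v \<in> tangent_space M p ==> w \<in> tangent_space M p ==> J p (v - w) = J p v - J p w"
 using J_add[of p v "- w"] J_neg[of p w] subspace_neg[OF subspace_tangent[OF M, of p], of w] by simp

lemma
 assumes p: "p \<in> points M" and u: "u \<in> tangent_space M p"
 shows g_add: "v \<in> tangent_space M p ==> w \<in> tangent_space M p ==> g p (u + v) w = g p u w + g p v w"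
  and g_scale: "w \<in> tangent_space M p ==> g p (a *\<^sub>R u) w = a * g p u w"
  and g_sym: "v \<in> tangent_space M p ==> g p u v = g p v u"
  and g_pos: "u \<noteq> 0 ==> g p u u > 0"
proof -
 note * = bspec[OF conjunct1[OF g[unfolded riemannian_metric_def]] p]
 note l = bspec[OF bspec[OF bspec[OF conjunct1[OF *] u]]]
 show "g p (u + v) w = g p u w + g p v w" if "v \<in> tangent_space M p" "w \<in> tangent_space M p" for v w
  using l[OF that] by simp
 show "g p (a *\<^sub>R u) w = a * g p u w" if "w \<in> tangent_space M p" for w
  using l[OF u that] by simp
 show "g p u v = g p v u" if "v \<in> tangent_space M p" for v
  using bspec[OF bspec[OF conjunct1[OF conjunct2[OF *]] u] that] .
 show "g p u u > 0" if "u \<noteq> 0" using bspec[OF conjunct2[OF conjunct2[OF *]] u] that by simp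
qed

lemma g_smooth: "vector_field_on M U X ==> vector_field_on M U Y ==> smooth_fun_on M U (\<lambda>p. g p (X p) (Y p))"
 using conjunct2[OF g[unfolded riemannian_metric_def]] by simp

lemma g_neg: "p \<in> points M ==> u \<in> tangent_space M p ==> w \<in> tangent_space M p ==> g p (- u) w = - g p u w"
 using g_scale[of p u w "-1"] by simp

lemma g_J: "p \<in> points M ==> u \<in> tangent_space M p ==> v \<in> tangent_space M p ==> g p (J p u) (J p v) = g p u v"
 using gJ unfolding compatible_metric_def by simp

lemma fund_anti:
 assumes p: "p \<in> points M" and uv: "u \<in> tangent_space M p" "v \<in> tangent_space M p"
 shows "fund g J p u v = - fund g J p v u"
proof -
 have "g p (J p u) v = g p (J p (J p u)) (J p v)" by (rule g_J[OF p J_tangent[OF p uv(1)] uv(2), symmetric])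
 also have "\<dots> = - g p u (J p v)" unfolding J_sq[OF p uv(1)] by (rule g_neg[OF p uv(1) J_tangent[OF p uv(2)]])
 also have "\<dots> = - g p (J p v) u" using g_sym[OF p uv(1) J_tangent[OF p uv(2)]] by simp
 finally show ?thesis by (simp add: fund_def)
qed

lemma fund_J:
 assumes p: "p \<in> points M" and uv: "u \<in> tangent_space M p" "v \<in> tangent_space M p"
 shows "fund g J p (J p u) (J p v) = fund g J p u v" "fund g J p u (J p v) = - fund g J p (J p u) v"
proof -
 have 1: "fund g J p (J p u) (J p v) = fund g J p u v"
  if "u \<in> tangent_space M p" "v \<in> tangent_space M p" for u v
  unfolding fund_def by (rule g_J[OF p J_tangent[OF p that(1)] that(2)])
 have "fund g J p u (J p v) = fund g J p (J p u) (J p (J p v))" by (rule 1[OF uv(1) J_tangent[OF p uv(2)], symmetric])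
 also have "\<dots> = fund g J p (J p u) (- v)" unfolding J_sq[OF p uv(2)] ..
 also have "\<dots> = - fund g J p (J p u) v"
  using fund_anti[OF p J_tangent[OF p uv(1)], of "- v"] fund_anti[OF p J_tangent[OF p uv(1)] uv(2)]
   J_neg[OF p uv(2)] g_neg[OF p J_tangent[OF p uv(2)] J_tangent[OF p uv(1)]]
   subspace_neg[OF subspace_tangent[OF M p] uv(2)] by (simp add: fund_def)
 finally show "fund g J p u (J p v) = - fund g J p (J p u) v" .
 show "fund g J p (J p u) (J p v) = fund g J p u v" by (rule 1[OF uv])
qed

lemma fund_two_form: "two_form M (fund g J)"
 unfolding two_form_def[OF M]
proof (intro conjI ballI allI impI)
 fix p u v w a assume p: "p \<in> points M" and u: "u \<in> tangent_space M p" and v: "v \<in> tangent_space M p"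
  and w: "w \<in> tangent_space M p"
 show "fund g J p (u + w) v = fund g J p u v + fund g J p w v"
  unfolding fund_def J_add[OF p u w] by (rule g_add[OF p J_tangent[OF p u] J_tangent[OF p w] v])
 show "fund g J p (a *\<^sub>R u) v = a * fund g J p u v"
  unfolding fund_def J_scale[OF p u] by (rule g_scale[OF p J_tangent[OF p u] v])
next
 fix U X Y assume "vector_field_on M U X \<and> vector_field_on M U Y"
 then show "smooth_fun_on M U (\<lambda>p. fund g J p (X p) (Y p))"
  unfolding fund_def using g_smooth[OF J_vf] by blast
qed (rule fund_anti)

text \<open>The exterior derivative of a (1,1)-form has no component of type (3,0) or (0,3), which is this identity in
  real terms. It holds because \<open>J\<close> is integrable: all terms of the Cartan formula cancel in pairs except for
  Nijenhuis tensors.\<close>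
lemma fund_type:
 assumes p: "p \<in> points M" and uvw: "u \<in> tangent_space M p" "v \<in> tangent_space M p" "w \<in> tangent_space M p"
 shows "d2 M (fund g J) p (J p u) v w + d2 M (fund g J) p u (J p v) w + d2 M (fund g J) p u v (J p w)
  = d2 M (fund g J) p (J p u) (J p v) (J p w)"
proof -
 obtain c where c: "c \<in> atlas M" "p \<in> chart_dom c" using smooth_atlas_cover[OF M p] by blast
 note sc = smooth_atlas_chart[OF M c(1)]
 let ?D = "chart_dom c" and ?F = "fund g J"
 note o = chart_open[OF smooth_chartD[OF sc]]
 have ext: "\<exists>X. vector_field_on M ?D X \<and> X p = v" if "v \<in> tangent_space M p" for v
  using vf_const[OF M sc chart_coords_tangent(1)[OF M sc c(2) that]] chart_coords_tangent(2)[OF M sc c(2) that] by blast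
 obtain X Y Z where X: "vector_field_on M ?D X" "X p = u" and Y: "vector_field_on M ?D Y" "Y p = v"
  and Z: "vector_field_on M ?D Z" "Z p = w" using ext uvw by meson
 define j where "j X q = J q (X q)" for X :: "'m \<Rightarrow> 'm tvec" and q
 have jv: "vector_field_on M ?D (j X)" if "vector_field_on M ?D X" for X unfolding j_def by (rule J_vf[OF that])
 note tf = fund_two_form
 have t: "X q \<in> tangent_space M q" if "vector_field_on M ?D X" "q \<in> ?D" for X q by (rule vf_tangent[OF M that])
 note br = bracket_tangent[OF M _ _ c(2)]
 have pw: "?F q (j A q) (j B q) = ?F q (A q) (B q)" "?F q (A q) (j B q) = - ?F q (j A q) (B q)"
  if "vector_field_on M ?D A" "vector_field_on M ?D B" "q \<in> ?D" for A B q
  unfolding j_def using fund_J[OF points_open[OF M o that(3)] t[OF that(1,3)] t[OF that(2,3)]] by auto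
 have d1: "V p (\<lambda>q. ?F q (j A q) (j B q)) = V p (\<lambda>q. ?F q (A q) (B q))"
  if "vector_field_on M ?D A" "vector_field_on M ?D B" "vector_field_on M ?D V" for A B V
  by (rule tangent_local[OF M t[OF that(3) c(2)] o c(2) pw(1)[OF that(1,2)]])
 have d2: "V p (\<lambda>q. ?F q (A q) (j B q)) = - V p (\<lambda>q. ?F q (j A q) (B q))"
  if A: "vector_field_on M ?D A" and B: "vector_field_on M ?D B" and V: "vector_field_on M ?D V" for A B V
 proof -
  have "smooth_fun_on M ?D (\<lambda>q. ?F q (j A q) (B q))" using tf jv[OF A] B unfolding two_form_def[OF M] by blast
  then have sn: "smooth_near M p (\<lambda>q. ?F q (j A q) (B q))" by (rule smooth_nearI[OF M c(2)])
  have "V p (\<lambda>q. ?F q (A q) (j B q)) = V p (\<lambda>q. (- 1) * ?F q (j A q) (B q))"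
   by (rule tangent_local[OF M t[OF V c(2)] o c(2)]) (simp add: pw(2)[OF A B])
  also have "\<dots> = (- 1) * V p (\<lambda>q. ?F q (j A q) (B q))"
   by (rule tangent_derivation(2)[OF M t[OF V c(2)] sn sn])
  finally show ?thesis by simp
 qed
 have F_diff: "?F p (a - b) x = ?F p a x - ?F p b x" if "a \<in> tangent_space M p" "b \<in> tangent_space M p" "x \<in> tangent_space M p" for a b x
  using g_add[OF p J_tangent[OF p that(1)] J_tangent[OF p subspace_neg[OF subspace_tangent[OF M p] that(2)]] that(3)]
   g_neg[OF p J_tangent[OF p that(2)] that(3)] J_diff[OF p that(1,2)] J_neg[OF p that(2)] by (simp add: fund_def)
 have nij: "?F p (lie_bracket M (j A) B p) (C p) + ?F p (lie_bracket M A (j B) p) (C p) + ?F p (lie_bracket M A B p) (j C p)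
   = ?F p (lie_bracket M (j A) (j B) p) (j C p)"
  if A: "vector_field_on M ?D A" and B: "vector_field_on M ?D B" and C: "vector_field_on M ?D C" for A B C
 proof -
  have "nijenhuis M J A B p = 0" using J A B c(2) unfolding integrable_complex_def by blast
  then have n: "lie_bracket M (j A) (j B) p - J p (lie_bracket M (j A) B p) - J p (lie_bracket M A (j B) p)
   - lie_bracket M A B p = 0" by (simp add: nijenhuis_def j_def[abs_def])
  note b = br[OF jv[OF A] jv[OF B]] br[OF jv[OF A] B] br[OF A jv[OF B]] br[OF A B]
  note jb = J_tangent[OF p b(2)] J_tangent[OF p b(3)]
  note jc = J_tangent[OF p t[OF C c(2)]]
  note S = subspace_diff[OF subspace_tangent[OF M p]]
  have "?F p (lie_bracket M (j A) (j B) p - J p (lie_bracket M (j A) B p) - J p (lie_bracket M A (j B) p)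
   - lie_bracket M A B p) (J p (C p)) = 0"
   unfolding n using F_diff[OF b(1) b(1) jc] by simp
  then have "?F p (lie_bracket M (j A) (j B) p) (J p (C p)) - ?F p (J p (lie_bracket M (j A) B p)) (J p (C p))
   - ?F p (J p (lie_bracket M A (j B) p)) (J p (C p)) - ?F p (lie_bracket M A B p) (J p (C p)) = 0"
   unfolding F_diff[OF S[OF S[OF b(1) jb(1)] jb(2)] b(4) jc] F_diff[OF S[OF b(1) jb(1)] jb(2) jc] F_diff[OF b(1) jb(1) jc] .
  then show ?thesis
   unfolding fund_J(1)[OF p b(2) t[OF C c(2)]] fund_J(1)[OF p b(3) t[OF C c(2)]] by (simp add: j_def)
 qed
 note C = cartan_eq_d2[OF M tf _ _ _ c(2), symmetric]
 have e: "J p u = j X p" "J p v = j Y p" "J p w = j Z p" by (simp_all add: j_def X Y Z)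
 note a = br[OF X(1) Y(1)]
 show ?thesis
  unfolding e unfolding X(2)[symmetric] Y(2)[symmetric] Z(2)[symmetric]
   C[OF jv[OF X(1)] Y(1) Z(1)] C[OF X(1) jv[OF Y(1)] Z(1)] C[OF X(1) Y(1) jv[OF Z(1)]]
   C[OF jv[OF X(1)] jv[OF Y(1)] jv[OF Z(1)]] cartan_def[OF M]
  using nij[OF X(1) Y(1) Z(1)] nij[OF X(1) Z(1) Y(1)] nij[OF Y(1) Z(1) X(1)]
   d1[OF Y(1) Z(1) jv[OF X(1)]] d1[OF X(1) Z(1) jv[OF Y(1)]] d1[OF X(1) Y(1) jv[OF Z(1)]]
   d2[OF Y(1) Z(1) X(1)] d2[OF X(1) Z(1) Y(1)] d2[OF X(1) Y(1) Z(1)]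
  by linarith
qed

text \<open>Since \<open>F\<close> has type (1,1), its holomorphic and antiholomorphic derivatives are the (2,1) and (1,2) parts of
  \<open>dF\<close>. Expanding these in real and imaginary parts and using \<open>fund_type\<close> leaves a single term.\<close>
lemma d_c_fundamental_form:
 assumes p: "p \<in> points M" and uvw: "u \<in> tangent_space M p" "v \<in> tangent_space M p" "w \<in> tangent_space M p"
 shows "d_c M J (fundamental_form g J) p [u, v, w] = complex_of_real (- d2 M (fund g J) p (J p u) (J p v) (J p w))"
proof -
 let ?\<omega> = "fundamental_form g J"
 have \<omega>: "?\<omega> q [a, b] = complex_of_real (fund g J q a b)" for q a b
  by (simp add: fundamental_form_def fund_def)
 have half: "fund g J q (k *\<^sub>R a) (l *\<^sub>R b) = k * l * fund g J q a b"
  if q: "q \<in> points M" and ab: "a \<in> tangent_space M q" "b \<in> tangent_space M q" for q a b k l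
 proof -
  note S = subspace_scale[OF subspace_tangent[OF M q]]
  have 1: "fund g J q (k *\<^sub>R a) b = k * fund g J q a b" if "a \<in> tangent_space M q" "b \<in> tangent_space M q" for a b k
   unfolding fund_def J_scale[OF q that(1)] by (rule g_scale[OF q J_tangent[OF q that(1)] that(2)])
  have "fund g J q a (l *\<^sub>R b) = l * fund g J q a b"
   unfolding fund_anti[OF q ab(1) S[OF ab(2)]] 1[OF ab(2,1)] fund_anti[OF q ab] by simp
  then show ?thesis using 1[OF ab(1) S[OF ab(2)]] by simp
 qed
 have JJ: "fund g J q (J q a) (J q b) = fund g J q a b" "fund g J q a (J q b) = - fund g J q (J q a) b"
  if "q \<in> points M" "a \<in> tangent_space M q" "b \<in> tangent_space M q" for q a b using fund_J[OF that] by auto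
 have parts: "type_part J 2 0 ?\<omega> q [a, b] = complex_of_real 0" "type_part J 0 2 ?\<omega> q [a, b] = complex_of_real 0"
  "type_part J 1 1 ?\<omega> q [a, b] = complex_of_real (fund g J q a b)"
  if q: "q \<in> points M" and ab: "a \<in> tangent_space M q" "b \<in> tangent_space M q" for q a b
  unfolding type_part2 complexify2 vec10_def vec01_def fst_conv snd_conv \<omega>
   half[OF q ab] half[OF q J_tangent[OF q ab(1)] ab(2)] half[OF q ab(1) J_tangent[OF q ab(2)]]
   half[OF q J_tangent[OF q ab(1)] J_tangent[OF q ab(2)]] JJ[OF q ab]
  by (simp_all add: complex_eq_iff)
 define \<eta> where "\<eta> = d2 M (fund g J) p"
 have z: "d2 M (\<lambda>q a b. 0) p a b c = 0"
  if "a \<in> tangent_space M p" "b \<in> tangent_space M p" "c \<in> tangent_space M p" for a b c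
  using tangent_const[OF that(1) p, of 0] tangent_const[OF that(2) p, of 0] tangent_const[OF that(3) p, of 0]
  by (simp add: d2_def[OF M] Let_def)
 have ed: "ext_deriv M (type_part J 2 0 ?\<omega>) p [a, b, c] = 0" "ext_deriv M (type_part J 0 2 ?\<omega>) p [a, b, c] = 0"
   "ext_deriv M (type_part J 1 1 ?\<omega>) p [a, b, c] = complex_of_real (\<eta> a b c)"
  if abc: "a \<in> tangent_space M p" "b \<in> tangent_space M p" "c \<in> tangent_space M p" for a b c
  using ext_deriv_real[where \<omega> = "type_part J 2 0 ?\<omega>" and \<beta> = "\<lambda>q a b. 0", OF parts(1) p abc] ext_deriv_real[where \<omega> = "type_part J 0 2 ?\<omega>" and \<beta> = "\<lambda>q a b. 0", OF parts(2) p abc]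
   ext_deriv_real[where \<omega> = "type_part J 1 1 ?\<omega>" and \<beta> = "fund g J", OF parts(3) p abc] z[OF abc]
  by (simp_all add: \<eta>_def)
 note S = subspace_scale[OF subspace_tangent[OF M p]]
 note Jt = J_tangent[OF p]
 have cz: "complexify \<theta> p [z0, z1, z2] = 0" if "\<And>a b c. a \<in> tangent_space M p ==> b \<in> tangent_space M p ==> c \<in> tangent_space M p ==> \<theta> p [a, b, c] = 0"
  "fst z0 \<in> tangent_space M p" "snd z0 \<in> tangent_space M p" "fst z1 \<in> tangent_space M p" "snd z1 \<in> tangent_space M p"
  "fst z2 \<in> tangent_space M p" "snd z2 \<in> tangent_space M p" for \<theta> z0 z1 z2
  unfolding complexify3 using that by simp
 have v10: "fst (vec10 J p a) \<in> tangent_space M p" "snd (vec10 J p a) \<in> tangent_space M p"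
  "fst (vec01 J p a) \<in> tangent_space M p" "snd (vec01 J p a) \<in> tangent_space M p" if "a \<in> tangent_space M p" for a
  using that S Jt by (auto simp: vec10_def vec01_def simp del: scaleR_minus_left)
 have t0: "type_part J r s \<theta> p [u, v, w] = 0"
  if "\<And>a b c. a \<in> tangent_space M p ==> b \<in> tangent_space M p ==> c \<in> tangent_space M p ==> \<theta> p [a, b, c] = 0" for r s \<theta>
 proof (cases "r + s = 3")
  case True
  have l: "length [u, v, w] = r + s" using True by simp
  have uu: "[0..<3] = [0, 1, 2::nat]" by (simp add: upt_rec)
  show ?thesis unfolding type_part_def l using v10[OF uvw(1)] v10[OF uvw(2)] v10[OF uvw(3)]
   by (auto simp: True uu intro!: sum.neutral cz[where \<theta> = \<theta>, OF that])
 qed (simp add: type_part_def)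
 have three: "{..<length [u, v, w]} = {0, 1, 2}" by auto
 have del: "del M J ?\<omega> p [u, v, w] = type_part J 2 1 (ext_deriv M (type_part J 1 1 ?\<omega>)) p [u, v, w]"
  unfolding del_def three Let_def using t0[where \<theta> = "ext_deriv M (type_part J 2 0 ?\<omega>)", OF ed(1)] t0[where \<theta> = "ext_deriv M (type_part J 0 2 ?\<omega>)", OF ed(2)] by (simp add: numeral_2_eq_2)
 have delbar: "delbar M J ?\<omega> p [u, v, w] = type_part J 1 2 (ext_deriv M (type_part J 1 1 ?\<omega>)) p [u, v, w]"
  unfolding delbar_def three Let_def using t0[where \<theta> = "ext_deriv M (type_part J 2 0 ?\<omega>)", OF ed(1)] t0[where \<theta> = "ext_deriv M (type_part J 0 2 ?\<omega>)", OF ed(2)] by (simp add: numeral_2_eq_2)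
 have \<eta>s: "\<eta> (k *\<^sub>R a) (l *\<^sub>R b) (m *\<^sub>R c) = k * l * m * \<eta> a b c"
  if "a \<in> tangent_space M p" "b \<in> tangent_space M p" "c \<in> tangent_space M p" for a b c k l m
  unfolding \<eta>_def by (rule d2_scale[OF fund_two_form p that])
 have ty: "\<eta> (J p u) v w + \<eta> u (J p v) w + \<eta> u v (J p w) = \<eta> (J p u) (J p v) (J p w)"
  unfolding \<eta>_def by (rule fund_type[OF p uvw])
 note Ju = Jt[OF uvw(1)] and Jv = Jt[OF uvw(2)] and Jw = Jt[OF uvw(3)]
 note e3 = ed(3)[OF S S S]
 have exp: "ext_deriv M (type_part J 1 1 ?\<omega>) p [k *\<^sub>R a, l *\<^sub>R b, m *\<^sub>R c] = complex_of_real (k * l * m * \<eta> a b c)"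
  if "a \<in> tangent_space M p" "b \<in> tangent_space M p" "c \<in> tangent_space M p" for a b c k l m
  unfolding ed(3)[OF S[OF that(1)] S[OF that(2)] S[OF that(3)]] \<eta>s[OF that] ..
 have "d_c M J ?\<omega> p [u, v, w] = complex_of_real (- (\<eta> (J p u) v w + \<eta> u (J p v) w + \<eta> u v (J p w) + 3 * \<eta> (J p u) (J p v) (J p w)) / 4)"
  unfolding d_c_def del delbar type_part3 complexify3 vec10_def vec01_def fst_conv snd_conv
   exp[OF uvw] exp[OF Ju uvw(2,3)] exp[OF uvw(1) Jv uvw(3)] exp[OF uvw(1,2) Jw]
   exp[OF Ju Jv uvw(3)] exp[OF Ju uvw(2) Jw] exp[OF uvw(1) Jv Jw] exp[OF Ju Jv Jw]
  by (simp add: complex_eq_iff field_simps)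
 also have "\<dots> = complex_of_real (- \<eta> (J p u) (J p v) (J p w))" using ty by simp
 finally show ?thesis by (simp add: \<eta>_def)
qed

end

end

section \<open>Commuting generalized Kaehler structures\<close>

context
 fixes M :: "('m, 'e::euclidean_space) charted_space" and g :: "'m metric" and Jp Jm :: "'m endo"
 assumes M: "smooth_atlas M" and gk: "generalized_kaehler M g Jp Jm" and comm: "commuting M Jp Jm"
begin

lemma g_riem: "riemannian_metric M g" and Jp_int: "integrable_complex M Jp" and Jm_int: "integrable_complex M Jm"
 and gJp: "compatible_metric M g Jp" and gJm: "compatible_metric M g Jm"
 using gk by (simp_all add: generalized_kaehler_def)

lemmas pT = J_tangent[OF M g_riem Jp_int gJp] and mT = J_tangent[OF M g_riem Jm_int gJm]
lemmas p_sq = J_sq[OF M g_riem Jp_int gJp] and m_sq = J_sq[OF M g_riem Jm_int gJm]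
lemmas p_add = J_add[OF M g_riem Jp_int gJp] and m_add = J_add[OF M g_riem Jm_int gJm]
lemmas p_scale = J_scale[OF M g_riem Jp_int gJp] and m_scale = J_scale[OF M g_riem Jm_int gJm]
lemmas p_diff = J_diff[OF M g_riem Jp_int gJp] and m_diff = J_diff[OF M g_riem Jm_int gJm]
lemmas p_vf = J_vf[OF M g_riem Jp_int gJp] and m_vf = J_vf[OF M g_riem Jm_int gJm]
lemmas gadd = g_add[OF M g_riem Jp_int gJp] and gscale = g_scale[OF M g_riem Jp_int gJp]
 and gsym = g_sym[OF M g_riem Jp_int gJp] and gpos = g_pos[OF M g_riem Jp_int gJp]
lemmas gp = g_J[OF M g_riem Jp_int gJp] and gm = g_J[OF M g_riem Jm_int gJm]

private lemma comm': "p \<in> points M ==> v \<in> tangent_space M p ==> Jm p (Jp p v) = Jp p (Jm p v)"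
 using comm unfolding commuting_def by simp

private lemma S: "p \<in> points M ==> subspace (tangent_space M p)"
 by (rule subspace_tangent[OF M])

text \<open>The \<open>\<sigma>\<close>-eigenbundle of \<open>J\<^sub>+ J\<^sub>-\<close>, for \<open>\<sigma> = \<plusminus>1\<close>, in the form in which it is used: \<open>J\<^sub>-\<close> is a multiple of \<open>J\<^sub>+\<close>.\<close>
definition TT :: "real \<Rightarrow> 'm \<Rightarrow> 'm tvec set" where
 "TT \<sigma> p = {v \<in> tangent_space M p. Jm p v = - \<sigma> *\<^sub>R Jp p v}"

text \<open>The projection onto the \<open>\<sigma>\<close>-eigenbundle along the other one.\<close>
definition Pr :: "real \<Rightarrow> 'm \<Rightarrow> 'm tvec \<Rightarrow> 'm tvec" where
 "Pr \<sigma> p v = (1/2) *\<^sub>R (v + \<sigma> *\<^sub>R Jp p (Jm p v))"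

lemma eigenbundle_eq_TT:
 assumes p: "p \<in> points M" and \<sigma>: "\<sigma> * \<sigma> = 1"
 shows "eigenbundle M (\<lambda>p v. Jp p (Jm p v)) \<sigma> p = TT \<sigma> p"
proof -
 have "Jp p (Jm p v) = \<sigma> *\<^sub>R v \<longleftrightarrow> Jm p v = - \<sigma> *\<^sub>R Jp p v" if v: "v \<in> tangent_space M p" for v
 proof
  assume "Jp p (Jm p v) = \<sigma> *\<^sub>R v"
  then have "Jp p (Jp p (Jm p v)) = \<sigma> *\<^sub>R Jp p v" using p_scale[OF p v] by simp
  then have "- Jm p v = \<sigma> *\<^sub>R Jp p v" using p_sq[OF p mT[OF p v]] by simp
  then have "- (- Jm p v) = - (\<sigma> *\<^sub>R Jp p v)" by (rule arg_cong)
  then show "Jm p v = - \<sigma> *\<^sub>R Jp p v" by simp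
 next
  assume "Jm p v = - \<sigma> *\<^sub>R Jp p v"
  then show "Jp p (Jm p v) = \<sigma> *\<^sub>R v" using p_scale[OF p pT[OF p v], of "- \<sigma>"] p_sq[OF p v] by simp
 qed
 then show ?thesis unfolding eigenbundle_def TT_def by blast
qed

lemma TT_tangent: "v \<in> TT \<sigma> p ==> v \<in> tangent_space M p"
 and TT_Jm: "v \<in> TT \<sigma> p ==> Jm p v = - \<sigma> *\<^sub>R Jp p v"
 by (simp_all add: TT_def)

lemma TT_I: "v \<in> tangent_space M p ==> Jm p v = - \<sigma> *\<^sub>R Jp p v ==> v \<in> TT \<sigma> p"
 by (simp add: TT_def)

lemma TT_subspace: "p \<in> points M ==> subspace (TT \<sigma> p)"
proof (rule subspaceI)
 assume p: "p \<in> points M"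
 have "Jp p 0 = 0" "Jm p 0 = 0"
  using p_scale[OF p subspace_0[OF S[OF p]], of 0] m_scale[OF p subspace_0[OF S[OF p]], of 0] by simp_all
 then show "0 \<in> TT \<sigma> p" using subspace_0[OF S[OF p]] by (simp add: TT_def)
 fix u v a assume u: "u \<in> TT \<sigma> p" and v: "v \<in> TT \<sigma> p"
 note t = TT_tangent[OF u] TT_tangent[OF v]
 show "u + v \<in> TT \<sigma> p"
  by (rule TT_I[OF subspace_add[OF S[OF p] t]])
   (simp add: m_add[OF p t] p_add[OF p t] TT_Jm[OF u] TT_Jm[OF v] scaleR_add_right)
 show "a *\<^sub>R u \<in> TT \<sigma> p"
  by (rule TT_I[OF subspace_scale[OF S[OF p] t(1)]])
   (simp add: m_scale[OF p t(1)] p_scale[OF p t(1)] TT_Jm[OF u])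
qed

lemma TT_Jp: "p \<in> points M ==> v \<in> TT \<sigma> p ==> Jp p v \<in> TT \<sigma> p"
proof (rule TT_I)
 assume p: "p \<in> points M" and v: "v \<in> TT \<sigma> p"
 note t = TT_tangent[OF v]
 show "Jp p v \<in> tangent_space M p" by (rule pT[OF p t])
 show "Jm p (Jp p v) = - \<sigma> *\<^sub>R Jp p (Jp p v)"
  unfolding comm'[OF p t] TT_Jm[OF v] by (rule p_scale[OF p pT[OF p t]])
qed

lemma TT_Jm_in: "p \<in> points M ==> v \<in> TT \<sigma> p ==> Jm p v \<in> TT \<sigma> p"
 using subspace_scale[OF TT_subspace TT_Jp] TT_Jm by metis

lemma Pr_tangent: "p \<in> points M ==> v \<in> tangent_space M p ==> Pr \<sigma> p v \<in> tangent_space M p"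
 unfolding Pr_def by (intro subspace_scale[OF S] subspace_add[OF S] pT mT)

lemma Pr_in:
 assumes \<sigma>: "\<sigma> * \<sigma> = 1" and p: "p \<in> points M" and v: "v \<in> tangent_space M p"
 shows "Pr \<sigma> p v \<in> TT \<sigma> p"
proof (rule TT_I[OF Pr_tangent[OF p v]])
 note mv = mT[OF p v] and qv = pT[OF p mT[OF p v]]
 note sq = subspace_scale[OF S[OF p] qv, of \<sigma>]
 have "Jm p (Jp p (Jm p v)) = - Jp p v"
  unfolding comm'[OF p mv] m_sq[OF p v] using p_scale[OF p v, of "-1"] by simp
 then have a: "Jm p (Pr \<sigma> p v) = (1/2) *\<^sub>R (Jm p v - \<sigma> *\<^sub>R Jp p v)"
  unfolding Pr_def by (simp add: m_scale[OF p subspace_add[OF S[OF p] v sq]] m_add[OF p v sq] m_scale[OF p qv])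
 have b: "Jp p (Pr \<sigma> p v) = (1/2) *\<^sub>R (Jp p v - \<sigma> *\<^sub>R Jm p v)"
  unfolding Pr_def by (simp add: p_scale[OF p subspace_add[OF S[OF p] v sq]] p_add[OF p v sq] p_scale[OF p qv] p_sq[OF p mv])
 have "- \<sigma> *\<^sub>R ((1/2) *\<^sub>R (Jp p v - \<sigma> *\<^sub>R Jm p v)) = (1/2) *\<^sub>R ((\<sigma> * \<sigma>) *\<^sub>R Jm p v - \<sigma> *\<^sub>R Jp p v)"
  by (simp add: algebra_simps)
 then show "Jm p (Pr \<sigma> p v) = - \<sigma> *\<^sub>R Jp p (Pr \<sigma> p v)" unfolding a b \<sigma> by simp
qed

lemma Pr_id: "\<sigma> * \<sigma> = 1 ==> p \<in> points M ==> v \<in> TT \<sigma> p ==> Pr \<sigma> p v = v"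
proof -
 assume \<sigma>: "\<sigma> * \<sigma> = 1" and p: "p \<in> points M" and v: "v \<in> TT \<sigma> p"
 note t = TT_tangent[OF v]
 have "Jp p (Jm p v) = \<sigma> *\<^sub>R v"
  unfolding TT_Jm[OF v] p_scale[OF p pT[OF p t]] p_sq[OF p t] by simp
 then have "Pr \<sigma> p v = (1/2) *\<^sub>R (v + v)" unfolding Pr_def using \<sigma> by simp
 then show ?thesis by (simp flip: scaleR_2)
qed

lemma Pr_decomp: "v = Pr \<sigma> p v + Pr (- \<sigma>) p v"
proof -
 have "Pr \<sigma> p v + Pr (- \<sigma>) p v = (1/2) *\<^sub>R (v + v)" by (simp add: Pr_def flip: scaleR_add_right)
 then show ?thesis by (simp flip: scaleR_2)
qed

lemma Pr_kernel: "\<sigma> * \<sigma> = 1 ==> p \<in> points M ==> v \<in> tangent_space M p ==> Pr (- \<sigma>) p v = 0 ==> v \<in> TT \<sigma> p"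
 using Pr_in[of \<sigma> p v] Pr_decomp[of v \<sigma> p] by simp

lemma Pr_linear:
 assumes p: "p \<in> points M" and uv: "u \<in> tangent_space M p" "v \<in> tangent_space M p"
 shows "Pr \<sigma> p (u + v) = Pr \<sigma> p u + Pr \<sigma> p v" "Pr \<sigma> p (a *\<^sub>R u) = a *\<^sub>R Pr \<sigma> p u"
  "Pr \<sigma> p (u - v) = Pr \<sigma> p u - Pr \<sigma> p v"
 unfolding Pr_def
 by (simp_all add: m_add[OF p uv] m_scale[OF p uv(1)] m_diff[OF p uv] p_add[OF p mT[OF p uv(1)] mT[OF p uv(2)]]
   p_diff[OF p mT[OF p uv(1)] mT[OF p uv(2)]] p_scale[OF p mT[OF p uv(1)]] algebra_simps)

lemma Pr_Jp: "p \<in> points M ==> v \<in> tangent_space M p ==> Pr \<sigma> p (Jp p v) = Jp p (Pr \<sigma> p v)"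
 unfolding Pr_def
 by (simp add: comm' p_scale p_add subspace_add[OF S] subspace_scale[OF S] pT mT)

lemma Pr_Jm:
 assumes \<sigma>: "\<sigma> * \<sigma> = 1" and p: "p \<in> points M" and v: "v \<in> tangent_space M p"
 shows "Pr \<sigma> p (Jm p v) = - \<sigma> *\<^sub>R Jp p (Pr \<sigma> p v)"
proof -
 have "Pr \<sigma> p (Jm p v) = Jm p (Pr \<sigma> p v)" unfolding Pr_def
  by (simp add: comm' p m_scale m_add subspace_add[OF S] subspace_scale[OF S] pT mT v)
 then show ?thesis using TT_Jm[OF Pr_in[OF assms]] by simp
qed

lemma Pr_vf: "vector_field_on M U X ==> vector_field_on M U (\<lambda>p. Pr \<sigma> p (X p))"
 unfolding Pr_def by (intro vf_scale[OF M] vf_add[OF M] p_vf m_vf)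

lemma TT_orthogonal:
 assumes \<sigma>: "\<sigma> * \<sigma> = 1" and p: "p \<in> points M" and u: "u \<in> TT \<sigma> p" and v: "v \<in> TT (- \<sigma>) p"
 shows "g p u v = 0"
proof -
 note t = TT_tangent[OF u] TT_tangent[OF v]
 have "g p u v = g p (Jm p u) (Jm p v)" by (rule gm[OF p t, symmetric])
 also have "\<dots> = g p (- \<sigma> *\<^sub>R Jp p u) (\<sigma> *\<^sub>R Jp p v)" using TT_Jm[OF u] TT_Jm[OF v] by simp
 also have "\<dots> = - \<sigma> * g p (Jp p u) (\<sigma> *\<^sub>R Jp p v)"
  by (rule gscale[OF p pT[OF p t(1)] subspace_scale[OF S[OF p] pT[OF p t(2)]]])
 also have "g p (Jp p u) (\<sigma> *\<^sub>R Jp p v) = \<sigma> * g p (Jp p v) (Jp p u)"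
  using gsym[OF p pT[OF p t(1)] subspace_scale[OF S[OF p] pT[OF p t(2)]], of \<sigma>] gscale[OF p pT[OF p t(2)] pT[OF p t(1)], of \<sigma>] by simp
 also have "g p (Jp p v) (Jp p u) = g p v u" by (rule gp[OF p t(2,1)])
 also have "g p v u = g p u v" by (rule gsym[OF p t(2,1)])
 also have "- \<sigma> * (\<sigma> * g p u v) = - ((\<sigma> * \<sigma>) * g p u v)" by (simp only: mult.assoc mult_minus_left)
 finally have "g p u v = - (1 * g p u v)" unfolding \<sigma> .
 then show ?thesis by linarith
qed

private abbreviation "Fp \<equiv> fund g Jp"
private abbreviation "Fm \<equiv> fund g Jm"

lemmas Fp_form = fund_two_form[OF M g_riem Jp_int gJp] and Fm_form = fund_two_form[OF M g_riem Jm_int gJm]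
lemmas Fp_anti = fund_anti[OF M g_riem Jp_int gJp] and Fm_anti = fund_anti[OF M g_riem Jm_int gJm]

lemma Fm_TT: "p \<in> points M ==> u \<in> TT \<sigma> p ==> v \<in> tangent_space M p ==> Fm p u v = - \<sigma> * Fp p u v"
 unfolding fund_def TT_Jm by (rule gscale[OF _ pT[OF _ TT_tangent]])

lemma F_cross:
 assumes "\<sigma> * \<sigma> = 1" "p \<in> points M" "u \<in> TT \<sigma> p" "v \<in> TT (- \<sigma>) p"
 shows "Fp p u v = 0" "Fm p u v = 0"
 using TT_orthogonal[OF assms(1,2) TT_Jp[OF assms(2,3)] assms(4)] Fm_TT[OF assms(2,3) TT_tangent[OF assms(4)]]
 by (simp_all add: fund_def)

lemma torsion_condition:
 assumes p: "p \<in> points M" and uvw: "u \<in> tangent_space M p" "v \<in> tangent_space M p" "w \<in> tangent_space M p"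
 shows "d2 M Fp p (Jp p u) (Jp p v) (Jp p w) + d2 M Fm p (Jm p u) (Jm p v) (Jm p w) = 0"
proof -
 have "form_zero M 3 (\<lambda>p vs. d_c M Jp (fundamental_form g Jp) p vs + d_c M Jm (fundamental_form g Jm) p vs)"
  using gk by (simp add: generalized_kaehler_def)
 then have "d_c M Jp (fundamental_form g Jp) p [u, v, w] + d_c M Jm (fundamental_form g Jm) p [u, v, w] = 0"
  using p uvw unfolding form_zero_def by (auto dest!: bspec[OF _ p] spec[of _ "[u, v, w]"])
 then show ?thesis
  unfolding d_c_fundamental_form[OF M g_riem Jp_int gJp p uvw] d_c_fundamental_form[OF M g_riem Jm_int gJm p uvw]
   of_real_add[symmetric] of_real_eq_0_iff by simp
qed

text \<open>On an eigenvector \<open>u\<close> for \<open>\<epsilon>\<close>, \<open>J\<^sub>- (J\<^sub>+)\<inverse>\<close> is multiplication by \<open>-\<epsilon>\<close>. Applying the condition on \<open>d\<^sup>c F\<close> to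
  the vectors \<open>(J\<^sub>+)\<inverse> u\<close> removes all complex structures from it.\<close>
lemma torsion_mixed:
 assumes p: "p \<in> points M" and \<epsilon>: "\<epsilon>1 * \<epsilon>1 = 1" "\<epsilon>2 * \<epsilon>2 = 1" "\<epsilon>3 * \<epsilon>3 = 1"
  and u: "u \<in> TT \<epsilon>1 p" and v: "v \<in> TT \<epsilon>2 p" and w: "w \<in> TT \<epsilon>3 p"
 shows "d2 M Fp p u v w = \<epsilon>1 * \<epsilon>2 * \<epsilon>3 * d2 M Fm p u v w"
proof -
 note t = TT_tangent[OF u] TT_tangent[OF v] TT_tangent[OF w]
 note n = subspace_neg[OF S[OF p]]
 note j = pT[OF p t(1)] pT[OF p t(2)] pT[OF p t(3)]
 have J2: "Jp p (- Jp p a) = a" if "a \<in> tangent_space M p" for a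
  using p_scale[OF p pT[OF p that], of "-1"] p_sq[OF p that] by simp
 have Jm2: "Jm p (- Jp p a) = - \<epsilon> *\<^sub>R a" if "a \<in> TT \<epsilon> p" for a \<epsilon>
  using subspace_neg[OF TT_subspace[OF p] TT_Jp[OF p that]] TT_Jm J2[OF TT_tangent[OF that]] by metis
 have "d2 M Fp p u v w + d2 M Fm p (- \<epsilon>1 *\<^sub>R u) (- \<epsilon>2 *\<^sub>R v) (- \<epsilon>3 *\<^sub>R w) = 0"
  using torsion_condition[OF p n[OF j(1)] n[OF j(2)] n[OF j(3)]] J2[OF t(1)] J2[OF t(2)] J2[OF t(3)]
   Jm2[OF u] Jm2[OF v] Jm2[OF w] by simp
 then show ?thesis using d2_scale[OF M Fm_form p t, of "- \<epsilon>1" "- \<epsilon>2" "- \<epsilon>3"] by simp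
qed

lemma TT_extension:
 assumes \<sigma>: "\<sigma> * \<sigma> = 1" and p: "p \<in> points M" and v: "v \<in> TT \<sigma> p"
 obtains U X where "p \<in> U" "vector_field_on M U X" "\<And>q. q \<in> U ==> X q \<in> TT \<sigma> q" "X p = v"
proof -
 obtain U X where U: "p \<in> U" and X: "vector_field_on M U X" and Xp: "X p = v"
  using vf_extension[OF M TT_tangent[OF v] p] .
 show thesis
 proof (rule that[OF U Pr_vf[OF X]])
  show "Pr \<sigma> q (X q) \<in> TT \<sigma> q" if "q \<in> U" for q
   by (rule Pr_in[OF \<sigma> points_open[OF M vf_open[OF M X] that] vf_tangent[OF M X that]])
  show "Pr \<sigma> p (X p) = v" using Pr_id[OF \<sigma> p v] Xp by simp
 qed
qed

text \<open>Let \<open>Z\<close> lie in the other eigenbundle. In the Cartan formula for \<open>F\<^sub>\<plusminus>(X, Y, Z)\<close> the terms \<open>X F(Y, Z)\<close> and \<open>Y F(X, Z)\<close> vanish by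
  orthogonality, and in the remaining ones \<open>F\<^sub>-\<close> is \<open>-\<sigma> F\<^sub>+\<close>, except in \<open>F([X, Y], Z)\<close>, where it is \<open>\<sigma> F\<^sub>+\<close> because \<open>Z\<close> is in
  the other eigenbundle. So \<open>torsion_mixed\<close> leaves \<open>2 F\<^sub>+([X, Y], Z) = 0\<close>, and \<open>[X, Y]\<close> has no component orthogonal to
  the eigenbundle.\<close>
lemma TT_involutive:
 assumes \<sigma>: "\<sigma> * \<sigma> = 1" and X: "section_on M (TT \<sigma>) U X" and Y: "section_on M (TT \<sigma>) U Y" and p: "p \<in> U"
 shows "lie_bracket M X Y p \<in> TT \<sigma> p"
proof -
 have Xv: "vector_field_on M U X" and XT: "\<And>q. q \<in> U ==> X q \<in> TT \<sigma> q"
  and Yv: "vector_field_on M U Y" and YT: "\<And>q. q \<in> U ==> Y q \<in> TT \<sigma> q"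
  using X Y by (auto simp: section_on_def)
 note pM = points_open[OF M vf_open[OF M Xv] p]
 have \<sigma>': "- \<sigma> * - \<sigma> = 1" using \<sigma> by simp
 define b where "b = lie_bracket M X Y p"
 have bt: "b \<in> tangent_space M p" unfolding b_def by (rule bracket_tangent[OF M Xv Yv p])
 have key: "g p (Jp p z) b = 0" if z: "z \<in> TT (- \<sigma>) p" for z
 proof -
  obtain W Z where W: "p \<in> W" and Zv: "vector_field_on M W Z" and ZT: "\<And>q. q \<in> W ==> Z q \<in> TT (- \<sigma>) q" and Zp: "Z p = z"
   using TT_extension[OF \<sigma>' pM z] by blast
  let ?V = "U \<inter> W"
  have oV: "openin (topo M) ?V" by (rule openin_Int[OF vf_open[OF M Xv] vf_open[OF M Zv]])
  have pV: "p \<in> ?V" using p W by simp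
  note X' = vf_subset[OF M Xv oV Int_lower1] and Y' = vf_subset[OF M Yv oV Int_lower1] and Z' = vf_subset[OF M Zv oV Int_lower2]
  have q: "q \<in> points M" "X q \<in> TT \<sigma> q" "Y q \<in> TT \<sigma> q" "Z q \<in> TT (- \<sigma>) q" if "q \<in> ?V" for q
   using points_open[OF M oV that] XT YT ZT that by auto
  note tX = vf_tangent[OF M X' pV] and tY = vf_tangent[OF M Y' pV] and tZ = vf_tangent[OF M Z' pV]
  have zero: "x (\<lambda>q. f q) = 0" if "x \<in> tangent_space M p" "\<And>q. q \<in> ?V ==> f q = 0" for x f
   using tangent_local[OF M that(1) oV pV, of f "\<lambda>q. 0"] that(2) tangent_const[OF M that(1) pM] by simp
  have crossX: "X p (\<lambda>q. Fp q (Y q) (Z q)) = 0" "X p (\<lambda>q. Fm q (Y q) (Z q)) = 0"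
   by (rule zero[OF tX]; rule F_cross[OF \<sigma> q(1,3,4)]; assumption)+
  have crossY: "Y p (\<lambda>q. Fp q (X q) (Z q)) = 0" "Y p (\<lambda>q. Fm q (X q) (Z q)) = 0"
   by (rule zero[OF tY]; rule F_cross[OF \<sigma> q(1,2,4)]; assumption)+
  have "smooth_fun_on M ?V (\<lambda>q. Fp q (X q) (Y q))" using Fp_form X' Y' unfolding two_form_def[OF M] by blast
  then have sn: "smooth_near M p (\<lambda>q. Fp q (X q) (Y q))" by (rule smooth_nearI[OF M pV])
  have "Z p (\<lambda>q. Fm q (X q) (Y q)) = Z p (\<lambda>q. - \<sigma> * Fp q (X q) (Y q))"
   by (rule tangent_local[OF M tZ oV pV]) (rule Fm_TT[OF q(1,2) TT_tangent[OF q(3)]])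
  also have "\<dots> = - \<sigma> * Z p (\<lambda>q. Fp q (X q) (Y q))" by (rule tangent_derivation(2)[OF M tZ sn sn])
  finally have ZF: "Z p (\<lambda>q. Fm q (X q) (Y q)) = - \<sigma> * Z p (\<lambda>q. Fp q (X q) (Y q))" .
  note bXZ = bracket_tangent[OF M X' Z' pV] and bYZ = bracket_tangent[OF M Y' Z' pV]
  have F1: "Fm p a y = - \<sigma> * Fp p a y" if "a \<in> tangent_space M p" "y \<in> TT \<sigma> p" for a y
   using Fm_TT[OF pM that(2,1)] Fm_anti[OF pM that(1) TT_tangent[OF that(2)]] Fp_anti[OF pM that(1) TT_tangent[OF that(2)]] by simp
  have F2: "Fm p b (Z p) = \<sigma> * Fp p b (Z p)"
   using Fm_TT[OF pM q(4)[OF pV] bt] Fm_anti[OF pM bt tZ] Fp_anti[OF pM bt tZ] by simp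
  have "cartan M Fp X Y Z p = \<sigma> * \<sigma> * (- \<sigma>) * cartan M Fm X Y Z p"
   unfolding cartan_eq_d2[OF M Fp_form X' Y' Z' pV] cartan_eq_d2[OF M Fm_form X' Y' Z' pV]
   by (rule torsion_mixed[OF pM \<sigma> \<sigma> \<sigma>' q(2,3,4)[OF pV]])
  then have "Fp p b (Z p) + \<sigma> * Fm p b (Z p) = 0"
   unfolding cartan_def[OF M] crossX crossY ZF F1[OF bXZ q(3)[OF pV]] F1[OF bYZ q(2)[OF pV]] b_def[symmetric]
   using \<sigma> by (simp add: algebra_simps) (simp add: mult.assoc[symmetric])
  then have "(1 + \<sigma> * \<sigma>) * Fp p b (Z p) = 0" unfolding F2 by (simp add: algebra_simps)
  then have "Fp p b (Z p) = 0" using \<sigma> by simp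
  then show ?thesis using Fp_anti[OF pM bt tZ] Zp by (simp add: fund_def)
 qed
 define w where "w = Pr (- \<sigma>) p b"
 have wT: "w \<in> TT (- \<sigma>) p" unfolding w_def by (rule Pr_in[OF \<sigma>' pM bt])
 note wt = TT_tangent[OF wT]
 have "g p (Jp p (- Jp p w)) b = 0"
  by (rule key[OF subspace_neg[OF TT_subspace[OF pM] TT_Jp[OF pM wT]]])
 moreover have "Jp p (- Jp p w) = w" using p_scale[OF pM pT[OF pM wt], of "-1"] p_sq[OF pM wt] by simp
 ultimately have "g p w b = 0" by simp
 moreover have "g p b w = g p w w"
 proof -
  note s = Pr_in[OF \<sigma> pM bt]
  have "g p b w = g p (Pr \<sigma> p b + w) w" using Pr_decomp[of b \<sigma> p] by (simp add: w_def)
  also have "\<dots> = g p (Pr \<sigma> p b) w + g p w w" by (rule gadd[OF pM TT_tangent[OF s] wt wt])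
  finally show ?thesis using TT_orthogonal[OF \<sigma> pM s wT] by simp
 qed
 ultimately have "g p w w = 0" using gsym[OF pM bt wt] by simp
 then have "w = 0" using gpos[OF pM wt] by force
 then show ?thesis unfolding b_def[symmetric] using Pr_kernel[OF \<sigma> pM bt] by (simp add: w_def)
qed

text \<open>Two relations of opposite sign between \<open>dF\<^sub>+\<close> and \<open>dF\<^sub>-\<close>: the pointwise one from \<open>torsion_mixed\<close>, and the
  one from \<open>F\<^sub>- = -\<sigma> F\<^sub>+\<close>, which passes to the exterior derivatives because the eigenbundle is involutive.\<close>
lemma F_closed_on_TT:
 assumes \<sigma>: "\<sigma> * \<sigma> = 1" and p: "p \<in> points M" and u: "u \<in> TT \<sigma> p" and v: "v \<in> TT \<sigma> p" and w: "w \<in> TT \<sigma> p"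
 shows "d2 M Fp p u v w = 0" "d2 M Fm p u v w = 0"
proof -
 obtain U X where U: "p \<in> U" and Xv: "vector_field_on M U X" and XT: "\<And>q. q \<in> U ==> X q \<in> TT \<sigma> q" and Xp: "X p = u"
  using TT_extension[OF \<sigma> p u] by blast
 obtain V Y where V: "p \<in> V" and Yv: "vector_field_on M V Y" and YT: "\<And>q. q \<in> V ==> Y q \<in> TT \<sigma> q" and Yp: "Y p = v"
  using TT_extension[OF \<sigma> p v] by blast
 obtain W Z where W: "p \<in> W" and Zv: "vector_field_on M W Z" and ZT: "\<And>q. q \<in> W ==> Z q \<in> TT \<sigma> q" and Zp: "Z p = w"
  using TT_extension[OF \<sigma> p w] by blast
 let ?O = "U \<inter> V \<inter> W"
 have oO: "openin (topo M) ?O" by (intro openin_Int vf_open[OF M Xv] vf_open[OF M Yv] vf_open[OF M Zv])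
 have pO: "p \<in> ?O" using U V W by simp
 have X': "vector_field_on M ?O X" by (rule vf_subset[OF M Xv oO]) blast
 have Y': "vector_field_on M ?O Y" by (rule vf_subset[OF M Yv oO]) blast
 have Z': "vector_field_on M ?O Z" by (rule vf_subset[OF M Zv oO]) blast
 have sX: "section_on M (TT \<sigma>) ?O X" and sY: "section_on M (TT \<sigma>) ?O Y" and sZ: "section_on M (TT \<sigma>) ?O Z"
  using X' Y' Z' XT YT ZT by (simp_all add: section_on_def)
 have D: "V p (\<lambda>q. Fm q (A q) (B q)) = - \<sigma> * V p (\<lambda>q. Fp q (A q) (B q))"
  if V: "vector_field_on M ?O V" and A: "section_on M (TT \<sigma>) ?O A" and B: "vector_field_on M ?O B" for V A B
 proof -
  note t = vf_tangent[OF M V pO]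
  have A': "vector_field_on M ?O A" "\<And>q. q \<in> ?O ==> A q \<in> TT \<sigma> q" using A by (auto simp: section_on_def)
  have "smooth_fun_on M ?O (\<lambda>q. Fp q (A q) (B q))" using Fp_form A'(1) B unfolding two_form_def[OF M] by blast
  then have sn: "smooth_near M p (\<lambda>q. Fp q (A q) (B q))" by (rule smooth_nearI[OF M pO])
  have "V p (\<lambda>q. Fm q (A q) (B q)) = V p (\<lambda>q. - \<sigma> * Fp q (A q) (B q))"
   by (rule tangent_local[OF M t oO pO]) (rule Fm_TT[OF points_open[OF M oO] A'(2) vf_tangent[OF M B]])
  also have "\<dots> = - \<sigma> * V p (\<lambda>q. Fp q (A q) (B q))" by (rule tangent_derivation(2)[OF M t sn sn])
  finally show ?thesis .
 qed
 have E: "Fm p (lie_bracket M A B p) (C p) = - \<sigma> * Fp p (lie_bracket M A B p) (C p)"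
  if "section_on M (TT \<sigma>) ?O A" "section_on M (TT \<sigma>) ?O B" "vector_field_on M ?O C" for A B C
  by (rule Fm_TT[OF p TT_involutive[OF \<sigma> that(1,2) pO] vf_tangent[OF M that(3) pO]])
 have "cartan M Fm X Y Z p = - \<sigma> * cartan M Fp X Y Z p"
  unfolding cartan_def[OF M] D[OF X' sY Z'] D[OF Y' sX Z'] D[OF Z' sX Y'] E[OF sX sY Z'] E[OF sX sZ Y'] E[OF sY sZ X']
  by (simp add: algebra_simps)
 then have a: "d2 M Fm p u v w = - \<sigma> * d2 M Fp p u v w"
  unfolding cartan_eq_d2[OF M Fp_form X' Y' Z' pO] cartan_eq_d2[OF M Fm_form X' Y' Z' pO] Xp Yp Zp .
 moreover have b: "d2 M Fp p u v w = \<sigma> * \<sigma> * \<sigma> * d2 M Fm p u v w"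
  by (rule torsion_mixed[OF p \<sigma> \<sigma> \<sigma> u v w])
 ultimately have "d2 M Fp p u v w = \<sigma> * \<sigma> * \<sigma> * (- \<sigma> * d2 M Fp p u v w)" by metis
 also have "\<dots> = - ((\<sigma> * \<sigma>) * (\<sigma> * \<sigma>) * d2 M Fp p u v w)" by (simp only: mult.assoc mult_minus_left mult_minus_right)
 finally have "d2 M Fp p u v w = - (1 * 1 * d2 M Fp p u v w)" unfolding \<sigma> .
 then show z: "d2 M Fp p u v w = 0" by linarith
 show "d2 M Fm p u v w = 0" unfolding a z by simp
qed

text \<open>Split \<open>X = A + B\<close> along the eigenbundles. The contribution of \<open>A\<close> is covered by involutivity. For \<open>B\<close>, replace
  \<open>J\<^sub>-\<close> by \<open>\<sigma> J\<^sub>+\<close> on \<open>B\<close> and by \<open>-\<sigma> J\<^sub>+\<close> on \<open>Y\<close> in the Nijenhuis tensors. After projection to the other eigenbundle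
  the two tensors contain \<open>[J B, J Y]\<close> and \<open>J [B, J Y]\<close> with opposite signs, and their sum is
  \<open>-2 ([B, Y] + J\<^sub>+ [J\<^sub>+ B, Y])\<close>.\<close>
lemma cauchy_riemann_TT:
 assumes \<sigma>: "\<sigma> * \<sigma> = 1" and X: "vector_field_on M U X" and Y: "section_on M (TT \<sigma>) U Y" and p: "p \<in> U"
 shows "cauchy_riemann M Jp X Y p \<in> TT \<sigma> p" "cauchy_riemann M Jm X Y p \<in> TT \<sigma> p"
proof -
 note oU = vf_open[OF M X]
 note pM = points_open[OF M oU]
 have Yv: "vector_field_on M U Y" and YT: "\<And>q. q \<in> U ==> Y q \<in> TT \<sigma> q" using Y by (auto simp: section_on_def)
 have \<sigma>': "- \<sigma> * - \<sigma> = 1" using \<sigma> by simp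
 define A where "A q = Pr \<sigma> q (X q)" for q
 define B where "B q = Pr (- \<sigma>) q (X q)" for q
 have Av: "vector_field_on M U A" and Bv: "vector_field_on M U B" unfolding A_def B_def by (rule Pr_vf[OF X])+
 have AT: "A q \<in> TT \<sigma> q" and BT: "B q \<in> TT (- \<sigma>) q" if "q \<in> U" for q
  unfolding A_def B_def by (rule Pr_in[OF \<sigma> pM[OF that] vf_tangent[OF M X that]] Pr_in[OF \<sigma>' pM[OF that] vf_tangent[OF M X that]])+
 have XAB: "X q = A q + B q" for q unfolding A_def B_def by (rule Pr_decomp)
 have sA: "section_on M (TT \<sigma>) U A" using Av AT by (simp add: section_on_def)
 have sJpA: "section_on M (TT \<sigma>) U (\<lambda>q. Jp q (A q))" using p_vf[OF Av] TT_Jp[OF pM AT] by (simp add: section_on_def)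
 have sJmA: "section_on M (TT \<sigma>) U (\<lambda>q. Jm q (A q))" using m_vf[OF Av] TT_Jm_in[OF pM AT] by (simp add: section_on_def)
 note invA = TT_involutive[OF \<sigma> sA Y p] and invJpA = TT_involutive[OF \<sigma> sJpA Y p] and invJmA = TT_involutive[OF \<sigma> sJmA Y p]
 note sub = TT_subspace[OF pM[OF p], of \<sigma>]
 note JpB = p_vf[OF Bv] and JmB = m_vf[OF Bv] and JpY = p_vf[OF Yv] and JmY = m_vf[OF Yv]
 define b1 where "b1 = lie_bracket M B Y p"
 define b2 where "b2 = lie_bracket M (\<lambda>q. Jp q (B q)) Y p"
 define b3 where "b3 = lie_bracket M B (\<lambda>q. Jp q (Y q)) p"
 define b4 where "b4 = lie_bracket M (\<lambda>q. Jp q (B q)) (\<lambda>q. Jp q (Y q)) p"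
 have bt: "b1 \<in> tangent_space M p" "b2 \<in> tangent_space M p" "b3 \<in> tangent_space M p" "b4 \<in> tangent_space M p"
  unfolding b1_def b2_def b3_def b4_def
  by (rule bracket_tangent[OF M Bv Yv p] bracket_tangent[OF M JpB Yv p] bracket_tangent[OF M Bv JpY p] bracket_tangent[OF M JpB JpY p])+
 have scr: "lie_bracket M V (\<lambda>q. a *\<^sub>R W q) p = a *\<^sub>R lie_bracket M V W p"
  if "vector_field_on M U V" "vector_field_on M U W" for V W a
  using bracket_scale_left[OF M that(2,1) p, of a] bracket_antisym[OF M, of V "\<lambda>q. a *\<^sub>R W q" p] bracket_antisym[OF M, of W V p] by simp
 \<comment> \<open>Replacing \<open>J\<^sub>-\<close> by multiples of \<open>J\<^sub>+\<close> inside brackets.\<close>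
 have m2: "lie_bracket M (\<lambda>q. Jm q (B q)) Y p = \<sigma> *\<^sub>R b2"
 proof -
  have "lie_bracket M (\<lambda>q. Jm q (B q)) Y p = lie_bracket M (\<lambda>q. \<sigma> *\<^sub>R Jp q (B q)) Y p"
   by (rule bracket_local[OF M JmB Yv oU p subset_refl]) (use TT_Jm[OF BT] in simp_all)
  then show ?thesis unfolding b2_def bracket_scale_left[OF M JpB Yv p] .
 qed
 have m3: "lie_bracket M B (\<lambda>q. Jm q (Y q)) p = - \<sigma> *\<^sub>R b3"
 proof -
  have "lie_bracket M B (\<lambda>q. Jm q (Y q)) p = lie_bracket M B (\<lambda>q. (- \<sigma>) *\<^sub>R Jp q (Y q)) p"
   by (rule bracket_local[OF M Bv JmY oU p subset_refl]) (use TT_Jm[OF YT] in simp_all)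
  then show ?thesis unfolding b3_def scr[OF Bv JpY] .
 qed
 have m4: "lie_bracket M (\<lambda>q. Jm q (B q)) (\<lambda>q. Jm q (Y q)) p = - b4"
 proof -
  have "lie_bracket M (\<lambda>q. Jm q (B q)) (\<lambda>q. Jm q (Y q)) p = lie_bracket M (\<lambda>q. \<sigma> *\<^sub>R Jp q (B q)) (\<lambda>q. (- \<sigma>) *\<^sub>R Jp q (Y q)) p"
   by (rule bracket_local[OF M JmB JmY oU p subset_refl]) (use TT_Jm[OF YT] TT_Jm[OF BT] in simp_all)
  also have "\<dots> = (- \<sigma>) *\<^sub>R lie_bracket M (\<lambda>q. \<sigma> *\<^sub>R Jp q (B q)) (\<lambda>q. Jp q (Y q)) p"
   by (rule scr[OF vf_scale[OF M JpB] JpY])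
  also have "\<dots> = (- \<sigma> * \<sigma>) *\<^sub>R b4" unfolding b4_def bracket_scale_left[OF M JpB JpY p] by simp
  finally show ?thesis using \<sigma> by simp
 qed
 have "nijenhuis M Jp B Y p = 0" "nijenhuis M Jm B Y p = 0"
  using Jp_int Jm_int Bv Yv p unfolding integrable_complex_def by blast+
 then have Np: "b4 - Jp p b2 - Jp p b3 - b1 = 0" and Nm: "- b4 - Jm p (\<sigma> *\<^sub>R b2) - Jm p (- \<sigma> *\<^sub>R b3) - b1 = 0"
  unfolding nijenhuis_def m2 m3 m4 by (simp_all add: b1_def b2_def b3_def b4_def)
 let ?P = "Pr (- \<sigma>) p" and ?J = "Jp p"
 note pp = pM[OF p]
 note Sd = subspace_diff[OF S[OF pp]] and Ss = subspace_scale[OF S[OF pp]]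
 note jt = pT[OF pp bt(2)] pT[OF pp bt(3)] mT[OF pp bt(2)] mT[OF pp bt(3)]
 have P0: "?P 0 = 0" using Pr_linear(2)[OF pp bt(1) bt(1), of "- \<sigma>" 0] by simp
 have PJm: "?P (Jm p x) = \<sigma> *\<^sub>R ?J (?P x)" if "x \<in> tangent_space M p" for x using Pr_Jm[OF \<sigma>' pp that] by simp
 have Pp: "?P b4 - ?J (?P b2) - ?J (?P b3) - ?P b1 = 0"
  using arg_cong[OF Np, of ?P]
  unfolding Pr_linear(3)[OF pp Sd[OF Sd[OF bt(4) jt(1)] jt(2)] bt(1)] Pr_linear(3)[OF pp Sd[OF bt(4) jt(1)] jt(2)]
   Pr_linear(3)[OF pp bt(4) jt(1)] Pr_Jp[OF pp bt(2)] Pr_Jp[OF pp bt(3)] P0 .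
 have Nm': "((-1) *\<^sub>R b4 - \<sigma> *\<^sub>R Jm p b2) + \<sigma> *\<^sub>R Jm p b3 - b1 = 0"
  using Nm m_scale[OF pp bt(2), of \<sigma>] m_scale[OF pp bt(3), of "- \<sigma>"] by simp
 have Pm: "(-1) *\<^sub>R ?P b4 - \<sigma> *\<^sub>R (\<sigma> *\<^sub>R ?J (?P b2)) + \<sigma> *\<^sub>R (\<sigma> *\<^sub>R ?J (?P b3)) - ?P b1 = 0"
  using arg_cong[OF Nm', of ?P]
  unfolding Pr_linear(3)[OF pp subspace_add[OF S[OF pp] Sd[OF Ss[OF bt(4)] Ss[OF jt(3)]] Ss[OF jt(4)]] bt(1)]
   Pr_linear(1)[OF pp Sd[OF Ss[OF bt(4)] Ss[OF jt(3)]] Ss[OF jt(4)]]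
   Pr_linear(3)[OF pp Ss[OF bt(4)] Ss[OF jt(3)]] Pr_linear(2)[OF pp bt(4) bt(4)] Pr_linear(2)[OF pp jt(3) jt(3)]
   Pr_linear(2)[OF pp jt(4) jt(4)] PJm[OF bt(2)] PJm[OF bt(3)] P0 .
 have "?P b1 + ?J (?P b2) = 0"
 proof -
  have "(?P b4 - ?J (?P b2) - ?J (?P b3) - ?P b1) + ((-1) *\<^sub>R ?P b4 - (\<sigma> * \<sigma>) *\<^sub>R ?J (?P b2) + (\<sigma> * \<sigma>) *\<^sub>R ?J (?P b3) - ?P b1) = 0"
   using Pp Pm by simp
  then have "(-2) *\<^sub>R (?P b1 + ?J (?P b2)) = 0" unfolding \<sigma> by (simp add: algebra_simps scaleR_2)
  then show ?thesis by simp
 qed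
 then have K: "?P (b1 + ?J b2) = 0"
  unfolding Pr_linear(1)[OF pp bt(1) jt(1)] Pr_Jp[OF pp bt(2)] .
 then have Kp: "b1 + Jp p b2 \<in> TT \<sigma> p" by (rule Pr_kernel[OF \<sigma> pp subspace_add[OF S[OF pp] bt(1) jt(1)]])
 have "?P (b1 + \<sigma> *\<^sub>R Jm p b2) = ?P b1 + \<sigma> *\<^sub>R (\<sigma> *\<^sub>R ?J (?P b2))"
  unfolding Pr_linear(1)[OF pp bt(1) Ss[OF jt(3)]] Pr_linear(2)[OF pp jt(3) jt(3)] PJm[OF bt(2)] ..
 also have "\<dots> = 0" using \<open>?P b1 + ?J (?P b2) = 0\<close> \<sigma> by simp
 finally have Km: "b1 + \<sigma> *\<^sub>R Jm p b2 \<in> TT \<sigma> p" by (rule Pr_kernel[OF \<sigma> pp subspace_add[OF S[OF pp] bt(1) Ss[OF jt(3)]]])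
 have e1: "lie_bracket M X Y p = lie_bracket M A Y p + b1"
 proof -
  have "lie_bracket M X Y p = lie_bracket M (\<lambda>q. A q + B q) Y p" unfolding XAB[symmetric] ..
  then show ?thesis unfolding b1_def bracket_add_left[OF M Av Bv Yv p] .
 qed
 have e2: "lie_bracket M (\<lambda>q. Jp q (X q)) Y p = lie_bracket M (\<lambda>q. Jp q (A q)) Y p + b2"
 proof -
  have "lie_bracket M (\<lambda>q. Jp q (X q)) Y p = lie_bracket M (\<lambda>q. Jp q (A q) + Jp q (B q)) Y p"
   by (rule bracket_local[OF M p_vf[OF X] Yv oU p subset_refl])
    (simp_all add: XAB p_add[OF pM vf_tangent[OF M Av] vf_tangent[OF M Bv]])
  then show ?thesis unfolding b2_def bracket_add_left[OF M p_vf[OF Av] JpB Yv p] .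
 qed
 have e3: "lie_bracket M (\<lambda>q. Jm q (X q)) Y p = lie_bracket M (\<lambda>q. Jm q (A q)) Y p + \<sigma> *\<^sub>R b2"
 proof -
  have "lie_bracket M (\<lambda>q. Jm q (X q)) Y p = lie_bracket M (\<lambda>q. Jm q (A q) + Jm q (B q)) Y p"
   by (rule bracket_local[OF M m_vf[OF X] Yv oU p subset_refl])
    (simp_all add: XAB m_add[OF pM vf_tangent[OF M Av] vf_tangent[OF M Bv]])
  then show ?thesis unfolding m2[symmetric] bracket_add_left[OF M m_vf[OF Av] JmB Yv p] .
 qed
 show "cauchy_riemann M Jp X Y p \<in> TT \<sigma> p"
 proof -
  have "cauchy_riemann M Jp X Y p = (1/2) *\<^sub>R ((lie_bracket M A Y p + Jp p (lie_bracket M (\<lambda>q. Jp q (A q)) Y p)) + (b1 + Jp p b2))"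
   unfolding cauchy_riemann_def e1 e2 p_add[OF pp TT_tangent[OF invJpA] bt(2)] by (simp add: algebra_simps)
  then show ?thesis using subspace_scale[OF sub subspace_add[OF sub subspace_add[OF sub invA TT_Jp[OF pp invJpA]] Kp]] by simp
 qed
 show "cauchy_riemann M Jm X Y p \<in> TT \<sigma> p"
 proof -
  have "cauchy_riemann M Jm X Y p = (1/2) *\<^sub>R ((lie_bracket M A Y p + Jm p (lie_bracket M (\<lambda>q. Jm q (A q)) Y p)) + (b1 + \<sigma> *\<^sub>R Jm p b2))"
   unfolding cauchy_riemann_def e1 e3 m_add[OF pp TT_tangent[OF invJmA] Ss[OF bt(2)]] m_scale[OF pp bt(2)] by (simp add: algebra_simps)
  then show ?thesis using subspace_scale[OF sub subspace_add[OF sub subspace_add[OF sub invA TT_Jm_in[OF pp invJmA]] Km]] by simp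
 qed
qed

end

section \<open>Frobenius theorem for projected distributions\<close>

text \<open>Near \<open>x0\<close> the range of \<open>P x\<close> is the graph of a map over the range of \<open>P x0\<close>. The frame \<open>G x v\<close> is the vector of the range
  of \<open>P x\<close> above \<open>P x0 v\<close>; it is \<open>P x\<close> applied to the inverse of \<open>S x\<close>, the compression of \<open>P x\<close> to the range of \<open>P x0\<close>
  extended by the identity on the kernel.\<close>
lemma graph_frame:
 fixes P :: "'e::euclidean_space \<Rightarrow> 'e \<Rightarrow> 'e"
 assumes x0: "x0 \<in> \<Omega>" and P: "\<And>v. Cinf \<Omega> (\<lambda>x. P x v)" "\<And>x. x \<in> \<Omega> ==> linear (P x)"
  "\<And>x v. x \<in> \<Omega> ==> P x (P x v) = P x v"
 shows "\<exists>r>0. ball x0 r \<subseteq> \<Omega> \<and> (\<exists>G. (\<forall>v. Cinf (ball x0 r) (\<lambda>x. G x v)) \<and> (\<forall>x\<in>ball x0 r. linear (G x) \<and>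
  (\<forall>v. P x0 (G x v) = P x0 v \<and> P x (G x v) = G x v) \<and> (\<forall>v. P x v = v \<and> P x0 v = 0 \<longrightarrow> v = 0)))"
proof -
 have \<Omega>: "open \<Omega>" using Cinf_open[OF P(1)] .
 let ?P = "P x0"
 have P0: "linear ?P" "?P (?P v) = ?P v" for v using P(2,3)[OF x0] by auto
 obtain K where K: "K > 0" "\<And>v. norm (?P v) \<le> norm v * K"
  using bounded_linear.pos_bounded P0(1) linear_conv_bounded_linear by blast
 define \<epsilon> where "\<epsilon> = min (1 / 2) (1 / (2 * K * K))"
 have \<epsilon>: "\<epsilon> > 0" "\<epsilon> \<le> 1 / 2" "K * \<epsilon> * K \<le> 1 / 2"
 proof -
  show "\<epsilon> > 0" "\<epsilon> \<le> 1 / 2" using K(1) by (auto simp: \<epsilon>_def)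
  have "K * \<epsilon> * K \<le> K * (1 / (2 * K * K)) * K" using K(1) by (intro mult_right_mono mult_left_mono) (auto simp: \<epsilon>_def)
  then show "K * \<epsilon> * K \<le> 1 / 2" using K(1) by simp
 qed
 define n where "n = real DIM('e)"
 have n: "n \<ge> 1" unfolding n_def using DIM_positive[where 'a='e] by linarith
 have "\<forall>\<^sub>F x in nhds x0. norm (P x b - ?P b) < \<epsilon> / n" for b
 proof -
  have "isCont (\<lambda>x. P x b) x0" using Cinf_continuous_on[OF P(1)] continuous_on_eq_continuous_at[OF \<Omega>] x0 by blast
  then show ?thesis
   using tendstoD[of "\<lambda>x. P x b" "?P b" "nhds x0" "\<epsilon> / n"] \<epsilon>(1) n tendsto_at_iff_tendsto_nhds[of "\<lambda>x. P x b" x0]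
   by (simp add: isCont_def dist_norm)
 qed
 then have "\<forall>\<^sub>F x in nhds x0. \<forall>b\<in>Basis. norm (P x b - ?P b) < \<epsilon> / n"
  by (simp add: eventually_ball_finite_distrib)
 then have "\<forall>\<^sub>F x in nhds x0. x \<in> \<Omega> \<and> (\<forall>b\<in>Basis. norm (P x b - ?P b) < \<epsilon> / n)"
  using eventually_nhds_in_open[OF \<Omega> x0] by eventually_elim simp
 then obtain r where r: "r > 0" "\<forall>x. dist x x0 < r \<longrightarrow> x \<in> \<Omega> \<and> (\<forall>b\<in>Basis. norm (P x b - ?P b) < \<epsilon> / n)"
  unfolding eventually_nhds_metric by blast
 let ?B = "ball x0 r"
 have B\<Omega>: "?B \<subseteq> \<Omega>" using r(2) by (auto simp: dist_commute)
 have near: "norm (P x v - ?P v) \<le> \<epsilon> * norm v" if x: "x \<in> ?B" for x v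
 proof -
  have "P x v - ?P v = (\<Sum>b\<in>Basis. (v \<bullet> b) *\<^sub>R (P x b - ?P b))"
   using linear_Basis_expand[OF P(2)[OF subsetD[OF B\<Omega> x]], of v] linear_Basis_expand[OF P0(1), of v]
   by (simp only: scaleR_diff_right sum_subtractf)
  also have "norm \<dots> \<le> (\<Sum>b\<in>(Basis::'e set). norm v * (\<epsilon> / n))"
  proof (rule sum_norm_le)
   fix b :: 'e assume b: "b \<in> Basis"
   have "norm (P x b - ?P b) \<le> \<epsilon> / n" using r(2) x b by (auto simp: dist_commute less_imp_le)
   then show "norm ((v \<bullet> b) *\<^sub>R (P x b - ?P b)) \<le> norm v * (\<epsilon> / n)"
    unfolding norm_scaleR by (intro mult_mono) (use Basis_le_norm[OF b, of v] in auto)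
  qed
  also have "\<dots> = \<epsilon> * norm v" using n by (simp add: n_def)
  finally show ?thesis .
 qed
 define S where "S x v = ?P (P x (?P v)) + (v - ?P v)" for x v
 have Slin: "linear (S x)" if x: "x \<in> ?B" for x
 proof -
  note l = P(2)[OF subsetD[OF B\<Omega> x]]
  show ?thesis unfolding S_def
   by (rule linearI) (simp_all add: linear_add[OF P0(1)] linear_add[OF l] linear_scale[OF P0(1)] linear_scale[OF l] algebra_simps)
 qed
 have Snear: "norm (S x v - v) \<le> norm v / 2" if x: "x \<in> ?B" for x v
 proof -
  have "S x v - v = ?P (P x (?P v) - ?P (?P v))" by (simp add: S_def linear_diff[OF P0(1)] P0(2))
  also have "norm \<dots> \<le> norm (P x (?P v) - ?P (?P v)) * K" by (rule K(2))
  also have "\<dots> \<le> (\<epsilon> * (norm v * K)) * K"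
   by (rule mult_right_mono[OF order_trans[OF near[OF x] mult_left_mono[OF K(2)]]]) (use \<epsilon>(1) K(1) in auto)
  also have "\<dots> = (K * \<epsilon> * K) * norm v" by (simp add: algebra_simps)
  also have "\<dots> \<le> 1 / 2 * norm v" by (rule mult_right_mono[OF \<epsilon>(3)]) simp
  finally show ?thesis by simp
 qed
 have Snorm: "norm v \<le> 2 * norm (S x v)" if x: "x \<in> ?B" for x v
  using Snear[OF x, of v] norm_triangle_ineq2[of v "v - S x v"] by (simp add: norm_minus_commute)
 have "\<exists>C. linear C \<and> (\<forall>v. C (S x v) = v) \<and> (\<forall>v. S x (C v) = v)" if x: "x \<in> ?B" for x
 proof -
  have "inj (S x)"
  proof (subst linear_injective_0[OF Slin[OF x]], intro allI impI)
   fix v assume "S x v = 0"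
   then show "v = 0" using Snorm[OF x, of v] by simp
  qed
  from linear_injective_isomorphism[OF Slin[OF x] this] show ?thesis by blast
 qed
 then have "\<forall>x\<in>?B. \<exists>C. linear C \<and> (\<forall>v. C (S x v) = v) \<and> (\<forall>v. S x (C v) = v)" by blast
 from bchoice[OF this] obtain C where C0: "\<forall>x\<in>?B. linear (C x) \<and> (\<forall>v. C x (S x v) = v) \<and> (\<forall>v. S x (C x v) = v)" ..
 have C: "linear (C x)" "C x (S x v) = v" "S x (C x v) = v" if "x \<in> ?B" for x v using bspec[OF C0 that] by simp_all
 have PC: "Cinf ?B (\<lambda>x. P x v)" for v by (rule Cinf_subset[OF P(1) open_ball B\<Omega>])
 have SC: "Cinf ?B (\<lambda>x. S x v)" for v unfolding S_def
  by (intro Cinf_add Cinf_linear[OF P0(1)] PC Cinf_const open_ball)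
 have CC: "Cinf ?B (\<lambda>x. C x v)" for v
 proof (rule Cinf_inverse_family[OF open_ball SC Slin C(1) _ C(2,3)])
  show "norm (C x v) \<le> 2 * norm v" if "x \<in> ?B" for x v using Snorm[OF that, of "C x v"] C(3)[OF that] by simp
 qed
 define G where "G x v = P x (C x (?P v))" for x v
 have "Cinf ?B (\<lambda>x. G x v)" for v unfolding G_def
  by (rule Cinf_linear_family[where L = P, OF PC P(2)[OF subsetD[OF B\<Omega>]] CC])
 moreover have "linear (G x) \<and> (\<forall>v. ?P (G x v) = ?P v \<and> P x (G x v) = G x v) \<and> (\<forall>v. P x v = v \<and> ?P v = 0 \<longrightarrow> v = 0)"
  if x: "x \<in> ?B" for x
 proof (intro conjI allI impI)
  note x\<Omega> = subsetD[OF B\<Omega> x]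
  note l = P(2)[OF x\<Omega>]
  show "linear (G x)"
   using linear_compose[OF linear_compose[OF P0(1) C(1)[OF x]] l] by (simp add: o_def G_def[abs_def])
  show "P x (G x v) = G x v" for v unfolding G_def by (rule P(3)[OF x\<Omega>])
  show "?P (G x v) = ?P v" for v
  proof -
   define u where "u = C x (?P v)"
   have Su: "?P (P x (?P u)) + (u - ?P u) = ?P v" using C(3)[OF x, of "?P v"] by (simp add: u_def S_def)
   then have "?P (?P (P x (?P u)) + (u - ?P u)) = ?P (?P v)" by simp
   then have "?P (P x (?P u)) = ?P v" by (simp add: linear_add[OF P0(1)] linear_diff[OF P0(1)] P0(2))
   with Su have "u = ?P u" by simp
   then show ?thesis using \<open>?P (P x (?P u)) = ?P v\<close> by (simp add: G_def u_def[symmetric])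
  qed
  show "v = 0" if "P x v = v \<and> ?P v = 0" for v
  proof -
   have "norm v \<le> \<epsilon> * norm v" using near[OF x, of v] that by simp
   also have "\<dots> \<le> 1 / 2 * norm v" by (rule mult_right_mono[OF \<epsilon>(2)]) simp
   finally show ?thesis by simp
  qed
 qed
 ultimately show ?thesis using r(1) B\<Omega> by (intro exI[of _ r] conjI exI[of _ G]) blast+
qed

context
 fixes M :: "('m, 'e::euclidean_space) charted_space" and Pj :: "'m \<Rightarrow> 'm tvec \<Rightarrow> 'm tvec" and D :: "'m \<Rightarrow> 'm tvec set"
 assumes M: "smooth_atlas M"
  and PT: "\<And>q v. q \<in> points M ==> v \<in> tangent_space M q ==> Pj q v \<in> D q"
  and Padd: "\<And>q u v. q \<in> points M ==> u \<in> tangent_space M q ==> v \<in> tangent_space M q ==> Pj q (u + v) = Pj q u + Pj q v"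
  and Pscale: "\<And>q v a. q \<in> points M ==> v \<in> tangent_space M q ==> Pj q (a *\<^sub>R v) = a *\<^sub>R Pj q v"
  and Pid: "\<And>q v. q \<in> points M ==> v \<in> D q ==> Pj q v = v"
  and DT: "\<And>q v. v \<in> D q ==> v \<in> tangent_space M q"
  and Pvf: "\<And>U X. vector_field_on M U X ==> vector_field_on M U (\<lambda>q. Pj q (X q))"
  and inv: "\<And>U X Y p. section_on M D U X ==> section_on M D U Y ==> p \<in> U ==> lie_bracket M X Y p \<in> D p"
begin

text \<open>The projection field in the chart \<open>d\<close>, extended by the projection onto the model.\<close>
definition coordP :: "('m, 'e) chart \<Rightarrow> 'e \<Rightarrow> 'e \<Rightarrow> 'e" where
 "coordP d x v = chart_coords d (Pj (cinv d x) (chart_vec M d (cinv d x) (proj (model d) v)))"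

context
 fixes d :: "('m, 'e) chart"
 assumes d: "smooth_chart M d"
begin

private lemma d': "is_chart (topo M) d" by (rule smooth_chartD[OF d])

lemma dpts: "q \<in> chart_dom d ==> q \<in> points M"
 using chart_dom_topspace[OF d'] by (auto simp: points_def)

lemmas Esub = chart_subspace[OF d']

lemma coordP_smooth: "Cinf (creg d (chart_dom d)) (\<lambda>x. coordP d x v)"
 using vf_coords[OF M Pvf[OF vf_const[OF M d proj_in[OF Esub]]] d, of v] by (simp add: vcoord_def[OF M, abs_def] coordP_def)

lemma cv_tangent: "q \<in> chart_dom d ==> chart_vec M d q (proj (model d) v) \<in> tangent_space M q"
 by (rule chart_vec_tangent[OF M d _ proj_in[OF Esub]])

lemma coordP_linear: "x \<in> creg d (chart_dom d) ==> linear (coordP d x)"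
proof (rule linearI)
 assume x: "x \<in> creg d (chart_dom d)"
 note q = cinv_creg(1)[OF d' x]
 note t = cv_tangent[OF q]
 note E = proj_in[OF Esub]
 show "coordP d x (u + v) = coordP d x u + coordP d x v" for u v
  unfolding coordP_def linear_add[OF linear_proj[OF Esub]] chart_vec_add(1)[OF M d q E E] Padd[OF dpts[OF q] t t]
  by (rule chart_coords_add[OF M])
 show "coordP d x (a *\<^sub>R v) = a *\<^sub>R coordP d x v" for a v
  unfolding coordP_def linear_scale[OF linear_proj[OF Esub]] chart_vec_add(2)[OF M d q E E] Pscale[OF dpts[OF q] t]
  by (rule chart_coords_scale[OF M])
qed

lemma coordP_fix_iff:
 assumes x: "x \<in> creg d (chart_dom d)" and v: "v \<in> model d"
 shows "coordP d x v = v \<longleftrightarrow> chart_vec M d (cinv d x) v \<in> D (cinv d x)"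
proof -
 note q = cinv_creg(1)[OF d' x]
 note t = chart_vec_tangent[OF M d q v]
 note c = chart_coords_tangent[OF M d q DT[OF PT[OF dpts[OF q] t]]]
 have e: "coordP d x v = chart_coords d (Pj (cinv d x) (chart_vec M d (cinv d x) v))"
  by (simp add: coordP_def proj_id[OF Esub v])
 show ?thesis
 proof
  assume "coordP d x v = v"
  then have "Pj (cinv d x) (chart_vec M d (cinv d x) v) = chart_vec M d (cinv d x) v" using c(2) e by simp
  then show "chart_vec M d (cinv d x) v \<in> D (cinv d x)" using PT[OF dpts[OF q] t] by simp
 next
  assume "chart_vec M d (cinv d x) v \<in> D (cinv d x)"
  then show "coordP d x v = v" unfolding e by (simp add: Pid[OF dpts[OF q]] chart_coords_vec[OF M d q v])
 qed
qed

lemma coordP_model: "x \<in> creg d (chart_dom d) ==> coordP d x v \<in> model d"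
 unfolding coordP_def
 using chart_coords_tangent(1)[OF M d cinv_creg(1)[OF d'] DT[OF PT[OF dpts[OF cinv_creg(1)[OF d']] cv_tangent[OF cinv_creg(1)[OF d']]]]] by simp

lemma coordP_idem:
 assumes x: "x \<in> creg d (chart_dom d)"
 shows "coordP d x (coordP d x v) = coordP d x v"
proof -
 note q = cinv_creg(1)[OF d' x]
 have "chart_vec M d (cinv d x) (coordP d x v) \<in> D (cinv d x)"
  using PT[OF dpts[OF q] cv_tangent[OF q]] chart_coords_tangent(2)[OF M d q DT[OF PT[OF dpts[OF q] cv_tangent[OF q]]]]
  by (simp add: coordP_def)
 then show ?thesis using coordP_fix_iff[OF x coordP_model[OF x]] by simp
qed

text \<open>The bracket of two fields of the graph frame lies in the distribution, by involutivity, and over zero, since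
  their projections to the range of \<open>P x0\<close> are constant. So it vanishes, and \<open>straightening\<close> applies.\<close>
lemma foliated_chart_near:
 assumes p: "p \<in> chart_dom d"
 shows "\<exists>c W. smooth_chart M c \<and> p \<in> chart_dom c \<and> subspace W \<and> W \<subseteq> model c \<and>
   (\<forall>q\<in>chart_dom c. \<forall>v\<in>tangent_space M q. v \<in> D q \<longleftrightarrow> chart_coords c v \<in> W)"
proof -
 let ?E = "model d" and ?p = "proj (model d)" and ?R = "creg d (chart_dom d)"
 define x0 where "x0 = chart_map d p"
 have x0R: "x0 \<in> ?R" unfolding x0_def by (rule map_creg[OF d' p p])
 let ?P0 = "coordP d x0"
 have P0: "linear ?P0" "?P0 (?P0 v) = ?P0 v" "?P0 v \<in> ?E" for v
  using coordP_linear[OF x0R] coordP_idem[OF x0R] coordP_model[OF x0R] by auto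
 obtain r G where r: "r > 0" "ball x0 r \<subseteq> ?R" and GC: "\<forall>v. Cinf (ball x0 r) (\<lambda>x. G x v)"
  and G0: "\<forall>x\<in>ball x0 r. linear (G x) \<and> (\<forall>v. ?P0 (G x v) = ?P0 v \<and> coordP d x (G x v) = G x v) \<and>
   (\<forall>v. coordP d x v = v \<and> ?P0 v = 0 \<longrightarrow> v = 0)"
  using graph_frame[where P = "coordP d", OF x0R coordP_smooth coordP_linear coordP_idem] by blast
 let ?B = "ball x0 r"
 have Glin: "linear (G x)" and PG: "?P0 (G x v) = ?P0 v" and GP: "coordP d x (G x v) = G x v"
  and Ginj: "coordP d x v = v ==> ?P0 v = 0 ==> v = 0" if "x \<in> ?B" for x v
  using bspec[OF G0 that] by blast+
 have GE: "G x v \<in> ?E" if "x \<in> ?B" for x v using coordP_model[OF subsetD[OF r(2) that], of "G x v"] GP[OF that, of v] by simp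
 define U where "U = {q \<in> chart_dom d. chart_map d q \<in> ?B}"
 have oU: "openin (topo M) U" unfolding U_def by (rule chart_preimage_open[OF d' open_ball])
 have Ud: "U \<subseteq> chart_dom d" by (auto simp: U_def)
 have pU: "p \<in> U" using p r(1) by (simp add: U_def x0_def)
 have rU: "creg d U = ?p -` ?B"
 proof
  show "creg d U \<subseteq> ?p -` ?B" by (auto simp: creg_def U_def)
  show "?p -` ?B \<subseteq> creg d U"
  proof
   fix x assume x: "x \<in> ?p -` ?B"
   then have px: "?p x \<in> ?R" using r(2) by blast
   then have xR: "x \<in> ?R" by (simp add: creg_def proj_proj[OF Esub])
   have "cinv d x \<in> U" using cinv_creg[OF d' xR] x by (simp add: U_def)
   then show "x \<in> creg d U" by (rule creg_sub[OF d' xR])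
  qed
 qed
 have o\<Omega>: "open (creg d U)" by (rule open_creg[OF d' oU])
 let ?\<Omega> = "creg d U"
 define G' where "G' x = G (?p x)" for x
 have pB: "?p x \<in> ?B" if "x \<in> ?\<Omega>" for x using that rU by blast
 have G'C: "Cinf ?\<Omega> (\<lambda>x. G' x v)" for v unfolding G'_def
  by (rule Cinf_compose[where g = "\<lambda>x. G x v", OF GC[rule_format] Cinf_proj[OF Esub o\<Omega>] pB])
 have G'lin: "linear (G' x)" if "x \<in> ?\<Omega>" for x unfolding G'_def by (rule Glin[OF pB[OF that]])
 have G'P: "?P0 (G' x v) = ?P0 v" and G'E: "G' x v \<in> ?E" if "x \<in> ?\<Omega>" for x v
  unfolding G'_def by (rule PG[OF pB[OF that]] GE[OF pB[OF that]])+
 have x0\<Omega>: "x0 \<in> ?\<Omega>" unfolding x0_def by (rule map_creg[OF d' p pU])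
 define Xf where "Xf h q = chart_vec M d q (G (chart_map d q) h)" for h q
 have XE: "G (chart_map d q) h \<in> ?E" if "q \<in> U" for q h using GE that by (simp add: U_def)
 have cp: "chart_map d (cinv d x) = ?p x" if "x \<in> ?\<Omega>" for x by (rule cinv_creg(3)[OF d' that])
 have Xvf: "vector_field_on M U (Xf h)" for h unfolding Xf_def
 proof (rule vf_chart_vec[OF M d oU Ud XE])
  show "Cinf ?\<Omega> (\<lambda>x. G (chart_map d (cinv d x)) h)"
   by (rule Cinf_cong[OF G'C]) (simp add: G'_def cp)
 qed
 have fixD: "chart_vec M d q v \<in> D q \<longleftrightarrow> coordP d (chart_map d q) v = v" if "q \<in> chart_dom d" "v \<in> ?E" for q v
  using coordP_fix_iff[OF map_creg[OF d' that(1) that(1)] that(2)] cinv_map[OF d' that(1)] by simp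
 have XD: "Xf h q \<in> D q" if q: "q \<in> U" for h q
  unfolding Xf_def fixD[OF subsetD[OF Ud q] XE[OF q]] by (rule GP) (use q in \<open>simp add: U_def\<close>)
 have sec: "section_on M D U (Xf h)" for h using Xvf XD by (simp add: section_on_def)
 have coords: "chart_coords d (Xf h q) = G (chart_map d q) h" if "q \<in> U" for h q
  unfolding Xf_def by (rule chart_coords_vec[OF M d subsetD[OF Ud that] XE[OF that]])
 have vc: "vcoord d (Xf h) x = G' x h" if "x \<in> ?\<Omega>" for h x
  unfolding vcoord_def[OF M] coords[OF cinv_creg(1)[OF d' that]] cp[OF that] G'_def ..
 have dproj: "Dd (\<lambda>y. G' y w) x u = Dd (\<lambda>y. G' y w) (?p x) u" if x: "x \<in> ?\<Omega>" for x w u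
 proof -
  have dp: "Dd ?p y u = ?p u" for y
   by (rule Dd_eqI) (use linear_proj[OF Esub] in \<open>simp add: linear_conv_bounded_linear bounded_linear_imp_has_derivative\<close>)
  have "Dd (\<lambda>y. G' y w) y u = Dd (\<lambda>x. G x w) (?p y) (?p u)" if "y \<in> ?\<Omega>" for y
   using Cinf_Dd_compose[OF GC[rule_format, of w] Cinf_proj[OF Esub o\<Omega>] that pB[OF that], of u] by (simp add: G'_def dp)
  from this[OF x] this[OF proj_creg[OF d' x]] show ?thesis by (simp add: proj_proj[OF Esub])
 qed
 \<comment> \<open>Brackets live on the model only; the projection \<open>?p\<close> carries the identity to the thickened region.\<close>
 have comm: "Dd (\<lambda>y. G' y w) x (G' x v) = Dd (\<lambda>y. G' y v) x (G' x w)" if x: "x \<in> ?\<Omega>" for x v w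
 proof -
  define q where "q = cinv d x"
  have q: "q \<in> U" "q \<in> chart_dom d" "chart_map d q = ?p x" using cinv_creg[OF d' x] by (auto simp: q_def)
  define y where "y = ?p x"
  have y: "y \<in> ?\<Omega>" unfolding y_def by (rule proj_creg[OF d' x])
  note br = bracket_chart[OF M Xvf[of v] Xvf[of w] d q(1,2), unfolded q(3), folded y_def]
  define z where "z = Dd (\<lambda>y. G' y w) y (G' y v) - Dd (\<lambda>y. G' y v) y (G' y w)"
  have Dv: "Dd (vcoord d (Xf h)) y u = Dd (\<lambda>y. G' y h) y u" for h u
   by (rule Dd_cong[OF o\<Omega> y vc[symmetric] Cinf_differentiable[OF G'C y]])
  have zE: "z \<in> ?E" and zb: "lie_bracket M (Xf v) (Xf w) q = chart_vec M d q z"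
   using br unfolding Dv vc[OF y] z_def by auto
  have "chart_vec M d q z \<in> D q" using inv[OF sec[of v] sec[of w] q(1)] unfolding zb .
  then have "coordP d y z = z" using fixD[OF q(2) zE] q(3) by (simp add: y_def)
  moreover have "?P0 z = 0"
  proof -
   have "?P0 (Dd (\<lambda>y. G' y h) y u) = 0" for h u
   proof -
    have "?P0 (Dd (\<lambda>y. G' y h) y u) = Dd (\<lambda>y. ?P0 (G' y h)) y u"
     by (rule Cinf_Dd_linear[OF G'C y P0(1), symmetric])
    also have "\<dots> = Dd (\<lambda>y. ?P0 h) y u" by (rule Dd_cong[OF o\<Omega> y]) (simp_all add: G'P)
    finally show ?thesis by (simp add: Dd_const)
   qed
   then show ?thesis by (simp add: z_def linear_diff[OF P0(1)])
  qed
  ultimately have "z = 0" by (rule Ginj[rotated 1]) (use pB[OF x] in \<open>simp add: y_def\<close>)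
  then have "Dd (\<lambda>y. G' y w) y (G' y v) = Dd (\<lambda>y. G' y v) y (G' y w)" by (simp add: z_def)
  moreover have "G' y h = G' x h" for h by (simp add: G'_def y_def proj_proj[OF Esub])
  ultimately show ?thesis unfolding dproj[OF x] y_def[symmetric] by simp
 qed
 have repr: "v = G (chart_map d q) (?P0 v)" if q: "q \<in> U" and v: "v \<in> ?E" "coordP d (chart_map d q) v = v" for q v
 proof -
  have b: "chart_map d q \<in> ?B" using q by (simp add: U_def)
  note l = coordP_linear[OF subsetD[OF r(2) b]]
  have "v - G (chart_map d q) (?P0 v) = 0"
   by (rule Ginj[OF b]) (simp_all add: linear_diff[OF l] linear_diff[OF P0(1)] v(2) GP[OF b] PG[OF b] P0(2))
  then show ?thesis by simp
 qed
 show "\<exists>c W. smooth_chart M c \<and> p \<in> chart_dom c \<and> subspace W \<and> W \<subseteq> model c \<and>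
   (\<forall>q\<in>chart_dom c. \<forall>v\<in>tangent_space M q. v \<in> D q \<longleftrightarrow> chart_coords c v \<in> W)"
 proof -
  have ex: "\<exists>N N' \<Phi> \<Psi>. x0 \<in> N \<and> N \<subseteq> ?\<Omega> \<and> Cinf N \<Phi> \<and> Cinf N' \<Psi> \<and> (\<forall>x\<in>N. \<Phi> x \<in> N') \<and> (\<forall>z\<in>N'. \<Psi> z \<in> N) \<and>
   (\<forall>x\<in>N. \<Psi> (\<Phi> x) = x) \<and> (\<forall>z\<in>N'. \<Phi> (\<Psi> z) = z) \<and> (\<forall>x\<in>N. \<forall>v. ?P0 v = v \<longrightarrow> Dd \<Phi> x (G' x v) = v) \<and>
   (\<forall>x\<in>N. \<Phi> x - x \<in> ?E)"
  proof (rule straightening[OF x0\<Omega> G'C G'lin P0(1,2) G'P comm])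
   fix N N' \<Phi> \<Psi>
   assume a: "x0 \<in> N" "N \<subseteq> ?\<Omega>" "Cinf N \<Phi>" "Cinf N' \<Psi>" "\<And>x. x \<in> N ==> \<Phi> x \<in> N'"
    "\<And>z. z \<in> N' ==> \<Psi> z \<in> N" "\<And>x. x \<in> N ==> \<Psi> (\<Phi> x) = x" "\<And>z. z \<in> N' ==> \<Phi> (\<Psi> z) = z"
    "\<And>x v. x \<in> N ==> ?P0 v = v ==> Dd \<Phi> x (G' x v) = v"
    and F: "\<And>F x. subspace F ==> (\<And>x v. x \<in> ?\<Omega> ==> G' x v \<in> F) ==> (\<And>v. ?P0 v \<in> F) ==> x \<in> N ==> \<Phi> x - x \<in> F"
   show "\<exists>N N' \<Phi> \<Psi>. x0 \<in> N \<and> N \<subseteq> ?\<Omega> \<and> Cinf N \<Phi> \<and> Cinf N' \<Psi> \<and> (\<forall>x\<in>N. \<Phi> x \<in> N') \<and> (\<forall>z\<in>N'. \<Psi> z \<in> N) \<and>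
   (\<forall>x\<in>N. \<Psi> (\<Phi> x) = x) \<and> (\<forall>z\<in>N'. \<Phi> (\<Psi> z) = z) \<and> (\<forall>x\<in>N. \<forall>v. ?P0 v = v \<longrightarrow> Dd \<Phi> x (G' x v) = v) \<and>
   (\<forall>x\<in>N. \<Phi> x - x \<in> ?E)"
   proof (rule exI[of _ N], rule exI[of _ N'], rule exI[of _ \<Phi>], rule exI[of _ \<Psi>], intro conjI)
    show "\<forall>x\<in>N. \<Phi> x \<in> N'" by (rule ballI) (rule a(5))
    show "\<forall>z\<in>N'. \<Psi> z \<in> N" by (rule ballI) (rule a(6))
    show "\<forall>x\<in>N. \<Psi> (\<Phi> x) = x" by (rule ballI) (rule a(7))
    show "\<forall>z\<in>N'. \<Phi> (\<Psi> z) = z" by (rule ballI) (rule a(8))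
    show "\<forall>x\<in>N. \<forall>v. ?P0 v = v \<longrightarrow> Dd \<Phi> x (G' x v) = v"
     by (rule ballI, rule allI, rule impI) (rule a(9))
    show "\<forall>x\<in>N. \<Phi> x - x \<in> ?E" by (rule ballI) (rule F[OF Esub G'E P0(3)])
   qed (rule a(1-4))+
  qed
  obtain N N' \<Phi> \<Psi> where N: "x0 \<in> N" "N \<subseteq> ?\<Omega>" and \<Phi>: "Cinf N \<Phi>" and \<Psi>: "Cinf N' \<Psi>"
   and NN': "\<forall>x\<in>N. \<Phi> x \<in> N'" "\<forall>z\<in>N'. \<Psi> z \<in> N" and inverse: "\<forall>x\<in>N. \<Psi> (\<Phi> x) = x" "\<forall>z\<in>N'. \<Phi> (\<Psi> z) = z"
   and D\<Phi>: "\<forall>x\<in>N. \<forall>v. ?P0 v = v \<longrightarrow> Dd \<Phi> x (G' x v) = v" and \<Phi>E: "\<forall>x\<in>N. \<Phi> x - x \<in> ?E"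
   using ex by (elim exE conjE) (rule that; assumption)
  define C where "C = {q \<in> chart_dom d. chart_map d q \<in> N}"
  define c where "c = Chart C (\<lambda>q. \<Phi> (chart_map d q)) ?E"
  have c_sel: "chart_dom c = C" "chart_map c = (\<lambda>q. \<Phi> (chart_map d q))" "model c = ?E" by (simp_all add: c_def)
  have oC: "openin (topo M) C" unfolding C_def by (rule chart_preimage_open[OF d' Cinf_open[OF \<Phi>]])
  have Cd: "C \<subseteq> chart_dom d" by (auto simp: C_def)
  have dinj: "inj_on (chart_map d) (chart_dom d)" by (rule chart_inj[OF d'])
  have inE: "\<Phi> x \<in> ?E" if "x \<in> N" "x \<in> ?E" for x
   using subspace_add[OF Esub bspec[OF \<Phi>E that(1)] that(2)] by simp
  have \<Psi>E: "\<Psi> z \<in> ?E" if "z \<in> N'" "z \<in> ?E" for z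
   using subspace_diff[OF Esub that(2) bspec[OF \<Phi>E bspec[OF NN'(2) that(1)]]] inverse(2) that(1) by simp
  have isc: "is_chart (topo M) c" unfolding c_def
  proof (rule is_chartI[OF oC Esub])
   show "inj_on (\<lambda>q. \<Phi> (chart_map d q)) C"
   proof (rule inj_onI)
    fix q q' assume q: "q \<in> C" "q' \<in> C" and e: "\<Phi> (chart_map d q) = \<Phi> (chart_map d q')"
    then have "chart_map d q = chart_map d q'" using inverse(1) by (metis (no_types, lifting) C_def mem_Collect_eq)
    then show "q = q'" using inj_onD[OF dinj] q Cd by blast
   qed
   show "openin (topo M) {q \<in> C. \<Phi> (chart_map d q) \<in> V}" if V: "open V" for V
   proof -
    have o: "open (N \<inter> \<Phi> -` V)" by (rule continuous_open_preimage[OF Cinf_continuous_on[OF \<Phi>] Cinf_open[OF \<Phi>] V])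
    have e: "{q \<in> C. \<Phi> (chart_map d q) \<in> V} = {q \<in> chart_dom d. chart_map d q \<in> N \<inter> \<Phi> -` V}" by (auto simp: C_def)
    show ?thesis unfolding e by (rule chart_preimage_open[OF d' o])
   qed
   show "openin (top_of_set ?E) ((\<lambda>q. \<Phi> (chart_map d q)) ` O')" if O': "openin (topo M) O'" "O' \<subseteq> C" for O'
   proof -
    have "openin (top_of_set ?E) (chart_map d ` (chart_dom d \<inter> O'))" by (rule chart_image_open[OF d' O'(1)])
    then obtain V where V: "open V" "chart_map d ` (chart_dom d \<inter> O') = ?E \<inter> V" using openin_open by metis
    have dO: "chart_dom d \<inter> O' = O'" using O'(2) Cd by auto
    have "(\<lambda>q. \<Phi> (chart_map d q)) ` O' = \<Phi> ` (?E \<inter> V)" using V(2) dO by (metis image_image)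
    also have "\<dots> = ?E \<inter> (N' \<inter> \<Psi> -` V)"
    proof
     have sub: "?E \<inter> V \<subseteq> N"
     proof
      fix x assume "x \<in> ?E \<inter> V"
      then have "x \<in> chart_map d ` O'" using V(2) dO by simp
      then obtain q where "q \<in> O'" "x = chart_map d q" by blast
      then show "x \<in> N" using O'(2) by (auto simp: C_def)
     qed
     show "\<Phi> ` (?E \<inter> V) \<subseteq> ?E \<inter> (N' \<inter> \<Psi> -` V)"
     proof
      fix z assume "z \<in> \<Phi> ` (?E \<inter> V)"
      then obtain x where x: "x \<in> ?E" "x \<in> V" "z = \<Phi> x" by blast
      have xN: "x \<in> N" using sub x by blast
      show "z \<in> ?E \<inter> (N' \<inter> \<Psi> -` V)" using x inE[OF xN x(1)] NN'(1) xN inverse(1) by simp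
     qed
     show "?E \<inter> (N' \<inter> \<Psi> -` V) \<subseteq> \<Phi> ` (?E \<inter> V)"
     proof
      fix z assume z: "z \<in> ?E \<inter> (N' \<inter> \<Psi> -` V)"
      then have "\<Psi> z \<in> ?E \<inter> V" using \<Psi>E by simp
      moreover have "z = \<Phi> (\<Psi> z)" using z inverse(2) by simp
      ultimately show "z \<in> \<Phi> ` (?E \<inter> V)" by blast
     qed
    qed
    finally show ?thesis
     using continuous_open_preimage[OF Cinf_continuous_on[OF \<Psi>] Cinf_open[OF \<Psi>] V(1)] by (simp add: openin_open_Int)
   qed
  qed
  have cinv_c: "chart_inv c z = cinv d (\<Psi> z)" if z: "z \<in> chart_map c ` C" for z
  proof -
   obtain q where q: "q \<in> C" "z = \<Phi> (chart_map d q)" using z by (auto simp: c_sel)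
   have "\<Psi> z = chart_map d q" using q inverse(1) by (simp add: C_def)
   then have "cinv d (\<Psi> z) = q" using cinv_map[OF d'] q(1) Cd by auto
   moreover have "chart_inv c z = q" using chart_inv_map[OF isc, of q] q by (simp add: c_sel)
   ultimately show ?thesis by simp
  qed
  have compat: "compatible c e" if e: "e \<in> atlas M" for e
  proof -
   note e1 = atlas_is_chart[OF M e]
   note oe = chart_open[OF e1]
   show ?thesis unfolding compatible_def c_sel
   proof
    show "smooth_on ((\<lambda>q. \<Phi> (chart_map d q)) ` (C \<inter> chart_dom e)) (chart_map e \<circ> chart_inv c)"
    proof (rule smooth_onI)
     fix x assume x: "x \<in> (\<lambda>q. \<Phi> (chart_map d q)) ` (C \<inter> chart_dom e)"
     then obtain q where q: "q \<in> C" "q \<in> chart_dom e" "x = \<Phi> (chart_map d q)" by blast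
     let ?V = "N' \<inter> \<Psi> -` creg d (chart_dom e)"
     have oV: "open ?V" by (rule continuous_open_preimage[OF Cinf_continuous_on[OF \<Psi>] Cinf_open[OF \<Psi>] open_creg[OF d' oe]])
     have "Cinf ?V (\<lambda>z. (\<lambda>y. chart_map e (cinv d y)) (\<Psi> z))"
      by (rule Cinf_compose[where g = "\<lambda>y. chart_map e (cinv d y)", OF transition[OF M d smooth_atlas_chart[OF M e]] Cinf_subset[OF \<Psi> oV]]) auto
     note h = this
     have qN: "chart_map d q \<in> N" using q(1) by (simp add: C_def)
     have \<Psi>x: "\<Psi> x = chart_map d q" unfolding q(3) by (rule bspec[OF inverse(1) qN])
     have xV: "x \<in> ?V"
     proof
      show "x \<in> N'" unfolding q(3) by (rule bspec[OF NN'(1) qN])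
      show "x \<in> \<Psi> -` creg d (chart_dom e)"
       unfolding vimage_def mem_Collect_eq \<Psi>x by (rule map_creg[OF d' subsetD[OF Cd q(1)] q(2)])
     qed
     have eq: "chart_map e (cinv d (\<Psi> y)) = (chart_map e \<circ> chart_inv c) y"
      if "y \<in> (\<lambda>q. \<Phi> (chart_map d q)) ` (C \<inter> chart_dom e)" for y
     proof -
      have "y \<in> chart_map c ` C" using that unfolding c_sel by blast
      then show ?thesis by (simp add: cinv_c)
     qed
     show "\<exists>V h. x \<in> V \<and> Cinf V h \<and> (\<forall>y\<in>V \<inter> (\<lambda>q. \<Phi> (chart_map d q)) ` (C \<inter> chart_dom e). h y = (chart_map e \<circ> chart_inv c) y)"
      by (rule exI[of _ ?V], rule exI[of _ "\<lambda>z. chart_map e (cinv d (\<Psi> z))"])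
       (intro conjI xV h ballI eq, erule IntD2)
    qed
    have "Cinf (creg e C) (\<lambda>x. \<Phi> ((\<lambda>x. chart_map d (cinv e x)) x))"
    proof (rule Cinf_compose[where f = "\<lambda>x. chart_map d (cinv e x)", OF \<Phi>])
     show "Cinf (creg e C) (\<lambda>x. chart_map d (cinv e x))"
      by (rule Cinf_subset[OF transition[OF M smooth_atlas_chart[OF M e] d] open_creg[OF e1 oC] creg_mono[OF e1 Cd]])
     show "chart_map d (cinv e x) \<in> N" if "x \<in> creg e C" for x using cinv_creg(1)[OF e1 that] by (simp add: C_def)
    qed
    then show "smooth_on (chart_map e ` (C \<inter> chart_dom e)) ((\<lambda>q. \<Phi> (chart_map d q)) \<circ> chart_inv e)"
     using smooth_on_chart_iff[OF e1 oC, of "\<lambda>q. \<Phi> (chart_map d q)"] by (simp add: Int_commute)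
   qed
  qed
  have sc: "smooth_chart M c" unfolding smooth_chart_def using isc compat by blast
  let ?W = "{w. ?P0 w = w}"
  have Wsub: "subspace ?W"
   by (rule subspaceI) (simp_all add: linear_0[OF P0(1)] linear_add[OF P0(1)] linear_scale[OF P0(1)])
  have WE: "?W \<subseteq> model c"
  proof
   fix w assume "w \<in> ?W"
   then have "?P0 w = w" by simp
   then show "w \<in> model c" using P0(3)[of w] by (simp add: c_sel)
  qed
  have pC: "p \<in> chart_dom c" using p N(1) by (simp add: c_sel C_def x0_def)
  have cc: "chart_coords c (chart_vec M d q a) = Dd \<Phi> (chart_map d q) a" if q: "q \<in> C" and a: "a \<in> ?E" for q a
  proof -
   have qd: "q \<in> chart_dom d" and qN: "chart_map d q \<in> N" using q by (auto simp: C_def)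
   have qc: "q \<in> chart_dom c" using q by (simp add: c_sel)
   note ch = chart_vec_change[OF M d sc qd qc a]
   have xr: "chart_map d q \<in> creg d C" by (rule map_creg[OF d' qd q])
   have "Dd (\<lambda>x. chart_map c (cinv d x)) (chart_map d q) a = Dd (\<lambda>x. \<Phi> (?p x)) (chart_map d q) a"
   proof (rule Dd_cong[OF open_creg[OF d' oC] xr])
    show "\<Phi> (?p y) = chart_map c (cinv d y)" if "y \<in> creg d C" for y by (simp add: c_sel cinv_creg(3)[OF d' that])
    have "Cinf (creg d C) (\<lambda>x. \<Phi> (?p x))"
     by (rule Cinf_compose[OF \<Phi> Cinf_proj[OF Esub open_creg[OF d' oC]]]) (auto simp: creg_def C_def)
    then show "(\<lambda>x. \<Phi> (?p x)) differentiable at (chart_map d q)" by (rule Cinf_differentiable[OF _ xr])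
   qed
   also have "\<dots> = Dd \<Phi> (?p (chart_map d q)) (Dd ?p (chart_map d q) a)"
    by (rule Cinf_Dd_compose[OF \<Phi> Cinf_proj[OF Esub open_UNIV]]) (simp_all add: proj_id[OF Esub chart_map_model[OF d' qd]] qN)
   also have "Dd ?p (chart_map d q) a = a"
    using Dd_eqI[OF bounded_linear_imp_has_derivative, of ?p "chart_map d q" a] linear_proj[OF Esub] proj_id[OF Esub a]
    by (simp add: linear_conv_bounded_linear)
   finally have "Dd (\<lambda>x. chart_map c (cinv d x)) (chart_map d q) a = Dd \<Phi> (chart_map d q) a"
    by (simp add: proj_id[OF Esub chart_map_model[OF d' qd]])
   then show ?thesis using chart_coords_vec[OF M sc qc ch(1)] ch(2) by simp
  qed
  have main: "v \<in> D q \<longleftrightarrow> chart_coords c v \<in> ?W" if qc: "q \<in> chart_dom c" and v: "v \<in> tangent_space M q" for q v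
  proof -
   have q: "q \<in> C" "q \<in> chart_dom d" "chart_map d q \<in> N" using qc by (auto simp: c_sel C_def)
   have qU: "q \<in> U" using cinv_creg(1)[OF d' subsetD[OF N(2) q(3)]] cinv_map[OF d' q(2)] by simp
   have b: "chart_map d q \<in> ?B" using qU by (simp add: U_def)
   have G'q: "G' (chart_map d q) = G (chart_map d q)" by (simp add: G'_def proj_id[OF Esub chart_map_model[OF d' q(2)]])
   define a where "a = chart_coords d v"
   have a: "a \<in> ?E" "chart_vec M d q a = v" unfolding a_def by (rule chart_coords_tangent[OF M d q(2) v])+
   show ?thesis
   proof
    assume "v \<in> D q"
    then have "coordP d (chart_map d q) a = a" using fixD[OF q(2) a(1)] a(2) by simp
    then have e: "a = G (chart_map d q) (?P0 a)" by (rule repr[OF qU a(1)])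
    have "Dd \<Phi> (chart_map d q) (G (chart_map d q) (?P0 a)) = ?P0 a"
     using mp[OF spec[OF bspec[OF D\<Phi> q(3)]] P0(2)[of a]] unfolding G'q .
    then have "Dd \<Phi> (chart_map d q) a = ?P0 a" unfolding e[symmetric] .
    then have "chart_coords c v = ?P0 a" using cc[OF q(1) a(1)] a(2) by simp
    then show "chart_coords c v \<in> ?W" using P0(2) by simp
   next
    assume "chart_coords c v \<in> ?W"
    then have w: "?P0 (chart_coords c v) = chart_coords c v" by simp
    let ?a = "G (chart_map d q) (chart_coords c v)"
    have "Dd \<Phi> (chart_map d q) ?a = chart_coords c v"
     using mp[OF spec[OF bspec[OF D\<Phi> q(3)]] w] unfolding G'q .
    then have e: "chart_coords c (chart_vec M d q ?a) = chart_coords c v" using cc[OF q(1) GE[OF b]] by simp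
    have "chart_vec M c q (chart_coords c (chart_vec M d q ?a)) = chart_vec M d q ?a"
     by (rule chart_coords_tangent(2)[OF M sc qc chart_vec_tangent[OF M d q(2) GE[OF b]]])
    then have "chart_vec M d q ?a = v" using chart_coords_tangent(2)[OF M sc qc v] e by simp
    moreover have "chart_vec M d q ?a \<in> D q" using XD[OF qU] by (simp add: Xf_def)
    ultimately show "v \<in> D q" by simp
   qed
  qed
  show ?thesis
  proof (rule exI[of _ c], rule exI[of _ ?W], intro conjI ballI)
   show "v \<in> D q \<longleftrightarrow> chart_coords c v \<in> ?W" if "q \<in> chart_dom c" "v \<in> tangent_space M q" for q v
    by (rule main[OF that])
  qed (rule sc, rule pC, rule Wsub, rule WE)
 qed
qed

end

lemma foliated_chart:
 assumes "p \<in> points M"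
 shows "\<exists>c W. smooth_chart M c \<and> p \<in> chart_dom c \<and> subspace W \<and> W \<subseteq> model c \<and>
   (\<forall>q\<in>chart_dom c. \<forall>v\<in>tangent_space M q. v \<in> D q \<longleftrightarrow> chart_coords c v \<in> W)"
proof -
 obtain d where d: "d \<in> atlas M" "p \<in> chart_dom d" using smooth_atlas_cover[OF M assms] by blast
 show ?thesis by (rule foliated_chart_near[OF smooth_atlas_chart[OF M d(1)] d(2)])
qed

end

section \<open>Foliation atlases\<close>

lemma linear_proj_complement:
 assumes "subspace W"
 shows "bounded_linear (\<lambda>z. z - proj W z)" "z - proj W z = 0 ==> z \<in> W" "z \<in> W ==> z - proj W z = 0"
proof -
 show "bounded_linear (\<lambda>z. z - proj W z)"
  by (intro bounded_linear_sub bounded_linear_ident) (use linear_proj[OF assms] in \<open>simp add: linear_conv_bounded_linear\<close>)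
 show "z \<in> W" if "z - proj W z = 0" using proj_in[OF assms, of z] that by simp
 show "z - proj W z = 0" if "z \<in> W" using proj_id[OF assms that] by simp
qed

text \<open>The charts in which the distribution \<open>D\<close> is the constant subspace \<open>W\<close>.\<close>
definition plaque_charts ::
 "('m, 'e::euclidean_space) charted_space \<Rightarrow> ('m \<Rightarrow> 'm tvec set) \<Rightarrow> ('m, 'e) foliation_atlas" where
 "plaque_charts M D = {(c, W). smooth_chart M c \<and> subspace W \<and> W \<subseteq> model c \<and>
   (\<forall>q\<in>chart_dom c. \<forall>v\<in>tangent_space M q. v \<in> D q \<longleftrightarrow> chart_coords c v \<in> W)}"

text \<open>The derivative of a transition map takes \<open>W\<close> into \<open>W'\<close>. Along a segment in direction \<open>W\<close> the image modulo \<open>W'\<close> is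
  therefore constant, so that it suffices to restrict to a ball in the coordinates of \<open>c\<close>.\<close>
lemma plaque_charts_transition:
 assumes M: "smooth_atlas M" and c: "(c, W) \<in> plaque_charts M D" and d: "(d, W') \<in> plaque_charts M D"
  and p: "p \<in> chart_dom c" "p \<in> chart_dom d"
 shows "\<exists>U. openin (topo M) U \<and> p \<in> U \<and> U \<subseteq> chart_dom c \<inter> chart_dom d \<and>
     (\<forall>q\<in>U. \<forall>q'\<in>U. chart_map c q - chart_map c q' \<in> W \<longrightarrow> chart_map d q - chart_map d q' \<in> W')"
proof -
 have c1: "smooth_chart M c" "subspace W" "W \<subseteq> model c"
  and cD: "\<And>q v. q \<in> chart_dom c ==> v \<in> tangent_space M q ==> v \<in> D q \<longleftrightarrow> chart_coords c v \<in> W"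
  using c by (auto simp: plaque_charts_def)
 have d1: "smooth_chart M d" "subspace W'" "W' \<subseteq> model d"
  and dD: "\<And>q v. q \<in> chart_dom d ==> v \<in> tangent_space M q ==> v \<in> D q \<longleftrightarrow> chart_coords d v \<in> W'"
  using d by (auto simp: plaque_charts_def)
 note c' = smooth_chartD[OF c1(1)] and d' = smooth_chartD[OF d1(1)]
 let ?\<tau> = "\<lambda>x. chart_map d (cinv c x)" and ?S = "creg c (chart_dom d)"
 note T = transition[OF M c1(1) d1(1)]
 obtain r where r: "r > 0" "ball (chart_map c p) r \<subseteq> ?S"
  using open_creg[OF c' chart_open[OF d']] map_creg[OF c' p] open_contains_ball by blast
 define U where "U = {q \<in> chart_dom c. chart_map c q \<in> ball (chart_map c p) r}"
 have Ud: "q \<in> chart_dom c" "q \<in> chart_dom d" if "q \<in> U" for q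
 proof -
  show q: "q \<in> chart_dom c" using that by (simp add: U_def)
  have "chart_map c q \<in> ?S" using that r by (auto simp: U_def)
  from cinv_creg(1)[OF c' this] show "q \<in> chart_dom d" by (simp add: cinv_map[OF c' q])
 qed
 have "chart_map d q - chart_map d q' \<in> W'"
  if q: "q \<in> U" and q': "q' \<in> U" and w: "chart_map c q - chart_map c q' \<in> W" for q q'
 proof -
  define y where "y = chart_map c q'"
  define w where "w = chart_map c q - chart_map c q'"
  let ?R = "\<lambda>z. z - proj W' z"
  have W: "w \<in> W" unfolding w_def by (rule w)
  have wE: "w \<in> model c" using W c1(3) by blast
  have yE: "y \<in> model c" unfolding y_def by (rule chart_map_model[OF c' Ud(1)[OF q']])
  have seg: "y + t *\<^sub>R w \<in> ball (chart_map c p) r" if t: "t \<in> {0..1::real}" for t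
  proof -
   have "(1 - t) *\<^sub>R y + t *\<^sub>R chart_map c q \<in> ball (chart_map c p) r"
    using q q' t by (intro convexD_alt[OF convex_ball]) (simp_all add: U_def y_def)
   then show ?thesis by (simp add: y_def w_def algebra_simps)
  qed
  have tang: "Dd ?\<tau> (y + t *\<^sub>R w) w \<in> W'" if t: "t \<in> {0..1::real}" for t
  proof -
   let ?z = "y + t *\<^sub>R w"
   let ?q = "cinv c ?z"
   have z: "?z \<in> ?S" using seg[OF t] r(2) by blast
   have qc: "?q \<in> chart_dom c" and qd: "?q \<in> chart_dom d" using cinv_creg(1,2)[OF c' z] by auto
   have "?z \<in> model c" using yE wE chart_subspace[OF c'] by (simp add: subspace_add subspace_scale)
   then have cz: "chart_map c ?q = ?z" using cinv_creg(3)[OF c' z] proj_id[OF chart_subspace[OF c']] by simp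
   let ?v = "chart_vec M c ?q w"
   have vT: "?v \<in> tangent_space M ?q" by (rule chart_vec_tangent[OF M c1(1) qc wE])
   have "chart_coords c ?v \<in> W" using chart_coords_vec[OF M c1(1) qc wE] W by simp
   then have "?v \<in> D ?q" using cD[OF qc vT] by simp
   then have e: "chart_coords d ?v \<in> W'" using dD[OF qd vT] by simp
   note ch = chart_vec_change[OF M c1(1) d1(1) qc qd wE]
   have "chart_coords d ?v = Dd ?\<tau> (chart_map c ?q) w"
    unfolding ch(2) by (rule chart_coords_vec[OF M d1(1) qd ch(1)])
   then show ?thesis using e cz by simp
  qed
  have der: "((\<lambda>t. ?R (?\<tau> (y + t *\<^sub>R w))) has_derivative (\<lambda>s. 0)) (at t within {0..1})"
   if t: "t \<in> {0..1::real}" for t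
  proof -
   have z: "y + t *\<^sub>R w \<in> ?S" using seg[OF t] r(2) by blast
   note hd = Cinf_has_derivative[OF T z]
   have "((\<lambda>t. y + t *\<^sub>R w) has_derivative (\<lambda>s. s *\<^sub>R w)) (at t within {0..1})"
    by (auto intro!: derivative_eq_intros)
   note h1 = has_derivative_compose[OF this hd]
   note h2 = bounded_linear.has_derivative[OF linear_proj_complement(1)[OF d1(2)] h1]
   have l: "linear (Dd ?\<tau> (y + t *\<^sub>R w))" using has_derivative_linear[OF hd] .
   have "?R (Dd ?\<tau> (y + t *\<^sub>R w) (s *\<^sub>R w)) = 0" for s :: real
    by (rule linear_proj_complement(3)[OF d1(2)]) (simp add: linear_scale[OF l] subspace_scale[OF d1(2) tang[OF t]])
   then show ?thesis using h2 by simp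
  qed
  obtain k where k: "\<And>t. t \<in> {0..1::real} ==> ?R (?\<tau> (y + t *\<^sub>R w)) = k"
   using has_derivative_zero_constant[of "{0..1::real}" "\<lambda>t. ?R (?\<tau> (y + t *\<^sub>R w))", OF _ der] by auto
  have "?R (?\<tau> (y + 1 *\<^sub>R w)) = ?R (?\<tau> (y + 0 *\<^sub>R w))" using k[of 0] k[of 1] by simp
  then have "?R (chart_map d q) = ?R (chart_map d q')"
   by (simp add: y_def w_def cinv_map[OF c' Ud(1)[OF q]] cinv_map[OF c' Ud(1)[OF q']])
  then have "?R (chart_map d q - chart_map d q') = 0"
   unfolding linear_diff[OF linear_proj[OF d1(2)], of "chart_map d q" "chart_map d q'"] by (simp add: algebra_simps)
  then show ?thesis by (rule linear_proj_complement(2)[OF d1(2)])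
 qed
 moreover have "openin (topo M) U" unfolding U_def by (rule chart_preimage_open[OF c' open_ball])
 moreover have "p \<in> U" using p r by (simp add: U_def)
 ultimately show ?thesis using Ud by (intro exI[of _ U]) blast
qed

lemma plaque_charts_tangent_to_foliation:
 assumes M: "smooth_atlas M"
  and ex: "\<And>p. p \<in> points M ==> \<exists>c W. (c, W) \<in> plaque_charts M D \<and> p \<in> chart_dom c"
  and DT: "\<And>p v. v \<in> D p ==> v \<in> tangent_space M p"
 shows "tangent_to_foliation M D (plaque_charts M D)"
proof -
 let ?F = "plaque_charts M D"
 have F: "smooth_chart M c" "subspace W" "W \<subseteq> model c"
  and FD: "\<And>q v. q \<in> chart_dom c ==> v \<in> tangent_space M q ==> v \<in> D q \<longleftrightarrow> chart_coords c v \<in> W"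
  if "(c, W) \<in> ?F" for c W using that by (auto simp: plaque_charts_def)
 have "foliation M ?F" unfolding foliation_def
 proof (intro conjI)
  show "\<forall>(c, W)\<in>?F. is_chart (topo M) c \<and> (\<forall>d\<in>atlas M. compatible c d) \<and> subspace W \<and> W \<subseteq> model c"
  proof clarify
   fix c W assume "(c, W) \<in> ?F"
   from F[OF this] show "is_chart (topo M) c \<and> (\<forall>d\<in>atlas M. compatible c d) \<and> subspace W \<and> W \<subseteq> model c"
    by (simp add: smooth_chart_def)
  qed
  have "chart_dom c \<subseteq> points M" if "(c, W) \<in> ?F" for c W
   using chart_dom_topspace[OF smooth_chartD[OF F(1)[OF that]]] by (simp add: points_def)
  then show "(\<Union>(c, W)\<in>?F. chart_dom c) = points M" using ex by fast
  show "\<forall>(c, W)\<in>?F. \<forall>(d, W')\<in>?F. \<forall>p\<in>chart_dom c \<inter> chart_dom d.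
    \<exists>U. openin (topo M) U \<and> p \<in> U \<and> U \<subseteq> chart_dom c \<inter> chart_dom d \<and>
     (\<forall>q\<in>U. \<forall>q'\<in>U. chart_map c q - chart_map c q' \<in> W \<longrightarrow> chart_map d q - chart_map d q' \<in> W')"
  proof clarify
   fix c W d W' p assume "(c, W) \<in> ?F" "(d, W') \<in> ?F" "p \<in> chart_dom c" "p \<in> chart_dom d"
   then show "\<exists>U. openin (topo M) U \<and> p \<in> U \<and> U \<subseteq> chart_dom c \<inter> chart_dom d \<and>
     (\<forall>q\<in>U. \<forall>q'\<in>U. chart_map c q - chart_map c q' \<in> W \<longrightarrow> chart_map d q - chart_map d q' \<in> W')"
    by (rule plaque_charts_transition[OF M])
  qed
 qed
 moreover have "foliation_tangent M ?F p = D p" if p: "p \<in> points M" for p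
 proof (rule set_eqI)
  fix v
  obtain c W where cW: "(c, W) \<in> ?F" "p \<in> chart_dom c" using ex[OF p] by blast
  show "v \<in> foliation_tangent M ?F p \<longleftrightarrow> v \<in> D p"
  proof
   assume "v \<in> foliation_tangent M ?F p"
   then show "v \<in> D p" unfolding foliation_tangent_def using FD by blast
  next
   assume v: "v \<in> D p"
   then have "chart_coords c v \<in> W" using FD[OF cW(1,2) DT[OF v]] by simp
   then show "v \<in> foliation_tangent M ?F p" unfolding foliation_tangent_def using cW DT[OF v] by blast
  qed
 qed
 ultimately show ?thesis unfolding tangent_to_foliation_def by blast
qed

text \<open>A basis of \<open>W\<close> gives constant coordinate fields, which form a frame.\<close>
lemma plaque_charts_subbundle:
 fixes M :: "('m, 'e::euclidean_space) charted_space"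
 assumes M: "smooth_atlas M"
  and ex: "\<And>p. p \<in> points M ==> \<exists>c W. (c, W) \<in> plaque_charts M D \<and> p \<in> chart_dom c"
  and DT: "\<And>p v. v \<in> D p ==> v \<in> tangent_space M p"
 shows "subbundle M D"
 unfolding subbundle_def
proof
 fix p assume "p \<in> points M"
 then obtain c W where "(c, W) \<in> plaque_charts M D" and pc: "p \<in> chart_dom c" using ex by blast
 then have c: "smooth_chart M c" and W: "subspace W" "W \<subseteq> model c"
  and cD: "\<And>q v. q \<in> chart_dom c ==> v \<in> tangent_space M q ==> v \<in> D q \<longleftrightarrow> chart_coords c v \<in> W"
  by (auto simp: plaque_charts_def)
 note c' = smooth_chartD[OF c]
 note E = chart_subspace[OF c']
 obtain Bs where Bs: "Bs \<subseteq> W" "independent Bs" "W \<subseteq> span Bs" by (rule basis_exists)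
 have spanB: "span Bs = W" using span_minimal[OF Bs(1) W(1)] Bs(3) by blast
 define k where "k = card Bs"
 obtain f where f: "bij_betw f {..<k} Bs"
  using ex_bij_betw_nat_finite[OF independent_imp_finite[OF Bs(2)]] by (auto simp: k_def atLeast0LessThan)
 define \<psi> where "\<psi> q w = chart_vec M c q (proj (model c) w)" for q w
 define X where "X i q = \<psi> q (f i)" for i q
 have "vector_field_on M (chart_dom c) (X i)" for i
  unfolding X_def \<psi>_def by (rule vf_const[OF M c proj_in[OF E]])
 moreover have "inj_on (\<lambda>i. X i q) {..<k} \<and> independent ((\<lambda>i. X i q) ` {..<k}) \<and> span ((\<lambda>i. X i q) ` {..<k}) = D q"
  if q: "q \<in> chart_dom c" for q
 proof -
  have lin: "linear (\<psi> q)"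
   by (rule linearI) (simp_all add: \<psi>_def linear_add[OF linear_proj[OF E]] linear_scale[OF linear_proj[OF E]]
     chart_vec_add[OF M c q proj_in[OF E] proj_in[OF E]])
  have \<psi>W: "chart_coords c (\<psi> q w) = w" if "w \<in> W" for w
   using chart_coords_vec[OF M c q subsetD[OF W(2) that]] by (simp add: \<psi>_def proj_id[OF E subsetD[OF W(2) that]])
  have inj: "inj_on (\<psi> q) W" by (rule inj_on_inverseI[where g = "chart_coords c"]) (rule \<psi>W)
  have im: "\<psi> q ` W = D q"
  proof
   show "\<psi> q ` W \<subseteq> D q"
    using cD[OF q] chart_vec_tangent[OF M c q proj_in[OF E]] \<psi>W by (auto simp: \<psi>_def)
   show "D q \<subseteq> \<psi> q ` W"
   proof
    fix v assume v: "v \<in> D q"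
    have w: "chart_coords c v \<in> W" using cD[OF q DT[OF v]] v by simp
    have "\<psi> q (chart_coords c v) = v"
     using chart_coords_tangent(2)[OF M c q DT[OF v]] by (simp add: \<psi>_def proj_id[OF E subsetD[OF W(2) w]])
    then show "v \<in> \<psi> q ` W" using w by (rule rev_image_eqI[OF _ sym, rotated])
   qed
  qed
  have e: "(\<lambda>i. X i q) ` {..<k} = \<psi> q ` Bs"
   unfolding X_def bij_betw_imp_surj_on[OF f, symmetric] by (simp add: image_image)
  have "inj_on (\<lambda>i. X i q) {..<k}"
   using comp_inj_on[OF bij_betw_imp_inj_on[OF f], of "\<psi> q"] inj_on_subset[OF inj Bs(1)] bij_betw_imp_surj_on[OF f]
   by (simp add: X_def o_def)
  moreover have "independent (\<psi> q ` Bs)"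
   by (rule linear_independent_injective_image[OF lin Bs(2)]) (simp add: spanB inj)
  moreover have "span (\<psi> q ` Bs) = D q" using linear_span_image[OF lin, of Bs] by (simp add: spanB im)
  ultimately show ?thesis by (simp add: e)
 qed
 ultimately show "\<exists>U k (X :: nat \<Rightarrow> 'm \<Rightarrow> 'm tvec). p \<in> U \<and> openin (topo M) U \<and> (\<forall>i<k. vector_field_on M U (X i)) \<and>
   (\<forall>q\<in>U. inj_on (\<lambda>i. X i q) {..<k} \<and> independent ((\<lambda>i. X i q) ` {..<k}) \<and> span ((\<lambda>i. X i q) ` {..<k}) = D q)"
  using pc chart_open[OF c'] by (intro exI[of _ "chart_dom c"] exI[of _ k] exI[of _ X]) simp
qed

context
 fixes M :: "('m, 'e::euclidean_space) charted_space" and F :: "('m, 'e) foliation_atlas"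
 assumes M: "smooth_atlas M" and fol: "foliation M F"
begin

lemma foliated_chartD:
 assumes "(c, W) \<in> F"
 shows "smooth_chart M c" "subspace W" "W \<subseteq> model c"
 using assms fol by (auto simp: foliation_def smooth_chart_def)

lemma foliated_cover:
 assumes "p \<in> points M"
 shows "\<exists>c W. (c, W) \<in> F \<and> p \<in> chart_dom c"
proof -
 have "p \<in> (\<Union>(c, W)\<in>F. chart_dom c)" using fol assms by (simp add: foliation_def)
 then show ?thesis by auto
qed

lemma foliated_transition:
 assumes "(c, W) \<in> F" "(d, W') \<in> F" "p \<in> chart_dom c" "p \<in> chart_dom d"
 shows "\<exists>U. openin (topo M) U \<and> p \<in> U \<and> U \<subseteq> chart_dom c \<inter> chart_dom d \<and>
     (\<forall>q\<in>U. \<forall>q'\<in>U. chart_map c q - chart_map c q' \<in> W \<longrightarrow> chart_map d q - chart_map d q' \<in> W')"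
proof -
 have "\<forall>x\<in>F. \<forall>y\<in>F. case x of (c, W) \<Rightarrow> case y of (d, W') \<Rightarrow> \<forall>p\<in>chart_dom c \<inter> chart_dom d.
    \<exists>U. openin (topo M) U \<and> p \<in> U \<and> U \<subseteq> chart_dom c \<inter> chart_dom d \<and>
     (\<forall>q\<in>U. \<forall>q'\<in>U. chart_map c q - chart_map c q' \<in> W \<longrightarrow> chart_map d q - chart_map d q' \<in> W')"
  using fol unfolding foliation_def by (elim conjE) (simp add: case_prod_beta)
 from bspec[OF bspec[OF this assms(1)] assms(2)] show ?thesis using assms(3,4) by simp
qed

text \<open>The definition of a foliation atlas constrains coordinate differences only; differentiating it along a line
  in \<open>W\<close> gives the statement about tangent vectors.\<close>
lemma leaf_direction_chart_independent:
 assumes c: "(c, W) \<in> F" and d: "(d, W') \<in> F" and p: "p \<in> chart_dom c" "p \<in> chart_dom d"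
  and v: "v \<in> tangent_space M p" and vW: "chart_coords c v \<in> W"
 shows "chart_coords d v \<in> W'"
proof -
 note c1 = foliated_chartD[OF c] and d1 = foliated_chartD[OF d]
 note c' = smooth_chartD[OF c1(1)] and d' = smooth_chartD[OF d1(1)]
 obtain U where U: "openin (topo M) U" "p \<in> U" "U \<subseteq> chart_dom c \<inter> chart_dom d"
  and UW: "\<And>q q'. q \<in> U ==> q' \<in> U ==> chart_map c q - chart_map c q' \<in> W ==> chart_map d q - chart_map d q' \<in> W'"
  using foliated_transition[OF c d p] by blast
 let ?\<tau> = "\<lambda>x. chart_map d (cinv c x)" and ?x = "chart_map c p" and ?R = "\<lambda>z. z - proj W' z"
 define w where "w = chart_coords c v"
 have W: "w \<in> W" and wE: "w \<in> model c" using vW c1(3) by (auto simp: w_def)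
 have v_eq: "chart_vec M c p w = v" unfolding w_def by (rule chart_coords_tangent(2)[OF M c1(1) p(1) v])
 have xU: "?x \<in> creg c U" by (rule map_creg[OF c' p(1) U(2)])
 let ?A = "{t. ?x + t *\<^sub>R w \<in> creg c U}"
 have oA: "open ?A"
  using open_vimage[OF open_creg[OF c' U(1)], of "\<lambda>t. ?x + t *\<^sub>R w"] by (simp add: vimage_def continuous_intros)
 have A0: "0 \<in> ?A" using xU by simp
 have R0: "?R (?\<tau> (?x + t *\<^sub>R w)) = ?R (chart_map d p)" if t: "t \<in> ?A" for t
 proof -
  have z: "?x + t *\<^sub>R w \<in> creg c U" using t by simp
  let ?q = "cinv c (?x + t *\<^sub>R w)"
  have qU: "?q \<in> U" by (rule cinv_creg(1)[OF c' z])
  have "?x + t *\<^sub>R w \<in> model c"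
   using chart_map_model[OF c' p(1)] wE chart_subspace[OF c'] by (simp add: subspace_add subspace_scale)
  then have "chart_map c ?q - chart_map c p = t *\<^sub>R w"
   using cinv_creg(3)[OF c' z] proj_id[OF chart_subspace[OF c']] by simp
  then have "chart_map d ?q - chart_map d p \<in> W'" using UW[OF qU U(2)] subspace_scale[OF c1(2) W] by simp
  then have "?R (chart_map d ?q - chart_map d p) = 0" by (rule linear_proj_complement(3)[OF d1(2)])
  then show ?thesis
   unfolding linear_diff[OF linear_proj[OF d1(2)], of "chart_map d ?q" "chart_map d p"] by (simp add: algebra_simps)
 qed
 have xd: "?x \<in> creg c (chart_dom d)" by (rule map_creg[OF c' p])
 note hd = Cinf_has_derivative[OF transition[OF M c1(1) d1(1)] xd]
 have l0: "((\<lambda>t. ?x + t *\<^sub>R w) has_derivative (\<lambda>s. s *\<^sub>R w)) (at 0)" by (auto intro!: derivative_eq_intros)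
 have hd': "(?\<tau> has_derivative Dd ?\<tau> ?x) (at (?x + 0 *\<^sub>R w))" using hd by simp
 note h2 = bounded_linear.has_derivative[OF linear_proj_complement(1)[OF d1(2)] has_derivative_compose[OF l0 hd']]
 have "((\<lambda>t. ?R (chart_map d p)) has_derivative (\<lambda>s. ?R (Dd ?\<tau> ?x (s *\<^sub>R w)))) (at 0)"
  by (rule has_derivative_transform_within_open[OF h2 oA A0 R0])
 from has_derivative_unique[OF this has_derivative_const] have "?R (Dd ?\<tau> ?x (1 *\<^sub>R w)) = 0" by (rule fun_cong)
 then have *: "Dd ?\<tau> ?x w \<in> W'" using linear_proj_complement(2)[OF d1(2)] by simp
 note ch = chart_vec_change[OF M c1(1) d1(1) p wE]
 have "chart_coords d (chart_vec M c p w) = Dd ?\<tau> ?x w"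
  unfolding ch(2) by (rule chart_coords_vec[OF M d1(1) p(2) ch(1)])
 then show ?thesis using * v_eq by simp
qed

lemma foliation_tangent_chart:
 assumes "(c, W) \<in> F" "p \<in> chart_dom c" "v \<in> tangent_space M p"
 shows "v \<in> foliation_tangent M F p \<longleftrightarrow> chart_coords c v \<in> W"
 unfolding foliation_tangent_def using assms leaf_direction_chart_independent[OF _ assms(1) _ assms(2,3)] by blast

end

section \<open>The leaf topology\<close>

definition plaque :: "('m, 'e::euclidean_space) chart \<Rightarrow> 'e set \<Rightarrow> 'm set \<Rightarrow> 'm \<Rightarrow> 'm set" where
 "plaque c W U p = {q \<in> U. chart_map c q - chart_map c p \<in> W}"

text \<open>Coordinates on the plaque through \<open>p\<close>, as a map from \<open>W\<close> to \<open>M\<close>.\<close>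
definition slide :: "('m, 'e::euclidean_space) chart \<Rightarrow> 'm \<Rightarrow> 'e \<Rightarrow> 'm" where
 "slide c p w = cinv c (chart_map c p + w)"

definition leaf_chart :: "'m set \<Rightarrow> ('m, 'e::euclidean_space) chart \<Rightarrow> 'e set \<Rightarrow> 'm \<Rightarrow> ('m, 'e) chart" where
 "leaf_chart L c W p = Chart {q \<in> chart_dom c \<inter> L. chart_map c q - chart_map c p \<in> W}
   (\<lambda>q. chart_map c q - chart_map c p) W"

lemma leaf_chart_sel:
 "chart_dom (leaf_chart L c W p) = {q \<in> chart_dom c \<inter> L. chart_map c q - chart_map c p \<in> W}"
 "chart_map (leaf_chart L c W p) = (\<lambda>q. chart_map c q - chart_map c p)"
 "model (leaf_chart L c W p) = W"
 by (simp_all add: leaf_chart_def)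

context
 fixes M :: "('m, 'e::euclidean_space) charted_space" and F :: "('m, 'e) foliation_atlas"
 assumes M: "smooth_atlas M" and fol: "foliation M F"
begin

private abbreviation "T \<equiv> leaf_topology M F"

lemma plaque_open:
 assumes "(c, W) \<in> F" "openin (topo M) U" "U \<subseteq> chart_dom c" "p \<in> U"
 shows "openin T (plaque c W U p)"
 unfolding leaf_topology_def plaque_def openin_topology_generated_by_iff
 by (rule generate_topology_on.Basis) (use assms in blast)

lemma plaque_self:
 assumes "(c, W) \<in> F" "p \<in> U"
 shows "p \<in> plaque c W U p"
 using assms subspace_0[OF foliated_chartD(2)[OF M fol assms(1)]] by (simp add: plaque_def)

lemma leaf_topspace: "topspace T = points M"
proof
 show "topspace T \<subseteq> points M"
  unfolding leaf_topology_def topology_generated_by_topspace points_def using openin_subset by fastforce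
 show "points M \<subseteq> topspace T"
 proof
  fix p assume "p \<in> points M"
  then obtain c W where c: "(c, W) \<in> F" "p \<in> chart_dom c" using foliated_cover[OF M fol] by blast
  have "openin T (plaque c W (chart_dom c) p)"
   by (rule plaque_open[OF c(1) chart_open[OF smooth_chartD[OF foliated_chartD(1)[OF M fol c(1)]]] subset_refl c(2)])
  then show "p \<in> topspace T" using plaque_self[OF c] openin_subset by blast
 qed
qed

text \<open>Plaques through a point in one fixed chart form a neighbourhood base of the leaf topology. For the generating
  sets this is the compatibility of foliated charts, and finite intersections and unions preserve it.\<close>
lemma plaque_basis:
 assumes O: "openin T O'" and q: "q \<in> O'" and c: "(c, W) \<in> F" and qc: "q \<in> chart_dom c"
 shows "\<exists>U. openin (topo M) U \<and> q \<in> U \<and> U \<subseteq> chart_dom c \<and> plaque c W U q \<subseteq> O'"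
proof -
 have "generate_topology_on {{q \<in> U. chart_map c q - chart_map c p \<in> W} | c W U p.
    (c, W) \<in> F \<and> openin (topo M) U \<and> U \<subseteq> chart_dom c \<and> p \<in> U} O'"
  using O unfolding leaf_topology_def openin_topology_generated_by_iff .
 then show ?thesis using q
 proof (induction O' rule: generate_topology_on.induct)
  case Empty
  then show ?case by simp
 next
  case (Int a b)
  obtain U1 where U1: "openin (topo M) U1" "q \<in> U1" "U1 \<subseteq> chart_dom c" "plaque c W U1 q \<subseteq> a"
   using Int.IH(1) Int.prems by blast
  obtain U2 where U2: "openin (topo M) U2" "q \<in> U2" "U2 \<subseteq> chart_dom c" "plaque c W U2 q \<subseteq> b"
   using Int.IH(2) Int.prems by blast
  have "plaque c W (U1 \<inter> U2) q \<subseteq> a \<inter> b" using U1(4) U2(4) by (auto simp: plaque_def)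
  then show ?case using U1 U2 by (intro exI[of _ "U1 \<inter> U2"]) (simp add: openin_Int le_infI1)
 next
  case (UN K)
  then obtain k where k: "k \<in> K" "q \<in> k" by blast
  obtain U where U: "openin (topo M) U" "q \<in> U" "U \<subseteq> chart_dom c" "plaque c W U q \<subseteq> k"
   using UN.IH[OF k] by blast
  then show ?case using k by (intro exI[of _ U]) blast
 next
  case (Basis s)
  then obtain d W' U p where d: "(d, W') \<in> F" "openin (topo M) U" "U \<subseteq> chart_dom d" "p \<in> U"
   and s: "s = {q \<in> U. chart_map d q - chart_map d p \<in> W'}" by blast
  have qU: "q \<in> U" and qW: "chart_map d q - chart_map d p \<in> W'" using Basis.prems by (auto simp: s)
  have qd: "q \<in> chart_dom d" using qU d by blast
  obtain V where V: "openin (topo M) V" "q \<in> V" "V \<subseteq> chart_dom c \<inter> chart_dom d"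
   and VW: "\<And>q q'. q \<in> V ==> q' \<in> V ==> chart_map c q - chart_map c q' \<in> W ==> chart_map d q - chart_map d q' \<in> W'"
   using foliated_transition[OF M fol c d(1) qc qd] by blast
  have "r \<in> s" if r: "r \<in> plaque c W (U \<inter> V) q" for r
  proof -
   have "chart_map d r - chart_map d q \<in> W'" using r V(2) by (intro VW) (auto simp: plaque_def)
   from subspace_add[OF foliated_chartD(2)[OF M fol d(1)] this qW] show ?thesis
    using r by (simp add: s plaque_def)
  qed
  then show ?case using V(1-3) d(2) qU by (intro exI[of _ "U \<inter> V"]) (auto intro: openin_Int)
 qed
qed

lemma leaf_topology_finer:
 assumes U: "openin (topo M) U"
 shows "openin T U"
proof (subst openin_subopen, intro ballI)
 fix q assume q: "q \<in> U"
 then have "q \<in> points M" using openin_subset[OF U] by (auto simp: points_def)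
 then obtain c W where c: "(c, W) \<in> F" "q \<in> chart_dom c" using foliated_cover[OF M fol] by blast
 note c' = smooth_chartD[OF foliated_chartD(1)[OF M fol c(1)]]
 have "openin T (plaque c W (U \<inter> chart_dom c) q)"
  by (rule plaque_open[OF c(1) openin_Int[OF U chart_open[OF c']]]) (use c q in auto)
 moreover have "q \<in> plaque c W (U \<inter> chart_dom c) q" by (rule plaque_self[OF c(1)]) (use c q in blast)
 ultimately show "\<exists>P. openin T P \<and> q \<in> P \<and> P \<subseteq> U" by (auto simp: plaque_def)
qed

lemma slide:
 assumes c: "(c, W) \<in> F" and p: "p \<in> chart_dom c" and w: "w \<in> W" and wU: "chart_map c p + w \<in> creg c U"
 shows "slide c p w \<in> U" "slide c p w \<in> chart_dom c" "chart_map c (slide c p w) = chart_map c p + w"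
proof -
 note c1 = foliated_chartD[OF M fol c]
 note c' = smooth_chartD[OF c1(1)]
 have "chart_map c p + w \<in> model c"
  using chart_map_model[OF c' p] c1(3) w by (blast intro: subspace_add[OF chart_subspace[OF c']])
 then show "chart_map c (slide c p w) = chart_map c p + w"
  using cinv_creg(3)[OF c' wU] proj_id[OF chart_subspace[OF c']] by (simp add: slide_def)
 show "slide c p w \<in> U" "slide c p w \<in> chart_dom c"
  using cinv_creg(1,2)[OF c' wU] by (simp_all add: slide_def)
qed

lemma slide_chart_map:
 assumes c: "(c, W) \<in> F" and q: "q \<in> chart_dom c"
 shows "slide c p (chart_map c q - chart_map c p) = q"
 using cinv_map[OF smooth_chartD[OF foliated_chartD(1)[OF M fol c]] q] by (simp add: slide_def)

lemma slide_continuous: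
 assumes c: "(c, W) \<in> F" and p: "p \<in> chart_dom c"
 shows "continuous_map (top_of_set {w \<in> W. chart_map c p + w \<in> creg c (chart_dom c)}) T (slide c p)"
proof -
 note c1 = foliated_chartD[OF M fol c]
 note c' = smooth_chartD[OF c1(1)]
 let ?S = "{w \<in> W. chart_map c p + w \<in> creg c (chart_dom c)}"
 show ?thesis unfolding continuous_map_def
 proof (intro conjI allI impI)
  show "slide c p \<in> topspace (top_of_set ?S) \<rightarrow> topspace T"
   using slide(2)[OF c p] chart_dom_topspace[OF c'] by (auto simp: leaf_topspace points_def)
  fix O' assume O: "openin T O'"
  show "openin (top_of_set ?S) {w \<in> topspace (top_of_set ?S). slide c p w \<in> O'}"
  proof (subst openin_subopen, intro ballI)
   fix w0 assume "w0 \<in> {w \<in> topspace (top_of_set ?S). slide c p w \<in> O'}"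
   then have w0: "w0 \<in> W" "chart_map c p + w0 \<in> creg c (chart_dom c)" "slide c p w0 \<in> O'" by auto
   note q0 = slide[OF c p w0(1,2)]
   obtain U where U: "openin (topo M) U" "slide c p w0 \<in> U" "U \<subseteq> chart_dom c" "plaque c W U (slide c p w0) \<subseteq> O'"
    using plaque_basis[OF O w0(3) c q0(1)] by blast
   let ?V = "{w. chart_map c p + w \<in> creg c U}"
   have oV: "open ?V"
    using open_vimage[OF open_creg[OF c' U(1)], of "\<lambda>w. chart_map c p + w"] by (simp add: vimage_def continuous_intros)
   have "slide c p w \<in> O'" if w: "w \<in> ?S \<inter> ?V" for w
   proof -
    have w': "w \<in> W" "chart_map c p + w \<in> creg c U" using w by auto
    note s = slide[OF c p w']
    have "chart_map c (slide c p w) - chart_map c (slide c p w0) = w - w0" using s(3) q0(3) by simp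
    then have "slide c p w \<in> plaque c W U (slide c p w0)"
     using s(1) subspace_diff[OF c1(2) w'(1) w0(1)] by (simp add: plaque_def)
    then show ?thesis using U(4) by blast
   qed
   moreover have "w0 \<in> ?V" using creg_sub[OF c' w0(2)] U(2) by (simp add: slide_def)
   ultimately show "\<exists>P. openin (top_of_set ?S) P \<and> w0 \<in> P \<and> P \<subseteq> {w \<in> topspace (top_of_set ?S). slide c p w \<in> O'}"
    using w0 openin_open_Int[OF oV, of ?S] by (intro exI[of _ "?S \<inter> ?V"]) auto
  qed
 qed
qed

text \<open>The leaf topology is locally connected: a plaque of a small ball is the continuous image of a convex set.\<close>
lemma leaf_open:
 assumes L: "L \<in> leaves M F"
 shows "openin T L"
proof (subst openin_subopen, intro ballI)
 fix q assume q: "q \<in> L"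
 have "L \<subseteq> topspace T" using L unfolding leaves_def by (rule connected_components_of_subset)
 then have "q \<in> points M" using q leaf_topspace by blast
 then obtain c W where c: "(c, W) \<in> F" "q \<in> chart_dom c" using foliated_cover[OF M fol] by blast
 note c1 = foliated_chartD[OF M fol c(1)]
 note c' = smooth_chartD[OF c1(1)]
 obtain r where r: "r > 0" "ball (chart_map c q) r \<subseteq> creg c (chart_dom c)"
  using open_creg[OF c' chart_open[OF c']] map_creg[OF c' c(2) c(2)] open_contains_ball by blast
 define U where "U = {q' \<in> chart_dom c. chart_map c q' \<in> ball (chart_map c q) r}"
 have oU: "openin (topo M) U" unfolding U_def by (rule chart_preimage_open[OF c' open_ball])
 have qU: "q \<in> U" using c(2) r(1) by (simp add: U_def)
 let ?P = "plaque c W U q"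
 let ?S = "{w \<in> W. chart_map c q + w \<in> creg c (chart_dom c)}"
 have S: "W \<inter> ball 0 r \<subseteq> ?S" using r(2) by (auto simp: dist_norm)
 have "?P = slide c q ` (W \<inter> ball 0 r)"
 proof
  show "?P \<subseteq> slide c q ` (W \<inter> ball 0 r)"
  proof
   fix x assume x: "x \<in> ?P"
   then have "chart_map c x - chart_map c q \<in> W \<inter> ball 0 r" by (simp add: plaque_def U_def dist_norm norm_minus_commute)
   moreover have "x = slide c q (chart_map c x - chart_map c q)"
    using slide_chart_map[OF c(1), of x q] x by (simp add: plaque_def U_def)
   ultimately show "x \<in> slide c q ` (W \<inter> ball 0 r)" by (rule rev_image_eqI)
  qed
  show "slide c q ` (W \<inter> ball 0 r) \<subseteq> ?P"
  proof (rule image_subsetI)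
   fix w assume w: "w \<in> W \<inter> ball 0 r"
   then have "w \<in> W" "chart_map c q + w \<in> creg c (chart_dom c)" using S by auto
   from slide[OF c(1,2) this] show "slide c q w \<in> ?P" using w by (simp add: plaque_def U_def dist_norm)
  qed
 qed
 moreover have "connected (W \<inter> ball 0 r)"
  by (intro convex_connected convex_Int convex_ball subspace_imp_convex c1(2))
 then have "connectedin (top_of_set ?S) (W \<inter> ball 0 r)" using S by (simp add: connectedin_subtopology)
 then have "connectedin T (slide c q ` (W \<inter> ball 0 r))"
  by (rule connectedin_continuous_map_image[OF slide_continuous[OF c]])
 ultimately have con: "connectedin T ?P" by simp
 have qP: "q \<in> ?P" by (rule plaque_self[OF c(1) qU])
 have "?P \<subseteq> L"
  by (rule connected_components_of_maximal[OF L[unfolded leaves_def] con]) (use q qP in \<open>auto simp: disjnt_iff\<close>)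
 moreover have "openin T ?P" by (rule plaque_open[OF c(1) oU _ qU]) (simp add: U_def)
 ultimately show "\<exists>P. openin T P \<and> q \<in> P \<and> P \<subseteq> L" using qP by blast
qed

section \<open>Leaves as manifolds\<close>

context
 fixes L :: "'m set"
 assumes L: "L \<in> leaves M F"
begin

private abbreviation "N \<equiv> leaf_space M F L"

lemma leaf_points: "points N = L" "L \<subseteq> points M"
proof -
 have "L \<subseteq> topspace T" using L unfolding leaves_def by (rule connected_components_of_subset)
 then show "points N = L" "L \<subseteq> points M" by (auto simp: points_def leaf_space_def leaf_topspace[unfolded points_def])
qed

lemma leaf_openin: "openin (topo N) U \<longleftrightarrow> openin T U \<and> U \<subseteq> L"
 by (simp add: leaf_space_def openin_open_subtopology[OF leaf_open[OF L]])

lemma leaf_atlas: "atlas N = {leaf_chart L c W p | c W p. (c, W) \<in> F \<and> p \<in> chart_dom c \<inter> L}"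
 by (simp add: leaf_space_def leaf_chart_def)

lemma leaf_openin_Int: "openin (topo M) U ==> openin (topo N) (U \<inter> L)"
 unfolding leaf_openin using leaf_topology_finer leaf_open[OF L] by (blast intro: openin_Int)

context
 fixes c W p
 assumes c: "(c, W) \<in> F" and p: "p \<in> chart_dom c" "p \<in> L"
begin

private abbreviation "lc \<equiv> leaf_chart L c W p"

lemma leaf_is_chart: "is_chart (topo N) lc"
proof -
 note c1 = foliated_chartD[OF M fol c]
 note c' = smooth_chartD[OF c1(1)]
 \<comment> \<open>A single slice is open in the leaf topology, being a union of plaques.\<close>
 have open_V: "openin (topo N) {q \<in> chart_dom c \<inter> L. chart_map c q - chart_map c p \<in> W \<and> chart_map c q - chart_map c p \<in> V}"
  if V: "open V" for V
 proof -
  have "openin T {q \<in> chart_dom c \<inter> L. chart_map c q - chart_map c p \<in> W \<and> chart_map c q - chart_map c p \<in> V}" (is "openin T ?O")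
  proof (subst openin_subopen, intro ballI)
   fix q assume q: "q \<in> ?O"
   let ?V = "{x. x - chart_map c p \<in> V}"
   let ?U = "{q \<in> chart_dom c. chart_map c q \<in> ?V}"
   have "open ?V" using open_vimage[OF V, of "\<lambda>x. x - chart_map c p"] by (simp add: vimage_def continuous_intros)
   then have oU: "openin (topo M) ?U" by (rule chart_preimage_open[OF c'])
   have qU: "q \<in> ?U" using q by auto
   let ?P = "plaque c W ?U q \<inter> L"
   have "openin T ?P" by (rule openin_Int[OF plaque_open[OF c oU _ qU] leaf_open[OF L]]) auto
   moreover have "q \<in> ?P" using plaque_self[OF c qU] q by simp
   moreover have "?P \<subseteq> ?O"
   proof
    fix r assume r: "r \<in> ?P"
    have "(chart_map c r - chart_map c q) + (chart_map c q - chart_map c p) \<in> W"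
     by (rule subspace_add[OF c1(2)]) (use r q in \<open>auto simp: plaque_def\<close>)
    then show "r \<in> ?O" using r by (simp add: plaque_def)
   qed
   ultimately show "\<exists>P. openin T P \<and> q \<in> P \<and> P \<subseteq> ?O" by blast
  qed
  then show ?thesis by (auto simp: leaf_openin)
 qed
 show ?thesis unfolding leaf_chart_def
 proof (rule is_chartI)
  show "openin (topo N) {q \<in> chart_dom c \<inter> L. chart_map c q - chart_map c p \<in> W}" using open_V[OF open_UNIV] by simp
  show "subspace W" by (rule c1(2))
  show "inj_on (\<lambda>q. chart_map c q - chart_map c p) {q \<in> chart_dom c \<inter> L. chart_map c q - chart_map c p \<in> W}"
   using chart_inj[OF c'] by (auto simp: inj_on_def)
  show "openin (topo N) {q \<in> {q \<in> chart_dom c \<inter> L. chart_map c q - chart_map c p \<in> W}. chart_map c q - chart_map c p \<in> V}"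
   if "open V" for V using open_V[OF that] by (simp add: conj_ac)
  fix U assume U: "openin (topo N) U" and Ud: "U \<subseteq> {q \<in> chart_dom c \<inter> L. chart_map c q - chart_map c p \<in> W}"
  show "openin (top_of_set W) ((\<lambda>q. chart_map c q - chart_map c p) ` U)"
  proof (subst openin_subopen, intro ballI)
   fix x assume "x \<in> (\<lambda>q. chart_map c q - chart_map c p) ` U"
   then obtain q where q: "q \<in> U" "x = chart_map c q - chart_map c p" by blast
   have qc: "q \<in> chart_dom c" and xW: "x \<in> W" using q Ud by auto
   have TU: "openin T U" using U by (simp add: leaf_openin)
   obtain U' where U': "openin (topo M) U'" "q \<in> U'" "U' \<subseteq> chart_dom c" "plaque c W U' q \<subseteq> U"
    using plaque_basis[OF TU q(1) c qc] by blast
   let ?V = "{w. chart_map c p + w \<in> creg c U'}"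
   have oV: "open ?V"
    using open_vimage[OF open_creg[OF c' U'(1)], of "\<lambda>w. chart_map c p + w"] by (simp add: vimage_def continuous_intros)
   have "W \<inter> ?V \<subseteq> (\<lambda>q. chart_map c q - chart_map c p) ` U"
   proof
    fix w assume w: "w \<in> W \<inter> ?V"
    then have w': "w \<in> W" "chart_map c p + w \<in> creg c U'" by auto
    note s = slide[OF c p(1) w']
    have "chart_map c (slide c p w) - chart_map c q = w - x" using s(3) q(2) by simp
    then have "slide c p w \<in> plaque c W U' q" using s(1) subspace_diff[OF c1(2) w'(1) xW] by (simp add: plaque_def)
    then have "slide c p w \<in> U" using U'(4) by blast
    moreover have "w = chart_map c (slide c p w) - chart_map c p" using s(3) by simp
    ultimately show "w \<in> (\<lambda>q. chart_map c q - chart_map c p) ` U" by (rule rev_image_eqI)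
   qed
   moreover have "x \<in> W \<inter> ?V" using xW map_creg[OF c' qc U'(2)] q(2) by simp
   ultimately show "\<exists>P. openin (top_of_set W) P \<and> x \<in> P \<and> P \<subseteq> (\<lambda>q. chart_map c q - chart_map c p) ` U"
    using openin_open_Int[OF oV, of W] by blast
  qed
 qed
qed

lemma leaf_creg:
 assumes x: "x \<in> creg lc U"
 shows "cinv lc x = cinv c (chart_map c p + proj W x)" "chart_map c p + proj W x \<in> creg c U"
proof -
 note c' = smooth_chartD[OF foliated_chartD(1)[OF M fol c]]
 obtain q where q: "q \<in> chart_dom lc" "q \<in> U" "proj W x = chart_map lc q"
  using x by (auto simp: creg_def leaf_chart_sel)
 have qc: "q \<in> chart_dom c" and e: "chart_map c p + proj W x = chart_map c q" using q by (auto simp: leaf_chart_sel)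
 have "cinv lc x = q"
  unfolding cinv_def leaf_chart_sel(3) q(3) by (rule chart_inv_map[OF leaf_is_chart q(1)])
 then show "cinv lc x = cinv c (chart_map c p + proj W x)" using cinv_map[OF c' qc] e by simp
 show "chart_map c p + proj W x \<in> creg c U" unfolding e by (rule map_creg[OF c' qc q(2)])
qed

end

lemma leaf_compatible:
 assumes c: "(c, W) \<in> F" "p \<in> chart_dom c" "p \<in> L" and d: "(d, W') \<in> F" "p' \<in> chart_dom d" "p' \<in> L"
 shows "smooth_on (chart_map (leaf_chart L c W p) ` (chart_dom (leaf_chart L c W p) \<inter> chart_dom (leaf_chart L d W' p')))
  (chart_map (leaf_chart L d W' p') \<circ> chart_inv (leaf_chart L c W p))"
proof (rule smooth_onI)
 note c1 = foliated_chartD[OF M fol c(1)] and d1 = foliated_chartD[OF M fol d(1)]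
 note c' = smooth_chartD[OF c1(1)] and d' = smooth_chartD[OF d1(1)]
 let ?lc = "leaf_chart L c W p" and ?lc' = "leaf_chart L d W' p'"
 fix x assume "x \<in> chart_map ?lc ` (chart_dom ?lc \<inter> chart_dom ?lc')"
 then obtain q where q: "q \<in> chart_dom ?lc" "q \<in> chart_dom ?lc'" "x = chart_map ?lc q" by blast
 have qc: "q \<in> chart_dom c" and qd: "q \<in> chart_dom d" using q by (auto simp: leaf_chart_sel)
 let ?V = "{w. chart_map c p + w \<in> creg c (chart_dom d)}"
 let ?h = "\<lambda>w. chart_map d (cinv c (chart_map c p + w)) - chart_map d p'"
 have oV: "open ?V"
  using open_vimage[OF open_creg[OF c' chart_open[OF d']], of "\<lambda>w. chart_map c p + w"] by (simp add: vimage_def continuous_intros)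
 have "Cinf ?V (\<lambda>w. (\<lambda>x. chart_map d (cinv c x)) (chart_map c p + w))"
  by (rule Cinf_compose[where g = "\<lambda>x. chart_map d (cinv c x)" and f = "\<lambda>w. chart_map c p + w", OF transition[OF M c1(1) d1(1)]])
   (auto intro: Cinf_add[OF Cinf_const[OF oV] Cinf_id[OF oV]])
 then have h: "Cinf ?V ?h" by (intro Cinf_diff Cinf_const[OF oV])
 have "?h y = (chart_map ?lc' \<circ> chart_inv ?lc) y" if "y \<in> chart_map ?lc ` (chart_dom ?lc \<inter> chart_dom ?lc')" for y
 proof -
  obtain r where r: "r \<in> chart_dom ?lc" "y = chart_map ?lc r" using \<open>y \<in> _\<close> by blast
  have rc: "r \<in> chart_dom c" using r by (simp add: leaf_chart_sel)
  have "chart_inv ?lc y = r" unfolding r(2) by (rule chart_inv_map[OF leaf_is_chart[OF c] r(1)])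
  moreover have "cinv c (chart_map c p + y) = r" using r(2) cinv_map[OF c' rc] by (simp add: leaf_chart_sel)
  ultimately show ?thesis by (simp add: leaf_chart_sel)
 qed
 moreover have "x \<in> ?V" using q(3) map_creg[OF c' qc qd] by (simp add: leaf_chart_sel)
 ultimately show "\<exists>V h. x \<in> V \<and> Cinf V h \<and> (\<forall>y\<in>V \<inter> chart_map ?lc ` (chart_dom ?lc \<inter> chart_dom ?lc').
   h y = (chart_map ?lc' \<circ> chart_inv ?lc) y)"
  using h by (intro exI[of _ ?V] exI[of _ ?h]) blast
qed

lemma leaf_smooth_atlas: "smooth_atlas N"
 unfolding smooth_atlas_def
proof (intro conjI ballI)
 show "is_chart (topo N) k" if "k \<in> atlas N" for k
 proof -
  obtain c W p where k: "k = leaf_chart L c W p" "(c, W) \<in> F" "p \<in> chart_dom c \<inter> L" using \<open>k \<in> _\<close> unfolding leaf_atlas by blast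
  show ?thesis unfolding k(1) by (rule leaf_is_chart) (use k in auto)
 qed
 show "compatible k l" if "k \<in> atlas N" "l \<in> atlas N" for k l
 proof -
  obtain c W p where k: "k = leaf_chart L c W p" "(c, W) \<in> F" "p \<in> chart_dom c" "p \<in> L" using \<open>k \<in> _\<close> unfolding leaf_atlas by blast
  obtain d W' p' where l: "l = leaf_chart L d W' p'" "(d, W') \<in> F" "p' \<in> chart_dom d" "p' \<in> L" using \<open>l \<in> _\<close> unfolding leaf_atlas by blast
  show ?thesis unfolding compatible_def k(1) l(1)
   using leaf_compatible[OF k(2-4) l(2-4)] leaf_compatible[OF l(2-4) k(2-4)] by (simp add: Int_commute)
 qed
 show "\<Union> (chart_dom ` atlas N) = points N"
 proof
  show "\<Union> (chart_dom ` atlas N) \<subseteq> points N" unfolding leaf_atlas leaf_points by (auto simp: leaf_chart_sel)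
  show "points N \<subseteq> \<Union> (chart_dom ` atlas N)"
  proof
   fix q assume "q \<in> points N"
   then have q: "q \<in> L" "q \<in> points M" using leaf_points by auto
   obtain c W where c: "(c, W) \<in> F" "q \<in> chart_dom c" using foliated_cover[OF M fol q(2)] by blast
   have "q \<in> chart_dom (leaf_chart L c W q)"
    using c q subspace_0[OF foliated_chartD(2)[OF M fol c(1)]] by (simp add: leaf_chart_sel)
   moreover have "leaf_chart L c W q \<in> atlas N" unfolding leaf_atlas using c q by blast
   ultimately show "q \<in> \<Union> (chart_dom ` atlas N)" by blast
  qed
 qed
qed

lemma leaf_smooth_chart:
 assumes "(c, W) \<in> F" "p \<in> chart_dom c" "p \<in> L"
 shows "smooth_chart N (leaf_chart L c W p)"
 by (rule smooth_atlas_chart[OF leaf_smooth_atlas]) (use assms in \<open>auto simp: leaf_atlas\<close>)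

text \<open>Inclusions of leaves are smooth.\<close>
lemma smooth_fun_leaf:
 assumes f: "smooth_fun_on M U f"
 shows "smooth_fun_on N (U \<inter> L) f"
proof (rule smooth_fun_on_atlasI[OF leaf_smooth_atlas leaf_openin_Int[OF smooth_fun_open[OF f]]])
 fix k assume "k \<in> atlas N"
 then obtain c W p where k: "k = leaf_chart L c W p" "(c, W) \<in> F" "p \<in> chart_dom c" "p \<in> L" unfolding leaf_atlas by blast
 note c1 = foliated_chartD[OF M fol k(2)]
 let ?S = "creg k (U \<inter> L)"
 have oS: "open ?S"
  unfolding k(1) by (rule open_creg[OF leaf_is_chart[OF k(2-4)] leaf_openin_Int[OF smooth_fun_open[OF f]]])
 have "?S \<subseteq> creg k U" unfolding k(1) by (rule creg_mono[OF leaf_is_chart[OF k(2-4)]]) simp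
 then have im: "chart_map c p + proj W x \<in> creg c U" if "x \<in> ?S" for x
  using leaf_creg(2)[OF k(2-4), of x U] that unfolding k(1) by blast
 have "Cinf ?S (\<lambda>x. (\<lambda>y. f (cinv c y)) (chart_map c p + proj W x))"
  by (rule Cinf_compose[where g = "\<lambda>y. f (cinv c y)" and f = "\<lambda>x. chart_map c p + proj W x",
     OF smooth_fun_rep[OF M c1(1) f] Cinf_add[OF Cinf_const[OF oS] Cinf_proj[OF c1(2) oS]] im])
 then show "Cinf ?S (\<lambda>x. f (cinv k x))"
  by (rule Cinf_cong) (use leaf_creg(1)[OF k(2-4)] in \<open>simp add: k(1)\<close>)
qed

lemma smooth_near_leaf:
 assumes "p \<in> L" "smooth_near M p f"
 shows "smooth_near N p f"
 using assms smooth_fun_leaf smooth_nearI[OF leaf_smooth_atlas] unfolding smooth_near_def by blast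

text \<open>In corresponding charts the differential of the inclusion of a leaf is the inclusion of \<open>W\<close> into the model.\<close>
lemma leaf_incl_chart_vec:
 assumes c: "(c, W) \<in> F" and p: "p \<in> chart_dom c" "p \<in> L" and q: "q \<in> chart_dom (leaf_chart L c W p)" and w: "w \<in> W"
 shows "leaf_incl M q (chart_vec N (leaf_chart L c W p) q w) = chart_vec M c q w"
proof
 fix f
 note c1 = foliated_chartD[OF M fol c]
 note c' = smooth_chartD[OF c1(1)]
 let ?lc = "leaf_chart L c W p"
 have qc: "q \<in> chart_dom c" and qL: "q \<in> L" and qW: "chart_map c q - chart_map c p \<in> W" using q by (auto simp: leaf_chart_sel)
 have wE: "w \<in> model c" using w c1(3) by blast
 have wE': "w \<in> model ?lc" using w by (simp add: leaf_chart_sel)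
 show "leaf_incl M q (chart_vec N ?lc q w) f = chart_vec M c q w f"
 proof (cases "smooth_near M q f")
  case False
  then show ?thesis by (simp add: leaf_incl_def chart_vec_nonsmooth[OF M])
 next
  case True
  then obtain U where U: "q \<in> U" "smooth_fun_on M U f" unfolding smooth_near_def by blast
  let ?x = "chart_map ?lc q" and ?S = "creg ?lc U"
  let ?g = "\<lambda>y. f (cinv c y)" and ?a = "\<lambda>x. chart_map c p + proj W x"
  have x: "?a ?x = chart_map c q" using proj_id[OF c1(2) qW] by (simp add: leaf_chart_sel)
  have oS: "open (creg ?lc (U \<inter> L))"
   by (rule open_creg[OF leaf_is_chart[OF c p] leaf_openin_Int[OF smooth_fun_open[OF U(2)]]])
  have xS: "?x \<in> creg ?lc (U \<inter> L)" by (rule map_creg[OF leaf_is_chart[OF c p] q]) (use U qL in blast)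
  have "(?g has_derivative Dd ?g (chart_map c q)) (at (?a ?x))"
   unfolding x by (rule Cinf_has_derivative[OF smooth_fun_rep[OF M c1(1) U(2)] map_creg[OF c' qc U(1)]])
  moreover have "(?a has_derivative (\<lambda>h. 0 + proj W h)) (at ?x)"
   by (intro has_derivative_add has_derivative_const bounded_linear_imp_has_derivative)
    (use linear_proj[OF c1(2)] in \<open>simp add: linear_conv_bounded_linear\<close>)
  ultimately have "((\<lambda>x. ?g (?a x)) has_derivative (\<lambda>h. Dd ?g (chart_map c q) (0 + proj W h))) (at ?x)"
   by (rule has_derivative_compose[rotated])
  then have "((\<lambda>x. f (cinv ?lc x)) has_derivative (\<lambda>h. Dd ?g (chart_map c q) (0 + proj W h))) (at ?x)"
   by (rule has_derivative_transform_within_open[OF _ oS xS]) (simp add: leaf_creg(1)[OF c p])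
  then have "Dd (\<lambda>x. f (cinv ?lc x)) ?x w = Dd ?g (chart_map c q) (0 + proj W w)" by (rule Dd_eqI)
  then show ?thesis
   using True by (simp add: leaf_incl_def chart_vec_apply[OF M c1(1) qc wE True] proj_id[OF c1(2) w]
    chart_vec_apply[OF leaf_smooth_atlas leaf_smooth_chart[OF c p] q wE' smooth_near_leaf[OF qL True]])
 qed
qed

end

end

section \<open>Tensors on leaves\<close>

text \<open>\<open>Y\<close> is a section of \<open>D\<close> on \<open>M\<close> that restricts on \<open>V\<close> to the field \<open>X\<close> of the leaf.\<close>
definition leaf_related :: "('m, 'e::euclidean_space) charted_space \<Rightarrow> ('m \<Rightarrow> 'm tvec set) \<Rightarrow>
  'm set \<Rightarrow> 'm set \<Rightarrow> ('m \<Rightarrow> 'm tvec) \<Rightarrow> ('m \<Rightarrow> 'm tvec) \<Rightarrow> bool" where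
 "leaf_related M D V U X Y \<longleftrightarrow> vector_field_on M U Y \<and> V \<subseteq> U \<and> (\<forall>q\<in>U. Y q \<in> D q) \<and>
   (\<forall>q\<in>V. leaf_incl M q (X q) = Y q)"

lemma leaf_incl_linear:
 "leaf_incl M p (u + v) = leaf_incl M p u + leaf_incl M p v"
 "leaf_incl M p (a *\<^sub>R u) = a *\<^sub>R leaf_incl M p u"
 "leaf_incl M p (u - v) = leaf_incl M p u - leaf_incl M p v"
 "leaf_incl M p (- u) = - leaf_incl M p u"
 "leaf_incl M p 0 = 0"
 by (auto simp: leaf_incl_def scaleR_fun_def fun_eq_iff)

context
 fixes M :: "('m, 'e::euclidean_space) charted_space" and g :: "'m metric" and J :: "'m endo"
  and D :: "'m \<Rightarrow> 'm tvec set" and F :: "('m, 'e) foliation_atlas" and L :: "'m set"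
 assumes M: "smooth_atlas M" and g: "riemannian_metric M g" and J: "integrable_complex M J"
  and gJ: "compatible_metric M g J"
  and tf: "tangent_to_foliation M D F"
  and DJ: "\<And>p v. p \<in> points M ==> v \<in> D p ==> J p v \<in> D p"
  and Dclosed: "\<And>p u v w. p \<in> points M ==> u \<in> D p ==> v \<in> D p ==> w \<in> D p ==> d2 M (fund g J) p u v w = 0"
  and L: "L \<in> leaves M F"
begin

private abbreviation "LL \<equiv> leaf_space M F L"
private abbreviation "incl \<equiv> leaf_incl M"
private abbreviation "J' \<equiv> leaf_endo M F L J"
private abbreviation "g' \<equiv> leaf_metric M g"
private abbreviation "rel \<equiv> leaf_related M D"

lemma leaf_fol: "foliation M F" and leaf_tangent: "p \<in> points M ==> foliation_tangent M F p = D p"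
 using tf by (auto simp: tangent_to_foliation_def)

lemma leaf_atlas_N: "smooth_atlas LL" by (rule leaf_smooth_atlas[OF M leaf_fol L])

lemma leaf_point: "p \<in> L ==> p \<in> points M" "points LL = L"
 using leaf_points[OF M leaf_fol L] by auto

lemma leaf_D_tangent: "p \<in> points M ==> v \<in> D p ==> v \<in> tangent_space M p"
 using leaf_tangent by (auto simp: foliation_tangent_def)

lemma leaf_D_chart:
 assumes "(c, W) \<in> F" "p \<in> chart_dom c" "v \<in> tangent_space M p"
 shows "v \<in> D p \<longleftrightarrow> chart_coords c v \<in> W"
proof -
 have "p \<in> points M"
  using chart_dom_topspace[OF smooth_chartD[OF foliated_chartD(1)[OF M leaf_fol assms(1)]]] assms(2) by (auto simp: points_def)
 then show ?thesis using foliation_tangent_chart[OF M leaf_fol assms] leaf_tangent by simp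
qed

lemma leaf_chart_at:
 assumes "p \<in> L"
 shows "\<exists>c W. (c, W) \<in> F \<and> p \<in> chart_dom c \<and> p \<in> chart_dom (leaf_chart L c W p)"
proof -
 obtain c W where c: "(c, W) \<in> F" "p \<in> chart_dom c" using foliated_cover[OF M leaf_fol leaf_point(1)[OF assms]] by blast
 have "p \<in> chart_dom (leaf_chart L c W p)"
  using assms c subspace_0[OF foliated_chartD(2)[OF M leaf_fol c(1)]] by (simp add: leaf_chart_sel)
 then show ?thesis using c by blast
qed

lemma leaf_incl_chart:
 assumes c: "(c, W) \<in> F" "p \<in> chart_dom c" "p \<in> L" and q: "q \<in> chart_dom (leaf_chart L c W p)"
  and u: "u \<in> tangent_space LL q"
 shows "incl q u \<in> D q" "chart_coords (leaf_chart L c W p) u = chart_coords c (incl q u)"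
proof -
 note c1 = foliated_chartD[OF M leaf_fol c(1)]
 have qc: "q \<in> chart_dom c" using q by (simp add: leaf_chart_sel)
 note sc = leaf_smooth_chart[OF M leaf_fol L c]
 obtain w where w: "w \<in> W" "u = chart_vec LL (leaf_chart L c W p) q w"
  using u unfolding tangent_space_chart[OF leaf_atlas_N sc q] by (auto simp: leaf_chart_sel)
 have wE: "w \<in> model c" using w c1(3) by blast
 have i: "incl q u = chart_vec M c q w" unfolding w(2) by (rule leaf_incl_chart_vec[OF M leaf_fol L c q w(1)])
 have cc: "chart_coords c (incl q u) = w" unfolding i by (rule chart_coords_vec[OF M c1(1) qc wE])
 show "incl q u \<in> D q"
  using leaf_D_chart[OF c(1) qc, of "incl q u"] chart_vec_tangent[OF M c1(1) qc wE] cc w(1) i by simp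
 have "chart_coords (leaf_chart L c W p) u = w"
  unfolding w(2) by (rule chart_coords_vec[OF leaf_atlas_N sc q]) (simp add: leaf_chart_sel w(1))
 then show "chart_coords (leaf_chart L c W p) u = chart_coords c (incl q u)" using cc by simp
qed

lemma leaf_incl_D: "p \<in> L ==> u \<in> tangent_space LL p ==> incl p u \<in> D p"
 using leaf_chart_at leaf_incl_chart(1) by blast

lemma leaf_incl_tangent: "p \<in> L ==> u \<in> tangent_space LL p ==> incl p u \<in> tangent_space M p"
 by (rule leaf_D_tangent[OF leaf_point(1) leaf_incl_D])

text \<open>With \<open>leaf_incl_surj\<close> this identifies the tangent spaces of the leaf with \<open>D\<close>, and makes the description in
  \<open>leaf_endo\<close> a definite one.\<close>
lemma leaf_incl_inj:
 assumes p: "p \<in> L" and u: "u \<in> tangent_space LL p" "v \<in> tangent_space LL p" and e: "incl p u = incl p v"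
 shows "u = v"
proof -
 obtain c W where c: "(c, W) \<in> F" "p \<in> chart_dom c" "p \<in> chart_dom (leaf_chart L c W p)" using leaf_chart_at[OF p] by blast
 note sc = leaf_smooth_chart[OF M leaf_fol L c(1,2) p]
 have "chart_coords (leaf_chart L c W p) u = chart_coords c (incl p u)" by (rule leaf_incl_chart(2)[OF c(1,2) p c(3) u(1)])
 also have "\<dots> = chart_coords (leaf_chart L c W p) v"
  unfolding e by (rule leaf_incl_chart(2)[OF c(1,2) p c(3) u(2), symmetric])
 finally have k: "chart_coords (leaf_chart L c W p) u = chart_coords (leaf_chart L c W p) v" .
 have "u = chart_vec LL (leaf_chart L c W p) p (chart_coords (leaf_chart L c W p) u)"
  by (rule chart_coords_tangent(2)[OF leaf_atlas_N sc c(3) u(1), symmetric])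
 also have "\<dots> = v" unfolding k by (rule chart_coords_tangent(2)[OF leaf_atlas_N sc c(3) u(2)])
 finally show ?thesis .
qed

lemma leaf_incl_surj:
 assumes p: "p \<in> L" and v: "v \<in> D p"
 shows "\<exists>u\<in>tangent_space LL p. incl p u = v"
proof -
 obtain c W where c: "(c, W) \<in> F" "p \<in> chart_dom c" "p \<in> chart_dom (leaf_chart L c W p)" using leaf_chart_at[OF p] by blast
 note c1 = foliated_chartD[OF M leaf_fol c(1)]
 note sc = leaf_smooth_chart[OF M leaf_fol L c(1,2) p]
 note vT = leaf_D_tangent[OF leaf_point(1)[OF p] v]
 have W: "chart_coords c v \<in> W" using leaf_D_chart[OF c(1,2) vT] v by simp
 have "incl p (chart_vec LL (leaf_chart L c W p) p (chart_coords c v)) = v"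
  using leaf_incl_chart_vec[OF M leaf_fol L c(1,2) p c(3) W] chart_coords_tangent(2)[OF M c1(1) c(2) vT] by simp
 moreover have "chart_vec LL (leaf_chart L c W p) p (chart_coords c v) \<in> tangent_space LL p"
  by (rule chart_vec_tangent[OF leaf_atlas_N sc c(3)]) (simp add: leaf_chart_sel W)
 ultimately show ?thesis by blast
qed

lemma leaf_endo:
 assumes p: "p \<in> L" and u: "u \<in> tangent_space LL p"
 shows "J' p u \<in> tangent_space LL p" "incl p (J' p u) = J p (incl p u)"
proof -
 have "\<exists>!w. w \<in> tangent_space LL p \<and> incl p w = J p (incl p u)"
 proof -
  obtain w where w: "w \<in> tangent_space LL p" "incl p w = J p (incl p u)"
   using leaf_incl_surj[OF p DJ[OF leaf_point(1)[OF p] leaf_incl_D[OF p u]]] by (rule bexE)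
  show ?thesis
  proof (rule ex1I[of _ w])
   show "w \<in> tangent_space LL p \<and> incl p w = J p (incl p u)" using w by blast
   show "x = w" if "x \<in> tangent_space LL p \<and> incl p x = J p (incl p u)" for x
    by (rule leaf_incl_inj[OF p]) (use that w in auto)
  qed
 qed
 note the = theI'[OF this]
 show "J' p u \<in> tangent_space LL p" unfolding leaf_endo_def by (rule conjunct1[OF the])
 show "incl p (J' p u) = J p (incl p u)" unfolding leaf_endo_def by (rule conjunct2[OF the])
qed

lemma leaf_fund:
 assumes "p \<in> L" "u \<in> tangent_space LL p"
 shows "fund g' J' p u v = fund g J p (incl p u) (incl p v)"
 using leaf_endo[OF assms] by (simp add: fund_def leaf_metric_def)

text \<open>The coefficients of \<open>X\<close> in a leaf chart are functions on \<open>W\<close>; made constant along the kernel of the projection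
  onto \<open>W\<close> they are the coefficients of a field on \<open>M\<close> with values in \<open>D\<close>.\<close>
lemma leaf_extension:
 assumes X: "vector_field_on LL V X" and p: "p \<in> V"
 shows "\<exists>V' U Y. p \<in> V' \<and> V' \<subseteq> V \<and> openin (topo LL) V' \<and> rel V' U X Y"
proof -
 have VL: "V \<subseteq> L" using vf_open[OF leaf_atlas_N X] openin_subset leaf_point(2) by (auto simp: points_def)
 have pL: "p \<in> L" using p VL by blast
 obtain c W where c: "(c, W) \<in> F" "p \<in> chart_dom c" "p \<in> chart_dom (leaf_chart L c W p)" using leaf_chart_at[OF pL] by blast
 let ?l = "leaf_chart L c W p"
 note c1 = foliated_chartD[OF M leaf_fol c(1)]
 note c' = smooth_chartD[OF c1(1)]
 note sl = leaf_smooth_chart[OF M leaf_fol L c(1,2) pL]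
 note l' = smooth_chartD[OF sl]
 let ?w = "\<lambda>q. vcoord ?l X (chart_map c q - chart_map c p)"
 note XC = vf_coords[OF leaf_atlas_N X sl]
 let ?S = "{x. x - chart_map c p \<in> creg ?l V}"
 have oS: "open ?S"
  using open_vimage[OF Cinf_open[OF XC], of "\<lambda>x. x - chart_map c p"] by (simp add: vimage_def continuous_intros)
 define U where "U = {q \<in> chart_dom c. chart_map c q \<in> ?S}"
 have oU: "openin (topo M) U" unfolding U_def by (rule chart_preimage_open[OF c' oS])
 have Uc: "U \<subseteq> chart_dom c" by (auto simp: U_def)
 define Y where "Y q = chart_vec M c q (?w q)" for q
 have wW: "?w q \<in> W" if q: "q \<in> U" for q
  using vcoord_model(1)[OF leaf_atlas_N X sl, of "chart_map c q - chart_map c p"] q by (simp add: U_def leaf_chart_sel)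
 have "Cinf (creg c U) (\<lambda>x. vcoord ?l X (chart_map c (cinv c x) - chart_map c p))"
 proof (rule Cinf_compose[where g = "vcoord ?l X" and f = "\<lambda>x. chart_map c (cinv c x) - chart_map c p", OF XC])
  show "Cinf (creg c U) (\<lambda>x. chart_map c (cinv c x) - chart_map c p)"
  proof (rule Cinf_diff[OF _ Cinf_const[OF open_creg[OF c' oU]]])
   show "Cinf (creg c U) (\<lambda>x. chart_map c (cinv c x))"
    by (rule Cinf_subset[OF transition[OF M c1(1) c1(1)] open_creg[OF c' oU] creg_mono[OF c' Uc]])
  qed
  show "chart_map c (cinv c x) - chart_map c p \<in> creg ?l V" if "x \<in> creg c U" for x
   using cinv_creg(1)[OF c' that] by (simp add: U_def)
 qed
 then have vf: "vector_field_on M U Y"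
  unfolding Y_def using c1(3) wW by (intro vf_chart_vec[OF M c1(1) oU Uc]) auto
 have YD: "Y q \<in> D q" if q: "q \<in> U" for q
 proof -
  have qc: "q \<in> chart_dom c" and wE: "?w q \<in> model c" using q Uc wW[OF q] c1(3) by auto
  show ?thesis unfolding Y_def
   using leaf_D_chart[OF c(1) qc chart_vec_tangent[OF M c1(1) qc wE]] chart_coords_vec[OF M c1(1) qc wE] wW[OF q] by simp
 qed
 let ?V' = "V \<inter> chart_dom ?l"
 have V'U: "?V' \<subseteq> U"
 proof
  fix q assume q: "q \<in> ?V'"
  then have "chart_map ?l q \<in> creg ?l V" by (intro map_creg[OF l']) auto
  then show "q \<in> U" using q by (simp add: U_def leaf_chart_sel)
 qed
 have "incl q (X q) = Y q" if q: "q \<in> ?V'" for q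
 proof -
  have ql: "q \<in> chart_dom ?l" and qV: "q \<in> V" using q by auto
  note XT = vf_tangent[OF leaf_atlas_N X qV]
  have w: "?w q = chart_coords ?l (X q)"
   using vcoord_map[OF leaf_atlas_N sl ql, of X] by (simp add: leaf_chart_sel)
  have "incl q (chart_vec LL ?l q (?w q)) = Y q"
   unfolding Y_def by (rule leaf_incl_chart_vec[OF M leaf_fol L c(1,2) pL ql wW]) (use V'U q in blast)
  then show ?thesis unfolding w chart_coords_tangent(2)[OF leaf_atlas_N sl ql XT] .
 qed
 moreover have "openin (topo LL) ?V'" by (rule openin_Int[OF vf_open[OF leaf_atlas_N X] chart_open[OF l']])
 ultimately show ?thesis
  using p c(3) vf YD V'U by (intro exI[of _ ?V'] exI[of _ U] exI[of _ Y]) (auto simp: leaf_related_def)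
qed

lemma leaf_related_subset:
 assumes "rel V U X Y" "V' \<subseteq> V" "openin (topo M) U'" "U' \<subseteq> U" "V' \<subseteq> U'"
 shows "rel V' U' X Y"
 using assms vf_subset[OF M _ assms(3,4), of Y] unfolding leaf_related_def by blast

lemma leaf_extension3:
 assumes X: "vector_field_on LL V X" "vector_field_on LL V Y" "vector_field_on LL V Z" and p: "p \<in> V"
 shows "\<exists>V' U X' Y' Z'. p \<in> V' \<and> V' \<subseteq> V \<and> openin (topo LL) V' \<and> rel V' U X X' \<and> rel V' U Y Y' \<and> rel V' U Z Z'"
proof -
 obtain V1 U1 X' where 1: "p \<in> V1" "V1 \<subseteq> V" "openin (topo LL) V1" "rel V1 U1 X X'" using leaf_extension[OF X(1) p] by blast
 obtain V2 U2 Y' where 2: "p \<in> V2" "V2 \<subseteq> V" "openin (topo LL) V2" "rel V2 U2 Y Y'" using leaf_extension[OF X(2) p] by blast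
 obtain V3 U3 Z' where 3: "p \<in> V3" "V3 \<subseteq> V" "openin (topo LL) V3" "rel V3 U3 Z Z'" using leaf_extension[OF X(3) p] by blast
 let ?V = "V1 \<inter> V2 \<inter> V3" and ?U = "U1 \<inter> U2 \<inter> U3"
 have "vector_field_on M U1 X'" "vector_field_on M U2 Y'" "vector_field_on M U3 Z'"
  using 1(4) 2(4) 3(4) by (simp_all add: leaf_related_def)
 from this[THEN vf_open[OF M]] have U: "openin (topo M) ?U" by (intro openin_Int)
 have VU: "?V \<subseteq> ?U" using 1(4) 2(4) 3(4) by (auto simp: leaf_related_def)
 have "rel ?V ?U X X'" by (rule leaf_related_subset[OF 1(4) _ U _ VU]) auto
 moreover have "rel ?V ?U Y Y'" by (rule leaf_related_subset[OF 2(4) _ U _ VU]) auto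
 moreover have "rel ?V ?U Z Z'" by (rule leaf_related_subset[OF 3(4) _ U _ VU]) auto
 moreover have "openin (topo LL) ?V" by (intro openin_Int 1 2 3)
 ultimately show ?thesis
  using 1(1,2) 2(1) 3(1) by (intro exI[of _ ?V] exI[of _ ?U] exI[of _ X'] exI[of _ Y'] exI[of _ Z']) auto
qed

text \<open>Converse to \<open>leaf_extension\<close>: fields on the leaf are recognised as smooth by their extensions.\<close>
lemma leaf_restriction:
 assumes r: "rel V U X Y" and V: "openin (topo LL) V" and XT: "\<And>q. q \<in> V ==> X q \<in> tangent_space LL q"
 shows "vector_field_on LL V X"
proof (rule vf_local[OF leaf_atlas_N V])
 have Y: "vector_field_on M U Y" and VU: "V \<subseteq> U" and XY: "\<And>q. q \<in> V ==> incl q (X q) = Y q"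
  using r by (auto simp: leaf_related_def)
 have VL: "V \<subseteq> L" using openin_subset[OF V] leaf_point(2) by (auto simp: points_def)
 fix p assume p: "p \<in> V"
 then have pL: "p \<in> L" using VL by blast
 obtain c W where c: "(c, W) \<in> F" "p \<in> chart_dom c" "p \<in> chart_dom (leaf_chart L c W p)" using leaf_chart_at[OF pL] by blast
 let ?l = "leaf_chart L c W p"
 note c1 = foliated_chartD[OF M leaf_fol c(1)]
 note sl = leaf_smooth_chart[OF M leaf_fol L c(1,2) pL]
 note l' = smooth_chartD[OF sl]
 let ?V = "V \<inter> chart_dom ?l"
 have oV: "openin (topo LL) ?V" by (rule openin_Int[OF V chart_open[OF l']])
 note oS = open_creg[OF l' oV]
 have "vector_field_on LL ?V X"
 proof (rule vf_from_coords[OF leaf_atlas_N sl oV])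
  show "X q \<in> tangent_space LL q" if "q \<in> ?V" for q using XT that by blast
  have im: "chart_map c p + proj W x \<in> creg c U" if x: "x \<in> creg ?l ?V" for x
  proof -
   have "creg ?l ?V \<subseteq> creg ?l U" by (rule creg_mono[OF l']) (use VU in blast)
   then show ?thesis using leaf_creg(2)[OF M leaf_fol L c(1,2) pL] x by blast
  qed
  have "Cinf (creg ?l ?V) (\<lambda>x. vcoord c Y (chart_map c p + proj W x))"
   by (rule Cinf_compose[where g = "vcoord c Y" and f = "\<lambda>x. chart_map c p + proj W x",
      OF vf_coords[OF M Y c1(1)] Cinf_add[OF Cinf_const[OF oS] Cinf_proj[OF c1(2) oS]] im])
  then show "Cinf (creg ?l ?V) (vcoord ?l X)"
  proof (rule Cinf_cong)
   fix x assume x: "x \<in> creg ?l ?V"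
   let ?q = "cinv ?l x"
   have q: "?q \<in> V" "?q \<in> chart_dom ?l" using cinv_creg(1)[OF l' x] by auto
   have "chart_coords ?l (X ?q) = chart_coords c (Y ?q)"
    using leaf_incl_chart(2)[OF c(1,2) pL q(2) XT[OF q(1)]] XY[OF q(1)] by simp
   then show "vcoord c Y (chart_map c p + proj W x) = vcoord ?l X x"
    using leaf_creg(1)[OF M leaf_fol L c(1,2) pL x] by (simp add: vcoord_def[OF M] vcoord_def[OF leaf_atlas_N])
  qed
 qed auto
 then show "\<exists>V'. p \<in> V' \<and> V' \<subseteq> V \<and> vector_field_on LL V' X" using p c(3) by (intro exI[of _ ?V]) auto
qed

lemma leaf_derivative:
 assumes r: "rel V U X X'" and p: "p \<in> V" and X: "X p \<in> tangent_space LL p"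
  and V1: "openin (topo LL) V1" "p \<in> V1" and h: "smooth_near M p h" and e: "\<And>q. q \<in> V1 ==> h' q = h q"
 shows "X p h' = X' p h"
proof -
 have "X p h' = X p h" by (rule tangent_local[OF leaf_atlas_N X V1 e])
 also have "\<dots> = incl p (X p) h" using h by (simp add: leaf_incl_def)
 also have "\<dots> = X' p h" using r p by (simp add: leaf_related_def)
 finally show ?thesis .
qed

text \<open>Brackets are computed on functions of \<open>M\<close>, and those restrict to smooth functions of the leaf on which a field and
  its extension agree.\<close>
lemma leaf_bracket:
 assumes X: "vector_field_on LL V X" "rel V U X X'" and Y: "vector_field_on LL V Y" "rel V U Y Y'" and p: "p \<in> V"
 shows "incl p (lie_bracket LL X Y p) = lie_bracket M X' Y' p"
proof
 fix f
 have VL: "V \<subseteq> L" using vf_open[OF leaf_atlas_N X(1)] openin_subset leaf_point(2) by (auto simp: points_def)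
 have pL: "p \<in> L" using p VL by blast
 have X': "vector_field_on M U X'" and Y': "vector_field_on M U Y'" and VU: "V \<subseteq> U"
  and XX: "\<And>q. q \<in> V ==> incl q (X q) = X' q" and YY: "\<And>q. q \<in> V ==> incl q (Y q) = Y' q"
  using X Y by (auto simp: leaf_related_def)
 show "incl p (lie_bracket LL X Y p) f = lie_bracket M X' Y' p f"
 proof (cases "smooth_near M p f")
  case False
  then show ?thesis by (simp add: leaf_incl_def lie_bracket_def)
 next
  case True
  obtain U0 where U0: "p \<in> U0" "U0 \<subseteq> U" "smooth_fun_on M U0 f"
   by (rule smooth_nearE[OF M True vf_open[OF M X']]) (use p VU in auto)
  let ?V = "V \<inter> (U0 \<inter> L)"
  have oV: "openin (topo LL) ?V"
   by (rule openin_Int[OF vf_open[OF leaf_atlas_N X(1)] leaf_openin_Int[OF M leaf_fol L smooth_fun_open[OF U0(3)]]])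
  have pV: "p \<in> ?V" using p U0(1) pL by blast
  have nf: "smooth_near M q f" if "q \<in> ?V" for q using smooth_nearI[OF M _ U0(3)] that by blast
  have eX: "X q f = X' q f" if q: "q \<in> ?V" for q using fun_cong[OF XX, of q f] nf[OF q] q by (simp add: leaf_incl_def)
  have eY: "Y q f = Y' q f" if q: "q \<in> ?V" for q using fun_cong[OF YY, of q f] nf[OF q] q by (simp add: leaf_incl_def)
  have "X p (\<lambda>q. Y q f) = X' p (\<lambda>q. Y' q f)"
   by (rule leaf_derivative[OF X(2) p vf_tangent[OF leaf_atlas_N X(1) p] oV pV
      smooth_nearI[OF M U0(1) vf_smooth[OF M Y' U0(2,3)]] eY])
  moreover have "Y p (\<lambda>q. X q f) = Y' p (\<lambda>q. X' q f)"
   by (rule leaf_derivative[OF Y(2) p vf_tangent[OF leaf_atlas_N Y(1) p] oV pV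
      smooth_nearI[OF M U0(1) vf_smooth[OF M X' U0(2,3)]] eX])
  ultimately show ?thesis
   using True smooth_near_leaf[OF M leaf_fol L pL True] by (simp add: leaf_incl_def lie_bracket_def)
 qed
qed

lemma leaf_vf_subset_L: "vector_field_on LL V X ==> q \<in> V ==> q \<in> L"
 using points_open[OF leaf_atlas_N vf_open[OF leaf_atlas_N]] leaf_point(2) by blast

lemma leaf_riemannian: "riemannian_metric LL g'"
 unfolding riemannian_metric_def leaf_point(2)
proof (intro conjI ballI allI impI; (elim conjE)?)
 fix p assume p: "p \<in> L"
 note pM = leaf_point(1)[OF p]
 fix u assume u: "u \<in> tangent_space LL p"
 note uT = leaf_incl_tangent[OF p u]
 show "0 < g' p u u" if "u \<noteq> 0"
 proof -
  have "incl p u \<noteq> 0"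
   using leaf_incl_inj[OF p u subspace_0[OF subspace_tangent[OF leaf_atlas_N]]] that p
   by (auto simp: leaf_incl_linear leaf_point(2))
  then show ?thesis unfolding leaf_metric_def by (rule g_pos[OF M g J gJ pM uT])
 qed
 fix v assume v: "v \<in> tangent_space LL p"
 note vT = leaf_incl_tangent[OF p v]
 show "g' p u v = g' p v u" unfolding leaf_metric_def by (rule g_sym[OF M g J gJ pM uT vT])
 fix w a assume w: "w \<in> tangent_space LL p"
 note wT = leaf_incl_tangent[OF p w]
 show "g' p (u + v) w = g' p u w + g' p v w"
  unfolding leaf_metric_def leaf_incl_linear by (rule g_add[OF M g J gJ pM uT vT wT])
 show "g' p (a *\<^sub>R u) w = a * g' p u w"
  unfolding leaf_metric_def leaf_incl_linear by (rule g_scale[OF M g J gJ pM uT wT])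
next
 fix V X Y assume X: "vector_field_on LL V X" and Y: "vector_field_on LL V Y"
 show "smooth_fun_on LL V (\<lambda>p. g' p (X p) (Y p))"
 proof (rule smooth_fun_local[OF leaf_atlas_N vf_open[OF leaf_atlas_N X]])
  fix p assume p: "p \<in> V"
  obtain V' U X' Y' Z' where e: "p \<in> V'" "V' \<subseteq> V" "openin (topo LL) V'" "rel V' U X X'" "rel V' U Y Y'" "rel V' U Y Z'"
   using leaf_extension3[OF X Y Y p] by blast
  have X': "vector_field_on M U X'" and Y': "vector_field_on M U Y'" and VU: "V' \<subseteq> U"
   and XX: "\<And>q. q \<in> V' ==> incl q (X q) = X' q" and YY: "\<And>q. q \<in> V' ==> incl q (Y q) = Y' q"
   using e(4,5) by (auto simp: leaf_related_def)
  have VL: "V' \<subseteq> L" using e(2) leaf_vf_subset_L[OF X] by blast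
  have "smooth_fun_on LL (U \<inter> L) (\<lambda>p. g p (X' p) (Y' p))"
   by (rule smooth_fun_leaf[OF M leaf_fol L g_smooth[OF M g J gJ X' Y']])
  then have "smooth_fun_on LL V' (\<lambda>p. g p (X' p) (Y' p))"
   by (rule smooth_fun_subset[OF leaf_atlas_N _ e(3)]) (use VU VL in blast)
  then have "smooth_fun_on LL V' (\<lambda>p. g' p (X p) (Y p))"
   by (rule smooth_fun_cong[OF leaf_atlas_N]) (simp add: leaf_metric_def XX YY)
  then show "\<exists>V'. p \<in> V' \<and> V' \<subseteq> V \<and> smooth_fun_on LL V' (\<lambda>p. g' p (X p) (Y p))" using e(1,2) by blast
 qed
qed

lemma leaf_related_endo:
 assumes "vector_field_on LL V X" "rel V U X Y"
 shows "rel V U (\<lambda>q. J' q (X q)) (\<lambda>q. J q (Y q))"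
 unfolding leaf_related_def
proof (intro conjI ballI)
 have Y: "vector_field_on M U Y" "V \<subseteq> U" "\<And>q. q \<in> U ==> Y q \<in> D q" "\<And>q. q \<in> V ==> incl q (X q) = Y q"
  using assms(2) by (auto simp: leaf_related_def)
 show "vector_field_on M U (\<lambda>q. J q (Y q))" by (rule J_vf[OF M g J gJ Y(1)])
 show "V \<subseteq> U" by (rule Y(2))
 show "J q (Y q) \<in> D q" if "q \<in> U" for q by (rule DJ[OF points_open[OF M vf_open[OF M Y(1)] that] Y(3)[OF that]])
 show "incl q (J' q (X q)) = J q (Y q)" if "q \<in> V" for q
  using leaf_endo(2)[OF leaf_vf_subset_L[OF assms(1) that] vf_tangent[OF leaf_atlas_N assms(1) that]] Y(4)[OF that] by simp
qed

lemma leaf_almost_complex: "almost_complex LL J'"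
 unfolding almost_complex_def leaf_point(2)
proof (intro conjI ballI allI impI)
 fix p assume p: "p \<in> L"
 note pM = leaf_point(1)[OF p]
 have sub: "subspace (tangent_space LL p)" by (rule subspace_tangent[OF leaf_atlas_N]) (simp add: leaf_point p)
 fix u assume u: "u \<in> tangent_space LL p"
 note uT = leaf_incl_tangent[OF p u] and Ju = leaf_endo[OF p u]
 show "J' p u \<in> tangent_space LL p" by (rule Ju)
 show "J' p (J' p u) = - u"
  by (rule leaf_incl_inj[OF p leaf_endo(1)[OF p Ju(1)] subspace_neg[OF sub u]])
   (simp add: leaf_endo(2)[OF p Ju(1)] Ju(2) leaf_incl_linear J_sq[OF M g J gJ pM uT])
 show "J' p (a *\<^sub>R u) = a *\<^sub>R J' p u" for a
  by (rule leaf_incl_inj[OF p leaf_endo(1)[OF p subspace_scale[OF sub u]] subspace_scale[OF sub Ju(1)]])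
   (simp add: leaf_endo(2)[OF p subspace_scale[OF sub u]] Ju(2) leaf_incl_linear J_scale[OF M g J gJ pM uT])
 fix v assume v: "v \<in> tangent_space LL p"
 show "J' p (u + v) = J' p u + J' p v"
  by (rule leaf_incl_inj[OF p leaf_endo(1)[OF p subspace_add[OF sub u v]] subspace_add[OF sub Ju(1) leaf_endo(1)[OF p v]]])
   (simp add: leaf_endo(2)[OF p subspace_add[OF sub u v]] Ju(2) leaf_endo(2)[OF p v] leaf_incl_linear
    J_add[OF M g J gJ pM uT leaf_incl_tangent[OF p v]])
next
 fix V X assume X: "vector_field_on LL V X"
 show "vector_field_on LL V (\<lambda>p. J' p (X p))"
 proof (rule vf_local[OF leaf_atlas_N vf_open[OF leaf_atlas_N X]])
  fix p assume "p \<in> V"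
  then obtain V' U Y where e: "p \<in> V'" "V' \<subseteq> V" "openin (topo LL) V'" "rel V' U X Y" using leaf_extension[OF X] by blast
  note X' = vf_subset[OF leaf_atlas_N X e(3,2)]
  have "vector_field_on LL V' (\<lambda>p. J' p (X p))"
   by (rule leaf_restriction[OF leaf_related_endo[OF X' e(4)] e(3)])
    (rule leaf_endo(1)[OF leaf_vf_subset_L[OF X'] vf_tangent[OF leaf_atlas_N X']])
  then show "\<exists>V'. p \<in> V' \<and> V' \<subseteq> V \<and> vector_field_on LL V' (\<lambda>p. J' p (X p))" using e(1,2) by blast
 qed
qed

lemma leaf_integrable: "integrable_complex LL J'"
 unfolding integrable_complex_def
proof (intro conjI allI impI ballI leaf_almost_complex)
 fix V X Y p assume XY: "vector_field_on LL V X \<and> vector_field_on LL V Y" and p: "p \<in> V"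
 then have X: "vector_field_on LL V X" and Y: "vector_field_on LL V Y" by auto
 obtain V' U X' Y' Z' where e: "p \<in> V'" "V' \<subseteq> V" "openin (topo LL) V'" "rel V' U X X'" "rel V' U Y Y'" "rel V' U Y Z'"
  using leaf_extension3[OF X Y Y p] by blast
 note X1 = vf_subset[OF leaf_atlas_N X e(3,2)] and Y1 = vf_subset[OF leaf_atlas_N Y e(3,2)]
 have JV: "vector_field_on LL V' Z ==> vector_field_on LL V' (\<lambda>p. J' p (Z p))" for Z
  using leaf_almost_complex by (simp add: almost_complex_def)
 note JX = JV[OF X1] and JY = JV[OF Y1]
 note rX = leaf_related_endo[OF X1 e(4)] and rY = leaf_related_endo[OF Y1 e(5)]
 have pL: "p \<in> L" by (rule leaf_vf_subset_L[OF X p])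
 note b1 = leaf_bracket[OF JX rX JY rY e(1)] and t1 = bracket_tangent[OF leaf_atlas_N JX JY e(1)]
 note b2 = leaf_bracket[OF JX rX Y1 e(5) e(1)] and t2 = bracket_tangent[OF leaf_atlas_N JX Y1 e(1)]
 note b3 = leaf_bracket[OF X1 e(4) JY rY e(1)] and t3 = bracket_tangent[OF leaf_atlas_N X1 JY e(1)]
 note b4 = leaf_bracket[OF X1 e(4) Y1 e(5) e(1)] and t4 = bracket_tangent[OF leaf_atlas_N X1 Y1 e(1)]
 have sub: "subspace (tangent_space LL p)" by (rule subspace_tangent[OF leaf_atlas_N]) (simp add: leaf_point pL)
 have T: "nijenhuis LL J' X Y p \<in> tangent_space LL p"
  unfolding nijenhuis_def by (intro subspace_diff[OF sub] t1 t4 leaf_endo(1)[OF pL t2] leaf_endo(1)[OF pL t3])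
 have "incl p (nijenhuis LL J' X Y p) = nijenhuis M J X' Y' p"
  unfolding nijenhuis_def leaf_incl_linear b1 b4 leaf_endo(2)[OF pL t2] leaf_endo(2)[OF pL t3] b2 b3 ..
 also have "\<dots> = 0"
 proof -
  have "vector_field_on M U X'" "vector_field_on M U Y'" "p \<in> U" using e(1,4,5) by (auto simp: leaf_related_def)
  then show ?thesis using J unfolding integrable_complex_def by blast
 qed
 finally show "nijenhuis LL J' X Y p = 0"
  using leaf_incl_inj[OF pL T subspace_0[OF sub]] by (simp add: leaf_incl_linear)
qed

lemma leaf_compatible_metric: "compatible_metric LL g' J'"
 unfolding compatible_metric_def leaf_point(2)
proof (intro ballI)
 fix p u v assume p: "p \<in> L" and u: "u \<in> tangent_space LL p" and v: "v \<in> tangent_space LL p"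
 show "g' p (J' p u) (J' p v) = g' p u v"
  using g_J[OF M g J gJ leaf_point(1)[OF p] leaf_incl_tangent[OF p u] leaf_incl_tangent[OF p v]]
  by (simp add: leaf_metric_def leaf_endo(2)[OF p u] leaf_endo(2)[OF p v])
qed

lemma leaf_cartan:
 assumes X: "vector_field_on LL V X" "rel V U X X'" and Y: "vector_field_on LL V Y" "rel V U Y Y'"
  and Z: "vector_field_on LL V Z" "rel V U Z Z'" and p: "p \<in> V"
 shows "cartan LL (fund g' J') X Y Z p = cartan M (fund g J) X' Y' Z' p"
proof -
 have X': "vector_field_on M U X'" and XX: "\<And>q. q \<in> V ==> incl q (X q) = X' q"
  and Y': "vector_field_on M U Y'" and YY: "\<And>q. q \<in> V ==> incl q (Y q) = Y' q"
  and Z': "vector_field_on M U Z'" and ZZ: "\<And>q. q \<in> V ==> incl q (Z q) = Z' q" and pU: "p \<in> U"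
  using X Y Z p by (auto simp: leaf_related_def)
 have pL: "p \<in> L" by (rule leaf_vf_subset_L[OF X(1) p])
 have sm: "smooth_near M p (\<lambda>q. fund g J q (A q) (B q))" if "vector_field_on M U A" "vector_field_on M U B" for A B
  using fund_two_form[OF M g J gJ] that smooth_nearI[OF M pU] unfolding two_form_def[OF M] by blast
 have e: "fund g' J' q (A q) (B q) = fund g J q (A' q) (B' q)"
  if "vector_field_on LL V A" "\<And>q. q \<in> V ==> incl q (A q) = A' q" "\<And>q. q \<in> V ==> incl q (B q) = B' q" "q \<in> V" for A A' B B' q
  using leaf_fund[OF leaf_vf_subset_L[OF that(1,4)] vf_tangent[OF leaf_atlas_N that(1,4)]] that(2)[OF that(4)] that(3)[OF that(4)] by simp
 have b: "fund g' J' p (lie_bracket LL A B p) x = fund g J p (lie_bracket M A' B' p) y"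
  if "vector_field_on LL V A" "rel V U A A'" "vector_field_on LL V B" "rel V U B B'" "incl p x = y" for A A' B B' x y
  using leaf_fund[OF pL bracket_tangent[OF leaf_atlas_N that(1,3) p]] leaf_bracket[OF that(1-4) p] that(5) by simp
 note oV = vf_open[OF leaf_atlas_N X(1)]
 have d1: "X p (\<lambda>q. fund g' J' q (Y q) (Z q)) = X' p (\<lambda>q. fund g J q (Y' q) (Z' q))"
  by (rule leaf_derivative[OF X(2) p vf_tangent[OF leaf_atlas_N X(1) p] oV p sm[OF Y' Z'] e[OF Y(1) YY ZZ]])
 have d2: "Y p (\<lambda>q. fund g' J' q (X q) (Z q)) = Y' p (\<lambda>q. fund g J q (X' q) (Z' q))"
  by (rule leaf_derivative[OF Y(2) p vf_tangent[OF leaf_atlas_N Y(1) p] oV p sm[OF X' Z'] e[OF X(1) XX ZZ]])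
 have d3: "Z p (\<lambda>q. fund g' J' q (X q) (Y q)) = Z' p (\<lambda>q. fund g J q (X' q) (Y' q))"
  by (rule leaf_derivative[OF Z(2) p vf_tangent[OF leaf_atlas_N Z(1) p] oV p sm[OF X' Y'] e[OF X(1) XX YY]])
 show ?thesis
  unfolding cartan_def[OF M] cartan_def[OF leaf_atlas_N] d1 d2 d3
   b[OF X Y ZZ[OF p]] b[OF X Z YY[OF p]] b[OF Y Z XX[OF p]] ..
qed

text \<open>By the Cartan formula on the leaf and on \<open>M\<close>, the exterior derivative on the leaf is that on \<open>M\<close> evaluated on \<open>D\<close>.\<close>
lemma leaf_fund_closed: "form_zero LL 3 (ext_deriv LL (fundamental_form g' J'))"
 unfolding form_zero_def leaf_point(2)
proof (intro ballI allI impI; elim conjE)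
 fix p vs assume p: "p \<in> L" and l: "length vs = 3" and vs: "set vs \<subseteq> tangent_space LL p"
 obtain u v w where e: "vs = [u, v, w]" using l by (auto simp: numeral_3_eq_3 length_Suc_conv)
 have u: "u \<in> tangent_space LL p" and v: "v \<in> tangent_space LL p" and w: "w \<in> tangent_space LL p" using vs e by auto
 have pN: "p \<in> points LL" by (simp add: leaf_point p)
 obtain V1 X where X: "p \<in> V1" "vector_field_on LL V1 X" "X p = u" by (rule vf_extension[OF leaf_atlas_N u pN])
 obtain V2 Y where Y: "p \<in> V2" "vector_field_on LL V2 Y" "Y p = v" by (rule vf_extension[OF leaf_atlas_N v pN])
 obtain V3 Z where Z: "p \<in> V3" "vector_field_on LL V3 Z" "Z p = w" by (rule vf_extension[OF leaf_atlas_N w pN])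
 let ?V = "V1 \<inter> V2 \<inter> V3"
 have oV: "openin (topo LL) ?V" by (intro openin_Int vf_open[OF leaf_atlas_N X(2)] vf_open[OF leaf_atlas_N Y(2)] vf_open[OF leaf_atlas_N Z(2)])
 have X1: "vector_field_on LL ?V X" by (rule vf_subset[OF leaf_atlas_N X(2) oV]) auto
 have Y1: "vector_field_on LL ?V Y" by (rule vf_subset[OF leaf_atlas_N Y(2) oV]) auto
 have Z1: "vector_field_on LL ?V Z" by (rule vf_subset[OF leaf_atlas_N Z(2) oV]) auto
 have pV: "p \<in> ?V" using X Y Z by blast
 obtain V' U X' Y' Z' where r: "p \<in> V'" "V' \<subseteq> ?V" "openin (topo LL) V'" "rel V' U X X'" "rel V' U Y Y'" "rel V' U Z Z'"
  using leaf_extension3[OF X1 Y1 Z1 pV] by blast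
 note X2 = vf_subset[OF leaf_atlas_N X1 r(3,2)] and Y2 = vf_subset[OF leaf_atlas_N Y1 r(3,2)] and Z2 = vf_subset[OF leaf_atlas_N Z1 r(3,2)]
 have X': "vector_field_on M U X'" "X' p \<in> D p" and Y': "vector_field_on M U Y'" "Y' p \<in> D p"
  and Z': "vector_field_on M U Z'" "Z' p \<in> D p" and pU: "p \<in> U"
  using r(1,4-6) by (auto simp: leaf_related_def)
 have "d2 LL (fund g' J') p u v w = cartan LL (fund g' J') X Y Z p"
  using cartan_eq_d2[OF leaf_atlas_N fund_two_form[OF leaf_atlas_N leaf_riemannian leaf_integrable leaf_compatible_metric] X2 Y2 Z2 r(1)]
  by (simp add: X(3) Y(3) Z(3))
 also have "\<dots> = cartan M (fund g J) X' Y' Z' p" by (rule leaf_cartan[OF X2 r(4) Y2 r(5) Z2 r(6) r(1)])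
 also have "\<dots> = d2 M (fund g J) p (X' p) (Y' p) (Z' p)"
  by (rule cartan_eq_d2[OF M fund_two_form[OF M g J gJ] X'(1) Y'(1) Z'(1) pU])
 also have "\<dots> = 0" by (rule Dclosed[OF leaf_point(1)[OF p] X'(2) Y'(2) Z'(2)])
 finally have z: "d2 LL (fund g' J') p u v w = 0" .
 have "ext_deriv LL (fundamental_form g' J') p [u, v, w] = complex_of_real (d2 LL (fund g' J') p u v w)"
  by (rule ext_deriv_real[OF leaf_atlas_N _ pN u v w]) (simp add: fundamental_form_def fund_def)
 then show "ext_deriv LL (fundamental_form g' J') p vs = 0" using z by (simp add: e)
qed

lemma leaf_kaehler: "kaehler_structure LL g' J'"
 unfolding kaehler_structure_def
 using leaf_riemannian leaf_integrable leaf_compatible_metric leaf_fund_closed by blast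

end

section \<open>Holomorphic foliations with Kaehler leaves\<close>

context
 fixes M :: "('m, 'e::euclidean_space) charted_space" and g :: "'m metric" and Jp Jm :: "'m endo" and \<sigma> :: real
 assumes M: "smooth_atlas M" and gk: "generalized_kaehler M g Jp Jm" and comm: "commuting M Jp Jm"
  and s: "\<sigma> * \<sigma> = 1"
begin

private abbreviation "D \<equiv> TT M Jp Jm \<sigma>"

text \<open>Also true outside of the points of \<open>M\<close>, where both sides are empty. This allows one to replace the
  eigenbundles by \<open>TT\<close> as functions.\<close>
lemma eigenbundle_eq: "eigenbundle M (\<lambda>p v. Jp p (Jm p v)) \<sigma> = D"
proof
 fix p
 show "eigenbundle M (\<lambda>p v. Jp p (Jm p v)) \<sigma> p = D p"
 proof (cases "p \<in> points M")
  case True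
  then show ?thesis by (rule eigenbundle_eq_TT[OF M gk comm _ s])
 next
  case False
  have "tangent_space M p = {}"
   using False chart_dom_topspace[OF atlas_is_chart[OF M]] unfolding tangent_space_def points_def by blast
  then show ?thesis using TT_tangent[OF M gk comm] by (auto simp: eigenbundle_def)
 qed
qed

lemma Pr_scale:
 "p \<in> points M ==> v \<in> tangent_space M p ==> Pr Jp Jm \<sigma> p (a *\<^sub>R v) = a *\<^sub>R Pr Jp Jm \<sigma> p v"
 by (rule Pr_linear(2)[OF M gk comm])

text \<open>The Frobenius theorem for the projections \<open>Pr\<close>.\<close>
lemma eigenbundle_plaque_chart:
 assumes p: "p \<in> points M"
 shows "\<exists>c W. (c, W) \<in> plaque_charts M D \<and> p \<in> chart_dom c"
proof -
 have "\<exists>c W. smooth_chart M c \<and> p \<in> chart_dom c \<and> subspace W \<and> W \<subseteq> model c \<and>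
   (\<forall>q\<in>chart_dom c. \<forall>v\<in>tangent_space M q. v \<in> D q \<longleftrightarrow> chart_coords c v \<in> W)"
  by (rule foliated_chart[OF M, where Pj = "Pr Jp Jm \<sigma>"])
   (fact p Pr_in[OF M gk comm s] Pr_linear(1)[OF M gk comm] Pr_scale Pr_id[OF M gk comm s]
    TT_tangent[OF M gk comm] Pr_vf[OF M gk comm] TT_involutive[OF M gk comm s])+
 then show ?thesis unfolding plaque_charts_def by blast
qed

lemma eigenbundle_subbundle: "subbundle M D"
 by (rule plaque_charts_subbundle[OF M eigenbundle_plaque_chart TT_tangent[OF M gk comm]])

lemma eigenbundle_integrable: "integrable_distribution M D"
 unfolding integrable_distribution_def using eigenbundle_subbundle TT_involutive[OF M gk comm s] by blast

lemma eigenbundle_foliation: "tangent_to_foliation M D (plaque_charts M D)"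
 by (rule plaque_charts_tangent_to_foliation[OF M eigenbundle_plaque_chart TT_tangent[OF M gk comm]])

lemma eigenbundle_holomorphic: "holomorphic_subbundle M Jp D" "holomorphic_subbundle M Jm D"
 unfolding holomorphic_subbundle_def
 using eigenbundle_subbundle TT_Jp[OF M gk comm] TT_Jm_in[OF M gk comm] cauchy_riemann_TT[OF M gk comm s] by blast+

lemma eigenbundle_leaves_kaehler:
 assumes F: "tangent_to_foliation M D F"
 shows "kaehler_leaves M g Jp F" "kaehler_leaves M g Jm F"
proof -
 have k: "riemannian_metric M g" "integrable_complex M Jp" "integrable_complex M Jm"
  "compatible_metric M g Jp" "compatible_metric M g Jm"
  using gk by (simp_all add: generalized_kaehler_def)
 show "kaehler_leaves M g Jp F" unfolding kaehler_leaves_def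
  by (rule ballI, rule leaf_kaehler[OF M k(1,2,4) F TT_Jp[OF M gk comm] F_closed_on_TT(1)[OF M gk comm s]])
 show "kaehler_leaves M g Jm F" unfolding kaehler_leaves_def
  by (rule ballI, rule leaf_kaehler[OF M k(1,3,5) F TT_Jm_in[OF M gk comm] F_closed_on_TT(2)[OF M gk comm s]])
qed

end

lemma eigenbundle_foliations_transverse:
 fixes M :: "('m, 'e::euclidean_space) charted_space" and g :: "'m metric" and Jp Jm :: "'m endo"
 assumes M: "smooth_atlas M" and gk: "generalized_kaehler M g Jp Jm" and comm: "commuting M Jp Jm"
  and F: "tangent_to_foliation M (TT M Jp Jm 1) F" and G: "tangent_to_foliation M (TT M Jp Jm (-1)) G"
 shows "transverse_foliations M F G"
 unfolding transverse_foliations_def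
proof
 fix p assume p: "p \<in> points M"
 have F': "foliation_tangent M F p = TT M Jp Jm 1 p" and G': "foliation_tangent M G p = TT M Jp Jm (-1) p"
  using F G p by (simp_all add: tangent_to_foliation_def)
 show "{v + w | v w. v \<in> foliation_tangent M F p \<and> w \<in> foliation_tangent M G p} = tangent_space M p"
  unfolding F' G'
 proof
  show "{v + w | v w. v \<in> TT M Jp Jm 1 p \<and> w \<in> TT M Jp Jm (-1) p} \<subseteq> tangent_space M p"
   using TT_tangent[OF M gk comm] subspace_add[OF subspace_tangent[OF M p]] by blast
  show "tangent_space M p \<subseteq> {v + w | v w. v \<in> TT M Jp Jm 1 p \<and> w \<in> TT M Jp Jm (-1) p}"
  proof
   fix v assume v: "v \<in> tangent_space M p"
   have a: "Pr Jp Jm 1 p v \<in> TT M Jp Jm 1 p" by (rule Pr_in[OF M gk comm _ p v]) simp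
   have b: "Pr Jp Jm (-1) p v \<in> TT M Jp Jm (-1) p" by (rule Pr_in[OF M gk comm _ p v]) simp
   have "v = Pr Jp Jm 1 p v + Pr Jp Jm (-1) p v" by (rule Pr_decomp[OF M gk comm])
   then show "v \<in> {v + w | v w. v \<in> TT M Jp Jm 1 p \<and> w \<in> TT M Jp Jm (-1) p}" using a b by blast
  qed
 qed
qed

theorem theorem4:
 fixes M :: "('m, 'e::euclidean_space) charted_space"
  and n :: nat
  and g :: "'m metric"
  and Jp Jm Q :: "'m endo"
  and Tp Tm :: "'m \<Rightarrow> 'm tvec set"
 assumes "smooth_manifold n M"
  and "generalized_kaehler M g Jp Jm"
  and "commuting M Jp Jm"
  and "Q = (\<lambda>p v. Jp p (Jm p v))"
  and "Tp = eigenbundle M Q 1"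
  and "Tm = eigenbundle M Q (-1)"
 shows "orthogonal_distributions M g Tp Tm \<and>
  integrable_distribution M Tp \<and> integrable_distribution M Tm \<and>
  (\<exists>Fp Fm. tangent_to_foliation M Tp Fp \<and> tangent_to_foliation M Tm Fm \<and>
    transverse_foliations M Fp Fm) \<and>
  holomorphic_subbundle M Jp Tp \<and> holomorphic_subbundle M Jm Tp \<and>
  holomorphic_subbundle M Jp Tm \<and> holomorphic_subbundle M Jm Tm \<and>
  (\<forall>F. tangent_to_foliation M Tp F \<or> tangent_to_foliation M Tm F \<longrightarrow>
    kaehler_leaves M g Jp F \<and> kaehler_leaves M g Jm F)"
proof -
 have M: "smooth_atlas M" using assms(1) by (auto simp: smooth_manifold_def smooth_atlas_def)
 note gk = assms(2) and comm = assms(3)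
 have one: "(1::real) * 1 = 1" "(-1::real) * -1 = 1" by auto
 have Tp: "Tp = TT M Jp Jm 1" and Tm: "Tm = TT M Jp Jm (-1)"
  unfolding assms(4-6) by (rule eigenbundle_eq[OF M gk comm one(1)] eigenbundle_eq[OF M gk comm one(2)])+
 note fol = eigenbundle_foliation[OF M gk comm one(1)] eigenbundle_foliation[OF M gk comm one(2)]
 have "orthogonal_distributions M g Tp Tm"
  unfolding orthogonal_distributions_def Tp Tm using TT_orthogonal[OF M gk comm one(1)] by blast
 moreover have "\<exists>Fp Fm. tangent_to_foliation M Tp Fp \<and> tangent_to_foliation M Tm Fm \<and> transverse_foliations M Fp Fm"
  unfolding Tp Tm using fol eigenbundle_foliations_transverse[OF M gk comm fol] by blast
 moreover have "kaehler_leaves M g Jp F \<and> kaehler_leaves M g Jm F"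
  if "tangent_to_foliation M Tp F \<or> tangent_to_foliation M Tm F" for F
  using that eigenbundle_leaves_kaehler[OF M gk comm one(1)] eigenbundle_leaves_kaehler[OF M gk comm one(2)]
  unfolding Tp Tm by blast
 ultimately show ?thesis
  unfolding Tp Tm
  using eigenbundle_integrable[OF M gk comm one(1)] eigenbundle_integrable[OF M gk comm one(2)]
   eigenbundle_holomorphic[OF M gk comm one(1)] eigenbundle_holomorphic[OF M gk comm one(2)] by blast
qed

end
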